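(* Let $N\geq1$, $0<T\leq\infty$, let $(r,p)$ be an admissible pair with $p<\infty$ and $r>2$, and let $1\leq q\leq\infty$. Fix $\sigma>r/2$ and define $\tilde\sigma$ by $$\frac1{\tilde\sigma}+\frac1\sigma=\frac2r.$$ Let $$\mathcal{F}(f)(t)=\int_0^te^{i(t-s)\Delta}f(s,\cdot)\,ds,\qquad t\in[0,T).$$ If $f\in L^{\tilde\sigma'}(0,T;L^{p',q}(\mathbb{R}^N))$, then $\mathcal{F}(f)\in L^\sigma(0,T;L^{p,q}(\mathbb{R}^N))$. Moreover there exists a constant $C=C(N,p,q,\sigma)>0$ such that $$\|\mathcal{F}(f)\|_{L^\sigma(0,T;L^{p,q}(\mathbb{R}^N))}\leq C\|f\|_{L^{\tilde\sigma'}(0,T;L^{p',q}(\mathbb{R}^N))}$$ for every $f\in L^{\tilde\sigma'}(0,T;L^{p',q}(\mathbb{R}^N))$.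
   Context: $L^{p,q}(\mathbb{R}^N)$ is the Lorentz space, $e^{it\Delta}$ is the free Schr\"odinger group on $\mathbb{R}^N$, and primes denote conjugate exponents. A pair $(r,p)$ is admissible if $\frac2r+\frac Np=\frac N2$ and $2\le p\le\frac{2N}{N-2}$ ($2\le p<\infty$ if $N=2$, $2\le p\le\infty$ if $N=1$). *)

theory Defs
  imports "HOL-Analysis.Analysis" "HOL-Probability.Essential_Supremum"
begin

text \<open>
  Exponents are elements of \<^typ>\<open>ennreal\<close>, where \<open>1 / \<infinity> = 0\<close> and \<open>1 / 0 = \<infinity>\<close>.
  Elements of function spaces are represented by functions; equality is understood almost everywhere.
\<close>

definition admissible_pair :: "nat \<Rightarrow> ennreal \<Rightarrow> ennreal \<Rightarrow> bool" where
  "admissible_pair N r p \<longleftrightarrow>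
     2 / r + of_nat N / p = of_nat N / 2 \<and> 2 \<le> p \<and>
     (N = 2 \<longrightarrow> p < \<infinity>) \<and>
     (N \<ge> 3 \<longrightarrow> p \<le> ennreal (2 * real N / (real N - 2)))"

text \<open>The truncated subtraction is harmless for \<open>p \<ge> 1\<close>; \<open>1\<close> and \<open>\<infinity>\<close> are exchanged.\<close>

definition conj_exponent :: "ennreal \<Rightarrow> ennreal" where
  "conj_exponent p = 1 / (1 - 1 / p)"

definition ennreal_powr :: "ennreal \<Rightarrow> real \<Rightarrow> ennreal" where
  "ennreal_powr x a = (if x = \<infinity> then \<infinity> else ennreal (enn2real x powr a))" \<comment> \<open>meant for \<open>a > 0\<close>\<close>

definition Lebesgue_norm :: "'x measure \<Rightarrow> ennreal \<Rightarrow> ('x \<Rightarrow> ennreal) \<Rightarrow> ennreal" where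
  "Lebesgue_norm M q g =
     (if q = \<infinity> then esssup M g
      else ennreal_powr (\<integral>\<^sup>+x. ennreal_powr (g x) (enn2real q) \<partial>M) (1 / enn2real q))"


subsection \<open>Lorentz spaces\<close>

definition decreasing_rearrangement :: "('a::euclidean_space \<Rightarrow> complex) \<Rightarrow> real \<Rightarrow> ennreal" where
  "decreasing_rearrangement f t =
     Inf {l::ennreal. emeasure lebesgue {x. l < ennreal (norm (f x))} \<le> ennreal t}"

text \<open>The norm of \<open>t\<^sup>1\<^sup>/\<^sup>p f\<^sup>*(t)\<close> in \<open>L\<^sup>q((0,\<infinity>), dt/t)\<close>.\<close>

definition lorentz_norm :: "ennreal \<Rightarrow> ennreal \<Rightarrow> ('a::euclidean_space \<Rightarrow> complex) \<Rightarrow> ennreal" where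
  "lorentz_norm p q f =
     Lebesgue_norm (density (lebesgue_on {0<..}) (\<lambda>t. ennreal (1 / t))) q
       (\<lambda>t. ennreal (t powr enn2real (1 / p)) * decreasing_rearrangement f t)"

definition lorentz_space :: "ennreal \<Rightarrow> ennreal \<Rightarrow> ('a::euclidean_space \<Rightarrow> complex) set" where
  "lorentz_space p q = {f \<in> borel_measurable lebesgue. lorentz_norm p q f < \<infinity>}"


subsection \<open>Bochner--Lebesgue spaces with values in a Lorentz space\<close>

definition time_interval :: "ereal \<Rightarrow> real set" where
  "time_interval T = {t. 0 < t \<and> ereal t < T}"

text \<open>
  Strong (Bochner) measurability: almost everywhere limit, in the norm of \<open>L\<^sup>p\<^sup>,\<^sup>q\<close>, of measurable
  functions of time with finitely many values in \<open>L\<^sup>p\<^sup>,\<^sup>q\<close>.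
\<close>

definition lorentz_strongly_measurable ::
  "ereal \<Rightarrow> ennreal \<Rightarrow> ennreal \<Rightarrow> (real \<Rightarrow> 'a::euclidean_space \<Rightarrow> complex) \<Rightarrow> bool" where
  "lorentz_strongly_measurable T p q f \<longleftrightarrow>
     (\<exists>s :: nat \<Rightarrow> real \<Rightarrow> 'a \<Rightarrow> complex.
        (\<forall>n. simple_function (lebesgue_on (time_interval T)) (s n) \<and>
             (\<forall>t\<in>time_interval T. s n t \<in> lorentz_space p q)) \<and>
        (AE t in lebesgue_on (time_interval T).
           (\<lambda>n. lorentz_norm p q (\<lambda>x. s n t x - f t x)) \<longlonglongrightarrow> 0))"

definition bochner_lorentz_norm ::
  "ennreal \<Rightarrow> ereal \<Rightarrow> ennreal \<Rightarrow> ennreal \<Rightarrow> (real \<Rightarrow> 'a::euclidean_space \<Rightarrow> complex) \<Rightarrow> ennreal" where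
  "bochner_lorentz_norm \<sigma> T p q f =
     Lebesgue_norm (lebesgue_on (time_interval T)) \<sigma> (\<lambda>t. lorentz_norm p q (f t))"

definition bochner_lorentz_space ::
  "ennreal \<Rightarrow> ereal \<Rightarrow> ennreal \<Rightarrow> ennreal \<Rightarrow> (real \<Rightarrow> 'a::euclidean_space \<Rightarrow> complex) set" where
  "bochner_lorentz_space \<sigma> T p q =
     {f. lorentz_strongly_measurable T p q f \<and>
         (AE t in lebesgue_on (time_interval T). f t \<in> lorentz_space p q) \<and>
         bochner_lorentz_norm \<sigma> T p q f < \<infinity>}"


subsection \<open>Schwartz functions and the free Schroedinger group\<close>

primrec iterated_partial :: "'a list \<Rightarrow> ('a::euclidean_space \<Rightarrow> complex) \<Rightarrow> 'a \<Rightarrow> complex" where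
  "iterated_partial [] \<phi> = \<phi>"
| "iterated_partial (b # bs) \<phi> = (\<lambda>x. frechet_derivative (iterated_partial bs \<phi>) (at x) b)"

definition schwartz_space :: "('a::euclidean_space \<Rightarrow> complex) set" where
  "schwartz_space =
     {\<phi>. \<forall>bs\<in>lists Basis. iterated_partial bs \<phi> differentiable_on UNIV \<and>
          (\<forall>k. bounded (range (\<lambda>x. norm x ^ k *\<^sub>R iterated_partial bs \<phi> x)))}"

definition fourier :: "('a::euclidean_space \<Rightarrow> complex) \<Rightarrow> 'a \<Rightarrow> complex" where
  "fourier \<phi> \<xi> = (\<integral>x. cis (- (x \<bullet> \<xi>)) * \<phi> x \<partial>lebesgue)"

definition inverse_fourier :: "('a::euclidean_space \<Rightarrow> complex) \<Rightarrow> 'a \<Rightarrow> complex" where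
  "inverse_fourier \<psi> x =
     complex_of_real (1 / (2 * pi) ^ DIM('a)) * (\<integral>\<xi>. cis (x \<bullet> \<xi>) * \<psi> \<xi> \<partial>lebesgue)"

text \<open>The group on Schwartz functions: the Fourier multiplier \<open>exp (- i t \<bar>\<xi>\<bar>\<^sup>2)\<close>.\<close>

definition schroedinger :: "real \<Rightarrow> ('a::euclidean_space \<Rightarrow> complex) \<Rightarrow> 'a \<Rightarrow> complex" where
  "schroedinger t \<phi> = inverse_fourier (\<lambda>\<xi>. cis (- t * (norm \<xi>)\<^sup>2) * fourier \<phi> \<xi>)"

text \<open>
  Tempered distributions are handled as functionals of which only the values on
  \<^const>\<open>schwartz_space\<close> matter. The pairing is bilinear (no complex conjugation), and the
  multiplier is even, so \<open>\<langle>e\<^sup>i\<^sup>t\<^sup>\<Delta> U, \<phi>\<rangle> = \<langle>U, e\<^sup>i\<^sup>t\<^sup>\<Delta> \<phi>\<rangle>\<close> with the same sign of \<open>t\<close>.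
\<close>

type_synonym 'a distribution = "('a \<Rightarrow> complex) \<Rightarrow> complex"

definition regular_distribution :: "('a::euclidean_space \<Rightarrow> complex) \<Rightarrow> 'a distribution" where
  "regular_distribution u = (\<lambda>\<phi>. \<integral>x. u x * \<phi> x \<partial>lebesgue)"

definition schroedinger_distribution :: "real \<Rightarrow> 'a::euclidean_space distribution \<Rightarrow> 'a distribution" where
  "schroedinger_distribution t U = (\<lambda>\<phi>. U (schroedinger t \<phi>))"

definition distribution_eq :: "'a::euclidean_space distribution \<Rightarrow> 'a distribution \<Rightarrow> bool" where
  "distribution_eq U V \<longleftrightarrow> (\<forall>\<phi>\<in>schwartz_space. U \<phi> = V \<phi>)"

text \<open>
  The Duhamel integral \<open>\<integral>\<^sub>0\<^sup>t e\<^sup>i\<^sup>(\<^sup>t\<^sup>-\<^sup>s\<^sup>)\<^sup>\<Delta> f(s) ds\<close>, as an integral of tempered distributions, i.e. after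
  pairing with a Schwartz function. It need not be a Bochner integral in \<open>L\<^sup>p\<^sup>,\<^sup>q\<close>: for \<open>q = \<infinity>\<close> the
  integrand is in general not strongly measurable even if \<open>f\<close> is constant in time. The integral makes
  sense when \<open>duhamel_converges f t\<close> holds.
\<close>

definition duhamel_integrand ::
  "(real \<Rightarrow> 'a::euclidean_space \<Rightarrow> complex) \<Rightarrow> real \<Rightarrow> real \<Rightarrow> 'a distribution" where
  "duhamel_integrand f t s = schroedinger_distribution (t - s) (regular_distribution (f s))"

definition duhamel_converges :: "(real \<Rightarrow> 'a::euclidean_space \<Rightarrow> complex) \<Rightarrow> real \<Rightarrow> bool" where
  "duhamel_converges f t \<longleftrightarrow>
     (\<forall>\<phi>\<in>schwartz_space. integrable (lebesgue_on {0..t}) (\<lambda>s. duhamel_integrand f t s \<phi>))"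

definition duhamel :: "(real \<Rightarrow> 'a::euclidean_space \<Rightarrow> complex) \<Rightarrow> real \<Rightarrow> 'a distribution" where
  "duhamel f t = (\<lambda>\<phi>. \<integral>s. duhamel_integrand f t s \<phi> \<partial>lebesgue_on {0..t})"

text \<open>\<open>u\<close> represents a curve \<open>U\<close> of distributions: almost every \<open>U t\<close> is the function \<open>u t\<close>.\<close>

definition represents ::
  "ereal \<Rightarrow> (real \<Rightarrow> 'a::euclidean_space \<Rightarrow> complex) \<Rightarrow> (real \<Rightarrow> 'a distribution) \<Rightarrow> bool" where
  "represents T u U \<longleftrightarrow>
     (AE t in lebesgue_on (time_interval T). distribution_eq (U t) (regular_distribution (u t)))"

end

theory Submission
  imports Defs "HOL-Probability.Probability" "HOL-Real_Asymp.Real_Asymp"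
begin

text \<open>
  The kernel of \<open>e\<^sup>i\<^sup>\<tau>\<^sup>\<Delta>\<close> is bounded by \<open>(4 \<pi> \<tau>)\<^sup>-\<^sup>N\<^sup>/\<^sup>2\<close>, and the group does not increase the \<open>L\<^sup>2\<close> norm.
  In the spirit of O'Neil, the datum \<open>H(\<tau>)\<close> is split at height \<open>H(\<tau>)\<^sup>*(\<tau>\<^sup>N / a)\<close>; estimating the upper part
  by the kernel bound and the lower part in \<open>L\<^sup>2\<close> bounds the decreasing rearrangement at \<open>a\<close> of
  \<open>\<integral> e\<^sup>i\<^sup>\<tau>\<^sup>\<Delta> H(\<tau>) d\<tau>\<close>, and Minkowski's inequality in the dilation parameter gives, for every \<open>q\<close> and without
  interpolation theory, the bound \<open>C \<integral> \<tau>\<^sup>-\<^sup>\<alpha> \<parallel>H(\<tau>)\<parallel> d\<tau>\<close> with \<open>\<alpha> = N/2 - N/p = 2/r\<close> and the norm of \<open>L\<^sup>p\<^sup>'\<^sup>,\<^sup>q\<close>.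
  The Hardy--Littlewood--Sobolev inequality, proved by the same splitting, then yields the estimate in time.

  For merely \<open>L\<^sup>p\<^sup>'\<^sup>,\<^sup>q\<close> data the integral is a limit in \<open>L\<^sup>1\<close> on balls of absolutely convergent kernel integrals,
  which is identified with the Duhamel integral by duality. For data with finitely many values it is uniformly
  continuous in time, hence strongly measurable, and this passes to the limit.
\<close>

text \<open>The height is dictated by balance: with b = \<tau>^N / a the kernel bound for the upper
  part, \<tau>^(-N/2) times b, and the weak L^2 bound for the lower part, a^(-1/2) times b^(1/2),
  carry the same factor \<tau>^(N/2) / a, so one integral over dilations controls both. The obstacle
  is that this height depends on a: each a comes with its own decomposition of the datum, while the
  solution must be a single function. Hence the integral is defined by a truncation that knows
  nothing of the height; its limit is unique and additive, so all decompositions estimate the same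
  function. A second obstacle is that the fractional integral of the norm is finite only for almost
  every t, whereas the Duhamel integral has to converge for every t. That is shown separately, by
  pairing with test functions, whose evolution stays bounded in L^\<infinity> and in L^2. In time
  the argument closes because \<sigma>t' and \<sigma> are exactly the Hardy-Littlewood-Sobolev
  exponents of the kernel \<tau>^(-2/r); extending the datum by 0 outside (0, T) makes the constant
  independent of T.\<close>

abbreviation enorm :: "'a::real_normed_vector \<Rightarrow> ennreal" where
  "enorm x \<equiv> ennreal (norm x)"

abbreviation lborel_nn_integral :: "('a::euclidean_space \<Rightarrow> ennreal) \<Rightarrow> ennreal" (binder "\<integral>\<^sub>+" 10) where
  "lborel_nn_integral g \<equiv> nn_integral lborel g"

abbreviation jointly_borel :: "('a::topological_space \<Rightarrow> 'b::topological_space \<Rightarrow> 'c::topological_space) \<Rightarrow> bool" where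
  "jointly_borel F \<equiv> case_prod F \<in> borel_measurable (borel \<Otimes>\<^sub>M borel)"

abbreviation frac_kernel :: "real \<Rightarrow> real \<Rightarrow> ennreal" where
  "frac_kernel \<alpha> \<tau> \<equiv> indicator {0<..} \<tau> * ennreal (\<tau> powr (- \<alpha>))"

abbreviation schr_pair :: "(real \<Rightarrow> 'a::euclidean_space \<Rightarrow> complex) \<Rightarrow> ('a \<Rightarrow> complex) \<Rightarrow> real \<times> 'a \<Rightarrow> complex" where
  "schr_pair H \<phi> z \<equiv> H (fst z) (snd z) * schroedinger (fst z) \<phi> (snd z)"

subsection \<open>Powers of extended nonnegative reals\<close>

lemma ennreal_powr_ennreal: "0 \<le> x \<Longrightarrow> ennreal_powr (ennreal x) a = ennreal (x powr a)"
  by (simp add: ennreal_powr_def)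

lemma ennreal_powr_top [simp]: "ennreal_powr top a = top"
  by (simp add: ennreal_powr_def)

lemma ennreal_powr_0 [simp]: "ennreal_powr 0 a = 0"
  by (simp add: ennreal_powr_def)

lemma ennreal_powr_1 [simp]: "ennreal_powr 1 a = 1"
  by (simp add: ennreal_powr_def)

lemma ennreal_powr_one [simp]: "ennreal_powr x 1 = x"
  by (cases x) (auto simp: ennreal_powr_def)

lemma ennreal_powr_eq_0_iff [simp]: "ennreal_powr x a = 0 \<longleftrightarrow> x = 0"
  by (cases x) (auto simp: ennreal_powr_def ennreal_eq_0_iff)

lemma ennreal_powr_eq_top_iff [simp]: "ennreal_powr x a = top \<longleftrightarrow> x = top"
  by (auto simp: ennreal_powr_def)

lemma ennreal_powr_less_top_iff [simp]: "ennreal_powr x a < top \<longleftrightarrow> x < top"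
  by (simp add: less_top[symmetric])

lemma ennreal_powr_mono: "0 \<le> a \<Longrightarrow> x \<le> y \<Longrightarrow> ennreal_powr x a \<le> ennreal_powr y a"
  by (cases x; cases y) (auto simp: ennreal_powr_def top_unique intro!: ennreal_leI powr_mono2)

lemma ennreal_powr_mult: "ennreal_powr (x * y) a = ennreal_powr x a * ennreal_powr y a"
proof (cases x; cases y)
  fix r s assume "x = ennreal r" "y = ennreal s" "0 \<le> r" "0 \<le> s"
  then show ?thesis
    by (simp add: ennreal_powr_ennreal powr_mult flip: ennreal_mult)
next
  fix r assume "x = ennreal r" "y = top" "0 \<le> r"
  then show ?thesis
    by (cases "r = 0") (auto simp: ennreal_powr_ennreal ennreal_mult_top ennreal_eq_0_iff)
next
  fix r assume "x = top" "y = ennreal r" "0 \<le> r"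
  then show ?thesis
    by (cases "r = 0") (auto simp: ennreal_powr_ennreal ennreal_top_mult ennreal_eq_0_iff)
qed (auto)

lemma ennreal_powr_powr: "ennreal_powr (ennreal_powr x a) b = ennreal_powr x (a * b)"
  by (cases x) (auto simp: ennreal_powr_ennreal powr_powr)

text \<open>At 0 and at \<infinity> the power ignores its exponent (\<open>0 powr a = 0\<close> for
  every a), so the law of exponents survives at both ends and for exponents of any sign.\<close>

lemma ennreal_powr_add: "ennreal_powr x (a + b) = ennreal_powr x a * ennreal_powr x b"
  by (cases x) (auto simp: ennreal_powr_ennreal powr_add ennreal_mult)

text \<open>Superlevel sets of a power are again half-lines. This is the form in which powers enter
  the layer-cake formula \<open>nn_integral_rearr\<close>.\<close>

lemma ennreal_powr_less_iff:
  assumes "0 < a"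
  shows "l < ennreal_powr x a \<longleftrightarrow> ennreal_powr l (1 / a) < x"
proof -
  have *: "x \<le> y" if "ennreal_powr x b \<le> ennreal_powr y b" "0 < b" for x y b
    using ennreal_powr_mono[of "1 / b", OF _ that(1)] that(2) by (simp add: ennreal_powr_powr)
  show ?thesis
    using assms *[of "ennreal_powr l (1/a)" a x] ennreal_powr_mono[of "1/a" "ennreal_powr x a" l]
      ennreal_powr_mono[of a x "ennreal_powr l (1/a)"]
    by (auto simp: ennreal_powr_powr not_le[symmetric] not_less)
qed

lemma ennreal_powr_le_iff:
  assumes "0 < a"
  shows "ennreal_powr x a \<le> y \<longleftrightarrow> x \<le> ennreal_powr y (1 / a)"
  using ennreal_powr_less_iff[OF assms, of y x] by (auto simp flip: not_le)

lemma borel_measurable_ennreal_powr [measurable (raw)]: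
  "f \<in> borel_measurable M \<Longrightarrow> (\<lambda>x. ennreal_powr (f x) a) \<in> borel_measurable M"
  unfolding ennreal_powr_def by (intro measurable_If) (auto simp: measurable_completion)

text \<open>Convexity of x powr Q, stated as its tangent line at y and obtained from Young's
  inequality with exponents Q and Q / (Q - 1).\<close>

lemma ennreal_powr_tangent:
  fixes x y Q :: real
  assumes "0 \<le> x" "0 \<le> y" "1 \<le> Q"
  shows "Q * y powr (Q - 1) * x \<le> x powr Q + (Q - 1) * y powr Q"
proof (cases "Q = 1")
  case True then show ?thesis using assms by (cases "y = 0") auto
next
  case False
  then have Q: "Q > 1" using assms by simp
  have "x * y powr (Q - 1) \<le> x powr Q / Q + (y powr (Q - 1)) powr (Q / (Q - 1)) / (Q / (Q - 1))"
    using Q assms by (intro Youngs_inequality) (auto simp: field_simps)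
  also have "(y powr (Q - 1)) powr (Q / (Q - 1)) = y powr Q"
    using Q by (simp add: powr_powr)
  finally show ?thesis using Q by (simp add: field_simps)
qed

text \<open>Jensen's inequality: integrate the tangent line taken at the mean. The tangent form
  stays meaningful for \<infinity>-valued X, and if the mean is infinite, the tangent at 1 already
  forces the right side to be infinite.\<close>

lemma (in prob_space) ennreal_powr_nn_integral_le:
  assumes X [measurable]: "X \<in> borel_measurable M" and Q: "1 \<le> Q"
  shows "ennreal_powr (\<integral>\<^sup>+x. X x \<partial>M) Q \<le> (\<integral>\<^sup>+x. ennreal_powr (X x) Q \<partial>M)"
proof -
  let ?I = "\<integral>\<^sup>+x. ennreal_powr (X x) Q \<partial>M"
  have tangent: "ennreal (Q * y powr (Q - 1)) * z \<le> ennreal_powr z Q + ennreal ((Q - 1) * y powr Q)"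
    if "0 \<le> y" for y z
    using ennreal_powr_tangent[of _ y Q] that Q
    by (cases z) (auto simp: ennreal_powr_ennreal simp flip: ennreal_mult ennreal_plus)
  have key: "ennreal (Q * y powr (Q - 1)) * (\<integral>\<^sup>+x. X x \<partial>M) \<le> ?I + ennreal ((Q - 1) * y powr Q)"
    if "0 \<le> y" for y
  proof -
    have "ennreal (Q * y powr (Q - 1)) * (\<integral>\<^sup>+x. X x \<partial>M)
        = (\<integral>\<^sup>+x. ennreal (Q * y powr (Q - 1)) * X x \<partial>M)"
      by (simp add: nn_integral_cmult)
    also have "\<dots> \<le> (\<integral>\<^sup>+x. ennreal_powr (X x) Q + ennreal ((Q - 1) * y powr Q) \<partial>M)"
      by (intro nn_integral_mono tangent that)
    also have "\<dots> = ?I + ennreal ((Q - 1) * y powr Q)"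
      by (subst nn_integral_add) (auto simp: emeasure_space_1)
    finally show ?thesis .
  qed
  show ?thesis
  proof (cases "\<integral>\<^sup>+x. X x \<partial>M")
    case (real y)
    show ?thesis
    proof (cases "?I")
      case (real z)
      from key[OF \<open>0 \<le> y\<close>] have "Q * y powr (Q - 1) * y \<le> z + (Q - 1) * y powr Q"
        using real \<open>_ = ennreal y\<close> \<open>0 \<le> y\<close> Q
        by (simp flip: ennreal_mult ennreal_plus)
      moreover have "y powr (Q - 1) * y = y powr Q"
        using \<open>0 \<le> y\<close> by (cases "y = 0") (auto simp: powr_diff)
      ultimately have "y powr Q \<le> z" by (simp add: algebra_simps)
      then show ?thesis using real \<open>_ = ennreal y\<close> \<open>0 \<le> y\<close> by (simp add: ennreal_powr_ennreal ennreal_leI)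
    qed auto
  next
    case top
    have "?I + ennreal (Q - 1) = top"
      using key[of 1] top Q by (simp add: ennreal_mult_top ennreal_top_mult top_unique ennreal_eq_0_iff)
    then show ?thesis by simp
  qed
qed

subsection \<open>Lebesgue norms with extended exponents\<close>

lemma Lebesgue_norm_top: "Lebesgue_norm M top g = esssup M g"
  by (simp add: Lebesgue_norm_def)

lemma Lebesgue_norm_ennreal:
  "0 \<le> Q \<Longrightarrow> Lebesgue_norm M (ennreal Q) g = ennreal_powr (\<integral>\<^sup>+x. ennreal_powr (g x) Q \<partial>M) (1 / Q)"
  by (simp add: Lebesgue_norm_def)

lemma exponent_cases:
  assumes "1 \<le> (q::ennreal)"
  obtains (top) "q = top" | (real) Q where "q = ennreal Q" "1 \<le> Q"
  using assms by (cases q) (auto simp flip: ennreal_1)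

lemma Lebesgue_norm_mono_AE:
  assumes "g \<in> borel_measurable M" "AE x in M. g x \<le> h x" "1 \<le> q"
  shows "Lebesgue_norm M q g \<le> Lebesgue_norm M q h"
  using \<open>1 \<le> q\<close>
proof (cases rule: exponent_cases)
  case top then show ?thesis using assms by (simp add: Lebesgue_norm_top esssup_AE_mono)
next
  case (real Q)
  have "(\<integral>\<^sup>+x. ennreal_powr (g x) Q \<partial>M) \<le> (\<integral>\<^sup>+x. ennreal_powr (h x) Q \<partial>M)"
    using assms(2) real by (intro nn_integral_mono_AE) (auto intro: ennreal_powr_mono elim!: eventually_mono)
  then show ?thesis using real by (auto simp: Lebesgue_norm_ennreal intro: ennreal_powr_mono)
qed

lemma Lebesgue_norm_mono:
  assumes "g \<in> borel_measurable M" "\<And>x. g x \<le> h x" "1 \<le> q"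
  shows "Lebesgue_norm M q g \<le> Lebesgue_norm M q h"
  using assms by (intro Lebesgue_norm_mono_AE) auto

lemma Lebesgue_norm_cmult:
  assumes g [measurable]: "g \<in> borel_measurable M" and q: "1 \<le> q" and c: "0 \<le> c"
  shows "Lebesgue_norm M q (\<lambda>x. ennreal c * g x) = ennreal c * Lebesgue_norm M q g"
proof -
  \<comment> \<open>For q = \<infinity> only this inequality is direct; scaling back by 1 / c turns
    it into an equality.\<close>
  have le: "Lebesgue_norm M q (\<lambda>x. ennreal c * g x) \<le> ennreal c * Lebesgue_norm M q g"
    if [measurable]: "g \<in> borel_measurable M" for c g using q
  proof (cases rule: exponent_cases)
    case top
    have "AE x in M. ennreal c * g x \<le> ennreal c * esssup M g"
      using esssup_AE[of g M] by eventually_elim (auto intro: mult_left_mono)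
    then show ?thesis using top by (auto simp: Lebesgue_norm_top)
  next
    case (real Q)
    then show ?thesis
      by (simp add: Lebesgue_norm_ennreal ennreal_powr_mult nn_integral_cmult ennreal_powr_powr)
  qed
  show ?thesis
  proof (cases "c = 0")
    case True then show ?thesis using le[OF g, of 0] by simp
  next
    case False
    then have c: "0 < c" using c by simp
    have inv: "ennreal (1 / c) * (ennreal c * z) = z" for z
      using c by (simp add: mult.assoc[symmetric] flip: ennreal_mult)
    have inv': "ennreal c * (ennreal (1 / c) * z) = z" for z
      using c by (simp add: mult.assoc[symmetric] flip: ennreal_mult)
    have "Lebesgue_norm M q g \<le> ennreal (1 / c) * Lebesgue_norm M q (\<lambda>x. ennreal c * g x)"
      using le[of "\<lambda>x. ennreal c * g x" "1 / c"] by (simp only: inv) simp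
    then have "ennreal c * Lebesgue_norm M q g \<le> Lebesgue_norm M q (\<lambda>x. ennreal c * g x)"
      using mult_left_mono[of _ _ "ennreal c"] by (metis inv' zero_le)
    then show ?thesis using le[OF g] by (auto intro: antisym)
  qed
qed

lemma Lebesgue_norm_eq_0:
  assumes g [measurable]: "g \<in> borel_measurable M" and q: "1 \<le> q" and 0: "Lebesgue_norm M q g = 0"
  shows "AE x in M. g x = 0"
  using q
proof (cases rule: exponent_cases)
  case top then show ?thesis using esssup_AE[of g M] 0 by (simp add: Lebesgue_norm_top)
next
  case (real Q) then show ?thesis using 0 by (simp add: Lebesgue_norm_ennreal nn_integral_0_iff_AE)
qed

text \<open>For q = \<infinity>, y lies below the essential supremum of a section exactly when the
  section exceeds y on a set of positive measure, and that measure depends measurably on the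
  parameter because M is sigma-finite.\<close>

lemma borel_measurable_Lebesgue_norm [measurable (raw)]:
  assumes M: "sigma_finite_measure M" and q: "1 \<le> q"
    and F [measurable]: "case_prod F \<in> borel_measurable (S \<Otimes>\<^sub>M M)"
  shows "(\<lambda>s. Lebesgue_norm M q (F s)) \<in> borel_measurable S"
proof -
  interpret sigma_finite_measure M by fact
  show ?thesis using q
  proof (cases rule: exponent_cases)
    case top
    have "{s \<in> space S. y < esssup M (F s)} = {s \<in> space S. 0 < emeasure M {x \<in> space M. y < F s x}}" for y
    proof (intro Collect_cong conj_cong refl)
      fix s assume s: "s \<in> space S"
      then have [measurable]: "F s \<in> borel_measurable M" by measurable
      show "(y < esssup M (F s)) = (0 < emeasure M {x \<in> space M. y < F s x})"
      proof
        assume "0 < emeasure M {x \<in> space M. y < F s x}"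
        show "y < esssup M (F s)"
        proof (rule ccontr)
          assume "\<not> y < esssup M (F s)"
          then have "AE x in M. F s x \<le> y" using esssup_AE[of "F s" M] by (auto elim: eventually_mono)
          then have "emeasure M {x \<in> space M. y < F s x} = 0"
            by (subst (asm) AE_iff_measurable[OF _ refl]) (auto simp: not_le)
          then show False using \<open>0 < _\<close> by simp
        qed
      qed (auto intro: esssup_pos_measure)
    qed
    then show ?thesis
      unfolding top Lebesgue_norm_top by (intro borel_measurableI_greater) simp
  next
    case (real Q) then show ?thesis by (simp add: Lebesgue_norm_ennreal)
  qed
qed

text \<open>Minkowski's integral inequality from Jensen's: the inner integral is W times the mean of
  F / w under the probability (w / W) ds, where w is the norm of the section and W its integral.
  After exchanging the integrals the powers of w cancel.\<close>

lemma Minkowski_nn_integral: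
  assumes M: "sigma_finite_measure M" and S: "sigma_finite_measure S" and q: "1 \<le> q"
    and F [measurable]: "case_prod F \<in> borel_measurable (S \<Otimes>\<^sub>M M)"
  shows "Lebesgue_norm M q (\<lambda>x. \<integral>\<^sup>+s. F s x \<partial>S) \<le> (\<integral>\<^sup>+s. Lebesgue_norm M q (F s) \<partial>S)"
proof -
  interpret M: sigma_finite_measure M by fact
  interpret S: sigma_finite_measure S by fact
  interpret pair_sigma_finite S M ..
  have Fs [measurable]: "F s \<in> borel_measurable M" if "s \<in> space S" for s using that by measurable
  define w where "w s = Lebesgue_norm M q (F s)" for s
  have w [measurable]: "w \<in> borel_measurable S"
    unfolding w_def by (rule borel_measurable_Lebesgue_norm[OF M q F])
  have F' [measurable]: "(\<lambda>(x, s). F s x) \<in> borel_measurable (M \<Otimes>\<^sub>M S)"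
    by (subst measurable_split_conv) measurable
  show ?thesis
  proof (cases "(\<integral>\<^sup>+s. w s \<partial>S) = top")
    case True then show ?thesis by (simp add: w_def)
  next
    case W_fin: False
    define W where "W = (\<integral>\<^sup>+s. w s \<partial>S)"
    from q show ?thesis
    proof (cases rule: exponent_cases)
      case top
      have "AE s in S. AE x in M. F s x \<le> w s"
        by (simp add: w_def top Lebesgue_norm_top esssup_AE)
      then have "AE x in M. AE s in S. F s x \<le> w s"
        by (subst (asm) AE_commute) auto
      then have "AE x in M. (\<integral>\<^sup>+s. F s x \<partial>S) \<le> W"
        unfolding W_def by eventually_elim (rule nn_integral_mono_AE)
      then show ?thesis unfolding top Lebesgue_norm_top W_def w_def by (intro esssup_I) auto
    next
      case (real Q)
      have wQ: "(\<integral>\<^sup>+x. ennreal_powr (F s x) Q \<partial>M) = ennreal_powr (w s) Q" for s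
        using real by (simp add: w_def Lebesgue_norm_ennreal ennreal_powr_powr)
      \<comment> \<open>A section of norm 0 vanishes almost everywhere, so dividing by w loses
        nothing; \<open>AE_commute\<close> makes this usable for almost every x.\<close>
      have "AE s in S. AE x in M. w s = 0 \<longrightarrow> F s x = 0"
      proof (rule AE_I2)
        fix s assume "s \<in> space S"
        then show "AE x in M. w s = 0 \<longrightarrow> F s x = 0"
          using Lebesgue_norm_eq_0[OF Fs q] by (cases "w s = 0") (auto simp: w_def)
      qed
      then have null: "AE x in M. AE s in S. w s = 0 \<longrightarrow> F s x = 0"
        by (subst (asm) AE_commute) auto
      have w_top: "AE s in S. w s \<noteq> top"
        using nn_integral_PInf_AE[of w S] W_fin by simp
      show ?thesis
      proof (cases "W = 0")
        case True
        then have w0: "AE s in S. w s = 0" by (simp add: W_def nn_integral_0_iff_AE)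
        have "AE x in M. (\<integral>\<^sup>+s. F s x \<partial>S) = 0"
          using null AE_space
        proof eventually_elim
          case (elim x)
          have "AE s in S. F s x = 0" using elim(1) w0 by eventually_elim auto
          then show ?case using elim by (subst nn_integral_0_iff_AE) auto
        qed
        then have "(\<integral>\<^sup>+x. ennreal_powr (\<integral>\<^sup>+s. F s x \<partial>S) Q \<partial>M) = 0"
          by (subst nn_integral_0_iff_AE) auto
        then show ?thesis using real by (simp add: Lebesgue_norm_ennreal)
      next
        case False
        have Wne: "W \<noteq> 0" "W \<noteq> top" using False W_fin by (auto simp: W_def)
        define P where "P = density S (\<lambda>s. w s / W)"
        have "emeasure P (space P) = (\<integral>\<^sup>+s. w s / W \<partial>S)"
          by (auto simp: P_def emeasure_density cong: nn_integral_cong)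
        also have "\<dots> = 1" using Wne
          by (simp add: nn_integral_divide W_def[symmetric] ennreal_divide_self less_top[symmetric])
        finally interpret P: prob_space P by (rule prob_spaceI)
        let ?X = "\<lambda>x s. F s x / w s"
        have 1: "AE x in M. (\<integral>\<^sup>+s. F s x \<partial>S) = W * (\<integral>\<^sup>+s. ?X x s \<partial>P)"
          using null AE_space
        proof eventually_elim
          case (elim x)
          have "W * (\<integral>\<^sup>+s. ?X x s \<partial>P) = W * (\<integral>\<^sup>+s. w s / W * ?X x s \<partial>S)"
            unfolding P_def using elim by (subst nn_integral_density) auto
          also have "\<dots> = (\<integral>\<^sup>+s. W * (w s / W * ?X x s) \<partial>S)"
            using elim by (subst nn_integral_cmult) auto
          also have "\<dots> = (\<integral>\<^sup>+s. F s x \<partial>S)"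
            using elim(1) w_top
          proof (intro nn_integral_cong_AE, eventually_elim)
            case (elim s)
            have "W * (w s / W * ?X x s) = (W / W) * ((w s / w s) * F s x)"
              by (simp add: divide_ennreal_def ac_simps)
            also have "W / W = 1" using Wne by (simp add: ennreal_divide_self less_top)
            also have "(w s / w s) * F s x = F s x"
              using elim by (cases "w s = 0") (auto simp: ennreal_divide_self less_top)
            finally show ?case by simp
          qed
          finally show ?case by simp
        qed
        have "(\<integral>\<^sup>+x. ennreal_powr (\<integral>\<^sup>+s. F s x \<partial>S) Q \<partial>M)
            = (\<integral>\<^sup>+x. ennreal_powr W Q * ennreal_powr (\<integral>\<^sup>+s. ?X x s \<partial>P) Q \<partial>M)"
          using 1 by (intro nn_integral_cong_AE) (auto simp: ennreal_powr_mult elim!: eventually_mono)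
        also have "\<dots> \<le> (\<integral>\<^sup>+x. ennreal_powr W Q * (\<integral>\<^sup>+s. ennreal_powr (?X x s) Q \<partial>P) \<partial>M)"
          using real by (intro nn_integral_mono mult_left_mono P.ennreal_powr_nn_integral_le)
            (auto simp: P_def)
        also have "\<dots> = ennreal_powr W Q * (\<integral>\<^sup>+x. (\<integral>\<^sup>+s. w s / W * ennreal_powr (?X x s) Q \<partial>S) \<partial>M)"
          unfolding P_def
          by (subst nn_integral_cmult[symmetric]; (intro nn_integral_cong)?)
            (auto simp: nn_integral_density)
        also have "(\<integral>\<^sup>+x. (\<integral>\<^sup>+s. w s / W * ennreal_powr (?X x s) Q \<partial>S) \<partial>M)
            = (\<integral>\<^sup>+s. (\<integral>\<^sup>+x. w s / W * ennreal_powr (?X x s) Q \<partial>M) \<partial>S)"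
          by (rule Fubini') measurable
        also have "\<dots> \<le> (\<integral>\<^sup>+s. w s / W \<partial>S)"
        proof (intro nn_integral_mono)
          fix s assume s: "s \<in> space S"
          have "(\<integral>\<^sup>+x. w s / W * ennreal_powr (?X x s) Q \<partial>M)
              = w s / W * (ennreal_powr (1 / w s) Q * (\<integral>\<^sup>+x. ennreal_powr (F s x) Q \<partial>M))"
            using s by (simp add: nn_integral_cmult nn_integral_multc divide_ennreal_def ennreal_powr_mult ac_simps)
          also have "\<dots> = w s / W * ennreal_powr (w s / w s) Q"
            by (simp add: wQ divide_ennreal_def ennreal_powr_mult[symmetric] ac_simps)
          also have "\<dots> \<le> w s / W * ennreal_powr 1 Q"
            using real by (intro mult_left_mono ennreal_powr_mono)
              (auto, metis ennreal_divide_self ennreal_zero_divide le_less linorder_not_less ennreal_divide_top order_refl zero_less_one top.not_eq_extremum zero_le)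
          finally show "(\<integral>\<^sup>+x. w s / W * ennreal_powr (?X x s) Q \<partial>M) \<le> w s / W" by simp
        qed
        also have "\<dots> = 1"
          using \<open>emeasure P (space P) = _\<close> P.emeasure_space_1 by simp
        finally have "(\<integral>\<^sup>+x. ennreal_powr (\<integral>\<^sup>+s. F s x \<partial>S) Q \<partial>M) \<le> ennreal_powr W Q"
          by (auto simp: mult_left_mono)
        then have "ennreal_powr (\<integral>\<^sup>+x. ennreal_powr (\<integral>\<^sup>+s. F s x \<partial>S) Q \<partial>M) (1 / Q) \<le> W"
          using ennreal_powr_mono[of "1 / Q"] real by (fastforce simp: ennreal_powr_powr)
        then show ?thesis using real by (simp add: Lebesgue_norm_ennreal W_def w_def)
      qed
    qed
  qed
qed

text \<open>The triangle inequality is Minkowski's integral inequality for the counting measure on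
  two points.\<close>

lemma Lebesgue_norm_add:
  assumes M: "sigma_finite_measure M" and q: "1 \<le> q"
    and [measurable]: "g \<in> borel_measurable M" "h \<in> borel_measurable M"
  shows "Lebesgue_norm M q (\<lambda>x. g x + h x) \<le> Lebesgue_norm M q g + Lebesgue_norm M q h"
proof -
  have "Lebesgue_norm M q (\<lambda>x. \<integral>\<^sup>+b. (if b then g x else h x) \<partial>count_space UNIV)
      \<le> (\<integral>\<^sup>+b. Lebesgue_norm M q (\<lambda>x. if b then g x else h x) \<partial>count_space UNIV)"
    by (intro Minkowski_nn_integral[OF M _ q] sigma_finite_measure_count_space_countable) measurable
  then show ?thesis by (simp add: nn_integral_count_space_finite UNIV_bool add.commute)
qed

text \<open>The case b = -1 is included because the reflection of x is the inversion a to 1 / a in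
  logarithmic variables.\<close>

lemma Lebesgue_norm_translate:
  assumes g [measurable]: "g \<in> borel_measurable lborel" and q: "1 \<le> q" and b: "\<bar>b\<bar> = 1"
  shows "Lebesgue_norm lborel q (\<lambda>x. g (c + b * x)) = Lebesgue_norm lborel q (g :: real \<Rightarrow> ennreal)"
  using q
proof (cases rule: exponent_cases)
  case top
  have b0: "b \<noteq> 0" using b by auto
  have "(AE x in lborel. g (c + b * x) \<le> z) \<longleftrightarrow> (AE x in lborel. g x \<le> z)" for z
  proof -
    have "(AE x in lborel. g x \<le> z) \<longleftrightarrow> (AE x in density (distr lborel borel (\<lambda>x. c + b * x)) (\<lambda>_. ennreal \<bar>b\<bar>). g x \<le> z)"
      by (subst lborel_real_affine[OF b0, of c]) (rule refl)
    also have "\<dots> \<longleftrightarrow> (AE x in lborel. g (c + b * x) \<le> z)"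
      using b by (simp add: AE_density AE_distr_iff)
    finally show ?thesis by simp
  qed
  then show ?thesis using top by (simp add: Lebesgue_norm_top esssup_eq_AE)
next
  case (real Q)
  have "(\<integral>\<^sub>+x. ennreal_powr (g x) Q) = (\<integral>\<^sub>+x. ennreal_powr (g (c + b * x)) Q)"
    using nn_integral_real_affine[of "\<lambda>x. ennreal_powr (g x) Q" b c] b by (cases "b = 0") auto
  then show ?thesis using real by (simp add: Lebesgue_norm_ennreal)
qed

subsection \<open>Rearrangements\<close>

text \<open>Values in \<open>ennreal\<close> and an arbitrary measure, so that one notion serves for
  norms of functions in space and for fractional integrals in time.\<close>

definition rearr :: "'a measure \<Rightarrow> ('a \<Rightarrow> ennreal) \<Rightarrow> real \<Rightarrow> ennreal" where
  "rearr M g t = Inf {l. emeasure M {x \<in> space M. l < g x} \<le> ennreal t}"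

lemma decreasing_rearrangement_eq_rearr:
  "decreasing_rearrangement f = rearr lebesgue (\<lambda>x. enorm (f x))"
  by (simp add: fun_eq_iff decreasing_rearrangement_def rearr_def)

text \<open>Rearrangement and distribution function are generalized inverses of each other; the
  strict form is exact because the distribution function is right-continuous. Most facts on
  rearrangements below go through this equivalence.\<close>

lemma less_rearr_iff:
  assumes g [measurable]: "g \<in> borel_measurable M"
  shows "l < rearr M g t \<longleftrightarrow> ennreal t < emeasure M {x \<in> space M. l < g x}"
proof
  show "ennreal t < emeasure M {x \<in> space M. l < g x}" if "l < rearr M g t"
  proof (rule ccontr)
    assume "\<not> ?thesis"
    then have "rearr M g t \<le> l" unfolding rearr_def by (intro Inf_lower) (simp add: not_less)
    then show False using that by simp
  qed
  show "l < rearr M g t" if t: "ennreal t < emeasure M {x \<in> space M. l < g x}"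
  proof (cases l)
    case (real a)
    show ?thesis
    proof (rule ccontr)
      assume "\<not> l < rearr M g t"
      then have le: "Inf {l. emeasure M {x \<in> space M. l < g x} \<le> ennreal t} \<le> l" by (simp add: rearr_def)
      \<comment> \<open>\<open>A n\<close> increases to the superlevel set {l < g}; continuity of
        the measure from below is the right continuity of the distribution function.\<close>
      define A where "A n = {x \<in> space M. ennreal (a + 1 / Suc n) < g x}" for n
      have "emeasure M (A n) \<le> ennreal t" for n
      proof -
        have "l < ennreal (a + 1 / Suc n)" using real by (simp add: ennreal_lessI)
        then obtain l' where l': "emeasure M {x \<in> space M. l' < g x} \<le> ennreal t" "l' < ennreal (a + 1 / Suc n)"
          using le by (metis (mono_tags, lifting) Inf_less_iff le_less_trans mem_Collect_eq)
        have "emeasure M (A n) \<le> emeasure M {x \<in> space M. l' < g x}"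
          unfolding A_def using l'(2) by (intro emeasure_mono) (auto intro: order.strict_trans)
        with l'(1) show ?thesis by simp
      qed
      moreover have "{x \<in> space M. l < g x} = (\<Union>n. A n)"
      proof (intro set_eqI iffI)
        fix x assume "x \<in> {x \<in> space M. l < g x}"
        then have x: "x \<in> space M" "ennreal a < g x" using real by auto
        then obtain b where b: "ennreal a < ennreal b" "ennreal b < g x" "0 \<le> b"
          by (metis dense ennreal_cases less_top top.not_eq_extremum order.strict_trans)
        then have "a < b" using real by (simp add: ennreal_less_iff)
        then obtain n where "1 / Suc n < b - a"
          using reals_Archimedean[of "b - a"] by (auto simp: field_simps)
        then have "ennreal (a + 1 / Suc n) \<le> ennreal b" by (intro ennreal_leI) simp
        then have "ennreal (a + 1 / Suc n) < g x" using b(2) by (rule le_less_trans)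
          then show "x \<in> (\<Union>n. A n)" using x by (auto simp: A_def)
      next
        fix x assume "x \<in> (\<Union>n. A n)"
        then obtain n where "x \<in> space M" "ennreal (a + 1 / Suc n) < g x" by (auto simp: A_def)
        moreover have "ennreal a \<le> ennreal (a + 1 / Suc n)" by (intro ennreal_leI) simp
        ultimately have "ennreal a < g x" by (metis le_less_trans)
        with \<open>x \<in> space M\<close> show "x \<in> {x \<in> space M. l < g x}" using real by auto
      qed
      moreover have "incseq A"
      proof (rule incseq_SucI, clarsimp simp: A_def)
        fix n x assume "ennreal (a + 1 / (1 + real n)) < g x"
        moreover have "ennreal (a + 1 / (2 + real n)) \<le> ennreal (a + 1 / (1 + real n))"
          by (intro ennreal_leI add_left_mono) (simp add: field_simps)
        ultimately show "ennreal (a + 1 / (2 + real n)) < g x" by simp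
      qed
      moreover have "range A \<subseteq> sets M" by (auto simp: A_def)
      ultimately have "emeasure M {x \<in> space M. l < g x} \<le> ennreal t"
        using SUP_emeasure_incseq[of A M] by (metis SUP_least)
      with t show False by simp
    qed
  qed (use t in \<open>auto simp: not_less\<close>)
qed

lemma rearr_le_iff:
  "g \<in> borel_measurable M \<Longrightarrow> rearr M g t \<le> l \<longleftrightarrow> emeasure M {x \<in> space M. l < g x} \<le> ennreal t"
  using less_rearr_iff[of g M l t] by (auto simp flip: not_le)

lemma emeasure_rearr_less:
  "g \<in> borel_measurable M \<Longrightarrow> emeasure M {x \<in> space M. rearr M g t < g x} \<le> ennreal t"
  using rearr_le_iff[of g M t "rearr M g t"] by simp

lemma rearr_antimono: "s \<le> t \<Longrightarrow> rearr M g t \<le> rearr M g s"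
  unfolding rearr_def by (rule Inf_superset_mono, clarify) (erule order_trans, rule ennreal_leI)

lemma rearr_mono_AE:
  assumes [measurable]: "g \<in> borel_measurable M" "h \<in> borel_measurable M"
    and le: "AE x in M. g x \<le> h x"
  shows "rearr M g t \<le> rearr M h t"
proof -
  have "emeasure M {x \<in> space M. rearr M h t < g x} \<le> emeasure M {x \<in> space M. rearr M h t < h x}"
    using le by (intro emeasure_mono_AE) (auto elim!: eventually_mono)
  also have "\<dots> \<le> ennreal t" by (rule emeasure_rearr_less) fact
  finally show ?thesis by (simp add: rearr_le_iff)
qed

lemma rearr_cong_AE:
  assumes "g \<in> borel_measurable M" "h \<in> borel_measurable M" "AE x in M. g x = h x"
  shows "rearr M g t = rearr M h t"
  using assms by (intro antisym rearr_mono_AE) auto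

lemma borel_measurable_rearr [measurable]:
  assumes [measurable]: "g \<in> borel_measurable M"
  shows "rearr M g \<in> borel_measurable borel"
  by (rule borel_measurableI_greater) (simp add: less_rearr_iff)

text \<open>By \<open>less_rearr_iff\<close> a superlevel set in (s, t) is a comparison of t with a
  measurable function of s.\<close>

lemma borel_measurable_rearr_pair:
  assumes M: "sigma_finite_measure M" and H [measurable]: "case_prod H \<in> borel_measurable (S \<Otimes>\<^sub>M M)"
  shows "(\<lambda>(s, t). rearr M (H s) t) \<in> borel_measurable (S \<Otimes>\<^sub>M borel)"
proof (rule borel_measurableI_greater)
  interpret sigma_finite_measure M by fact
  fix y
  have [measurable]: "H s \<in> borel_measurable M" if "s \<in> space S" for s using that by measurable
  have "{x \<in> space (S \<Otimes>\<^sub>M borel). y < (case x of (s, t) \<Rightarrow> rearr M (H s) t)}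
      = {x \<in> space (S \<Otimes>\<^sub>M borel). ennreal (snd x) < emeasure M {z \<in> space M. y < H (fst x) z}}"
    by (auto simp: space_pair_measure less_rearr_iff)
  also have "\<dots> \<in> sets (S \<Otimes>\<^sub>M borel)" by measurable
  finally show "{x \<in> space (S \<Otimes>\<^sub>M borel). y < (case x of (s, t) \<Rightarrow> rearr M (H s) t)} \<in> sets (S \<Otimes>\<^sub>M borel)" .
qed

section \<open>Layer-cake formulas and integrals of truncations\<close>

lemma emeasure_lborel_layer:
  "emeasure lborel {l. 0 < l \<and> ennreal l < y} = y"
proof (cases y)
  case (real r)
  then have "{l. 0 < l \<and> ennreal l < y} = {0<..<r}" by (auto simp: ennreal_less_iff)
  then show ?thesis using real by simp
next
  case top
  have "of_nat n \<le> emeasure lborel {l. 0 < l \<and> ennreal l < y}" for n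
  proof -
    have "emeasure lborel {0<..<real n} \<le> emeasure lborel {l. 0 < l \<and> ennreal l < y}"
      using top by (intro emeasure_mono) auto
    then show ?thesis by (simp add: ennreal_of_nat_eq_real_of_nat)
  qed
  then show ?thesis using top by (metis ennreal_Ex_less_of_nat not_le top.not_eq_extremum)
qed

lemma nn_integral_layer_cake:
  assumes M: "sigma_finite_measure M" and g [measurable]: "g \<in> borel_measurable M"
  shows "(\<integral>\<^sup>+x. g x \<partial>M) = (\<integral>\<^sub>+l. indicator {0<..} l * emeasure M {x \<in> space M. ennreal l < g x})"
proof -
  interpret M: sigma_finite_measure M by fact
  interpret pair_sigma_finite M lborel ..
  have "(\<integral>\<^sup>+x. g x \<partial>M) = (\<integral>\<^sup>+x. (\<integral>\<^sub>+l. indicator {l. 0 < l \<and> ennreal l < g x} l) \<partial>M)"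
    by (simp add: emeasure_lborel_layer)
  also have "\<dots> = (\<integral>\<^sub>+l. (\<integral>\<^sup>+x. indicator {l. 0 < l \<and> ennreal l < g x} l \<partial>M))"
    unfolding indicator_def by (rule Fubini'[symmetric]) measurable
  also have "\<dots> = (\<integral>\<^sub>+l. indicator {0<..} l * emeasure M {x \<in> space M. ennreal l < g x})"
  proof (intro nn_integral_cong)
    fix l :: real
    have "(\<integral>\<^sup>+x. indicator {l. 0 < l \<and> ennreal l < g x} l \<partial>M)
        = (\<integral>\<^sup>+x. indicator {0<..} l * indicator {x \<in> space M. ennreal l < g x} x \<partial>M)"
      by (intro nn_integral_cong) (auto simp: indicator_def)
    then show "(\<integral>\<^sup>+x. indicator {l. 0 < l \<and> ennreal l < g x} l \<partial>M)
        = indicator {0<..} l * emeasure M {x \<in> space M. ennreal l < g x}"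
      by (simp add: nn_integral_cmult)
  qed
  finally show ?thesis .
qed

text \<open>Equimeasurability: g and its rearrangement have the same distribution function, and
  layer cake reduces both sides to it. The assumption \<open>level\<close> says that \<Phi> is
  increasing and left-continuous with \<Phi> 0 = 0; positive powers, y - lev and min y lev are of
  this kind.\<close>

lemma nn_integral_rearr:
  assumes M: "sigma_finite_measure M" and g [measurable]: "g \<in> borel_measurable M"
    and \<Phi> [measurable]: "\<Phi> \<in> borel_measurable borel" and level: "\<And>l. \<exists>m. \<forall>y. l < \<Phi> y \<longleftrightarrow> m < y"
  shows "(\<integral>\<^sup>+x. \<Phi> (g x) \<partial>M) = (\<integral>\<^sub>+c. indicator {0<..} c * \<Phi> (rearr M g c))"
proof -
  have "emeasure M {x \<in> space M. l < \<Phi> (g x)}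
      = emeasure lborel {c \<in> space lborel. l < indicator {0<..} c * \<Phi> (rearr M g c)}" for l
  proof -
    obtain m where m: "\<And>y. l < \<Phi> y \<longleftrightarrow> m < y" using level by blast
    have "{c \<in> space lborel. l < indicator {0<..} c * \<Phi> (rearr M g c)} = {c. 0 < c \<and> ennreal c < emeasure M {x \<in> space M. m < g x}}"
      by (auto simp: indicator_def m less_rearr_iff)
    then show ?thesis by (simp add: m emeasure_lborel_layer)
  qed
  then show ?thesis
    by (subst nn_integral_layer_cake[OF M], measurable)
      (subst nn_integral_layer_cake[OF sigma_finite_lborel], auto)
qed

lemma nn_integral_powr_rearr:
  assumes "sigma_finite_measure M" "g \<in> borel_measurable M" "0 < a"
  shows "(\<integral>\<^sup>+x. ennreal_powr (g x) a \<partial>M) = (\<integral>\<^sub>+c. indicator {0<..} c * ennreal_powr (rearr M g c) a)"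
proof (rule nn_integral_rearr[where \<Phi>="\<lambda>y. ennreal_powr y a", OF assms(1,2)])
  show "\<exists>m. \<forall>y. (l < ennreal_powr y a) = (m < y)" for l
    by (rule exI[of _ "ennreal_powr l (1 / a)"], rule allI, rule ennreal_powr_less_iff, rule assms(3))
  show "(\<lambda>y. ennreal_powr y a) \<in> borel_measurable borel"
    by (rule borel_measurable_ennreal_powr) simp
qed

text \<open>Outside the union of the two exceptional sets, of measure at most s + t, the sum stays
  below the sum of the two rearrangements.\<close>

lemma rearr_add:
  assumes [measurable]: "g \<in> borel_measurable M" "h \<in> borel_measurable M" and "0 \<le> s" "0 \<le> t"
  shows "rearr M (\<lambda>x. g x + h x) (s + t) \<le> rearr M g s + rearr M h t"
proof -
  let ?A = "{x \<in> space M. rearr M g s < g x}" and ?B = "{x \<in> space M. rearr M h t < h x}"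
  have "emeasure M {x \<in> space M. rearr M g s + rearr M h t < g x + h x} \<le> emeasure M (?A \<union> ?B)"
  proof (rule emeasure_mono)
    show "{x \<in> space M. rearr M g s + rearr M h t < g x + h x} \<subseteq> ?A \<union> ?B"
      using add_mono[of "g _" "rearr M g s" "h _" "rearr M h t"] by (fastforce simp: not_less[symmetric])
  qed auto
  also have "\<dots> \<le> emeasure M ?A + emeasure M ?B" by (intro emeasure_subadditive) auto
  also have "\<dots> \<le> ennreal s + ennreal t" by (intro add_mono emeasure_rearr_less) auto
  finally show ?thesis using assms by (simp add: rearr_le_iff)
qed

lemma rearr_cmult_le:
  assumes [measurable]: "g \<in> borel_measurable M"
  shows "rearr M (\<lambda>x. c * g x) t \<le> c * rearr M g t"
proof -
  have "emeasure M {x \<in> space M. c * rearr M g t < c * g x} \<le> emeasure M {x \<in> space M. rearr M g t < g x}"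
    by (intro emeasure_mono) (auto simp: not_le[symmetric] intro: mult_left_mono)
  also have "\<dots> \<le> ennreal t" by (rule emeasure_rearr_less) fact
  finally show ?thesis by (simp add: rearr_le_iff)
qed

text \<open>A bounded summand only shifts the rearrangement; this disposes of the part of the
  solution that the kernel bound controls.\<close>

lemma rearr_le_add:
  assumes [measurable]: "g \<in> borel_measurable M" "h \<in> borel_measurable M"
    and le: "AE x in M. g x \<le> A + h x"
  shows "rearr M g t \<le> A + rearr M h t"
proof -
  have "emeasure M {x \<in> space M. A + rearr M h t < g x} \<le> emeasure M {x \<in> space M. rearr M h t < h x}"
    using le by (intro emeasure_mono_AE)
      (auto elim!: eventually_mono simp: not_le[symmetric] intro: order_trans add_left_mono)
  also have "\<dots> \<le> ennreal t" by (rule emeasure_rearr_less) fact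
  finally show ?thesis by (simp add: rearr_le_iff)
qed

lemma rearr_Chebyshev:
  assumes M: "sigma_finite_measure M" and g [measurable]: "g \<in> borel_measurable M" and a: "0 < a" and t: "0 < t"
  shows "ennreal t * ennreal_powr (rearr M g t) a \<le> (\<integral>\<^sup>+x. ennreal_powr (g x) a \<partial>M)"
proof -
  have "ennreal t * ennreal_powr (rearr M g t) a = (\<integral>\<^sub>+c. ennreal_powr (rearr M g t) a * indicator {0<..<t} c)"
    using t by (subst nn_integral_cmult_indicator) (auto simp: mult.commute)
  also have "\<dots> \<le> (\<integral>\<^sub>+c. indicator {0<..} c * ennreal_powr (rearr M g c) a)"
    using a by (intro nn_integral_mono) (auto simp: indicator_def intro!: ennreal_powr_mono rearr_antimono)
  finally show ?thesis using nn_integral_powr_rearr[OF M g a] by simp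
qed

text \<open>The excess over a height that dominates the rearrangement at b is carried by the
  arguments c < b, and there it is at most the rearrangement itself.\<close>

lemma nn_integral_diff_rearr_le:
  assumes M: "sigma_finite_measure M" and g [measurable]: "g \<in> borel_measurable M"
    and b: "rearr M g b \<le> ennreal lev" and lev: "0 \<le> lev"
  shows "(\<integral>\<^sup>+x. g x - ennreal lev \<partial>M) \<le> (\<integral>\<^sub>+c. indicator {0<..<b} c * rearr M g c)"
proof -
  have "(\<integral>\<^sup>+x. g x - ennreal lev \<partial>M) = (\<integral>\<^sub>+c. indicator {0<..} c * (rearr M g c - ennreal lev))"
  proof (rule nn_integral_rearr[where \<Phi>="\<lambda>y. y - ennreal lev", OF M g])
    show "\<exists>m. \<forall>y. (l < y - ennreal lev) = (m < y)" for l
    proof (rule exI[of _ "ennreal lev + l"], rule allI)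
      show "(l < y - ennreal lev) = (ennreal lev + l < y)" for y
        using lev by (cases y; cases l)
          (auto simp: ennreal_minus ennreal_less_iff ennreal_eq_0_iff not_less simp flip: ennreal_plus)
    qed
  qed auto
  also have "\<dots> \<le> (\<integral>\<^sub>+c. indicator {0<..<b} c * rearr M g c)"
  proof (intro nn_integral_mono)
    fix c
    show "indicator {0<..} c * (rearr M g c - ennreal lev) \<le> indicator {0<..<b} c * rearr M g c"
    proof (cases "c < b")
      case False
      then have "rearr M g c \<le> ennreal lev" using rearr_antimono[of b c M g] b by simp
      then show ?thesis by (simp add: diff_eq_0_ennreal[OF le_less_trans[OF \<open>rearr M g c \<le> ennreal lev\<close> ennreal_less_top]])
    qed (auto simp: indicator_def diff_le_self_ennreal)
  qed
  finally show ?thesis .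
qed

text \<open>The L^2 norm of the lower part has to be bounded by something linear in the
  rearrangement, since only such a bound can be fed to Minkowski's inequality later. Monotonicity
  provides it: L^(2,1) dominates L^2, here localized to c > b / 2.\<close>

lemma nn_integral_min_rearr_le:
  assumes M: "sigma_finite_measure M" and g [measurable]: "g \<in> borel_measurable M" and b: "0 < b"
    and lev: "ennreal lev \<le> rearr M g b"
  shows "(\<integral>\<^sup>+x. ennreal_powr (min (g x) (ennreal lev)) 2 \<partial>M)
    \<le> ennreal_powr (3 * (\<integral>\<^sub>+c. indicator {b / 2<..} c * (ennreal (c powr (- 1 / 2)) * rearr M g c))) 2"
proof -
  define I where "I = (\<integral>\<^sub>+c. indicator {b / 2<..} c * (ennreal (c powr (- 1 / 2)) * rearr M g c))"
  have sq: "ennreal_powr x 2 = x * x" for x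
    using ennreal_powr_add[of x 1 1] by simp
  \<comment> \<open>Both c powr (-1/2) and the rearrangement decrease, so their product at c is at
    most its mean over (c / 2, c); hence the lower limit b / 2 in \<open>I\<close>.\<close>
  have I: "ennreal (c powr (1 / 2)) * rearr M g c \<le> 2 * I" if "b \<le> c" for c
  proof -
    have c: "0 < c" using b that by simp
    have "ennreal (c powr (1/2)) * rearr M g c = 2 * (ennreal (c powr (-1/2)) * rearr M g c * ennreal (c / 2))"
    proof -
      have "ennreal (c powr (1/2)) = 2 * (ennreal (c powr (-1/2)) * ennreal (c / 2))"
        using c powr_add[of c "-1/2" 1] by (simp flip: ennreal_mult ennreal_numeral)
      then show ?thesis by (simp add: ac_simps)
    qed
    also have "ennreal (c powr (-1/2)) * rearr M g c * ennreal (c / 2)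
        = (\<integral>\<^sub>+x. ennreal (c powr (-1/2)) * rearr M g c * indicator {c / 2<..<c} x)"
      using c by (subst nn_integral_cmult_indicator) auto
    also have "\<dots> \<le> I"
      unfolding I_def using that c b
      by (intro nn_integral_mono)
        (auto simp: indicator_def intro!: mult_mono rearr_antimono ennreal_leI powr_mono2')
    finally show ?thesis by (simp add: mult_left_mono)
  qed
  have "(\<integral>\<^sup>+x. ennreal_powr (min (g x) (ennreal lev)) 2 \<partial>M)
      = (\<integral>\<^sub>+c. indicator {0<..} c * ennreal_powr (min (rearr M g c) (ennreal lev)) 2)"
  proof (rule nn_integral_rearr[where \<Phi>="\<lambda>y. ennreal_powr (min y (ennreal lev)) 2", OF M g])
    show "\<exists>m. \<forall>y. (l < ennreal_powr (min y (ennreal lev)) 2) = (m < y)" for l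
      by (rule exI[of _ "if ennreal_powr l (1/2) < ennreal lev then ennreal_powr l (1/2) else top"])
        (auto simp: ennreal_powr_less_iff)
  qed auto
  also have "\<dots> \<le> (\<integral>\<^sub>+c. indicator {0<..<b} c * ennreal_powr (rearr M g b) 2
      + indicator {b..} c * ((2 * I) * (ennreal (c powr (- 1 / 2)) * rearr M g c)))"
  proof (intro nn_integral_mono)
    fix c
    show "indicator {0<..} c * ennreal_powr (min (rearr M g c) (ennreal lev)) 2
      \<le> indicator {0<..<b} c * ennreal_powr (rearr M g b) 2
      + indicator {b..} c * ((2 * I) * (ennreal (c powr (- 1 / 2)) * rearr M g c))"
    proof (cases "c < b")
      case True
      then show ?thesis using lev by (auto simp: indicator_def intro!: ennreal_powr_mono min.coboundedI2)
    next
      case False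
      have "ennreal_powr (min (rearr M g c) (ennreal lev)) 2 \<le> ennreal_powr (rearr M g c) 2"
        by (intro ennreal_powr_mono) auto
      also have "\<dots> = (ennreal (c powr (1/2)) * rearr M g c) * (ennreal (c powr (-1/2)) * rearr M g c)"
      proof -
        have "ennreal (c powr (1/2)) * ennreal (c powr (-1/2)) = 1"
          using False b by (simp flip: ennreal_mult powr_add)
        then have "(ennreal (c powr (1/2)) * ennreal (c powr (-1/2))) * (rearr M g c * rearr M g c) = rearr M g c * rearr M g c"
          by simp
        then show ?thesis by (simp add: sq ac_simps)
      qed
      also have "\<dots> \<le> (2 * I) * (ennreal (c powr (- 1 / 2)) * rearr M g c)"
        using False by (intro mult_right_mono I) auto
      finally show ?thesis using False b by simp
    qed
  qed
  also have "\<dots> = ennreal b * ennreal_powr (rearr M g b) 2 + (2 * I) * (\<integral>\<^sub>+c. indicator {b..} c * (ennreal (c powr (- 1 / 2)) * rearr M g c))"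
    using b by (subst nn_integral_add) (auto simp: nn_integral_multc nn_integral_cmult mult.left_commute[of "indicator _ _"])
  also have "\<dots> \<le> (2 * I) * (2 * I) + (2 * I) * I"
  proof (intro add_mono mult_left_mono)
    have "ennreal b * ennreal_powr (rearr M g b) 2 = (ennreal (b powr (1/2)) * rearr M g b) * (ennreal (b powr (1/2)) * rearr M g b)"
    proof -
      have "ennreal b = ennreal (b powr (1/2)) * ennreal (b powr (1/2))"
        using b by (simp flip: ennreal_mult powr_add)
      then show ?thesis by (simp add: sq ac_simps)
    qed
    also have "\<dots> \<le> (2 * I) * (2 * I)" by (intro mult_mono I) auto
    finally show "ennreal b * ennreal_powr (rearr M g b) 2 \<le> (2 * I) * (2 * I)" .
    show "(\<integral>\<^sub>+c. indicator {b..} c * (ennreal (c powr (- 1 / 2)) * rearr M g c)) \<le> I"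
      unfolding I_def using b by (intro nn_integral_mono) (auto simp: indicator_def)
  qed auto
  \<comment> \<open>The interval (0, b) contributes b times the square of the height, at most (2
    I)^2, and the rest contributes 2 I times I; the total 6 I^2 is rounded up to (3 I)^2.\<close>
  also have "\<dots> = (4 + 2) * (I * I)"
  proof -
    have "(2 * I) * (2 * I) = (2 * 2) * (I * I)" by (simp only: ac_simps)
    moreover have "(2 * I) * I = 2 * (I * I)" by (simp only: mult.assoc)
    ultimately show ?thesis by (simp only: distrib_right) simp
  qed
  also have "\<dots> \<le> (3 * 3) * (I * I)" by (intro mult_right_mono) auto
  also have "\<dots> = ennreal_powr (3 * I) 2" unfolding sq by (simp only: ac_simps)
  finally show ?thesis unfolding I_def .
qed

subsection \<open>Lorentz norms in logarithmic variables\<close>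

text \<open>The measure dt / t is the image of Lebesgue measure under exp: substitute on [-n, n] and
  let n grow by monotone convergence.\<close>

lemma density_inverse_eq_distr_exp:
  "density lborel (\<lambda>t. indicator {0<..} t * ennreal (1 / t)) = distr lborel borel exp"
proof (rule measure_eqI)
  fix A assume "A \<in> sets (density lborel (\<lambda>t::real. indicator {0<..} t * ennreal (1 / t)))"
  then have A [measurable]: "A \<in> sets borel" by simp
  let ?l = "\<lambda>n t. ennreal (indicator A t / t * indicator {exp (- real n)..exp (real n)} t)"
  let ?r = "\<lambda>n x. ennreal (indicator A (exp x) * indicator {- real n..real n} x)"
  have eq: "(\<integral>\<^sub>+t. ?l n t) = (\<integral>\<^sub>+x. ?r n x)" for n
  proof -
    have "(\<integral>\<^sub>+t. ?l n t) = (\<integral>\<^sub>+x. ennreal (indicator A (exp x) / exp x * exp x * indicator {- real n..real n} x))"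
    proof (rule nn_integral_substitution)
      show "continuous_on {- real n..real n} exp" by (intro continuous_on_exp continuous_on_id)
    qed (auto simp: set_borel_measurable_def intro!: derivative_eq_intros)
    then show ?thesis by simp
  qed
  have "emeasure (density lborel (\<lambda>t. indicator {0<..} t * ennreal (1 / t))) A
      = (\<integral>\<^sub>+t. (SUP n. ?l n t))"
    unfolding emeasure_density[OF _ A[unfolded sets_lborel[symmetric]], simplified]
  proof (subst emeasure_density)
    show "(\<integral>\<^sub>+t. indicator {0<..} t * ennreal (1 / t) * indicator A t) = (\<integral>\<^sub>+t. (SUP n. ?l n t))"
    proof (intro nn_integral_cong antisym)
      fix t :: real
      show "indicator {0<..} t * ennreal (1 / t) * indicator A t \<le> (SUP n. ?l n t)"
      proof (cases "0 < t \<and> t \<in> A")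
        case True
        obtain n where n: "\<bar>ln t\<bar> \<le> real n" using real_arch_simple by blast
        then have "exp (- real n) \<le> exp (ln t)" "exp (ln t) \<le> exp (real n)" by (auto simp del: exp_ln_iff exp_ln)
        then have "indicator {0<..} t * ennreal (1 / t) * indicator A t \<le> ?l n t"
          using True by simp
        also have "\<dots> \<le> (SUP n. ?l n t)" by (rule SUP_upper) simp
        finally show ?thesis .
      qed (auto simp: indicator_def)
      show "(SUP n. ?l n t) \<le> indicator {0<..} t * ennreal (1 / t) * indicator A t"
      proof (rule SUP_least)
        fix n
        have "0 < t" if "exp (- real n) \<le> t" using that exp_gt_zero[of "- real n"] by linarith
        then show "?l n t \<le> indicator {0<..} t * ennreal (1 / t) * indicator A t"
          by (auto simp: indicator_def)
      qed
    qed
  qed auto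
  also have "\<dots> = (SUP n. \<integral>\<^sup>+t. ?l n t \<partial>lborel)"
  proof (rule nn_integral_monotone_convergence_SUP)
    show "incseq ?l"
    proof (intro incseq_SucI le_funI)
      fix n and t :: real
      have "exp (- real (Suc n)) \<le> exp (- real n)" "exp (real n) \<le> exp (real (Suc n))" by auto
      moreover have "0 < t" if "exp (- real n) \<le> t" using that exp_gt_zero[of "- real n"] by linarith
      ultimately show "?l n t \<le> ?l (Suc n) t"
        by (auto simp: indicator_def simp del: exp_le_cancel_iff)
    qed
  qed auto
  also have "\<dots> = (SUP n. \<integral>\<^sup>+x. ?r n x \<partial>lborel)" by (simp only: eq)
  also have "\<dots> = (\<integral>\<^sub>+x. (SUP n. ?r n x))"
    by (rule nn_integral_monotone_convergence_SUP[symmetric]) (auto simp: incseq_def le_fun_def indicator_def)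
  also have "\<dots> = (\<integral>\<^sub>+x. indicator A (exp x))"
  proof (intro nn_integral_cong antisym)
    fix x :: real
    obtain n where n: "\<bar>x\<bar> \<le> real n" using real_arch_simple by blast
    then have "indicator A (exp x) \<le> ?r n x" by (auto simp: indicator_def)
    also have "\<dots> \<le> (SUP n. ?r n x)" by (rule SUP_upper) simp
    finally show "indicator A (exp x) \<le> (SUP n. ?r n x)" .
    show "(SUP n. ?r n x) \<le> indicator A (exp x)" by (rule SUP_least) (auto simp: indicator_def)
  qed
  also have "\<dots> = (\<integral>\<^sub>+x. indicator (exp -` A) x)" by (simp add: indicator_def)
  also have "\<dots> = emeasure (distr lborel borel exp) A"
  proof -
    have "exp -` A \<in> sets (lborel :: real measure)"
      using measurable_sets_borel[OF borel_measurable_exp A] by simp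
    then show ?thesis by (subst emeasure_distr) auto
  qed
  finally show "emeasure (density lborel (\<lambda>t. indicator {0<..} t * ennreal (1 / t))) A
      = emeasure (distr lborel borel exp) A" .
qed simp

lemma nn_integral_dt_over_t:
  assumes [measurable]: "\<phi> \<in> borel_measurable borel"
  shows "(\<integral>\<^sup>+t. \<phi> t \<partial>density (lebesgue_on {0<..}) (\<lambda>t. ennreal (1 / t))) = (\<integral>\<^sub>+x. \<phi> (exp x))"
proof -
  have [measurable]: "\<phi> \<in> borel_measurable (lebesgue_on {0<..})" "(\<lambda>t::real. ennreal (1 / t)) \<in> borel_measurable (lebesgue_on {0<..})"
    by (auto intro!: measurable_restrict_space1 measurable_completion)
  have "(\<integral>\<^sup>+t. \<phi> t \<partial>density (lebesgue_on {0<..}) (\<lambda>t. ennreal (1 / t))) = (\<integral>\<^sup>+t. ennreal (1 / t) * \<phi> t \<partial>lebesgue_on {0<..})"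
    by (rule nn_integral_density) auto
  also have "\<dots> = (\<integral>\<^sub>+t. ennreal (1 / t) * \<phi> t * indicator {0<..} t)"
    by (subst nn_integral_restrict_space) (auto simp: nn_integral_completion)
  also have "\<dots> = (\<integral>\<^sup>+t. \<phi> t \<partial>density lborel (\<lambda>t. indicator {0<..} t * ennreal (1 / t)))"
    by (subst nn_integral_density) (auto intro!: nn_integral_cong simp: ac_simps)
  also have "\<dots> = (\<integral>\<^sub>+x. \<phi> (exp x))"
    unfolding density_inverse_eq_distr_exp by (simp add: nn_integral_distr)
  finally show ?thesis .
qed

lemma Lebesgue_norm_dt_over_t:
  assumes [measurable]: "\<phi> \<in> borel_measurable borel" and q: "1 \<le> q"
  shows "Lebesgue_norm (density (lebesgue_on {0<..}) (\<lambda>t. ennreal (1 / t))) q \<phi> = Lebesgue_norm lborel q (\<lambda>x. \<phi> (exp x))"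
    (is "Lebesgue_norm ?N q \<phi> = _")
  using q
proof (cases rule: exponent_cases)
  case top
  have [measurable]: "\<phi> \<in> borel_measurable ?N"
    by (auto intro!: measurable_restrict_space1 measurable_completion)
  have "emeasure ?N {t \<in> space ?N. z < \<phi> t} = emeasure lborel {x \<in> space lborel. z < \<phi> (exp x)}" for z
  proof -
    have "emeasure ?N {t \<in> space ?N. z < \<phi> t} = (\<integral>\<^sup>+t. indicator {t \<in> space ?N. z < \<phi> t} t \<partial>?N)"
      by (rule nn_integral_indicator[symmetric]) measurable
    also have "\<dots> = (\<integral>\<^sup>+t. indicator {t. z < \<phi> t} t \<partial>?N)"
      by (intro nn_integral_cong) (auto simp: indicator_def)
    also have "\<dots> = (\<integral>\<^sub>+x. indicator {t. z < \<phi> t} (exp x))"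
      by (rule nn_integral_dt_over_t) measurable
    also have "\<dots> = (\<integral>\<^sub>+x. indicator {x \<in> space lborel. z < \<phi> (exp x)} x)"
      by (intro nn_integral_cong) (auto simp: indicator_def)
    also have "\<dots> = emeasure lborel {x \<in> space lborel. z < \<phi> (exp x)}"
      by (rule nn_integral_indicator) measurable
    finally show ?thesis .
  qed
  then show ?thesis using top by (simp add: Lebesgue_norm_top esssup_eq)
next
  case (real Q)
  then show ?thesis by (simp add: Lebesgue_norm_ennreal nn_integral_dt_over_t)
qed

text \<open>The Lorentz functional in the variable x = ln t: dilations of \<phi> become translations
  and dt / t becomes Lebesgue measure. An arbitrary \<phi> in place of a rearrangement allows it to
  be applied to majorants.\<close>

definition lorentz_fun :: "real \<Rightarrow> ennreal \<Rightarrow> (real \<Rightarrow> ennreal) \<Rightarrow> ennreal" where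
  "lorentz_fun P q \<phi> = Lebesgue_norm lborel q (\<lambda>x. ennreal (exp (x / P)) * \<phi> (exp x))"

lemma lorentz_norm_eq:
  fixes f :: "'a::euclidean_space \<Rightarrow> complex"
  assumes [measurable]: "f \<in> borel_measurable lebesgue" and q: "1 \<le> q" and P: "0 < P"
  shows "lorentz_norm (ennreal P) q f = lorentz_fun P q (rearr lebesgue (\<lambda>x. enorm (f x)))"
proof -
  have "enn2real (1 / ennreal P) = 1 / P"
    using P by (simp flip: ennreal_1 add: divide_ennreal)
  then show ?thesis
    unfolding lorentz_norm_def lorentz_fun_def decreasing_rearrangement_eq_rearr
    by (subst Lebesgue_norm_dt_over_t[OF _ q]) (auto simp: powr_def)
qed

lemma rearr_lebesgue:
  assumes [measurable]: "g \<in> borel_measurable lborel"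
  shows "rearr lebesgue g = rearr lborel g"
proof -
  have "emeasure lebesgue {x. l < g x} = emeasure lborel {x. l < g x}" for l
  proof -
    have "{x \<in> space lborel. l < g x} \<in> sets lborel" by measurable
    then show ?thesis by simp
  qed
  then show ?thesis by (simp add: rearr_def fun_eq_iff)
qed

lemma lorentz_norm_borel:
  fixes f :: "'a::euclidean_space \<Rightarrow> complex"
  assumes [measurable]: "f \<in> borel_measurable borel" and "1 \<le> q" "0 < P"
  shows "lorentz_norm (ennreal P) q f = lorentz_fun P q (rearr lborel (\<lambda>x. enorm (f x)))"
  using assms by (subst lorentz_norm_eq) (auto intro: measurable_completion simp: rearr_lebesgue)

lemma lorentz_norm_cong_AE:
  fixes f g :: "'a::euclidean_space \<Rightarrow> complex"
  assumes [measurable]: "f \<in> borel_measurable lebesgue" "g \<in> borel_measurable lebesgue"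
    and "1 \<le> q" "0 < P" and eq: "AE x in lebesgue. f x = g x"
  shows "lorentz_norm (ennreal P) q f = lorentz_norm (ennreal P) q g"
proof -
  have "rearr lebesgue (\<lambda>x. enorm (f x)) = rearr lebesgue (\<lambda>x. enorm (g x))"
    using eq by (intro ext rearr_cong_AE) (auto elim!: eventually_mono)
  then show ?thesis using assms by (simp add: lorentz_norm_eq)
qed

lemma lorentz_fun_mono:
  assumes [measurable]: "\<phi> \<in> borel_measurable borel" and "1 \<le> q" and "\<And>t. 0 < t \<Longrightarrow> \<phi> t \<le> \<psi> t"
  shows "lorentz_fun P q \<phi> \<le> lorentz_fun P q \<psi>"
  unfolding lorentz_fun_def using assms by (intro Lebesgue_norm_mono mult_left_mono) auto

text \<open>A dilation by c is a translation by ln c, and the weight exp (x / P) turns that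
  translation into a factor.\<close>

lemma lorentz_fun_dilation:
  assumes [measurable]: "\<phi> \<in> borel_measurable borel" and q: "1 \<le> q" and c: "0 < c"
  shows "lorentz_fun P q (\<lambda>t. \<phi> (c * t)) = ennreal (c powr (- 1 / P)) * lorentz_fun P q \<phi>"
proof -
  have "lorentz_fun P q (\<lambda>t. \<phi> (c * t))
      = Lebesgue_norm lborel q (\<lambda>x. ennreal (c powr (- 1 / P)) * (ennreal (exp ((ln c + 1 * x) / P)) * \<phi> (exp (ln c + 1 * x))))"
    unfolding lorentz_fun_def
  proof (intro arg_cong[where f="Lebesgue_norm lborel q"] ext)
    fix x
    have "ennreal (exp (x / P)) = ennreal (c powr (- 1 / P)) * ennreal (exp ((ln c + 1 * x) / P))"
      using c by (simp add: powr_def add_divide_distrib flip: ennreal_mult exp_add)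
    moreover have "exp (ln c + 1 * x) = c * exp x" using c by (simp add: exp_add)
    ultimately show "ennreal (exp (x / P)) * \<phi> (c * exp x)
      = ennreal (c powr (- 1 / P)) * (ennreal (exp ((ln c + 1 * x) / P)) * \<phi> (exp (ln c + 1 * x)))"
      by (simp only: mult.assoc)
  qed
  also have "\<dots> = ennreal (c powr (- 1 / P)) * Lebesgue_norm lborel q (\<lambda>x. ennreal (exp ((ln c + 1 * x) / P)) * \<phi> (exp (ln c + 1 * x)))"
    by (rule Lebesgue_norm_cmult[OF _ q]) auto
  also have "Lebesgue_norm lborel q (\<lambda>x. ennreal (exp ((ln c + 1 * x) / P)) * \<phi> (exp (ln c + 1 * x))) = lorentz_fun P q \<phi>"
    unfolding lorentz_fun_def by (rule Lebesgue_norm_translate[OF _ q]) auto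
  finally show ?thesis .
qed

lemma lorentz_fun_cmult:
  assumes [measurable]: "\<phi> \<in> borel_measurable borel" and q: "1 \<le> q" and "0 \<le> c"
  shows "lorentz_fun P q (\<lambda>t. ennreal c * \<phi> t) = ennreal c * lorentz_fun P q \<phi>"
  unfolding lorentz_fun_def mult.left_commute[of _ "ennreal c"]
  using assms by (intro Lebesgue_norm_cmult) auto

text \<open>Only a quasi-triangle inequality: t is split into t / 2 + t / 2 for the rearrangement of
  the sum, and the dilation by 1/2 costs 2 powr (1 / P), at most 2 since P is at least 1.\<close>

lemma lorentz_norm_add:
  fixes f g :: "'a::euclidean_space \<Rightarrow> complex"
  assumes [measurable]: "f \<in> borel_measurable lebesgue" "g \<in> borel_measurable lebesgue"
    and q: "1 \<le> q" and P: "1 \<le> P"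
  shows "lorentz_norm (ennreal P) q (\<lambda>x. f x + g x) \<le> 2 * (lorentz_norm (ennreal P) q f + lorentz_norm (ennreal P) q g)"
proof -
  let ?R = "\<lambda>f. rearr lebesgue (\<lambda>x. enorm (f x :: complex))"
  have half: "?R (\<lambda>x. f x + g x) t \<le> ?R f (1/2 * t) + ?R g (1/2 * t)" if "0 < t" for t
  proof -
    have "?R (\<lambda>x. f x + g x) t \<le> rearr lebesgue (\<lambda>x. enorm (f x) + enorm (g x)) (1/2 * t + 1/2 * t)"
      using that by (simp, intro rearr_mono_AE AE_I2) (auto simp flip: ennreal_plus intro!: ennreal_leI norm_triangle_ineq)
    also have "\<dots> \<le> ?R f (1/2 * t) + ?R g (1/2 * t)" using that by (intro rearr_add) auto
    finally show ?thesis .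
  qed
  have "lorentz_fun P q (?R (\<lambda>x. f x + g x)) \<le> lorentz_fun P q (\<lambda>t. ?R f (1/2 * t) + ?R g (1/2 * t))"
    by (intro lorentz_fun_mono[OF _ q] half) auto
  also have "\<dots> \<le> lorentz_fun P q (\<lambda>t. ?R f (1/2 * t)) + lorentz_fun P q (\<lambda>t. ?R g (1/2 * t))"
    unfolding lorentz_fun_def distrib_left by (intro Lebesgue_norm_add sigma_finite_lborel q) auto
  also have "\<dots> = ennreal ((1/2) powr (- 1 / P)) * (lorentz_fun P q (?R f) + lorentz_fun P q (?R g))"
    by (subst (1 2) lorentz_fun_dilation[OF _ q]) (auto simp: distrib_left)
  also have "\<dots> \<le> 2 * (lorentz_fun P q (?R f) + lorentz_fun P q (?R g))"
  proof (intro mult_right_mono)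
    have "(1/2::real) powr (- 1 / P) = 2 powr (1 / P)" by (simp add: powr_divide powr_minus)
    also have "\<dots> \<le> 2 powr 1" using P by (intro powr_mono) auto
    finally show "ennreal ((1/2) powr (- 1 / P)) \<le> 2" by (simp add: ennreal_leI flip: ennreal_numeral)
  qed auto
  finally show ?thesis using P q by (simp add: lorentz_norm_eq)
qed

lemma lorentz_norm_cmult_le:
  fixes f :: "'a::euclidean_space \<Rightarrow> complex"
  assumes [measurable]: "f \<in> borel_measurable lebesgue" and q: "1 \<le> q" and P: "0 < P"
  shows "lorentz_norm (ennreal P) q (\<lambda>x. c * f x) \<le> enorm c * lorentz_norm (ennreal P) q f"
proof -
  have "lorentz_fun P q (rearr lebesgue (\<lambda>x. enorm (c * f x)))
      \<le> lorentz_fun P q (\<lambda>t. enorm c * rearr lebesgue (\<lambda>x. enorm (f x)) t)"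
    by (intro lorentz_fun_mono[OF _ q]) (auto simp: norm_mult ennreal_mult intro!: rearr_cmult_le)
  then show ?thesis using P q by (simp add: lorentz_norm_eq lorentz_fun_cmult)
qed

text \<open>The embedding into weak L^P. On the unit interval [ln t - 1, ln t] the decreasing \<phi>
  is at least \<phi> t, and a constant on a set of measure 1 has the same norm for every q; hence
  the factor exp (1 / P), independent of q.\<close>

lemma lorentz_fun_pointwise:
  assumes [measurable]: "\<phi> \<in> borel_measurable borel" and anti: "\<And>s t. 0 < s \<Longrightarrow> s \<le> t \<Longrightarrow> \<phi> t \<le> \<phi> s"
    and q: "1 \<le> q" and P: "0 < P" and t: "0 < t"
  shows "\<phi> t \<le> ennreal (exp (1 / P) * t powr (- 1 / P)) * lorentz_fun P q \<phi>"
proof -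
  define x0 where "x0 = ln t"
  define c where "c = ennreal (exp ((x0 - 1) / P)) * \<phi> t"
  have "c = Lebesgue_norm lborel q (\<lambda>x. c * indicator {x0 - 1..x0} x)"
    using q
  proof (cases rule: exponent_cases)
    case top
    have "c \<le> esssup lborel (\<lambda>x. c * indicator {x0 - 1..x0} x)"
    proof (rule ccontr)
      assume *: "\<not> ?thesis"
      have "AE x in lborel. x \<notin> {x0 - 1..x0}"
        using esssup_AE[of "\<lambda>x. c * indicator {x0 - 1..x0} x" lborel]
      proof eventually_elim
        case (elim x) then show ?case using * by (auto simp: indicator_def)
      qed
      then have "emeasure lborel {x0 - 1..x0} = 0"
        by (subst (asm) AE_iff_measurable[of "{x0 - 1..x0}"]) auto
      then show False by simp
    qed
    moreover have "esssup lborel (\<lambda>x. c * indicator {x0 - 1..x0} x) \<le> c"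
      by (intro esssup_I) (auto simp: indicator_def)
    ultimately show ?thesis using top by (simp add: Lebesgue_norm_top)
  next
    case (real Q)
    have "(\<integral>\<^sub>+x. ennreal_powr (c * indicator {x0 - 1..x0} x) Q) = (\<integral>\<^sub>+x. ennreal_powr c Q * indicator {x0 - 1..x0} x)"
      by (intro nn_integral_cong) (auto simp: indicator_def)
    also have "\<dots> = ennreal_powr c Q" by (subst nn_integral_cmult_indicator) auto
    finally show ?thesis using real by (simp add: Lebesgue_norm_ennreal ennreal_powr_powr)
  qed
  also have "\<dots> \<le> lorentz_fun P q \<phi>"
    unfolding lorentz_fun_def
  proof (rule Lebesgue_norm_mono[OF _ _ q])
    fix x show "c * indicator {x0 - 1..x0} x \<le> ennreal (exp (x / P)) * \<phi> (exp x)"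
    proof (cases "x \<in> {x0 - 1..x0}")
      case True
      have "exp x \<le> t" using True t unfolding x0_def by (metis atLeastAtMost_iff exp_le_cancel_iff exp_ln)
      then show ?thesis using True P unfolding c_def
        by (auto intro!: mult_mono ennreal_leI anti divide_right_mono)
    qed simp
  qed auto
  finally have "c \<le> lorentz_fun P q \<phi>" .
  then have "ennreal (exp (1 / P) * t powr (- 1 / P)) * c \<le> ennreal (exp (1 / P) * t powr (- 1 / P)) * lorentz_fun P q \<phi>"
    by (rule mult_left_mono) simp
  moreover have "ennreal (exp (1 / P) * t powr (- 1 / P)) * c = \<phi> t"
  proof -
    have "exp (1 / P) * t powr (- 1 / P) * exp ((x0 - 1) / P) = 1"
      using t by (simp add: x0_def powr_def diff_divide_distrib flip: exp_add)
    then have "ennreal (exp (1 / P) * t powr (- 1 / P)) * ennreal (exp ((x0 - 1) / P)) = 1"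
      by (simp flip: ennreal_mult)
    then show ?thesis by (simp add: c_def mult.assoc[symmetric])
  qed
  ultimately show ?thesis by simp
qed

subsection \<open>Integrals on product spaces\<close>

lemma (in pair_sigma_finite) integrable_pairI:
  fixes f :: "'a \<Rightarrow> 'b \<Rightarrow> 'c::{banach, second_countable_topology}"
  assumes [measurable]: "case_prod f \<in> borel_measurable (M1 \<Otimes>\<^sub>M M2)"
    and fin: "(\<integral>\<^sup>+x. \<integral>\<^sup>+y. enorm (f x y) \<partial>M2 \<partial>M1) < top"
  shows "integrable (M1 \<Otimes>\<^sub>M M2) (case_prod f)"
proof (rule integrableI_bounded)
  have "(\<integral>\<^sup>+x. enorm (case_prod f x) \<partial>(M1 \<Otimes>\<^sub>M M2)) = (\<integral>\<^sup>+x. \<integral>\<^sup>+y. enorm (f x y) \<partial>M2 \<partial>M1)"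
    by (subst M2.nn_integral_fst[symmetric]) auto
  then show "(\<integral>\<^sup>+x. enorm (case_prod f x) \<partial>(M1 \<Otimes>\<^sub>M M2)) < \<infinity>" using fin by simp
qed measurable

lemma (in pair_sigma_finite) integrable_pair_product:
  fixes f :: "'a \<Rightarrow> 'b \<Rightarrow> 'c::{banach, second_countable_topology}" and g h :: "_ \<Rightarrow> real"
  assumes [measurable]: "case_prod f \<in> borel_measurable (M1 \<Otimes>\<^sub>M M2)"
    and g: "integrable M1 g" and h: "integrable M2 h"
    and le: "\<And>x y. norm (f x y) \<le> \<bar>g x\<bar> * \<bar>h y\<bar>"
  shows "integrable (M1 \<Otimes>\<^sub>M M2) (case_prod f)"
proof (rule integrable_pairI)
  have [measurable]: "g \<in> borel_measurable M1" "h \<in> borel_measurable M2" using g h by auto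
  have "(\<integral>\<^sup>+x. \<integral>\<^sup>+y. enorm (f x y) \<partial>M2 \<partial>M1) \<le> (\<integral>\<^sup>+x. \<integral>\<^sup>+y. ennreal \<bar>g x\<bar> * ennreal \<bar>h y\<bar> \<partial>M2 \<partial>M1)"
    using le by (intro nn_integral_mono) (auto simp flip: ennreal_mult intro!: ennreal_leI)
  also have "\<dots> = (\<integral>\<^sup>+x. ennreal \<bar>g x\<bar> \<partial>M1) * (\<integral>\<^sup>+y. ennreal \<bar>h y\<bar> \<partial>M2)"
    by (simp add: nn_integral_cmult nn_integral_multc)
  also have "\<dots> < top"
    using g h by (auto simp: integrable_iff_bounded ennreal_mult_less_top)
  finally show "(\<integral>\<^sup>+x. \<integral>\<^sup>+y. enorm (f x y) \<partial>M2 \<partial>M1) < top" .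
qed measurable

text \<open>Dominated convergence along arbitrary sequences: by the mean value inequality the
  linearization error divided by the step is at most 2 g.\<close>

lemma has_vector_derivative_integral:
  fixes f :: "real \<Rightarrow> 'b \<Rightarrow> 'c::{banach, second_countable_topology}"
  assumes int: "\<And>t. integrable M (f t)" and g: "integrable M g"
    and der: "\<And>t x. ((\<lambda>t. f t x) has_vector_derivative f' t x) (at t)"
    and bd: "\<And>t x. norm (f' t x) \<le> g x" and [measurable]: "f' t0 \<in> borel_measurable M"
  shows "((\<lambda>t. \<integral>x. f t x \<partial>M) has_vector_derivative (\<integral>x. f' t0 x \<partial>M)) (at t0)"
  unfolding has_vector_derivative_def has_derivative_iff_norm
proof (intro conjI bounded_linear_scaleR_left)
  have f't: "integrable M (f' t0)" by (rule Bochner_Integration.integrable_bound[OF g]) (auto intro!: AE_I2 intro: order_trans[OF bd abs_ge_self])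
  show "((\<lambda>y. norm ((\<integral>x. f y x \<partial>M) - (\<integral>x. f t0 x \<partial>M) - (y - t0) *\<^sub>R (\<integral>x. f' t0 x \<partial>M)) / norm (y - t0)) \<longlongrightarrow> 0) (at t0)"
    unfolding tendsto_at_iff_sequentially comp_def
  proof (intro allI impI)
    fix X :: "nat \<Rightarrow> real" assume X: "\<forall>i. X i \<in> UNIV - {t0}" "X \<longlonglongrightarrow> t0"
    let ?q = "\<lambda>i x. (f (X i) x - f t0 x - (X i - t0) *\<^sub>R f' t0 x) /\<^sub>R \<bar>X i - t0\<bar>"
    have [measurable]: "f t \<in> borel_measurable M" for t using int by auto
    have "(\<lambda>i. \<integral>x. ?q i x \<partial>M) \<longlonglongrightarrow> (\<integral>x. 0 \<partial>M)"
    proof (rule integral_dominated_convergence[where w="\<lambda>x. 2 * g x"])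
      show "AE x in M. (\<lambda>i. ?q i x) \<longlonglongrightarrow> 0"
      proof (rule AE_I2)
        fix x
        have "((\<lambda>y. norm (f y x - f t0 x - (y - t0) *\<^sub>R f' t0 x) / norm (y - t0)) \<longlongrightarrow> 0) (at t0)"
          using der[of x t0] unfolding has_vector_derivative_def has_derivative_iff_norm by simp
        then have "(\<lambda>i. norm (f (X i) x - f t0 x - (X i - t0) *\<^sub>R f' t0 x) / norm (X i - t0)) \<longlonglongrightarrow> 0"
          using X unfolding tendsto_at_iff_sequentially comp_def by blast
        then have "(\<lambda>i. norm (?q i x)) \<longlonglongrightarrow> 0" by (simp add: divide_inverse mult.commute)
        then show "(\<lambda>i. ?q i x) \<longlonglongrightarrow> 0" by (rule tendsto_norm_zero_cancel)
      qed
      show "AE x in M. norm (?q i x) \<le> 2 * g x" for i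
      proof (rule AE_I2)
        fix x
        have "norm (f (X i) x - f t0 x - (X i - t0) *\<^sub>R f' t0 x) \<le> norm (X i - t0) * (2 * g x)"
        proof (rule vector_differentiable_bound_linearization[where S=UNIV and f'="\<lambda>t. f' t x"])
          show "norm (f' t x - f' t0 x) \<le> 2 * g x" for t
            using bd[of t x] bd[of t0 x] norm_triangle_ineq4[of "f' t x" "f' t0 x"] by linarith
        qed (use der in auto)
        then have "norm (f (X i) x - f t0 x - (X i - t0) *\<^sub>R f' t0 x) / \<bar>X i - t0\<bar> \<le> 2 * g x"
          using X(1) by (subst pos_divide_le_eq) (auto simp: mult.commute)
        moreover have "norm (?q i x) = norm (f (X i) x - f t0 x - (X i - t0) *\<^sub>R f' t0 x) / \<bar>X i - t0\<bar>"
          by (simp add: divide_inverse mult.commute)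
        ultimately show "norm (?q i x) \<le> 2 * g x" by simp
      qed
    qed (use g in auto)
    moreover have "(\<integral>x. ?q i x \<partial>M) = ((\<integral>x. f (X i) x \<partial>M) - (\<integral>x. f t0 x \<partial>M) - (X i - t0) *\<^sub>R (\<integral>x. f' t0 x \<partial>M)) /\<^sub>R \<bar>X i - t0\<bar>" for i
      using int f't by simp
    ultimately have "(\<lambda>i. ((\<integral>x. f (X i) x \<partial>M) - (\<integral>x. f t0 x \<partial>M) - (X i - t0) *\<^sub>R (\<integral>x. f' t0 x \<partial>M)) /\<^sub>R \<bar>X i - t0\<bar>) \<longlonglongrightarrow> 0"
      by (simp only: Bochner_Integration.integral_zero)
    from tendsto_norm_zero[OF this]
    show "(\<lambda>i. norm ((\<integral>x. f (X i) x \<partial>M) - (\<integral>x. f t0 x \<partial>M) - (X i - t0) *\<^sub>R (\<integral>x. f' t0 x \<partial>M)) / norm (X i - t0)) \<longlonglongrightarrow> 0"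
      by (simp add: divide_inverse mult.commute)
  qed
qed

subsection \<open>Gaussian integrals with complex parameters\<close>

lemma integral_derivative_eq_0:
  fixes F f :: "real \<Rightarrow> complex"
  assumes "\<And>x. (F has_vector_derivative f x) (at x)" "continuous_on UNIV f" "integrable lborel f"
    "(F \<longlongrightarrow> 0) at_bot" "(F \<longlongrightarrow> 0) at_top"
  shows "(\<integral>x. f x \<partial>lborel) = 0"
proof -
  have "(LBINT x=-\<infinity>..\<infinity>. f x) = 0 - 0"
    using assms by (intro interval_integral_FTC_integrable[where F=F])
      (auto simp: ereal_tendsto_simps continuous_on_eq_continuous_at set_integrable_def)
  then show ?thesis by (simp add: interval_lebesgue_integral_def set_lebesgue_integral_def)
qed

lemma gaussian_moments:
  fixes a :: real
  assumes a: "0 < a"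
  shows "has_bochner_integral lborel (\<lambda>x. exp (- a * x\<^sup>2)) (sqrt (pi / a))"
    and "integrable lborel (\<lambda>x. x\<^sup>2 * exp (- a * x\<^sup>2))"
proof -
  define s where "s = 1 / sqrt (2 * a)"
  have s2: "s\<^sup>2 = 1 / (2 * a)" using a by (simp add: s_def power_divide)
  have nd: "normal_density 0 s x = exp (- a * x\<^sup>2) / sqrt (pi / a)" for x
    unfolding normal_density_def s2 using a by (simp add: field_simps)
  have nz: "sqrt (pi / a) \<noteq> 0" using a by simp
  have "has_bochner_integral lborel (\<lambda>x. normal_density 0 s x * sqrt (pi / a)) (1 * sqrt (pi / a))"
    using normal_moment_even[of s 0 0] a by (intro has_bochner_integral_mult_left) (auto simp: s_def)
  then show "has_bochner_integral lborel (\<lambda>x. exp (- a * x\<^sup>2)) (sqrt (pi / a))"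
    unfolding nd using nz by simp
  have "integrable lborel (\<lambda>x. normal_density 0 s x * (x - 0) ^ (2 * 1))"
    by (rule has_bochner_integral_integrable[THEN integrable.intros, OF _]) 
      (use normal_moment_even[of s 0 1] a in \<open>auto simp: s_def has_bochner_integral_iff\<close>)
  then have "integrable lborel (\<lambda>x. sqrt (pi / a) * (normal_density 0 s x * x\<^sup>2))" by simp
  then show "integrable lborel (\<lambda>x. x\<^sup>2 * exp (- a * x\<^sup>2))"
    unfolding nd using nz by (simp add: mult.commute)
qed

lemma tendsto_mult_gaussian:
  fixes a :: real
  assumes "0 < a"
  shows "((\<lambda>x. x * exp (- a * x\<^sup>2)) \<longlongrightarrow> 0) at_top" "((\<lambda>x. x * exp (- a * x\<^sup>2)) \<longlongrightarrow> 0) at_bot"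
    "((\<lambda>x. exp (- a * x\<^sup>2)) \<longlongrightarrow> 0) at_top" "((\<lambda>x. exp (- a * x\<^sup>2)) \<longlongrightarrow> 0) at_bot"
  using assms by real_asymp+

text \<open>Deform the integral: for the parameter a + i s b and the frequency s w, integration by
  parts turns the s-derivative of J into a linear differential equation, and at s = 0 the real
  Gaussian is known. Following the path from s = 0 to s = 1 also selects the principal branch of the
  square root.\<close>

lemma gaussian_fourier_real:
  fixes a b w :: real
  assumes a: "0 < a"
  defines "z \<equiv> Complex a b"
  shows "integrable lborel (\<lambda>x. exp (- z * of_real (x\<^sup>2) + \<i> * of_real (w * x)))"
    and "(\<integral>x. exp (- z * of_real (x\<^sup>2) + \<i> * of_real (w * x)) \<partial>lborel) = of_real (sqrt pi) / csqrt z * exp (- of_real (w\<^sup>2) / (4 * z))"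
proof -
  define Z where "Z s = complex_of_real a + \<i> * of_real (s * b)" for s
  define e where "e s x = exp (- Z s * of_real (x\<^sup>2) + \<i> * of_real (s * w * x))" for s x
  have Z1: "Z 1 = z" by (simp add: Z_def z_def Complex_eq)
  have ReZ: "Re (Z s) = a" for s by (simp add: Z_def)
  have Znz: "Z s \<noteq> 0" for s using a ReZ[of s] by auto
  have norm_e: "norm (e s x) = exp (- a * x\<^sup>2)" for s x by (simp add: e_def norm_exp_eq_Re ReZ power2_eq_square[of x] Z_def)
  have [measurable]: "e s \<in> borel_measurable borel" for s unfolding e_def by measurable
  have g0: "integrable lborel (\<lambda>x. exp (- a * x\<^sup>2))"
    using gaussian_moments(1)[OF a] by (simp add: has_bochner_integral_iff)
  note g2 = gaussian_moments(2)[OF a]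
  have int0: "integrable lborel (e s)" for s
    by (rule Bochner_Integration.integrable_bound[OF g0]) (auto simp: norm_e)
  have int2: "integrable lborel (\<lambda>x. of_real (x\<^sup>2) * e s x)" for s
    by (rule Bochner_Integration.integrable_bound[OF g2]) (auto simp: norm_e norm_mult norm_power)
  have le1: "\<bar>x\<bar> \<le> 1 + x\<^sup>2" for x :: real
  proof -
    have "0 \<le> (\<bar>x\<bar> - 1/2)\<^sup>2" by simp
    then show ?thesis by (simp add: power2_eq_square algebra_simps)
  qed
  have g1: "integrable lborel (\<lambda>x. (1 + x\<^sup>2) * exp (- a * x\<^sup>2))"
    using Bochner_Integration.integrable_add[OF g0 g2] by (simp add: algebra_simps)
  have int1: "integrable lborel (\<lambda>x. of_real x * e s x)" for s
    by (rule Bochner_Integration.integrable_bound[OF g1]) (auto simp: norm_e norm_mult intro!: mult_right_mono le1)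
  define J where "J s = (\<integral>x. e s x \<partial>lborel)" for s
  define A1 where "A1 s = (\<integral>x. of_real x * e s x \<partial>lborel)" for s
  define A2 where "A2 s = (\<integral>x. of_real (x\<^sup>2) * e s x \<partial>lborel)" for s
  have hb: "has_bochner_integral lborel (e s) (J s)" "has_bochner_integral lborel (\<lambda>x. of_real x * e s x) (A1 s)"
    "has_bochner_integral lborel (\<lambda>x. of_real (x\<^sup>2) * e s x) (A2 s)" for s
    using int0 int1 int2 by (auto simp: has_bochner_integral_iff J_def A1_def A2_def)
  have de: "(e s has_vector_derivative (- 2 * Z s * of_real x + \<i> * of_real (s * w)) * e s x) (at x)" for s x
  proof -
    have "((\<lambda>y. exp (- Z s * y\<^sup>2 + \<i> * (of_real (s * w) * y))) has_field_derivative
      (- 2 * Z s * of_real x + \<i> * of_real (s * w)) * exp (- Z s * (of_real x)\<^sup>2 + \<i> * (of_real (s * w) * of_real x))) (at (of_real x))"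
      by (auto intro!: derivative_eq_intros simp: algebra_simps)
    from has_vector_derivative_real_field[OF this] show ?thesis
      by (simp add: e_def[abs_def])
  qed
  have dxe: "((\<lambda>x. of_real x * e s x) has_vector_derivative e s x + (- 2 * Z s * of_real (x\<^sup>2) + \<i> * of_real (s * w) * of_real x) * e s x) (at x)" for s x
    using has_vector_derivative_mult[OF has_vector_derivative_of_real[OF DERIV_ident] de, of s x]
    by (simp add: algebra_simps power2_eq_square)
  have cont_e: "continuous_on UNIV (e s)" for s unfolding e_def by (intro continuous_intros)
  have lim: "(e s \<longlongrightarrow> 0) at_top" "(e s \<longlongrightarrow> 0) at_bot"
    "((\<lambda>x. of_real x * e s x) \<longlongrightarrow> 0) at_top" "((\<lambda>x. of_real x * e s x) \<longlongrightarrow> 0) at_bot" for s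
  proof -
    show "(e s \<longlongrightarrow> 0) at_top" "(e s \<longlongrightarrow> 0) at_bot"
      using tendsto_mult_gaussian[OF a] by (auto intro!: tendsto_norm_zero_cancel[of "e s"] simp: norm_e)
    show "((\<lambda>x. of_real x * e s x) \<longlongrightarrow> 0) at_top" "((\<lambda>x. of_real x * e s x) \<longlongrightarrow> 0) at_bot"
      using tendsto_mult_gaussian[OF a, THEN tendsto_rabs]
      by (auto intro!: tendsto_norm_zero_cancel[of "\<lambda>x. of_real x * e s x"] simp: norm_e norm_mult abs_mult)
  qed
  \<comment> \<open>The integrals of the derivatives of e and of x e vanish; these two relations
    express the first and second moments through J.\<close>
  have rel1: "2 * Z s * A1 s = \<i> * of_real (s * w) * J s" for s
  proof -
    have eq: "(- 2 * Z s * of_real x + \<i> * of_real (s * w)) * e s x = - 2 * Z s * (of_real x * e s x) + \<i> * of_real (s * w) * e s x" for x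
      by (simp add: algebra_simps)
    have "(\<integral>x. (- 2 * Z s * of_real x + \<i> * of_real (s * w)) * e s x \<partial>lborel) = 0"
    proof (rule integral_derivative_eq_0[where F="e s"])
      show "continuous_on UNIV (\<lambda>x. (- 2 * Z s * of_real x + \<i> * of_real (s * w)) * e s x)"
        by (intro continuous_intros cont_e)
      show "integrable lborel (\<lambda>x. (- 2 * Z s * of_real x + \<i> * of_real (s * w)) * e s x)"
        unfolding eq by (intro Bochner_Integration.integrable_add integrable_mult_right int0 int1)
    qed (rule de lim)+
    then have "- 2 * Z s * A1 s + \<i> * of_real (s * w) * J s = 0"
      using has_bochner_integral_integral_eq[OF has_bochner_integral_add[OF
          has_bochner_integral_mult_right[OF hb(2), of "- 2 * Z s" s]
          has_bochner_integral_mult_right[OF hb(1), of "\<i> * of_real (s * w)" s]]]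
      unfolding eq by simp
    then show ?thesis by (simp add: algebra_simps)
  qed
  have rel2: "2 * Z s * A2 s = J s + \<i> * of_real (s * w) * A1 s" for s
  proof -
    have eq: "e s x + (- 2 * Z s * of_real (x\<^sup>2) + \<i> * of_real (s * w) * of_real x) * e s x
      = e s x + (- 2 * Z s * (of_real (x\<^sup>2) * e s x) + \<i> * of_real (s * w) * (of_real x * e s x))" for x
      by (simp add: algebra_simps)
    have "(\<integral>x. e s x + (- 2 * Z s * of_real (x\<^sup>2) + \<i> * of_real (s * w) * of_real x) * e s x \<partial>lborel) = 0"
    proof (rule integral_derivative_eq_0[where F="\<lambda>x. of_real x * e s x"])
      show "continuous_on UNIV (\<lambda>x. e s x + (- 2 * Z s * of_real (x\<^sup>2) + \<i> * of_real (s * w) * of_real x) * e s x)"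
        by (intro continuous_intros cont_e)
      show "integrable lborel (\<lambda>x. e s x + (- 2 * Z s * of_real (x\<^sup>2) + \<i> * of_real (s * w) * of_real x) * e s x)"
        unfolding eq by (intro Bochner_Integration.integrable_add integrable_mult_right int0 int1 int2)
    qed (rule dxe lim)+
    then have "J s + (- 2 * Z s * A2 s + \<i> * of_real (s * w) * A1 s) = 0"
      using has_bochner_integral_integral_eq[OF has_bochner_integral_add[OF hb(1)[of s] has_bochner_integral_add[OF
          has_bochner_integral_mult_right[OF hb(3), of "- 2 * Z s" s]
          has_bochner_integral_mult_right[OF hb(2), of "\<i> * of_real (s * w)" s]]]]
      unfolding eq by simp
    then show ?thesis by (simp add: algebra_simps)
  qed
  have dJ: "(J has_vector_derivative - \<i> * b * A2 s + \<i> * w * A1 s) (at s)" for s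
  proof -
    have "(J has_vector_derivative (\<integral>x. - \<i> * b * (of_real (x\<^sup>2) * e s x) + \<i> * w * (of_real x * e s x) \<partial>lborel)) (at s)"
      unfolding J_def
    proof (rule has_vector_derivative_integral[where g="\<lambda>x. (\<bar>b\<bar> + \<bar>w\<bar>) * ((1 + x\<^sup>2) * exp (- a * x\<^sup>2))"])
      show "((\<lambda>s. e s x) has_vector_derivative - \<i> * b * (of_real (x\<^sup>2) * e s x) + \<i> * w * (of_real x * e s x)) (at s)" for s x
      proof -
        have "((\<lambda>s. exp (- (of_real a + \<i> * (s * of_real b)) * of_real (x\<^sup>2) + \<i> * (s * of_real w * of_real x)))
          has_field_derivative (- \<i> * b * of_real (x\<^sup>2) + \<i> * w * of_real x) * e s x) (at (of_real s))"
          unfolding e_def Z_def by (auto intro!: derivative_eq_intros simp: algebra_simps)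
        from has_vector_derivative_real_field[OF this] show ?thesis
          by (simp add: e_def[abs_def] Z_def algebra_simps)
      qed
      show "norm (- \<i> * b * (of_real (x\<^sup>2) * e s x) + \<i> * w * (of_real x * e s x)) \<le> (\<bar>b\<bar> + \<bar>w\<bar>) * ((1 + x\<^sup>2) * exp (- a * x\<^sup>2))" for s x
      proof -
        have "norm (- \<i> * b * (of_real (x\<^sup>2) * e s x) + \<i> * w * (of_real x * e s x)) \<le> \<bar>b\<bar> * (x\<^sup>2 * exp (- a * x\<^sup>2)) + \<bar>w\<bar> * (\<bar>x\<bar> * exp (- a * x\<^sup>2))"
          by (rule order_trans[OF norm_triangle_ineq]) (simp add: norm_mult norm_e norm_power)
        also have "\<dots> \<le> \<bar>b\<bar> * ((1 + x\<^sup>2) * exp (- a * x\<^sup>2)) + \<bar>w\<bar> * ((1 + x\<^sup>2) * exp (- a * x\<^sup>2))"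
          using le1[of x] by (intro add_mono mult_left_mono mult_right_mono) auto
        finally show ?thesis by (simp add: algebra_simps)
      qed
    qed (use int0 g1 in auto)
    also have "(\<integral>x. - \<i> * b * (of_real (x\<^sup>2) * e s x) + \<i> * w * (of_real x * e s x) \<partial>lborel) = - \<i> * b * A2 s + \<i> * w * A1 s"
      by (intro has_bochner_integral_integral_eq has_bochner_integral_add has_bochner_integral_mult_right hb)
    finally show ?thesis .
  qed
  \<comment> \<open>G is, up to a constant, the reciprocal of the expected value of J, so the
    product of J and G must be constant; g below is its logarithmic derivative. \<open>csqrt\<close>
    is differentiable along the path because Re Z = a > 0.\<close>
  define G where "G s = csqrt (Z s) * exp (of_real ((s * w)\<^sup>2) / (4 * Z s))" for s
  define g where "g s = \<i> * b / (2 * Z s) + (2 * s * w\<^sup>2) / (4 * Z s) - of_real ((s * w)\<^sup>2) * \<i> * b / (4 * Z s ^ 2)" for s :: real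
  have dG: "(G has_vector_derivative g s * G s) (at s)" for s
  proof -
    define Zc where "Zc \<zeta> = of_real a + \<i> * (\<zeta> * of_real b)" for \<zeta>
    have dZ: "(Zc has_field_derivative \<i> * b) (at \<zeta>)" for \<zeta>
      unfolding Zc_def[abs_def] by (auto intro!: derivative_eq_intros)
    have Zc: "Zc (of_real s) = Z s" for s by (simp add: Zc_def Z_def)
    define S where "S = csqrt (Z s)"
    have S: "Z s = S * S" "csqrt (S * S) = S" "S \<noteq> 0"
      using Znz[of s] by (auto simp: S_def power2_csqrt simp flip: power2_eq_square)
    have Zpos: "Z s \<notin> \<real>\<^sub>\<le>\<^sub>0"
      using a ReZ[of s] by (auto simp: complex_nonpos_Reals_iff)
    define E where "E \<zeta> = (\<zeta> * of_real w)\<^sup>2 / (4 * Zc \<zeta>)" for \<zeta>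
    have dE: "(E has_field_derivative (2 * of_real s * of_real (w\<^sup>2) * Z s - of_real ((s * w)\<^sup>2) * \<i> * b) / (4 * (Z s * Z s))) (at (of_real s))"
      unfolding E_def[abs_def]
      by (rule DERIV_cong[OF DERIV_divide[OF _ DERIV_cmult[OF dZ]]])
        (use Znz[of s] in \<open>auto intro!: derivative_eq_intros simp: Zc field_simps power2_eq_square\<close>)
    have "((\<lambda>\<zeta>. csqrt (Zc \<zeta>) * exp (E \<zeta>)) has_field_derivative g s * G s) (at (of_real s))"
    proof (rule DERIV_cong[OF DERIV_mult[OF has_field_derivative_csqrt'[OF dZ] DERIV_chain2[OF DERIV_exp dE]]])
      show "Zc (of_real s) \<notin> \<real>\<^sub>\<le>\<^sub>0" using Zpos by (simp add: Zc)
      have E: "E (of_real s) = of_real ((s * w)\<^sup>2) / (4 * Z s)" by (simp add: E_def Zc)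
      show "\<i> * b / (2 * csqrt (Zc (of_real s))) * exp (E (of_real s)) +
        exp (E (of_real s)) * ((2 * of_real s * of_real (w\<^sup>2) * Z s - of_real ((s * w)\<^sup>2) * \<i> * b) / (4 * (Z s * Z s))) * csqrt (Zc (of_real s))
        = g s * G s"
      proof -
        define X where "X = exp (E (of_real s))"
        have "G s = S * X" by (simp add: G_def X_def E S_def)
        moreover have "csqrt (Zc (of_real s)) = S" by (simp add: Zc S_def)
        ultimately show ?thesis
          using S(3) unfolding X_def[symmetric] g_def S(1)
          by (simp add: divide_simps) (simp add: algebra_simps eval_nat_numeral)
      qed
    qed
    from has_vector_derivative_real_field[OF this] show ?thesis
      by (simp add: G_def[abs_def] E_def Zc)
  qed
  have dJ': "- \<i> * b * A2 s + \<i> * w * A1 s = - g s * J s" for s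
  proof -
    have 1: "A1 s = \<i> * of_real (s * w) * J s / (2 * Z s)"
      using rel1[of s] Znz[of s] by (simp add: field_simps)
    have 2: "A2 s = (J s + \<i> * of_real (s * w) * A1 s) / (2 * Z s)"
      using rel2[of s] Znz[of s] by (simp add: field_simps)
    show ?thesis unfolding g_def 2 1 using Znz[of s] by (simp add: field_simps power2_eq_square)
  qed
  have "((\<lambda>s. J s * G s) has_vector_derivative 0) (at s)" for s
    using has_vector_derivative_mult[OF dJ dG, of s] unfolding dJ' by (simp add: algebra_simps)
  then have "((\<lambda>s. J s * G s) has_derivative (\<lambda>h. 0)) (at s)" for s
    by (simp add: has_vector_derivative_def)
  then have const: "J 1 * G 1 = J 0 * G 0"
    by (intro has_derivative_zero_unique[of UNIV]) (auto)
  have "J 0 = of_real (sqrt (pi / a))"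
  proof -
    have "e 0 x = of_real (exp (- a * x\<^sup>2))" for x by (simp add: e_def Z_def exp_of_real[symmetric])
    then show ?thesis using gaussian_moments(1)[OF a] by (simp add: J_def has_bochner_integral_iff)
  qed
  moreover have "G 0 = of_real (sqrt a)" using a by (simp add: G_def Z_def csqrt_of_real_nonneg)
  ultimately have "J 1 * G 1 = of_real (sqrt pi)" using const a by (simp add: real_sqrt_divide)
  then have "J 1 * csqrt z * exp (of_real (w\<^sup>2) / (4 * z)) = of_real (sqrt pi)" by (simp add: G_def Z1 mult.assoc)
  moreover have "csqrt z \<noteq> 0" using Znz[of 1] Z1 by simp
  ultimately have "J 1 = of_real (sqrt pi) / csqrt z * exp (- of_real (w\<^sup>2) / (4 * z))"
    by (simp add: field_simps exp_minus)
  moreover have "e 1 = (\<lambda>x. exp (- z * of_real (x\<^sup>2) + \<i> * of_real (w * x)))"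
    by (simp add: fun_eq_iff e_def Z1)
  ultimately show "integrable lborel (\<lambda>x. exp (- z * of_real (x\<^sup>2) + \<i> * of_real (w * x)))"
    and "(\<integral>x. exp (- z * of_real (x\<^sup>2) + \<i> * of_real (w * x)) \<partial>lborel) = of_real (sqrt pi) / csqrt z * exp (- of_real (w\<^sup>2) / (4 * z))"
    using int0[of 1] by (auto simp: J_def)
qed

text \<open>\<open>lborel\<close> is the image of a product of one-dimensional Lebesgue measures, so
  a product of functions of single coordinates integrates factor by factor.\<close>

lemma lborel_product_integral:
  fixes f :: "'a::euclidean_space \<Rightarrow> real \<Rightarrow> 'b::{real_normed_field, banach, second_countable_topology}"
  assumes f: "\<And>b. b \<in> Basis \<Longrightarrow> integrable lborel (f b)"
  shows "integrable lborel (\<lambda>x. \<Prod>b\<in>Basis. f b (x \<bullet> b))"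
    and "(\<integral>x. (\<Prod>b\<in>Basis. f b (x \<bullet> b)) \<partial>lborel) = (\<Prod>b\<in>Basis. \<integral>x. f b x \<partial>lborel)"
proof -
  interpret product_sigma_finite "\<lambda>b::'a. lborel :: real measure" ..
  let ?T = "\<lambda>f. \<Sum>b\<in>Basis. f b *\<^sub>R (b::'a)"
  have [measurable]: "?T \<in> measurable (\<Pi>\<^sub>M b\<in>Basis. lborel) borel" by measurable
  have fm: "b \<in> Basis \<Longrightarrow> f b \<in> borel_measurable borel" for b using f[of b] by auto
  have [measurable]: "(\<lambda>x. \<Prod>b\<in>Basis. f b (x \<bullet> b)) \<in> borel_measurable borel"
    by (intro borel_measurable_prod measurable_compose[OF _ fm]) auto
  have eq: "(\<Prod>b\<in>Basis. f b (?T x \<bullet> b)) = (\<Prod>b\<in>Basis. f b (x b))" for x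
    by (intro prod.cong refl) (simp add: inner_sum_left inner_Basis if_distrib cong: if_cong)
  show "integrable lborel (\<lambda>x. \<Prod>b\<in>Basis. f b (x \<bullet> b))"
    by (subst lborel_eq, subst integrable_distr_eq) (auto simp: eq intro!: product_integrable_prod f)
  show "(\<integral>x. (\<Prod>b\<in>Basis. f b (x \<bullet> b)) \<partial>lborel) = (\<Prod>b\<in>Basis. \<integral>x. f b x \<partial>lborel)"
    by (subst lborel_eq, subst integral_distr) (auto simp: eq intro!: product_integral_prod f)
qed

lemma gaussian_fourier:
  fixes a b :: real and w :: "'a::euclidean_space"
  assumes a: "0 < a"
  defines "z \<equiv> Complex a b"
  shows "integrable lborel (\<lambda>x::'a. exp (- z * of_real ((norm x)\<^sup>2)) * cis (w \<bullet> x))"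
    and "(\<integral>x. exp (- z * of_real ((norm x)\<^sup>2)) * cis (w \<bullet> x) \<partial>lborel)
      = (of_real (sqrt pi) / csqrt z) ^ DIM('a) * exp (- of_real ((norm w)\<^sup>2) / (4 * z))"
proof -
  let ?f = "\<lambda>b x. exp (- z * of_real (x\<^sup>2) + \<i> * of_real ((w \<bullet> b) * x))"
  have eq: "exp (- z * of_real ((norm x)\<^sup>2)) * cis (w \<bullet> x) = (\<Prod>b\<in>Basis. ?f b (x \<bullet> b))" for x :: 'a
  proof -
    have "(norm x)\<^sup>2 = (\<Sum>b\<in>Basis. (x \<bullet> b)\<^sup>2)"
      unfolding power2_norm_eq_inner by (subst euclidean_inner) (simp add: power2_eq_square)
    moreover have "w \<bullet> x = (\<Sum>b\<in>Basis. (w \<bullet> b) * (x \<bullet> b))" by (rule euclidean_inner)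
    ultimately show ?thesis
      by (simp add: cis_conv_exp exp_sum[symmetric] sum.distrib sum_subtractf sum_negf sum_distrib_left flip: exp_add)
  qed
  show "integrable lborel (\<lambda>x::'a. exp (- z * of_real ((norm x)\<^sup>2)) * cis (w \<bullet> x))"
    unfolding eq by (intro lborel_product_integral) (use gaussian_fourier_real(1)[OF a] in \<open>simp add: z_def\<close>)
  have "(\<integral>x. exp (- z * of_real ((norm x)\<^sup>2)) * cis (w \<bullet> x) \<partial>lborel) = (\<Prod>b\<in>(Basis::'a set). of_real (sqrt pi) / csqrt z * exp (- of_real ((w \<bullet> b)\<^sup>2) / (4 * z)))"
    unfolding eq
    by (subst lborel_product_integral) (use gaussian_fourier_real[OF a] in \<open>simp_all add: z_def\<close>)
  also have "\<dots> = (of_real (sqrt pi) / csqrt z) ^ DIM('a) * exp (- of_real ((norm w)\<^sup>2) / (4 * z))"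
  proof -
    have "(norm w)\<^sup>2 = (\<Sum>b\<in>Basis. (w \<bullet> b)\<^sup>2)"
      unfolding power2_norm_eq_inner by (subst euclidean_inner) (simp add: power2_eq_square)
    then show ?thesis
      by (simp add: prod.distrib power_divide exp_sum[symmetric] sum_divide_distrib sum_negf prod_dividef)
  qed
  finally show "(\<integral>x. exp (- z * of_real ((norm x)\<^sup>2)) * cis (w \<bullet> x) \<partial>lborel)
      = (of_real (sqrt pi) / csqrt z) ^ DIM('a) * exp (- of_real ((norm w)\<^sup>2) / (4 * z))" .
qed

subsection \<open>The Fourier transform in \<open>L\<^sup>2\<close> and the Schroedinger kernel\<close>

lemma borel_measurable_cis [measurable (raw)]:
  "f \<in> borel_measurable M \<Longrightarrow> (\<lambda>x. cis (f x)) \<in> borel_measurable M"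
  by (rule measurable_compose[of f M borel cis])
    (auto intro!: borel_measurable_continuous_onI continuous_intros)

lemma borel_measurable_cnj [measurable (raw)]:
  "f \<in> borel_measurable M \<Longrightarrow> (\<lambda>x. cnj (f x)) \<in> borel_measurable M"
  by (rule measurable_compose[of f M borel cnj])
    (auto intro!: borel_measurable_continuous_onI continuous_intros)

text \<open>A non-integrable f has Bochner integral 0, so the bound is trivial for it.\<close>

lemma ennreal_norm_integral_le:
  fixes f :: "'a \<Rightarrow> 'b::{banach, second_countable_topology}"
  shows "enorm (\<integral>x. f x \<partial>M) \<le> (\<integral>\<^sup>+x. enorm (f x) \<partial>M)"
  by (cases "integrable M f") (auto simp: not_integrable_integral_eq intro: integral_norm_bound_ennreal)

lemma Complex_0_right: "Complex x 0 = of_real x"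
  by (simp add: complex_eq_iff)

lemma nn_integral_lborel_diff:
  fixes f :: "'a::euclidean_space \<Rightarrow> ennreal"
  assumes [measurable]: "f \<in> borel_measurable borel"
  shows "(\<integral>\<^sub>+x. f (y - x)) = (\<integral>\<^sub>+x. f x)"
proof -
  have "(\<integral>\<^sub>+x. f x) = (\<integral>\<^sup>+x. f x \<partial>density (distr lborel borel (\<lambda>x. y + (-1) *\<^sub>R x)) (\<lambda>_. ennreal (\<bar>-1\<bar> ^ DIM('a))))"
    by (subst lborel_affine[of "-1" y]) auto
  also have "\<dots> = (\<integral>\<^sub>+x. f (y - x))"
    by (simp add: nn_integral_density nn_integral_distr)
  finally show ?thesis by simp
qed

lemma nn_integral_lborel_scale:
  fixes f :: "'a::euclidean_space \<Rightarrow> ennreal"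
  assumes [measurable]: "f \<in> borel_measurable borel" and c: "0 < c"
  shows "(\<integral>\<^sub>+x. f (c *\<^sub>R x)) = ennreal ((1 / c) ^ DIM('a)) * (\<integral>\<^sub>+x. f x)"
proof -
  have "(\<integral>\<^sub>+x. f x) = (\<integral>\<^sup>+x. f x \<partial>density (distr lborel borel (\<lambda>x. 0 + c *\<^sub>R x)) (\<lambda>_. ennreal (\<bar>c\<bar> ^ DIM('a))))"
    using c by (subst lborel_affine[of c 0]) auto
  also have "\<dots> = ennreal (c ^ DIM('a)) * (\<integral>\<^sub>+x. f (c *\<^sub>R x))"
    using c by (simp add: nn_integral_density nn_integral_distr nn_integral_cmult)
  finally show ?thesis using c by (simp add: mult.assoc[symmetric] power_divide flip: ennreal_mult)
qed

lemma integral_lborel_plus: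
  fixes f :: "'a::euclidean_space \<Rightarrow> 'b::{banach, second_countable_topology}"
  assumes [measurable]: "f \<in> borel_measurable borel"
  shows "(\<integral>x. f (y + x) \<partial>lborel) = (\<integral>x. f x \<partial>lborel)"
proof -
  have "(\<integral>x. f x \<partial>lborel) = (\<integral>x. f x \<partial>distr lborel borel ((+) y))" by (simp add: lborel_distr_plus)
  then show ?thesis by (simp add: integral_distr)
qed

lemma fourier_borel:
  assumes [measurable]: "g \<in> borel_measurable borel"
  shows "fourier g \<xi> = (\<integral>x. cis (- (x \<bullet> \<xi>)) * g x \<partial>lborel)"
  unfolding fourier_def by (rule integral_completion) measurable

lemma borel_measurable_fourier [measurable]:
  assumes [measurable]: "g \<in> borel_measurable borel"
  shows "fourier g \<in> borel_measurable borel"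
  unfolding fourier_borel[OF assms, abs_def] by measurable

lemma norm_fourier_le:
  assumes "integrable lborel g"
  shows "norm (fourier g \<xi>) \<le> (\<integral>x. norm (g x) \<partial>lborel)"
proof -
  have [measurable]: "g \<in> borel_measurable borel" using assms by auto
  show ?thesis
    unfolding fourier_borel[OF \<open>g \<in> borel_measurable borel\<close>] using assms
    by (intro order_trans[OF integral_norm_bound]) (simp add: norm_mult)
qed

text \<open>Damp the square of the transform by a Gaussian, expand its two factors and apply Fubini:
  the result is a quadratic form in g with kernel h (y - x), where h is the transform of the
  Gaussian. The mass (2 pi)^N of h does not depend on e, so the Schur test bounds the form
  uniformly, and Fatou's lemma removes the damping.\<close>

lemma fourier_Bessel:
  fixes g :: "'a::euclidean_space \<Rightarrow> complex"
  assumes g: "integrable lborel g"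
  shows "(\<integral>\<^sub>+\<xi>. ennreal ((norm (fourier g \<xi>))\<^sup>2))
    \<le> ennreal ((2 * pi) ^ DIM('a)) * (\<integral>\<^sub>+x. ennreal ((norm (g x))\<^sup>2))"
proof -
  have [measurable]: "g \<in> borel_measurable borel" using g by auto
  have cnj_g: "integrable lborel (\<lambda>x. cnj (g x))" using g by simp
  define m where "m = (2 * pi) ^ DIM('a)"
  define A where "A = (\<integral>\<^sub>+x. ennreal ((norm (g x))\<^sup>2))"
  have key: "(\<integral>\<^sub>+\<xi>. ennreal (exp (- e * (norm \<xi>)\<^sup>2) * (norm (fourier g \<xi>))\<^sup>2)) \<le> ennreal m * A" if e: "0 < e" for e
  proof -
    define E :: "'a \<Rightarrow> complex" where "E \<xi> = of_real (exp (- e * (norm \<xi>)\<^sup>2))" for \<xi>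
    have E_eq: "E \<xi> = exp (- Complex e 0 * of_real ((norm \<xi>)\<^sup>2))" for \<xi>
      by (simp add: E_def exp_of_real[symmetric] Complex_0_right)
    have [measurable]: "E \<in> borel_measurable borel" unfolding E_def[abs_def] by measurable
    define h where "h w = sqrt (pi / e) ^ DIM('a) * exp (- (1 / (4 * e)) * (norm w)\<^sup>2)" for w :: 'a
    have [measurable]: "h \<in> borel_measurable borel" unfolding h_def[abs_def] by measurable
    have hpos: "0 \<le> h w" for w using e by (simp add: h_def)
    have csq: "csqrt (Complex e 0) = of_real (sqrt e)"
      using e by (simp add: Complex_0_right csqrt_of_real_nonneg)
    have h: "(\<integral>\<xi>. E \<xi> * cis (w \<bullet> \<xi>) \<partial>lborel) = of_real (h w)" for w :: 'a
    proof -
      have "(\<integral>\<xi>. E \<xi> * cis (w \<bullet> \<xi>) \<partial>lborel) = (of_real (sqrt pi) / of_real (sqrt e)) ^ DIM('a) * exp (- of_real ((norm w)\<^sup>2) / (4 * Complex e 0))"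
        unfolding E_eq gaussian_fourier(2)[OF e] csq ..
      also have "exp (- of_real ((norm w)\<^sup>2) / (4 * Complex e 0)) = of_real (exp (- (1 / (4 * e)) * (norm w)\<^sup>2))"
        by (simp add: exp_of_real[symmetric] Complex_0_right field_simps)
      finally show ?thesis by (simp add: h_def real_sqrt_divide)
    qed
    have E_int: "integrable lborel E"
      using gaussian_fourier(1)[OF e, of 0 0] by (simp add: E_eq[abs_def])
    have h_int: "(\<integral>\<^sub>+w. ennreal (h w)) = ennreal m"
    proof -
      have e4: "0 < 1 / (4 * e)" using e by simp
      have "(\<integral>w. of_real (exp (- (1 / (4 * e)) * (norm (w::'a))\<^sup>2)) \<partial>lborel) = (of_real (sqrt pi) / csqrt (Complex (1 / (4 * e)) 0)) ^ DIM('a)"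
        using gaussian_fourier(2)[OF e4, of 0 "0::'a"]
        by (simp add: exp_of_real[symmetric] Complex_0_right)
      also have "csqrt (Complex (1 / (4 * e)) 0) = of_real (sqrt (1 / (4 * e)))"
        using e by (simp add: Complex_0_right csqrt_of_real_nonneg)
      finally have "complex_of_real (\<integral>w. (exp (- (1 / (4 * e)) * (norm (w::'a))\<^sup>2)) \<partial>lborel) = of_real ((sqrt pi / sqrt (1 / (4 * e))) ^ DIM('a))"
        by simp
      then have I: "(\<integral>w. (exp (- (1 / (4 * e)) * (norm (w::'a))\<^sup>2)) \<partial>lborel) = (sqrt pi / sqrt (1 / (4 * e))) ^ DIM('a)"
        by (simp only: of_real_eq_iff)
      have int: "integrable lborel (\<lambda>w::'a. exp (- (1 / (4 * e)) * (norm w)\<^sup>2))"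
        using integrable_norm[OF gaussian_fourier(1)[OF e4, of 0 "0::'a"]]
        by (simp add: norm_mult norm_exp_eq_Re Complex_0_right)
      have "(\<integral>\<^sub>+w. ennreal (h w)) = ennreal (\<integral>w. h w \<partial>lborel)"
        by (rule nn_integral_eq_integral) (use hpos int in \<open>auto simp: h_def[abs_def]\<close>)
      also have "(\<integral>w. h w \<partial>lborel) = sqrt (pi / e) ^ DIM('a) * (sqrt pi / sqrt (1 / (4 * e))) ^ DIM('a)"
        unfolding h_def by (simp only: integral_mult_right_zero I)
      also have "\<dots> = (sqrt (pi / e) * (sqrt pi / sqrt (1 / (4 * e)))) ^ DIM('a)"
        by (rule power_mult_distrib[symmetric])
      also have "sqrt (pi / e) * (sqrt pi / sqrt (1 / (4 * e))) = 2 * pi"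
        using e by (simp add: real_sqrt_divide real_sqrt_mult)
      also have "(2 * pi) ^ DIM('a) = m" by (simp add: m_def)
      finally show ?thesis .
    qed
    have cnjF: "cnj (fourier g \<xi>) = (\<integral>y. cis (y \<bullet> \<xi>) * cnj (g y) \<partial>lborel)" for \<xi>
    proof -
      have "cnj (fourier g \<xi>) = (\<integral>x. cnj (cis (- (x \<bullet> \<xi>)) * g x) \<partial>lborel)"
        unfolding fourier_borel[OF \<open>g \<in> borel_measurable borel\<close>]
      proof (rule integral_bounded_linear[OF bounded_linear_cnj, symmetric])
        show "integrable lborel (\<lambda>x. cis (- (x \<bullet> \<xi>)) * g x)"
          by (rule Bochner_Integration.integrable_bound[OF g]) (auto simp: norm_mult)
      qed
      then show ?thesis by (simp add: cis_cnj)
    qed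
    have Fb: "norm (fourier g \<xi>) \<le> (\<integral>x. norm (g x) \<partial>lborel)" for \<xi> by (rule norm_fourier_le[OF g])
    define L where "L = (\<integral>x. norm (g x) \<partial>lborel)"
    have L: "0 \<le> L" by (simp add: L_def)
    have E_norm: "integrable lborel (\<lambda>\<xi>. norm (E \<xi>))" using E_int by simp
    have int1: "integrable (lborel \<Otimes>\<^sub>M lborel) (\<lambda>(\<xi>, y). E \<xi> * fourier g \<xi> * (cis (y \<bullet> \<xi>) * cnj (g y)))"
    proof (rule lborel_pair.integrable_pair_product)
      show "integrable lborel (\<lambda>\<xi>. norm (E \<xi>) * L)" "integrable lborel (\<lambda>y. norm (g y))" using E_norm g by auto
      show "norm (E \<xi> * fourier g \<xi> * (cis (y \<bullet> \<xi>) * cnj (g y))) \<le> \<bar>norm (E \<xi>) * L\<bar> * \<bar>norm (g y)\<bar>" for \<xi> y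
        using Fb[of \<xi>] L by (auto simp: norm_mult L_def[symmetric] intro!: mult_right_mono mult_left_mono)
    qed measurable
    have int2: "integrable (lborel \<Otimes>\<^sub>M lborel) (\<lambda>(\<xi>, x). E \<xi> * cis ((y - x) \<bullet> \<xi>) * g x)" for y
    proof (rule lborel_pair.integrable_pair_product)
      show "integrable lborel (\<lambda>\<xi>. norm (E \<xi>))" "integrable lborel (\<lambda>y. norm (g y))" using E_norm g by auto
    qed (auto simp: norm_mult)
    have inner: "(\<integral>\<xi>. E \<xi> * fourier g \<xi> * (cis (y \<bullet> \<xi>) * cnj (g y)) \<partial>lborel) = cnj (g y) * (\<integral>x. of_real (h (y - x)) * g x \<partial>lborel)" for y
    proof -
      have "(\<integral>\<xi>. E \<xi> * fourier g \<xi> * (cis (y \<bullet> \<xi>) * cnj (g y)) \<partial>lborel)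
          = (\<integral>\<xi>. cnj (g y) * (E \<xi> * cis (y \<bullet> \<xi>) * fourier g \<xi>) \<partial>lborel)"
        by (simp add: ac_simps)
      also have "\<dots> = cnj (g y) * (\<integral>\<xi>. E \<xi> * cis (y \<bullet> \<xi>) * fourier g \<xi> \<partial>lborel)"
        by (rule integral_mult_right_zero)
      also have "(\<integral>\<xi>. E \<xi> * cis (y \<bullet> \<xi>) * fourier g \<xi> \<partial>lborel) = (\<integral>\<xi>. (\<integral>x. E \<xi> * cis ((y - x) \<bullet> \<xi>) * g x \<partial>lborel) \<partial>lborel)"
      proof (intro Bochner_Integration.integral_cong refl)
        fix \<xi>
        have "E \<xi> * cis ((y - x) \<bullet> \<xi>) * g x = E \<xi> * cis (y \<bullet> \<xi>) * (cis (- (x \<bullet> \<xi>)) * g x)" for x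
        proof -
          have "cis ((y - x) \<bullet> \<xi>) = cis (y \<bullet> \<xi>) * cis (- (x \<bullet> \<xi>))" by (simp add: cis_mult inner_diff_left)
          then show ?thesis by (simp only: mult.assoc)
        qed
        then show "E \<xi> * cis (y \<bullet> \<xi>) * fourier g \<xi> = (\<integral>x. E \<xi> * cis ((y - x) \<bullet> \<xi>) * g x \<partial>lborel)"
          unfolding fourier_borel[OF \<open>g \<in> borel_measurable borel\<close>]
          by (simp only: integral_mult_right_zero)
      qed
      also have "\<dots> = (\<integral>x. (\<integral>\<xi>. E \<xi> * cis ((y - x) \<bullet> \<xi>) * g x \<partial>lborel) \<partial>lborel)"
        by (rule lborel_pair.Fubini_integral[OF int2, symmetric])
      also have "\<dots> = (\<integral>x. of_real (h (y - x)) * g x \<partial>lborel)"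
        by (simp only: integral_mult_left_zero h)
      finally show ?thesis .
    qed
    have sq: "of_real (exp (- e * (norm \<xi>)\<^sup>2) * (norm (fourier g \<xi>))\<^sup>2) = E \<xi> * fourier g \<xi> * cnj (fourier g \<xi>)" for \<xi>
      by (simp add: E_def complex_norm_square mult.assoc del: of_real_power)
    have int0: "integrable lborel (\<lambda>\<xi>. exp (- e * (norm \<xi>)\<^sup>2) * (norm (fourier g \<xi>))\<^sup>2)"
    proof (rule Bochner_Integration.integrable_bound)
      show "integrable lborel (\<lambda>\<xi>. norm (E \<xi>) * L\<^sup>2)" using E_norm by simp
      show "AE \<xi> in lborel. norm (exp (- e * (norm \<xi>)\<^sup>2) * (norm (fourier g \<xi>))\<^sup>2) \<le> norm (norm (E \<xi>) * L\<^sup>2)"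
        using Fb L by (auto simp: E_def L_def[symmetric] intro!: AE_I2 mult_left_mono power_mono)
    qed measurable
    have "(\<integral>\<^sub>+\<xi>. ennreal (exp (- e * (norm \<xi>)\<^sup>2) * (norm (fourier g \<xi>))\<^sup>2))
        = ennreal (\<integral>\<xi>. exp (- e * (norm \<xi>)\<^sup>2) * (norm (fourier g \<xi>))\<^sup>2 \<partial>lborel)"
      by (rule nn_integral_eq_integral[OF int0]) auto
    also have "\<dots> \<le> enorm (complex_of_real (\<integral>\<xi>. exp (- e * (norm \<xi>)\<^sup>2) * (norm (fourier g \<xi>))\<^sup>2 \<partial>lborel))"
      by (intro ennreal_leI) simp
    also have "complex_of_real (\<integral>\<xi>. exp (- e * (norm \<xi>)\<^sup>2) * (norm (fourier g \<xi>))\<^sup>2 \<partial>lborel)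
        = (\<integral>\<xi>. E \<xi> * fourier g \<xi> * cnj (fourier g \<xi>) \<partial>lborel)"
      by (simp only: integral_complex_of_real[symmetric] sq)
    also have "\<dots> = (\<integral>\<xi>. (\<integral>y. E \<xi> * fourier g \<xi> * (cis (y \<bullet> \<xi>) * cnj (g y)) \<partial>lborel) \<partial>lborel)"
      by (simp only: cnjF integral_mult_right_zero)
    also have "\<dots> = (\<integral>y. cnj (g y) * (\<integral>x. of_real (h (y - x)) * g x \<partial>lborel) \<partial>lborel)"
      by (subst lborel_pair.Fubini_integral[OF int1, symmetric]) (simp only: inner)
    also have "enorm \<dots> \<le> (\<integral>\<^sub>+y. enorm (cnj (g y) * (\<integral>x. of_real (h (y - x)) * g x \<partial>lborel)))"
      by (rule ennreal_norm_integral_le) 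
    also have "\<dots> \<le> (\<integral>\<^sub>+y. (\<integral>\<^sub>+x. enorm (g y) * ennreal (h (y - x) * norm (g x))))"
      using hpos by (intro nn_integral_mono)
        (auto simp: norm_mult ennreal_mult nn_integral_cmult intro!: mult_left_mono order_trans[OF ennreal_norm_integral_le] )
    \<comment> \<open>Schur test: the product of the two values is replaced by half the sum of their
      squares, after which h is integrated over the other variable.\<close>
    also have "\<dots> \<le> (\<integral>\<^sub>+y. (\<integral>\<^sub>+x. ennreal (h (y - x)) * (ennreal ((norm (g y))\<^sup>2 / 2) + ennreal ((norm (g x))\<^sup>2 / 2))))"
    proof (intro nn_integral_mono)
      fix x y
      have "norm (g y) * norm (g x) \<le> (norm (g y))\<^sup>2 / 2 + (norm (g x))\<^sup>2 / 2"
        using sum_squares_bound[of "norm (g y)" "norm (g x)"] by simp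
      then have "h (y - x) * (norm (g y) * norm (g x)) \<le> h (y - x) * ((norm (g y))\<^sup>2 / 2 + (norm (g x))\<^sup>2 / 2)"
        by (rule mult_left_mono) (rule hpos)
      then show "enorm (g y) * ennreal (h (y - x) * norm (g x)) \<le> ennreal (h (y - x)) * (ennreal ((norm (g y))\<^sup>2 / 2) + ennreal ((norm (g x))\<^sup>2 / 2))"
        using hpos by (simp add: ac_simps flip: ennreal_mult ennreal_plus)
    qed
    also have "\<dots> = (\<integral>\<^sub>+y. (\<integral>\<^sub>+x. ennreal (h (y - x)) * ennreal ((norm (g y))\<^sup>2 / 2)))
        + (\<integral>\<^sub>+y. (\<integral>\<^sub>+x. ennreal (h (y - x)) * ennreal ((norm (g x))\<^sup>2 / 2)))"
      by (simp add: distrib_left nn_integral_add)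
    also have "(\<integral>\<^sub>+y. (\<integral>\<^sub>+x. ennreal (h (y - x)) * ennreal ((norm (g x))\<^sup>2 / 2)))
        = (\<integral>\<^sub>+x. (\<integral>\<^sub>+y. ennreal (h (y - x)) * ennreal ((norm (g x))\<^sup>2 / 2)))"
      by (rule lborel_pair.Fubini') measurable
    also have "\<dots> = (\<integral>\<^sub>+x. (\<integral>\<^sub>+y. ennreal (h (x - y)) * ennreal ((norm (g x))\<^sup>2 / 2)))"
      by (simp add: h_def norm_minus_commute)
    also have "(\<integral>\<^sub>+y. (\<integral>\<^sub>+x. ennreal (h (y - x)) * ennreal ((norm (g y))\<^sup>2 / 2))) = ennreal m * (\<integral>\<^sub>+x. ennreal ((norm (g x))\<^sup>2 / 2))"
      using nn_integral_lborel_diff[of "\<lambda>x. ennreal (h x)"]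
      by (simp add: nn_integral_multc nn_integral_cmult h_int)
    also have "ennreal m * (\<integral>\<^sub>+x. ennreal ((norm (g x))\<^sup>2 / 2)) + ennreal m * (\<integral>\<^sub>+x. ennreal ((norm (g x))\<^sup>2 / 2)) = ennreal m * A"
      unfolding A_def by (simp add: distrib_left[symmetric] nn_integral_add[symmetric] flip: ennreal_plus)
    finally show ?thesis .
  qed
  \<comment> \<open>The damping parameter 1 / (n + 1) tends to 0; Fatou's lemma passes the uniform
    bound to the limit.\<close>
  have "(\<integral>\<^sub>+\<xi>. ennreal ((norm (fourier g \<xi>))\<^sup>2))
      = (\<integral>\<^sub>+\<xi>. liminf (\<lambda>n. ennreal (exp (- (1 / Suc n) * (norm \<xi>)\<^sup>2) * (norm (fourier g \<xi>))\<^sup>2)))"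
  proof (intro nn_integral_cong)
    fix \<xi> :: 'a
    have "(\<lambda>n. ennreal (exp (- (1 / Suc n) * (norm \<xi>)\<^sup>2) * (norm (fourier g \<xi>))\<^sup>2)) \<longlonglongrightarrow> ennreal (exp (- 0 * (norm \<xi>)\<^sup>2) * (norm (fourier g \<xi>))\<^sup>2)"
      by (intro tendsto_intros tendsto_ennrealI LIMSEQ_inverse_real_of_nat[unfolded inverse_eq_divide])
    then show "ennreal ((norm (fourier g \<xi>))\<^sup>2) = liminf (\<lambda>n. ennreal (exp (- (1 / Suc n) * (norm \<xi>)\<^sup>2) * (norm (fourier g \<xi>))\<^sup>2))"
      by (intro lim_imp_Liminf[symmetric]) auto
  qed
  also have "\<dots> \<le> liminf (\<lambda>n. \<integral>\<^sub>+\<xi>. ennreal (exp (- (1 / Suc n) * (norm \<xi>)\<^sup>2) * (norm (fourier g \<xi>))\<^sup>2))"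
    by (rule nn_integral_liminf) measurable
  also have "\<dots> \<le> ennreal m * A"
    by (intro Liminf_le always_eventually allI key) simp_all
  finally show ?thesis by (simp add: m_def A_def)
qed

text \<open>The factor is (4 pi i \<tau>)^(-N/2), written as the N-th power of a one-dimensional
  factor: this is how it arises from the Gaussian integral, with the branch of the root fixed by
  \<open>csqrt\<close>.\<close>

definition schr_kernel :: "real \<Rightarrow> 'a::euclidean_space \<Rightarrow> complex" where
  "schr_kernel \<tau> w = (of_real (sqrt pi) / (of_real (2 * pi) * csqrt (Complex 0 \<tau>))) ^ DIM('a) * cis ((norm w)\<^sup>2 / (4 * \<tau>))"

definition schr_conv :: "real \<Rightarrow> ('a::euclidean_space \<Rightarrow> complex) \<Rightarrow> 'a \<Rightarrow> complex" where
  "schr_conv \<tau> g x = (\<integral>y. schr_kernel \<tau> (x - y) * g y \<partial>lborel)"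

text \<open>\<open>csqrt\<close> jumps across the negative real axis, but along the imaginary axis
  it is sqrt \<bar>t\<bar> times one of two constants, which makes it Borel there.\<close>

lemma borel_measurable_schr_kernel [measurable (raw)]:
  assumes [measurable]: "f \<in> borel_measurable M" "g \<in> borel_measurable M"
  shows "(\<lambda>x. schr_kernel (f x) (g x :: 'a::euclidean_space)) \<in> borel_measurable M"
proof -
  define c d where "c = csqrt \<i>" and "d = csqrt (- \<i>)"
  have cd: "c\<^sup>2 = \<i>" "d\<^sup>2 = - \<i>" by (simp_all only: c_def d_def power2_csqrt)
  have princ: "0 < Re c \<or> Re c = 0 \<and> 0 \<le> Im c" "0 < Re d \<or> Re d = 0 \<and> 0 \<le> Im d"
    unfolding c_def d_def by (rule csqrt_principal)+
  have "(\<lambda>t. csqrt (Complex 0 t)) = (\<lambda>t. if 0 \<le> t then of_real (sqrt t) * c else of_real (sqrt (- t)) * d)"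
  proof
    fix t :: real
    have "csqrt (of_real t * \<i>) = of_real (sqrt t) * c" if "0 \<le> t"
      using that princ(1) by (cases "t = 0"; intro csqrt_unique) (auto simp: power_mult_distrib cd mult_nonneg_nonneg zero_less_mult_iff simp flip: of_real_power)
    moreover have "csqrt (of_real (- t) * (- \<i>)) = of_real (sqrt (- t)) * d" if "t < 0"
    proof (rule csqrt_unique)
      have "(of_real (sqrt (- t)) * d)\<^sup>2 = of_real ((sqrt (- t))\<^sup>2) * d\<^sup>2"
        by (simp only: power_mult_distrib of_real_power)
      then show "(of_real (sqrt (- t)) * d)\<^sup>2 = of_real (- t) * - \<i>" using that by (simp add: cd)
      show "0 < Re (of_real (sqrt (- t)) * d) \<or> Re (of_real (sqrt (- t)) * d) = 0 \<and> 0 \<le> Im (of_real (sqrt (- t)) * d)"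
        using that princ(2) by (auto simp: zero_less_mult_iff mult_nonneg_nonneg)
    qed
    ultimately show "csqrt (Complex 0 t) = (if 0 \<le> t then of_real (sqrt t) * c else of_real (sqrt (- t)) * d)"
      by (simp add: Complex_eq mult.commute)
  qed
  moreover have "(\<lambda>t. if 0 \<le> t then of_real (sqrt t) * c else of_real (sqrt (- t)) * d) \<in> borel_measurable borel"
    by measurable
  ultimately have "(\<lambda>t. csqrt (Complex 0 t)) \<in> borel_measurable borel" by simp
  then have [measurable]: "(\<lambda>x. csqrt (Complex 0 (f x))) \<in> borel_measurable M"
    by (rule measurable_compose[OF assms(1)])
  show ?thesis unfolding schr_kernel_def by measurable
qed

lemma norm_schr_kernel:
  assumes "0 < \<tau>"
  shows "norm (schr_kernel \<tau> (w::'a::euclidean_space)) = (4 * pi * \<tau>) powr (- DIM('a) / 2)"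
proof -
  have "sqrt pi / (2 * pi * sqrt \<tau>) = 1 / sqrt (4 * pi * \<tau>)"
    using assms by (simp add: field_simps real_sqrt_mult)
  also have "\<dots> = (4 * pi * \<tau>) powr (- 1 / 2)"
    using assms by (simp add: powr_minus_divide powr_half_sqrt)
  finally have eq: "sqrt pi / (2 * pi * sqrt \<tau>) = (4 * pi * \<tau>) powr (- 1 / 2)" .
  have "norm (Complex 0 \<tau>) = \<tau>" using assms by (simp add: cmod_def)
  then have "norm (schr_kernel \<tau> w) = (sqrt pi / (2 * pi * sqrt \<tau>)) ^ DIM('a)"
    using assms by (simp add: schr_kernel_def norm_mult norm_power norm_divide)
  then have "norm (schr_kernel \<tau> w) = ((4 * pi * \<tau>) powr (- 1 / 2)) ^ DIM('a)" unfolding eq .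
  then show ?thesis using assms by (simp add: powr_realpow[symmetric] powr_powr)
qed

lemma schr_kernel_commute: "schr_kernel \<tau> (x - y) = schr_kernel \<tau> (y - x)"
  by (simp add: schr_kernel_def norm_minus_commute)

lemma borel_measurable_schr_conv [measurable]:
  assumes [measurable]: "g \<in> borel_measurable borel"
  shows "(\<lambda>(\<tau>, x). schr_conv \<tau> g x) \<in> borel_measurable (borel \<Otimes>\<^sub>M borel)"
  unfolding schr_conv_def by measurable

text \<open>The dispersive estimate: the modulus of the kernel does not depend on its spatial
  argument. For a non-measurable g the integrand is not measurable either, because the kernel never
  vanishes, and the Bochner integral is 0.\<close>

lemma norm_schr_conv_le:
  fixes g :: "'a::euclidean_space \<Rightarrow> complex"
  assumes "0 < \<tau>"
  shows "enorm (schr_conv \<tau> g x) \<le> ennreal ((4 * pi * \<tau>) powr (- DIM('a) / 2)) * (\<integral>\<^sub>+y. enorm (g y))"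
proof (cases "g \<in> borel_measurable lborel")
  case True
  have "enorm (schr_conv \<tau> g x) \<le> (\<integral>\<^sub>+y. enorm (schr_kernel \<tau> (x - y) * g y))"
    unfolding schr_conv_def by (rule ennreal_norm_integral_le)
  also have "\<dots> = ennreal ((4 * pi * \<tau>) powr (- DIM('a) / 2)) * (\<integral>\<^sub>+y. enorm (g y))"
    using True by (simp add: norm_mult norm_schr_kernel assms ennreal_mult nn_integral_cmult)
  finally show ?thesis .
next
  case False
  have "\<not> integrable lborel (\<lambda>y. schr_kernel \<tau> (x - y) * g y)"
  proof
    assume "integrable lborel (\<lambda>y. schr_kernel \<tau> (x - y) * g y)"
    then have [measurable]: "(\<lambda>y. schr_kernel \<tau> (x - y) * g y) \<in> borel_measurable lborel" by simp
    have nz: "schr_kernel \<tau> w \<noteq> 0" for w :: 'a using norm_schr_kernel[OF assms, of w] assms by auto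
    have "(\<lambda>y. (schr_kernel \<tau> (x - y) * g y) / schr_kernel \<tau> (x - y)) \<in> borel_measurable lborel" by measurable
    then show False using False nz by simp
  qed
  then show ?thesis by (simp add: schr_conv_def not_integrable_integral_eq)
qed

text \<open>Expanding the square of the distance shows that the convolution is
  \<open>schr_kernel \<tau> x\<close> times the Fourier transform, at x / (2 \<tau>), of g
  multiplied by a quadratic phase. After \<open>fourier_Bessel\<close> and rescaling the constants
  multiply to exactly 1.\<close>

lemma schr_conv_L2:
  fixes g :: "'a::euclidean_space \<Rightarrow> complex"
  assumes g: "integrable lborel g" and \<tau>: "0 < \<tau>"
  shows "(\<integral>\<^sub>+x. ennreal ((norm (schr_conv \<tau> g x))\<^sup>2)) \<le> (\<integral>\<^sub>+x. ennreal ((norm (g x))\<^sup>2))"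
proof -
  have [measurable]: "g \<in> borel_measurable borel" using g by auto
  define gc where "gc y = cis ((norm y)\<^sup>2 / (4 * \<tau>)) * g y" for y
  have [measurable]: "gc \<in> borel_measurable borel" unfolding gc_def[abs_def] by measurable
  have gc: "integrable lborel gc"
    by (rule Bochner_Integration.integrable_bound[OF g]) (auto simp: gc_def norm_mult)
  define k where "k = (4 * pi * \<tau>) powr (- DIM('a) / 2)"
  have k: "0 < k" using \<tau> by (simp add: k_def)
  have eq: "norm (schr_conv \<tau> g x) = k * norm (fourier gc ((1 / (2 * \<tau>)) *\<^sub>R x))" for x
  proof -
    have "schr_kernel \<tau> (x - y) * g y = schr_kernel \<tau> x * (cis (- (y \<bullet> ((1 / (2 * \<tau>)) *\<^sub>R x))) * gc y)" for y
    proof -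
      have "(norm (x - y))\<^sup>2 / (4 * \<tau>) = (norm x)\<^sup>2 / (4 * \<tau>) + (- (y \<bullet> ((1 / (2 * \<tau>)) *\<^sub>R x)) + (norm y)\<^sup>2 / (4 * \<tau>))"
        using \<tau> by (simp add: power2_norm_eq_inner inner_diff_left inner_diff_right inner_commute field_simps)
      then have "cis ((norm (x - y))\<^sup>2 / (4 * \<tau>)) = cis ((norm x)\<^sup>2 / (4 * \<tau>)) * (cis (- (y \<bullet> ((1 / (2 * \<tau>)) *\<^sub>R x))) * cis ((norm y)\<^sup>2 / (4 * \<tau>)))"
        by (simp only: cis_mult)
      then show ?thesis unfolding schr_kernel_def gc_def by (simp only: mult.assoc)
    qed
    then have "schr_conv \<tau> g x = schr_kernel \<tau> x * fourier gc ((1 / (2 * \<tau>)) *\<^sub>R x)"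
      by (simp add: schr_conv_def fourier_borel)
    then show ?thesis using \<tau> by (simp add: norm_mult norm_schr_kernel k_def)
  qed
  have k2: "k\<^sup>2 = (1 / (4 * pi * \<tau>)) ^ DIM('a)"
    using \<tau> by (simp add: k_def power2_eq_square powr_minus powr_realpow inverse_eq_divide power_one_over flip: powr_add)
  have "(\<integral>\<^sub>+x. ennreal ((norm (schr_conv \<tau> g x))\<^sup>2))
      = ennreal (k\<^sup>2) * (\<integral>\<^sub>+x. ennreal ((norm (fourier gc ((1 / (2 * \<tau>)) *\<^sub>R x)))\<^sup>2))"
    by (simp add: eq power_mult_distrib ennreal_mult nn_integral_cmult)
  also have "(\<integral>\<^sub>+x. ennreal ((norm (fourier gc ((1 / (2 * \<tau>)) *\<^sub>R x)))\<^sup>2)) = ennreal ((2 * \<tau>) ^ DIM('a)) * (\<integral>\<^sub>+x. ennreal ((norm (fourier gc x))\<^sup>2))"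
    using nn_integral_lborel_scale[of "\<lambda>x. ennreal ((norm (fourier gc x))\<^sup>2)" "1 / (2 * \<tau>)"] \<tau> by simp
  also have "(\<integral>\<^sub>+x. ennreal ((norm (fourier gc x))\<^sup>2)) \<le> ennreal ((2 * pi) ^ DIM('a)) * (\<integral>\<^sub>+x. ennreal ((norm (gc x))\<^sup>2))"
    by (rule fourier_Bessel[OF gc])
  also have "(\<integral>\<^sub>+x. ennreal ((norm (gc x))\<^sup>2)) = (\<integral>\<^sub>+x. ennreal ((norm (g x))\<^sup>2))"
    by (simp add: gc_def norm_mult)
  also have "ennreal (k\<^sup>2) * (ennreal ((2 * \<tau>) ^ DIM('a)) * (ennreal ((2 * pi) ^ DIM('a)) * (\<integral>\<^sub>+x. ennreal ((norm (g x))\<^sup>2))))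
      = (\<integral>\<^sub>+x. ennreal ((norm (g x))\<^sup>2))"
  proof -
    have "k\<^sup>2 * ((2 * \<tau>) ^ DIM('a) * (2 * pi) ^ DIM('a)) = (1 / (4 * pi * \<tau>) * ((2 * \<tau>) * (2 * pi))) ^ DIM('a)"
      unfolding k2 power_mult_distrib ..
    also have "1 / (4 * pi * \<tau>) * ((2 * \<tau>) * (2 * pi)) = 1" using \<tau> by simp
    finally have "k\<^sup>2 * ((2 * \<tau>) ^ DIM('a) * (2 * pi) ^ DIM('a)) = 1" by simp
    then have "ennreal (k\<^sup>2) * (ennreal ((2 * \<tau>) ^ DIM('a)) * ennreal ((2 * pi) ^ DIM('a))) = 1"
      using \<tau> by (simp flip: ennreal_mult)
    moreover have "ennreal (k\<^sup>2) * (a * (b * I)) = (ennreal (k\<^sup>2) * (a * b)) * I" for a b I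
      by (simp only: mult.assoc)
    ultimately show ?thesis by simp
  qed
  finally show ?thesis by (simp add: mult_left_mono)
qed

subsection \<open>Schwartz functions\<close>

lemma iterated_partial_append:
  "iterated_partial (bs @ cs) \<phi> = iterated_partial bs (iterated_partial cs \<phi>)"
  by (induction bs) auto

lemma schwartz_iterated_partial:
  assumes "\<phi> \<in> schwartz_space" "cs \<in> lists Basis"
  shows "iterated_partial cs \<phi> \<in> schwartz_space"
  using assms unfolding schwartz_space_def by (auto simp flip: iterated_partial_append)

lemma schwartz_differentiable:
  assumes "\<phi> \<in> schwartz_space"
  shows "\<phi> differentiable (at x)"
proof -
  have "iterated_partial [] \<phi> differentiable_on UNIV"
    using assms unfolding schwartz_space_def by (auto simp del: iterated_partial.simps)
  then show ?thesis by (auto simp: differentiable_on_def)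
qed

lemma schwartz_borel:
  assumes "\<phi> \<in> schwartz_space"
  shows "\<phi> \<in> borel_measurable borel"
  using schwartz_differentiable[OF assms]
  by (intro borel_measurable_continuous_onI continuous_at_imp_continuous_on)
    (auto intro: differentiable_imp_continuous_within)

text \<open>The weight (1 + s)^N with s = |x|^2 is at most 2^N (1 + s^N), so two bounds, on \<phi>
  and on its product with |x|^(2 N), give a decay that is integrable.\<close>

lemma decay_of_bounds:
  fixes \<phi> :: "'a::euclidean_space \<Rightarrow> complex"
  assumes A: "norm (\<phi> x) \<le> A" and B: "norm x ^ (2 * DIM('a)) * norm (\<phi> x) \<le> B"
  shows "norm (\<phi> x) \<le> 2 ^ DIM('a) * (A + B) / (1 + (norm x)\<^sup>2) ^ DIM('a)"
proof -
  have "(1 + (norm x)\<^sup>2) ^ DIM('a) \<le> 2 ^ DIM('a) * (1 + ((norm x)\<^sup>2) ^ DIM('a))"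
  proof (cases "(norm x)\<^sup>2 \<le> 1")
    case True
    then have "(1 + (norm x)\<^sup>2) ^ DIM('a) \<le> 2 ^ DIM('a) * 1" by (simp add: power_mono)
    also have "\<dots> \<le> 2 ^ DIM('a) * (1 + ((norm x)\<^sup>2) ^ DIM('a))" by (intro mult_left_mono) auto
    finally show ?thesis .
  next
    case False
    then have "(1 + (norm x)\<^sup>2) ^ DIM('a) \<le> (2 * (norm x)\<^sup>2) ^ DIM('a)" by (intro power_mono) auto
    also have "\<dots> = 2 ^ DIM('a) * ((norm x)\<^sup>2) ^ DIM('a)" by (rule power_mult_distrib)
    also have "\<dots> \<le> 2 ^ DIM('a) * (1 + ((norm x)\<^sup>2) ^ DIM('a))" by (intro mult_left_mono) auto
    finally show ?thesis .
  qed
  then have "(1 + (norm x)\<^sup>2) ^ DIM('a) * norm (\<phi> x) \<le> 2 ^ DIM('a) * (1 + ((norm x)\<^sup>2) ^ DIM('a)) * norm (\<phi> x)"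
    by (rule mult_right_mono) simp
  also have "\<dots> = 2 ^ DIM('a) * (norm (\<phi> x) + norm x ^ (2 * DIM('a)) * norm (\<phi> x))"
    by (simp add: power_mult[symmetric] algebra_simps)
  also have "\<dots> \<le> 2 ^ DIM('a) * (A + B)" using A B by (intro mult_left_mono add_mono) auto
  finally show ?thesis
    by (simp add: pos_le_divide_eq zero_less_power add_pos_nonneg mult.commute)
qed

lemma schwartz_decay:
  fixes \<phi> :: "'a::euclidean_space \<Rightarrow> complex"
  assumes "\<phi> \<in> schwartz_space"
  obtains C where "0 \<le> C" "\<And>x. norm (\<phi> x) \<le> C / (1 + (norm x)\<^sup>2) ^ DIM('a)"
proof -
  have bdd: "bounded (range (\<lambda>x. norm x ^ k *\<^sub>R \<phi> x))" for k
  proof -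
    have "\<forall>k. bounded (range (\<lambda>x. norm x ^ k *\<^sub>R iterated_partial [] \<phi> x))"
      using assms unfolding schwartz_space_def by (auto simp del: iterated_partial.simps)
    then show ?thesis by simp
  qed
  obtain A where A: "\<And>x. norm (\<phi> x) \<le> A" using bdd[of 0] by (auto simp: bounded_iff)
  obtain B where B: "\<And>x. norm x ^ (2 * DIM('a)) * norm (\<phi> x) \<le> B"
    using bdd[of "2 * DIM('a)"] by (auto simp: bounded_iff)
  have A0: "0 \<le> A" using A[of 0] norm_ge_zero order_trans by blast
  have B0: "0 \<le> B" using B[of 0] by (simp add: power_0_left)
  have "0 \<le> 2 ^ DIM('a) * (A + B)" using A0 B0 by simp
  then show ?thesis by (rule that) (rule decay_of_bounds[OF A B])
qed

text \<open>Each coordinate of x is at most |x| in modulus, so the function lies below a product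
  over the coordinates of the integrable function 1 / (1 + s^2).\<close>

lemma integrable_inverse_power_norm:
  "integrable lborel (\<lambda>x::'a::euclidean_space. 1 / (1 + (norm x)\<^sup>2) ^ DIM('a))"
proof (rule Bochner_Integration.integrable_bound)
  have "set_integrable lborel (einterval (-\<infinity>) \<infinity>) (\<lambda>x::real. inverse (1 + x\<^sup>2))"
    by (rule integrable_inverse_1_plus_square)
  then have "integrable lborel (\<lambda>x::real. 1 / (1 + x\<^sup>2))"
    by (simp add: set_integrable_def inverse_eq_divide)
  then show "integrable lborel (\<lambda>x::'a. \<Prod>b\<in>Basis. 1 / (1 + (x \<bullet> b)\<^sup>2))"
    by (intro lborel_product_integral(1))
  have "norm (1 / (1 + (norm x)\<^sup>2) ^ DIM('a)) \<le> norm (\<Prod>b\<in>Basis. 1 / (1 + (x \<bullet> b)\<^sup>2))" for x :: 'a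
  proof -
    have "(\<Prod>b\<in>(Basis::'a set). 1 / (1 + (norm x)\<^sup>2)) \<le> (\<Prod>b\<in>Basis. 1 / (1 + (x \<bullet> b)\<^sup>2))"
    proof (intro prod_mono conjI)
      fix b :: 'a assume b: "b \<in> Basis"
      have "(x \<bullet> b)\<^sup>2 \<le> (norm x)\<^sup>2" using Basis_le_norm[OF b, of x] by (metis abs_le_square_iff abs_norm_cancel)
      then show "1 / (1 + (norm x)\<^sup>2) \<le> 1 / (1 + (x \<bullet> b)\<^sup>2)"
        by (intro divide_left_mono) (auto intro!: mult_pos_pos add_pos_nonneg)
    qed auto
    then show ?thesis
      by (simp add: power_one_over abs_of_nonneg prod_nonneg power_abs abs_prod)
  qed
  then show "AE x::'a in lborel. norm (1 / (1 + (norm x)\<^sup>2) ^ DIM('a)) \<le> norm (\<Prod>b\<in>Basis. 1 / (1 + (x \<bullet> b)\<^sup>2))"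
    by simp
qed measurable

lemma integrable_of_decay:
  fixes \<phi> :: "'a::euclidean_space \<Rightarrow> complex"
  assumes [measurable]: "\<phi> \<in> borel_measurable borel"
    and "\<And>x. norm (\<phi> x) \<le> C / (1 + (norm x)\<^sup>2) ^ DIM('a)"
  shows "integrable lborel \<phi>"
proof (rule Bochner_Integration.integrable_bound)
  show "integrable lborel (\<lambda>x::'a. C * (1 / (1 + (norm x)\<^sup>2) ^ DIM('a)))"
    by (intro integrable_mult_right integrable_inverse_power_norm)
  show "AE x in lborel. norm (\<phi> x) \<le> norm (C * (1 / (1 + (norm x)\<^sup>2) ^ DIM('a)))"
  proof (rule AE_I2)
    fix x :: 'a
    have "norm (\<phi> x) \<le> \<bar>C / (1 + (norm x)\<^sup>2) ^ DIM('a)\<bar>" by (rule order_trans[OF assms(2) abs_ge_self])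
    then show "norm (\<phi> x) \<le> norm (C * (1 / (1 + (norm x)\<^sup>2) ^ DIM('a)))" by simp
  qed
qed measurable

lemma schwartz_integrable: "\<phi> \<in> schwartz_space \<Longrightarrow> integrable lborel \<phi>"
  by (rule schwartz_decay) (auto intro: integrable_of_decay schwartz_borel)

lemma schwartz_square_integrable:
  fixes \<phi> :: "'a::euclidean_space \<Rightarrow> complex"
  assumes "\<phi> \<in> schwartz_space"
  shows "(\<integral>\<^sub>+x. ennreal ((norm (\<phi> x))\<^sup>2)) < top"
proof -
  have [measurable]: "\<phi> \<in> borel_measurable borel" by (rule schwartz_borel[OF assms])
  obtain C where C: "0 \<le> C" "\<And>x. norm (\<phi> x) \<le> C / (1 + (norm x)\<^sup>2) ^ DIM('a)"
    using schwartz_decay[OF assms] by blast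
  have le: "norm (\<phi> x) \<le> C" for x
  proof -
    have "C / (1 + (norm x)\<^sup>2) ^ DIM('a) \<le> C / 1"
      using C(1) by (intro divide_left_mono one_le_power) (auto intro!: mult_pos_pos zero_less_power add_pos_nonneg)
    then show ?thesis using C(2)[of x] by simp
  qed
  have "(\<integral>\<^sub>+x. ennreal ((norm (\<phi> x))\<^sup>2)) \<le> (\<integral>\<^sub>+x. ennreal C * enorm (\<phi> x))"
    using le C(1) by (intro nn_integral_mono) (auto simp: power2_eq_square simp flip: ennreal_mult intro!: ennreal_leI mult_right_mono)
  also have "\<dots> = ennreal C * (\<integral>\<^sub>+x. enorm (\<phi> x))" by (simp add: nn_integral_cmult)
  also have "\<dots> < top"
    using schwartz_integrable[OF assms] by (auto simp: integrable_iff_bounded ennreal_mult_less_top)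
  finally show ?thesis .
qed

lemma has_vector_derivative_quotient:
  assumes "(f has_vector_derivative D) (at 0)"
  shows "((\<lambda>t. (f t - f 0) /\<^sub>R t) \<longlongrightarrow> D) (at 0)"
proof -
  have "((\<lambda>t. norm (f t - f 0 - t *\<^sub>R D) / norm t) \<longlongrightarrow> 0) (at 0)"
    using assms unfolding has_vector_derivative_def has_derivative_iff_norm by simp
  moreover have "\<forall>\<^sub>F t in at 0. norm (f t - f 0 - t *\<^sub>R D) / norm t = norm ((f t - f 0) /\<^sub>R t - D)"
    unfolding eventually_at_filter
  proof (intro always_eventually allI impI)
    fix t :: real assume "t \<noteq> 0"
    then have "(f t - f 0) /\<^sub>R t - D = inverse t *\<^sub>R (f t - f 0 - t *\<^sub>R D)" by (simp add: scaleR_diff_right)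
    then show "norm (f t - f 0 - t *\<^sub>R D) / norm t = norm ((f t - f 0) /\<^sub>R t - D)"
      by (simp add: divide_inverse mult.commute)
  qed
  ultimately have "((\<lambda>t. norm ((f t - f 0) /\<^sub>R t - D)) \<longlongrightarrow> 0) (at 0)"
    by (rule Lim_transform_eventually)
  then show ?thesis by (rule LIM_zero_cancel[OF tendsto_norm_zero_cancel])
qed

text \<open>Difference quotients instead of integration by parts: a translation multiplies the
  transform by a phase, and dominated convergence takes the limit of the quotients under the
  integral.\<close>

lemma fourier_partial:
  fixes \<phi> :: "'a::euclidean_space \<Rightarrow> complex"
  assumes \<phi>: "\<phi> \<in> schwartz_space" and b: "b \<in> Basis"
  shows "fourier (iterated_partial [b] \<phi>) \<xi> = \<i> * of_real (\<xi> \<bullet> b) * fourier \<phi> \<xi>"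
proof -
  let ?D = "iterated_partial [b] \<phi>"
  have D: "?D \<in> schwartz_space" using \<phi> b by (intro schwartz_iterated_partial) auto
  have [measurable]: "\<phi> \<in> borel_measurable borel" "?D \<in> borel_measurable borel"
    using schwartz_borel \<phi> D by auto
  have norm_b: "norm b = 1" using b by simp
  obtain C where C: "0 \<le> C" "\<And>x. norm (?D x) \<le> C / (1 + (norm x)\<^sup>2) ^ DIM('a)"
    using schwartz_decay[OF D] by blast
  \<comment> \<open>The power of 3 compares the weights at x and at x + t b for t in [0, 1]; the
    outer 3 is a linearization error 2 M plus M for the derivative at x.\<close>
  define C' where "C' = 3 * (C * 3 ^ DIM('a))"
  have der: "((\<lambda>t. \<phi> (x + t *\<^sub>R b)) has_vector_derivative ?D (x + t *\<^sub>R b)) (at t)" for x t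
  proof -
    have "(\<phi> has_derivative frechet_derivative \<phi> (at (x + t *\<^sub>R b))) (at (x + t *\<^sub>R b))"
      using schwartz_differentiable[OF \<phi>] frechet_derivative_works by blast
    moreover have "((\<lambda>t. x + t *\<^sub>R b) has_derivative (\<lambda>h. h *\<^sub>R b)) (at t)"
      by (auto intro!: derivative_eq_intros)
    ultimately have "((\<lambda>t. \<phi> (x + t *\<^sub>R b)) has_derivative (\<lambda>h. frechet_derivative \<phi> (at (x + t *\<^sub>R b)) (h *\<^sub>R b))) (at t)"
      using has_derivative_compose[of "\<lambda>t. x + t *\<^sub>R b" "\<lambda>h. h *\<^sub>R b" t UNIV \<phi>] by simp
    moreover have "frechet_derivative \<phi> (at (x + t *\<^sub>R b)) (h *\<^sub>R b) = h *\<^sub>R ?D (x + t *\<^sub>R b)" for h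
      using linear_frechet_derivative[OF schwartz_differentiable[OF \<phi>]] by (simp add: linear_scale)
    ultimately show ?thesis by (simp add: has_vector_derivative_def)
  qed
  have Dle: "norm (?D (x + t *\<^sub>R b)) \<le> C * 3 ^ DIM('a) / (1 + (norm x)\<^sup>2) ^ DIM('a)" if "t \<in> {0..1}" for x t
  proof -
    have "norm x \<le> norm (x + t *\<^sub>R b) + 1"
      using norm_triangle_ineq4[of "x + t *\<^sub>R b" "t *\<^sub>R b"] that norm_b by auto
    then have "(norm x)\<^sup>2 \<le> (norm (x + t *\<^sub>R b) + 1)\<^sup>2" by (intro power_mono) auto
    also have "\<dots> \<le> 2 * (norm (x + t *\<^sub>R b))\<^sup>2 + 2"
      using sum_squares_bound[of "norm (x + t *\<^sub>R b)" 1] by (simp add: power2_sum)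
    finally have "(norm x)\<^sup>2 \<le> 2 * (norm (x + t *\<^sub>R b))\<^sup>2 + 2" .
    note le = this
    have "1 + (norm x)\<^sup>2 \<le> 3 * (1 + (norm (x + t *\<^sub>R b))\<^sup>2)"
    proof -
      define z where "z = (norm (x + t *\<^sub>R b))\<^sup>2"
      have "0 \<le> z" by (simp add: z_def)
      then show ?thesis using le unfolding z_def[symmetric] by simp
    qed
    then have "(1 + (norm x)\<^sup>2) ^ DIM('a) \<le> (3 * (1 + (norm (x + t *\<^sub>R b))\<^sup>2)) ^ DIM('a)"
      by (intro power_mono) auto
    then have le: "(1 + (norm x)\<^sup>2) ^ DIM('a) \<le> 3 ^ DIM('a) * (1 + (norm (x + t *\<^sub>R b))\<^sup>2) ^ DIM('a)"
      by (simp only: power_mult_distrib)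
    have pos: "0 < (1 + (norm y)\<^sup>2) ^ DIM('a)" for y :: 'a by (simp add: add_pos_nonneg)
    have "norm (?D (x + t *\<^sub>R b)) \<le> C / (1 + (norm (x + t *\<^sub>R b))\<^sup>2) ^ DIM('a)" by (rule C(2))
    also have "\<dots> \<le> C * 3 ^ DIM('a) / (1 + (norm x)\<^sup>2) ^ DIM('a)"
      using mult_left_mono[OF le C(1)] pos[of x] pos[of "x + t *\<^sub>R b"]
      by (simp add: divide_le_eq pos_le_divide_eq field_simps)
    finally show ?thesis .
  qed
  define h where "h n = 1 / real (Suc n)" for n
  have h: "0 < h n" "h n \<le> 1" for n by (auto simp: h_def)
  have hlim: "h \<longlonglongrightarrow> 0" unfolding h_def using LIMSEQ_inverse_real_of_nat by (simp add: inverse_eq_divide)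
  have hlim': "filterlim h (at 0) sequentially"
    using hlim h by (auto simp: filterlim_at intro!: always_eventually) (metis less_irrefl)
  let ?q = "\<lambda>n x. (\<phi> (x + h n *\<^sub>R b) - \<phi> x) /\<^sub>R h n"
  have lim1: "(\<lambda>n. \<integral>x. cis (- (x \<bullet> \<xi>)) * ?q n x \<partial>lborel) \<longlonglongrightarrow> (\<integral>x. cis (- (x \<bullet> \<xi>)) * ?D x \<partial>lborel)"
  proof (rule integral_dominated_convergence[where w="\<lambda>x. C' * (1 / (1 + (norm x)\<^sup>2) ^ DIM('a))"])
    show "AE x in lborel. (\<lambda>n. cis (- (x \<bullet> \<xi>)) * ?q n x) \<longlonglongrightarrow> cis (- (x \<bullet> \<xi>)) * ?D x"
    proof (intro AE_I2 tendsto_mult_left)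
      fix x :: 'a
      have "((\<lambda>t. (\<phi> (x + t *\<^sub>R b) - \<phi> x) /\<^sub>R t) \<longlongrightarrow> ?D x) (at 0)"
        using has_vector_derivative_quotient[OF der[of x 0]] by simp
      from filterlim_compose[OF this hlim'] show "(\<lambda>n. ?q n x) \<longlonglongrightarrow> ?D x" .
    qed
    show "AE x in lborel. norm (cis (- (x \<bullet> \<xi>)) * ?q n x) \<le> C' * (1 / (1 + (norm x)\<^sup>2) ^ DIM('a))" for n
    proof (rule AE_I2)
      fix x :: 'a
      define M where "M = C * 3 ^ DIM('a) / (1 + (norm x)\<^sup>2) ^ DIM('a)"
      have "norm (\<phi> (x + h n *\<^sub>R b) - \<phi> (x + 0 *\<^sub>R b) - (h n - 0) *\<^sub>R ?D (x + 0 *\<^sub>R b)) \<le> norm (h n - 0) * (2 * M)"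
      proof (rule vector_differentiable_bound_linearization[where S="{0..1}"])
        show "((\<lambda>t. \<phi> (x + t *\<^sub>R b)) has_vector_derivative ?D (x + t *\<^sub>R b)) (at t within {0..1})" for t
          by (rule has_vector_derivative_at_within[OF der])
        show "closed_segment 0 (h n) \<subseteq> {0..1}" using h[of n] by (auto simp: closed_segment_eq_real_ivl)
        show "norm (?D (x + t *\<^sub>R b) - ?D (x + 0 *\<^sub>R b)) \<le> 2 * M" if "t \<in> {0..1}" for t
          using Dle[OF that, of x] Dle[of 0 x] norm_triangle_ineq4[of "?D (x + t *\<^sub>R b)" "?D (x + 0 *\<^sub>R b)"]
          unfolding M_def[symmetric] by auto
      qed auto
      then have "norm (\<phi> (x + h n *\<^sub>R b) - \<phi> x) \<le> h n * (2 * M) + norm (h n *\<^sub>R ?D x)"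
        using norm_triangle_sub[of "\<phi> (x + h n *\<^sub>R b) - \<phi> x" "h n *\<^sub>R ?D x"] h[of n] by simp
      also have "\<dots> \<le> h n * (3 * M)"
        using Dle[of 0 x] h[of n] unfolding M_def[symmetric] by (simp add: algebra_simps mult_left_mono)
      finally have "norm (\<phi> (x + h n *\<^sub>R b) - \<phi> x) / h n \<le> 3 * M"
        using h[of n] by (simp add: divide_le_eq mult.commute)
      then show "norm (cis (- (x \<bullet> \<xi>)) * ?q n x) \<le> C' * (1 / (1 + (norm x)\<^sup>2) ^ DIM('a))"
        using h(1)[of n] by (simp add: norm_mult M_def C'_def divide_inverse ac_simps)
    qed
    show "integrable lborel (\<lambda>x::'a. C' * (1 / (1 + (norm x)\<^sup>2) ^ DIM('a)))"
      by (intro integrable_mult_right integrable_inverse_power_norm)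
  qed measurable
  have lim2: "(\<integral>x. cis (- (x \<bullet> \<xi>)) * ?q n x \<partial>lborel) = ((cis (h n * (\<xi> \<bullet> b)) - 1) /\<^sub>R h n) * fourier \<phi> \<xi>" for n
  proof -
    have int: "integrable lborel (\<lambda>x. cis (- (x \<bullet> \<xi>)) * \<phi> x)"
      by (rule Bochner_Integration.integrable_bound[OF schwartz_integrable[OF \<phi>]]) (auto simp: norm_mult)
    have eq: "cis (- (x \<bullet> \<xi>)) * \<phi> (x + h n *\<^sub>R b) = cis (h n * (\<xi> \<bullet> b)) * (cis (- ((h n *\<^sub>R b + x) \<bullet> \<xi>)) * \<phi> (h n *\<^sub>R b + x))" for x
      by (simp add: mult.assoc[symmetric] cis_mult inner_add_left inner_commute[of \<xi>] add.commute)
    have shift: "(\<integral>x. cis (- ((h n *\<^sub>R b + x) \<bullet> \<xi>)) * \<phi> (h n *\<^sub>R b + x) \<partial>lborel) = fourier \<phi> \<xi>"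
      unfolding fourier_borel[OF \<open>\<phi> \<in> borel_measurable borel\<close>]
      by (rule integral_lborel_plus[of "\<lambda>x. cis (- (x \<bullet> \<xi>)) * \<phi> x"]) measurable
    have int': "integrable lborel (\<lambda>x. cis (- (x \<bullet> \<xi>)) * \<phi> (x + h n *\<^sub>R b))"
    proof -
      have "integrable (distr lborel borel ((+) (h n *\<^sub>R b))) (\<lambda>x. cis (- (x \<bullet> \<xi>)) * \<phi> x)"
        unfolding lborel_distr_plus by (rule int)
      then have "integrable lborel (\<lambda>x. cis (- ((h n *\<^sub>R b + x) \<bullet> \<xi>)) * \<phi> (h n *\<^sub>R b + x))"
        by (subst (asm) integrable_distr_eq) auto
      then show ?thesis unfolding eq by (rule integrable_mult_right)
    qed
    have "(\<integral>x. cis (- (x \<bullet> \<xi>)) * ?q n x \<partial>lborel)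
        = (\<integral>x. (cis (- (x \<bullet> \<xi>)) * \<phi> (x + h n *\<^sub>R b) - cis (- (x \<bullet> \<xi>)) * \<phi> x) /\<^sub>R h n \<partial>lborel)"
      by (simp add: algebra_simps)
    also have "\<dots> = ((\<integral>x. cis (- (x \<bullet> \<xi>)) * \<phi> (x + h n *\<^sub>R b) \<partial>lborel) - (\<integral>x. cis (- (x \<bullet> \<xi>)) * \<phi> x \<partial>lborel)) /\<^sub>R h n"
      using int int' by simp
    also have "(\<integral>x. cis (- (x \<bullet> \<xi>)) * \<phi> (x + h n *\<^sub>R b) \<partial>lborel) = cis (h n * (\<xi> \<bullet> b)) * fourier \<phi> \<xi>"
      unfolding eq by (simp only: integral_mult_right_zero shift)
    also have "(\<integral>x. cis (- (x \<bullet> \<xi>)) * \<phi> x \<partial>lborel) = fourier \<phi> \<xi>"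
      by (simp add: fourier_borel)
    finally show ?thesis by (simp add: algebra_simps)
  qed
  have lim3: "(\<lambda>n. ((cis (h n * (\<xi> \<bullet> b)) - 1) /\<^sub>R h n) * fourier \<phi> \<xi>) \<longlonglongrightarrow> (\<i> * of_real (\<xi> \<bullet> b)) * fourier \<phi> \<xi>"
  proof (intro tendsto_mult_right)
    have "((\<lambda>z. exp (z * (\<i> * of_real (\<xi> \<bullet> b)))) has_field_derivative \<i> * of_real (\<xi> \<bullet> b)) (at (of_real 0))"
      by (auto intro!: derivative_eq_intros)
    from has_vector_derivative_real_field[OF this]
    have "((\<lambda>t. cis (t * (\<xi> \<bullet> b))) has_vector_derivative \<i> * of_real (\<xi> \<bullet> b)) (at 0)"
      by (simp add: cis_conv_exp ac_simps)
    then have "((\<lambda>t. (cis (t * (\<xi> \<bullet> b)) - 1) /\<^sub>R t) \<longlongrightarrow> \<i> * of_real (\<xi> \<bullet> b)) (at 0)"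
      using has_vector_derivative_quotient by force
    from filterlim_compose[OF this hlim'] show "(\<lambda>n. (cis (h n * (\<xi> \<bullet> b)) - 1) /\<^sub>R h n) \<longlonglongrightarrow> \<i> * of_real (\<xi> \<bullet> b)" .
  qed
  have "(\<integral>x. cis (- (x \<bullet> \<xi>)) * ?D x \<partial>lborel) = \<i> * of_real (\<xi> \<bullet> b) * fourier \<phi> \<xi>"
    by (rule LIMSEQ_unique[OF lim1[unfolded lim2] lim3])
  then show ?thesis by (simp add: fourier_borel del: iterated_partial.simps)
qed

text \<open>Coordinate powers times the transform are, up to phases, transforms of derivatives,
  hence bounded; and some coordinate always has modulus at least |\<xi>| / N. This gives decay of
  order 2 N in |\<xi>|.\<close>

lemma fourier_schwartz_integrable:
  fixes \<phi> :: "'a::euclidean_space \<Rightarrow> complex"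
  assumes \<phi>: "\<phi> \<in> schwartz_space"
  shows "integrable lborel (fourier \<phi>)"
proof -
  let ?N = "2 * DIM('a)"
  define I where "I cs = (\<integral>x. norm (iterated_partial cs \<phi> x) \<partial>lborel)" for cs
  have I0: "0 \<le> I cs" for cs by (simp add: I_def)
  have pow: "\<bar>\<xi> \<bullet> b\<bar> ^ k * norm (fourier \<phi> \<xi>) \<le> I (replicate k b)" if b: "b \<in> Basis" for \<xi> b k
  proof -
    have S: "iterated_partial (replicate k b) \<phi> \<in> schwartz_space" for k
      using b by (intro schwartz_iterated_partial \<phi>) auto
    have "fourier (iterated_partial (replicate k b) \<phi>) \<xi> = (\<i> * of_real (\<xi> \<bullet> b)) ^ k * fourier \<phi> \<xi>"
    proof (induction k)
      case (Suc k)
      then show ?case using fourier_partial[OF S b, of k \<xi>] by simp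
    qed simp
    then have "\<bar>\<xi> \<bullet> b\<bar> ^ k * norm (fourier \<phi> \<xi>) = norm (fourier (iterated_partial (replicate k b) \<phi>) \<xi>)"
      by (simp add: norm_mult norm_power)
    also have "\<dots> \<le> I (replicate k b)" unfolding I_def by (intro norm_fourier_le schwartz_integrable S)
    finally show ?thesis .
  qed
  define B where "B = real DIM('a) ^ ?N * (\<Sum>b\<in>(Basis::'a set). I (replicate ?N b))"
  have B: "norm \<xi> ^ ?N * norm (fourier \<phi> \<xi>) \<le> B" for \<xi>
  proof -
    have "\<exists>b\<in>Basis. norm \<xi> \<le> real DIM('a) * \<bar>\<xi> \<bullet> b\<bar>"
    proof (rule ccontr)
      assume "\<not> ?thesis"
      then have "(\<Sum>b\<in>(Basis::'a set). \<bar>\<xi> \<bullet> b\<bar>) < (\<Sum>b\<in>(Basis::'a set). norm \<xi> / real DIM('a))"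
        by (intro sum_strict_mono) (auto simp: field_simps not_le)
      then show False using norm_le_l1[of \<xi>] by simp
    qed
    then obtain b where b: "b \<in> Basis" "norm \<xi> \<le> real DIM('a) * \<bar>\<xi> \<bullet> b\<bar>" by blast
    have "norm \<xi> ^ ?N * norm (fourier \<phi> \<xi>) \<le> (real DIM('a) * \<bar>\<xi> \<bullet> b\<bar>) ^ ?N * norm (fourier \<phi> \<xi>)"
      using b(2) by (intro mult_right_mono power_mono) auto
    also have "\<dots> = real DIM('a) ^ ?N * (\<bar>\<xi> \<bullet> b\<bar> ^ ?N * norm (fourier \<phi> \<xi>))"
      unfolding power_mult_distrib by (simp only: mult.assoc)
    also have "\<dots> \<le> real DIM('a) ^ ?N * I (replicate ?N b)"
      by (intro mult_left_mono pow b) auto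
    also have "\<dots> \<le> B"
      unfolding B_def using b I0 by (intro mult_left_mono member_le_sum) auto
    finally show ?thesis .
  qed
  have A: "norm (fourier \<phi> \<xi>) \<le> I []" for \<xi>
    unfolding I_def using norm_fourier_le[OF schwartz_integrable[OF \<phi>]] by simp
  show ?thesis
  proof (rule integrable_of_decay)
    show "fourier \<phi> \<in> borel_measurable borel" using schwartz_borel[OF \<phi>] by measurable
    show "norm (fourier \<phi> \<xi>) \<le> 2 ^ DIM('a) * (I [] + B) / (1 + (norm \<xi>)\<^sup>2) ^ DIM('a)" for \<xi>
      by (rule decay_of_bounds[OF A B])
  qed
qed

subsection \<open>The Schroedinger group on Schwartz functions\<close>

lemma schroedinger_lborel:
  assumes "\<phi> \<in> schwartz_space"
  shows "schroedinger t \<phi> (x::'a::euclidean_space) = of_real (1 / (2 * pi) ^ DIM('a)) *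
    (\<integral>\<xi>. cis (x \<bullet> \<xi>) * (cis (- t * (norm \<xi>)\<^sup>2) * fourier \<phi> \<xi>) \<partial>lborel)"
proof -
  have [measurable]: "\<phi> \<in> borel_measurable borel" by (rule schwartz_borel[OF assms])
  show ?thesis unfolding schroedinger_def inverse_fourier_def
    by (subst integral_completion) auto
qed

lemma borel_measurable_schroedinger [measurable (raw)]:
  assumes "\<phi> \<in> schwartz_space" and [measurable]: "f \<in> borel_measurable M" "g \<in> borel_measurable M"
  shows "(\<lambda>z. schroedinger (f z) \<phi> (g z :: 'a::euclidean_space)) \<in> borel_measurable M"
proof -
  have [measurable]: "\<phi> \<in> borel_measurable borel" by (rule schwartz_borel[OF assms(1)])
  show ?thesis unfolding schroedinger_lborel[OF assms(1)] by measurable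
qed

text \<open>The bound is uniform in time because the multiplier has modulus 1 and the Fourier
  transform of \<phi> is integrable.\<close>

lemma schroedinger_bounded:
  fixes \<phi> :: "'a::euclidean_space \<Rightarrow> complex"
  assumes "\<phi> \<in> schwartz_space"
  obtains S where "0 \<le> S" "\<And>t x. norm (schroedinger t \<phi> x) \<le> S"
proof
  let ?S = "1 / (2 * pi) ^ DIM('a) * (\<integral>\<xi>. norm (fourier \<phi> \<xi>) \<partial>lborel)"
  show "0 \<le> ?S" by (auto intro!: mult_nonneg_nonneg)
  show "norm (schroedinger t \<phi> x) \<le> ?S" for t x
  proof -
    have "norm (\<integral>\<xi>. cis (x \<bullet> \<xi>) * (cis (- t * (norm \<xi>)\<^sup>2) * fourier \<phi> \<xi>) \<partial>lborel) \<le> (\<integral>\<xi>. norm (fourier \<phi> \<xi>) \<partial>lborel)"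
      using fourier_schwartz_integrable[OF assms]
      by (intro order_trans[OF integral_norm_bound]) (simp add: norm_mult)
    then show ?thesis
      unfolding schroedinger_lborel[OF assms] by (simp add: norm_mult norm_divide norm_power divide_right_mono)
  qed
qed

text \<open>Regularize the multiplier to \<open>exp (- (\<epsilon> + i t) \<bar>\<xi>\<bar>\<^sup>2)\<close> and let \<open>\<epsilon>\<close> tend to \<open>0\<close> on both sides.\<close>

lemma schroedinger_eq_schr_conv:
  fixes \<phi> :: "'a::euclidean_space \<Rightarrow> complex"
  assumes \<phi>: "\<phi> \<in> schwartz_space" and t: "0 < t"
  shows "schroedinger t \<phi> x = schr_conv t \<phi> x"
proof -
  have [measurable]: "\<phi> \<in> borel_measurable borel" by (rule schwartz_borel[OF \<phi>])
  have \<phi>_int: "integrable lborel \<phi>" by (rule schwartz_integrable[OF \<phi>])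
  have F_int: "integrable lborel (fourier \<phi>)" by (rule fourier_schwartz_integrable[OF \<phi>])
  define h where "h n = 1 / real (Suc n)" for n
  have h: "0 < h n" for n by (simp add: h_def)
  have hlim: "h \<longlonglongrightarrow> 0" unfolding h_def using LIMSEQ_inverse_real_of_nat by (simp add: inverse_eq_divide)
  define z where "z n = Complex (h n) t" for n
  define z0 where "z0 = Complex 0 t"
  have zlim: "z \<longlonglongrightarrow> z0" unfolding z_def z0_def using hlim by (intro tendsto_Complex) auto
  have z0: "z0 \<noteq> 0" "z0 \<notin> \<real>\<^sub>\<le>\<^sub>0" using t by (auto simp: z0_def complex_eq_iff complex_nonpos_Reals_iff)
  have znz: "z n \<noteq> 0" for n using t by (auto simp: z_def complex_eq_iff)
  have exp_z0: "exp (- z0 * of_real s) = cis (- t * s)" for s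
    by (simp add: z0_def cis_conv_exp Complex_eq mult.assoc)
  have exp_z0': "exp (- of_real s / (4 * z0)) = cis (s / (4 * t))" for s
  proof -
    have "- of_real s / (4 * z0) = \<i> * of_real (s / (4 * t))"
      using t by (simp add: z0_def complex_eq_iff Re_divide Im_divide power2_eq_square)
    then show ?thesis by (simp only: cis_conv_exp)
  qed
  define A where "A n = (\<integral>\<xi>. cis (x \<bullet> \<xi>) * (exp (- z n * of_real ((norm \<xi>)\<^sup>2)) * fourier \<phi> \<xi>) \<partial>lborel)" for n
  have "A \<longlonglongrightarrow> (\<integral>\<xi>. cis (x \<bullet> \<xi>) * (exp (- z0 * of_real ((norm \<xi>)\<^sup>2)) * fourier \<phi> \<xi>) \<partial>lborel)"
    unfolding A_def
  proof (rule integral_dominated_convergence[where w="\<lambda>\<xi>. norm (fourier \<phi> \<xi>)"])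
    show "AE \<xi> in lborel. norm (cis (x \<bullet> \<xi>) * (exp (- z n * of_real ((norm \<xi>)\<^sup>2)) * fourier \<phi> \<xi>)) \<le> norm (fourier \<phi> \<xi>)" for n
      using h[of n] by (intro AE_I2) (auto simp: norm_mult norm_exp_eq_Re z_def intro!: mult_left_le_one_le)
    show "AE \<xi> in lborel. (\<lambda>n. cis (x \<bullet> \<xi>) * (exp (- z n * of_real ((norm \<xi>)\<^sup>2)) * fourier \<phi> \<xi>)) \<longlonglongrightarrow> cis (x \<bullet> \<xi>) * (exp (- z0 * of_real ((norm \<xi>)\<^sup>2)) * fourier \<phi> \<xi>)"
      by (intro AE_I2 tendsto_intros zlim)
  qed (use F_int in auto)
  then have lim1: "A \<longlonglongrightarrow> (\<integral>\<xi>. cis (x \<bullet> \<xi>) * (cis (- t * (norm \<xi>)\<^sup>2) * fourier \<phi> \<xi>) \<partial>lborel)"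
    unfolding exp_z0 .
  have A_eq: "A n = (\<integral>y. (of_real (sqrt pi) / csqrt (z n)) ^ DIM('a) * exp (- of_real ((norm (x - y))\<^sup>2) / (4 * z n)) * \<phi> y \<partial>lborel)" for n
  proof -
    have int: "integrable (lborel \<Otimes>\<^sub>M lborel) (\<lambda>(\<xi>, y). exp (- z n * of_real ((norm \<xi>)\<^sup>2)) * cis ((x - y) \<bullet> \<xi>) * \<phi> y)"
    proof (rule lborel_pair.integrable_pair_product)
      show "integrable lborel (\<lambda>\<xi>::'a. norm (exp (- z n * of_real ((norm \<xi>)\<^sup>2)) * cis (0 \<bullet> \<xi>)))"
        unfolding z_def by (rule integrable_norm[OF gaussian_fourier(1)[OF h]])
      show "integrable lborel (\<lambda>y. norm (\<phi> y))" using \<phi>_int by simp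
    qed (auto simp: norm_mult)
    have "A n = (\<integral>\<xi>. (\<integral>y. exp (- z n * of_real ((norm \<xi>)\<^sup>2)) * cis ((x - y) \<bullet> \<xi>) * \<phi> y \<partial>lborel) \<partial>lborel)"
      unfolding A_def
    proof (intro Bochner_Integration.integral_cong refl)
      fix \<xi>
      have "exp (- z n * of_real ((norm \<xi>)\<^sup>2)) * cis ((x - y) \<bullet> \<xi>) * \<phi> y
          = cis (x \<bullet> \<xi>) * exp (- z n * of_real ((norm \<xi>)\<^sup>2)) * (cis (- (y \<bullet> \<xi>)) * \<phi> y)" for y
      proof -
        have "cis ((x - y) \<bullet> \<xi>) = cis (x \<bullet> \<xi>) * cis (- (y \<bullet> \<xi>))" by (simp add: cis_mult inner_diff_left)
        then show ?thesis by (simp only: ac_simps)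
      qed
      then show "cis (x \<bullet> \<xi>) * (exp (- z n * of_real ((norm \<xi>)\<^sup>2)) * fourier \<phi> \<xi>)
          = (\<integral>y. exp (- z n * of_real ((norm \<xi>)\<^sup>2)) * cis ((x - y) \<bullet> \<xi>) * \<phi> y \<partial>lborel)"
        unfolding fourier_borel[OF \<open>\<phi> \<in> borel_measurable borel\<close>]
        by (simp only: integral_mult_right_zero mult.assoc)
    qed
    also have "\<dots> = (\<integral>y. (\<integral>\<xi>. exp (- z n * of_real ((norm \<xi>)\<^sup>2)) * cis ((x - y) \<bullet> \<xi>) * \<phi> y \<partial>lborel) \<partial>lborel)"
      by (rule lborel_pair.Fubini_integral[OF int, symmetric])
    also have "\<dots> = (\<integral>y. (of_real (sqrt pi) / csqrt (z n)) ^ DIM('a) * exp (- of_real ((norm (x - y))\<^sup>2) / (4 * z n)) * \<phi> y \<partial>lborel)"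
      unfolding z_def by (simp only: integral_mult_left_zero gaussian_fourier(2)[OF h])
    finally show ?thesis .
  qed
  \<comment> \<open>The limit z0 is purely imaginary and nonzero, so it lies off the cut of
    \<open>csqrt\<close>.\<close>
  have csq: "(\<lambda>n. csqrt (z n)) \<longlonglongrightarrow> csqrt z0"
    using isCont_tendsto_compose[OF _ zlim] continuous_at_csqrt[OF z0(2)] by blast
  have "A \<longlonglongrightarrow> (\<integral>y. (of_real (sqrt pi) / csqrt z0) ^ DIM('a) * exp (- of_real ((norm (x - y))\<^sup>2) / (4 * z0)) * \<phi> y \<partial>lborel)"
    unfolding A_eq[abs_def]
  proof (rule integral_dominated_convergence[where w="\<lambda>y. (sqrt pi / sqrt t) ^ DIM('a) * norm (\<phi> y)"])
    show "AE y in lborel. norm ((of_real (sqrt pi) / csqrt (z n)) ^ DIM('a) * exp (- of_real ((norm (x - y))\<^sup>2) / (4 * z n)) * \<phi> y)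
        \<le> (sqrt pi / sqrt t) ^ DIM('a) * norm (\<phi> y)" for n
    proof (rule AE_I2)
      fix y
      \<comment> \<open>A majorant uniform in n: |z n| is at least t, which bounds the root from
        below, and 1 / z n has nonnegative real part, which makes the exponential at most 1.\<close>
      have "t \<le> norm (z n)" using t abs_Im_le_cmod[of "z n"] by (simp add: z_def)
      then have "sqrt t \<le> sqrt (norm (z n))" by simp
      then have "sqrt pi / sqrt (norm (z n)) \<le> sqrt pi / sqrt t"
        using t by (intro divide_left_mono) (auto intro!: mult_pos_pos simp: znz)
      then have 1: "norm ((of_real (sqrt pi) / csqrt (z n)) ^ DIM('a)) \<le> (sqrt pi / sqrt t) ^ DIM('a)"
        by (simp only: norm_power norm_divide norm_of_real norm_csqrt abs_of_nonneg[OF real_sqrt_ge_zero[OF pi_ge_zero]])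
          (auto intro!: power_mono)
      have "Re (- of_real s / (4 * z n)) = - (s * (4 * h n)) / ((4 * h n)\<^sup>2 + (4 * t)\<^sup>2)" for s
        by (simp add: z_def Re_divide)
      moreover have "- (s * (4 * h n)) / ((4 * h n)\<^sup>2 + (4 * t)\<^sup>2) \<le> 0" if "0 \<le> s" for s
        using that h[of n] by (intro divide_nonpos_nonneg) auto
      ultimately have "Re (- of_real ((norm (x - y))\<^sup>2) / (4 * z n)) \<le> 0" by (metis zero_le_power2)
      then have 2: "norm (exp (- of_real ((norm (x - y))\<^sup>2) / (4 * z n))) \<le> 1"
        by (simp only: norm_exp_eq_Re exp_le_one_iff)
      have "norm ((of_real (sqrt pi) / csqrt (z n)) ^ DIM('a)) * norm (exp (- of_real ((norm (x - y))\<^sup>2) / (4 * z n))) \<le> (sqrt pi / sqrt t) ^ DIM('a) * 1"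
        using t by (intro mult_mono 1 2) auto
      then show "norm ((of_real (sqrt pi) / csqrt (z n)) ^ DIM('a) * exp (- of_real ((norm (x - y))\<^sup>2) / (4 * z n)) * \<phi> y)
        \<le> (sqrt pi / sqrt t) ^ DIM('a) * norm (\<phi> y)"
        unfolding norm_mult by (intro mult_right_mono) auto
    qed
    show "AE y in lborel. (\<lambda>n. (of_real (sqrt pi) / csqrt (z n)) ^ DIM('a) * exp (- of_real ((norm (x - y))\<^sup>2) / (4 * z n)) * \<phi> y)
       \<longlonglongrightarrow> (of_real (sqrt pi) / csqrt z0) ^ DIM('a) * exp (- of_real ((norm (x - y))\<^sup>2) / (4 * z0)) * \<phi> y"
      using z0 by (intro AE_I2 tendsto_intros zlim csq) auto
  qed (use \<phi>_int in auto)
  then have "(\<integral>\<xi>. cis (x \<bullet> \<xi>) * (cis (- t * (norm \<xi>)\<^sup>2) * fourier \<phi> \<xi>) \<partial>lborel)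
      = (\<integral>y. (of_real (sqrt pi) / csqrt z0) ^ DIM('a) * exp (- of_real ((norm (x - y))\<^sup>2) / (4 * z0)) * \<phi> y \<partial>lborel)"
    by (rule LIMSEQ_unique[OF lim1])
  then have "schroedinger t \<phi> x = of_real (1 / (2 * pi) ^ DIM('a)) *
      (\<integral>y. (of_real (sqrt pi) / csqrt z0) ^ DIM('a) * exp (- of_real ((norm (x - y))\<^sup>2) / (4 * z0)) * \<phi> y \<partial>lborel)"
    by (simp only: schroedinger_lborel[OF \<phi>])
  also have "\<dots> = (\<integral>y. of_real (1 / (2 * pi) ^ DIM('a)) * ((of_real (sqrt pi) / csqrt z0) ^ DIM('a) * exp (- of_real ((norm (x - y))\<^sup>2) / (4 * z0)) * \<phi> y) \<partial>lborel)"
    by (rule integral_mult_right_zero[symmetric])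
  also have "\<dots> = schr_conv t \<phi> x"
    unfolding schr_conv_def schr_kernel_def exp_z0' z0_def[symmetric]
    by (intro Bochner_Integration.integral_cong refl) (simp add: power_divide power_mult_distrib)
  finally show ?thesis .
qed

subsection \<open>The space \<open>L\<^sup>2\<close>\<close>

abbreviation L2norm :: "'a measure \<Rightarrow> ('a \<Rightarrow> ennreal) \<Rightarrow> ennreal" where
  "L2norm M \<equiv> Lebesgue_norm M 2"

lemma one_le_ennreal_2: "1 \<le> (2::ennreal)"
  by simp

lemma ennreal_powr_2: "ennreal_powr x 2 = x * x"
  using ennreal_powr_add[of x 1 1] by simp

lemma L2norm_eq: "L2norm M f = ennreal_powr (\<integral>\<^sup>+x. f x * f x \<partial>M) (1 / 2)"
  using Lebesgue_norm_ennreal[of 2 M f] by (simp add: ennreal_powr_2)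

lemma L2norm_square: "L2norm M f * L2norm M f = (\<integral>\<^sup>+x. f x * f x \<partial>M)"
  unfolding L2norm_eq ennreal_powr_2[symmetric] by (simp add: ennreal_powr_powr)

lemma ennreal_norm_square: "ennreal ((norm x)\<^sup>2) = enorm x * enorm x"
  by (simp add: power2_eq_square ennreal_mult)

lemma Hoelder_L2:
  assumes [measurable]: "f \<in> borel_measurable M" "g \<in> borel_measurable M"
  shows "(\<integral>\<^sup>+x. f x * g x \<partial>M) \<le> L2norm M f * L2norm M g"
proof -
  have sq: "x\<^sup>2 = ennreal_powr x 2" for x by (simp add: ennreal_powr_2 power2_eq_square)
  have "(\<integral>\<^sup>+x. f x * g x \<partial>M)\<^sup>2 \<le> (\<integral>\<^sup>+x. (f x)\<^sup>2 \<partial>M) * (\<integral>\<^sup>+x. (g x)\<^sup>2 \<partial>M)"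
    by (rule Cauchy_Schwarz_nn_integral) auto
  then have "ennreal_powr (ennreal_powr (\<integral>\<^sup>+x. f x * g x \<partial>M) 2) (1 / 2)
      \<le> ennreal_powr ((\<integral>\<^sup>+x. (f x)\<^sup>2 \<partial>M) * (\<integral>\<^sup>+x. (g x)\<^sup>2 \<partial>M)) (1 / 2)"
    unfolding sq by (intro ennreal_powr_mono) auto
  then show ?thesis by (simp add: ennreal_powr_powr ennreal_powr_mult L2norm_eq power2_eq_square)
qed

text \<open>Countable subadditivity is Minkowski's integral inequality for the counting measure on
  the naturals.\<close>

lemma Lebesgue_norm_suminf:
  assumes M: "sigma_finite_measure M" and q: "1 \<le> q" and [measurable]: "\<And>n. g n \<in> borel_measurable M"
  shows "Lebesgue_norm M q (\<lambda>x. \<Sum>n. g n x) \<le> (\<Sum>n. Lebesgue_norm M q (g n))"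
proof -
  have "Lebesgue_norm M q (\<lambda>x. \<integral>\<^sup>+n. g n x \<partial>count_space UNIV)
      \<le> (\<integral>\<^sup>+n. Lebesgue_norm M q (g n) \<partial>count_space UNIV)"
  proof (intro Minkowski_nn_integral[OF M _ q] sigma_finite_measure_count_space_countable)
    show "case_prod g \<in> borel_measurable (count_space UNIV \<Otimes>\<^sub>M M)"
      by (rule measurable_pair_measure_countable1) auto
  qed auto
  then show ?thesis by (simp add: nn_integral_count_space_nat)
qed

lemma Lebesgue_norm_less_top_AE:
  assumes [measurable]: "g \<in> borel_measurable M" and q: "1 \<le> q" and fin: "Lebesgue_norm M q g < top"
  shows "AE x in M. g x < top"
  using q
proof (cases rule: exponent_cases)
  case top
  then show ?thesis using esssup_AE[of g M] fin by (auto simp: Lebesgue_norm_top elim!: eventually_mono)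
next
  case (real Q)
  then have "(\<integral>\<^sup>+x. ennreal_powr (g x) Q \<partial>M) \<noteq> top" using fin by (simp add: Lebesgue_norm_ennreal)
  then have "AE x in M. ennreal_powr (g x) Q \<noteq> top" using nn_integral_PInf_AE[of "\<lambda>x. ennreal_powr (g x) Q" M] by simp
  then show ?thesis by (auto simp: less_top elim!: eventually_mono)
qed

text \<open>Riesz-Fischer with a rate: the limit is found along a rapidly converging subsequence,
  and Fatou's lemma gives the distance d n for every index n, so the whole sequence
  converges.\<close>

lemma L2_complete:
  fixes f :: "nat \<Rightarrow> 'a \<Rightarrow> complex"
  assumes M: "sigma_finite_measure M" and [measurable]: "\<And>n. f n \<in> borel_measurable M"
    and d: "d \<longlonglongrightarrow> 0" and Cauchy: "\<And>n m. n \<le> m \<Longrightarrow> L2norm M (\<lambda>x. enorm (f m x - f n x)) \<le> d n"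
  obtains v where "v \<in> borel_measurable M" "\<And>n. L2norm M (\<lambda>x. enorm (f n x - v x)) \<le> d n"
proof -
  have "\<exists>r. \<forall>k. d (r k) \<le> ennreal ((1/2) ^ k) \<and> r k < r (Suc k)"
  proof (rule dependent_nat_choice)
    have ev: "\<forall>\<^sub>F n in sequentially. d n < ennreal ((1/2) ^ k)" for k
      using d by (rule order_tendstoD) simp
    show "\<exists>x. d x \<le> ennreal ((1 / 2) ^ 0)"
      using eventually_happens[OF ev[of 0]] by (auto intro: less_imp_le)
    show "\<exists>y. d y \<le> ennreal ((1 / 2) ^ Suc n) \<and> x < y" for x n
      using eventually_happens[OF eventually_conj[OF ev[of "Suc n"] eventually_gt_at_top[of x]]]
      by (auto intro: less_imp_le)
  qed
  then obtain r where r: "\<And>k. d (r k) \<le> ennreal ((1/2) ^ k)" "\<And>k. r k < r (Suc k)" by blast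
  have mono: "strict_mono r" using r(2) by (simp add: strict_mono_Suc_iff)
  define g where "g k x = enorm (f (r (Suc k)) x - f (r k) x)" for k x
  have [measurable]: "g k \<in> borel_measurable M" for k unfolding g_def by measurable
  have "L2norm M (\<lambda>x. \<Sum>k. g k x) \<le> (\<Sum>k. L2norm M (g k))"
    by (rule Lebesgue_norm_suminf[OF M one_le_ennreal_2]) measurable
  also have "\<dots> \<le> (\<Sum>k. ennreal ((1/2) ^ k))"
    unfolding g_def using r(2)
    by (intro suminf_le summableI order_trans[OF Cauchy r(1)]) (auto intro: less_imp_le)
  also have "\<dots> = ennreal (\<Sum>k. (1/2) ^ k)" by (intro suminf_ennreal2 summable_geometric) auto
  also have "\<dots> < top" by simp
  finally have "AE x in M. (\<Sum>k. g k x) < top"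
    by (intro Lebesgue_norm_less_top_AE[OF _ one_le_ennreal_2]) auto
  then have conv: "AE x in M. convergent (\<lambda>k. f (r k) x)"
  proof eventually_elim
    case (elim x)
    have "summable (\<lambda>k. norm (f (r (Suc k)) x - f (r k) x))"
      using elim unfolding g_def by (intro summable_suminf_not_top) auto
    then have "summable (\<lambda>k. f (r (Suc k)) x - f (r k) x)" by (rule summable_norm_cancel)
    then obtain l where "(\<lambda>n. \<Sum>k<n. f (r (Suc k)) x - f (r k) x) \<longlonglongrightarrow> l"
      using summable_LIMSEQ by blast
    then have "(\<lambda>n. f (r n) x - f (r 0) x) \<longlonglongrightarrow> l"
      using sum_lessThan_telescope[of "\<lambda>k. f (r k) x"] by simp
    from tendsto_add[OF this tendsto_const[of "f (r 0) x"]] show ?case by (auto simp: convergent_def)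
  qed
  define v where "v x = lim (\<lambda>k. f (r k) x)" for x
  have [measurable]: "v \<in> borel_measurable M" unfolding v_def by measurable
  show ?thesis
  proof
    fix n
    have "(\<integral>\<^sup>+x. enorm (f n x - v x) * enorm (f n x - v x) \<partial>M)
        \<le> (\<integral>\<^sup>+x. liminf (\<lambda>k. enorm (f n x - f (r k) x) * enorm (f n x - f (r k) x)) \<partial>M)"
    proof (rule nn_integral_mono_AE, use conv in eventually_elim)
      case (elim x)
      then have "(\<lambda>k. f (r k) x) \<longlonglongrightarrow> v x" unfolding v_def by (rule convergent_LIMSEQ_iff[THEN iffD1])
      then have "(\<lambda>k. ennreal (norm (f n x - f (r k) x) * norm (f n x - f (r k) x))) \<longlonglongrightarrow> ennreal (norm (f n x - v x) * norm (f n x - v x))"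
        by (intro tendsto_ennrealI tendsto_intros)
      from lim_imp_Liminf[OF _ this] show ?case by (simp add: ennreal_mult)
    qed
    also have "\<dots> \<le> liminf (\<lambda>k. \<integral>\<^sup>+x. enorm (f n x - f (r k) x) * enorm (f n x - f (r k) x) \<partial>M)"
      by (rule nn_integral_liminf) measurable
    also have "\<dots> \<le> d n * d n"
    proof (rule Liminf_le)
      show "\<forall>\<^sub>F k in sequentially. (\<integral>\<^sup>+x. enorm (f n x - f (r k) x) * enorm (f n x - f (r k) x) \<partial>M) \<le> d n * d n"
        using eventually_ge_at_top[of n]
      proof eventually_elim
        case (elim k)
        have "n \<le> r k" using elim seq_suble[OF mono, of k] by simp
        then show ?case
          unfolding L2norm_square[symmetric] using Cauchy[of n "r k"]
          by (intro mult_mono) (auto simp: norm_minus_commute)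
      qed
    qed simp
    finally have "ennreal_powr (\<integral>\<^sup>+x. enorm (f n x - v x) * enorm (f n x - v x) \<partial>M) (1/2)
        \<le> ennreal_powr (ennreal_powr (d n) 2) (1 / 2)"
      unfolding ennreal_powr_2 by (intro ennreal_powr_mono) auto
    then show "L2norm M (\<lambda>x. enorm (f n x - v x)) \<le> d n" by (simp add: L2norm_eq ennreal_powr_powr)
  qed measurable
qed

subsection \<open>Time integrals of the Schroedinger group\<close>

text \<open>
  \<open>schr_int H\<close> is \<open>\<integral> e\<^sup>i\<^sup>\<tau>\<^sup>\<Delta> H(\<tau>) d\<tau>\<close> whenever the space-time integral against the kernel converges
  absolutely. \<open>schr_limit H v\<close> extends this to sums of such an \<open>H\<close> and a function in \<open>L\<^sup>1\<^sub>\<tau> L\<^sup>2\<^sub>y\<close>.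
\<close>

definition schr_int :: "(real \<Rightarrow> 'a::euclidean_space \<Rightarrow> complex) \<Rightarrow> 'a \<Rightarrow> complex" where
  "schr_int H x = (\<integral>z. schr_kernel (fst z) (x - snd z) * H (fst z) (snd z) \<partial>lborel)"

text \<open>For \<open>forward H\<close> this is the absolute space-time integral of the kernel
  against H. It does not depend on the point x, because the modulus of the kernel depends on time
  alone, and so it bounds \<open>schr_int H\<close> uniformly.\<close>

definition kernel_norm :: "(real \<Rightarrow> 'a::euclidean_space \<Rightarrow> complex) \<Rightarrow> ennreal" where
  "kernel_norm H = (\<integral>\<^sub>+\<tau>. ennreal ((4 * pi * \<tau>) powr (- DIM('a) / 2)) * (\<integral>\<^sub>+y. enorm (H \<tau> y)))"

definition energy_norm :: "(real \<Rightarrow> 'a::euclidean_space \<Rightarrow> complex) \<Rightarrow> ennreal" where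
  "energy_norm H = (\<integral>\<^sub>+\<tau>. L2norm lborel (\<lambda>y. enorm (H \<tau> y)))"

text \<open>Support in positive times, where the kernel represents the group; integrals over all
  real \<tau> are then integrals over the half-line.\<close>

definition forward :: "(real \<Rightarrow> 'a::euclidean_space \<Rightarrow> complex) \<Rightarrow> bool" where
  "forward H \<longleftrightarrow> jointly_borel H \<and> (\<forall>\<tau>\<le>0. \<forall>y. H \<tau> y = 0)"

text \<open>Small times carry the singularity of the kernel, and restriction to a ball turns L^2
  into L^1. The truncation refers to H alone, so limits along it do not depend on how H is
  decomposed.\<close>

definition cut :: "nat \<Rightarrow> (real \<Rightarrow> 'a::euclidean_space \<Rightarrow> complex) \<Rightarrow> real \<Rightarrow> 'a \<Rightarrow> complex" where
  "cut n H \<tau> y = (if 1 / real (Suc n) \<le> \<tau> \<and> norm y \<le> real n then H \<tau> y else 0)"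

definition schr_limit :: "(real \<Rightarrow> 'a::euclidean_space \<Rightarrow> complex) \<Rightarrow> ('a \<Rightarrow> complex) \<Rightarrow> bool" where
  "schr_limit H v \<longleftrightarrow> forward H \<and> (\<forall>n. kernel_norm (cut n H) < top) \<and> v \<in> borel_measurable borel \<and>
     (\<forall>k::nat. (\<lambda>n. \<integral>\<^sub>+x. enorm (schr_int (cut n H) x - v x) * indicator (cball 0 k) x) \<longlonglongrightarrow> 0)"

lemma sets_cball_borel [measurable]: "cball (x::'a::euclidean_space) r \<in> sets borel"
  by simp

lemma forward_measurable: "forward H \<Longrightarrow> jointly_borel H"
  by (simp add: forward_def)

lemma forward_measurable':
  assumes "forward H" and [measurable]: "f \<in> borel_measurable M" "g \<in> borel_measurable M"
  shows "(\<lambda>z. H (f z) (g z)) \<in> borel_measurable M"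
proof -
  have "(\<lambda>z. case_prod H (f z, g z)) \<in> borel_measurable M"
    by (rule measurable_compose[OF _ forward_measurable[OF assms(1)]]) measurable
  then show ?thesis by simp
qed

lemma forward_zero: "forward H \<Longrightarrow> \<tau> \<le> 0 \<Longrightarrow> H \<tau> y = 0"
  by (simp add: forward_def)

lemma forwardI:
  assumes "(\<lambda>z. H (fst z) (snd z)) \<in> borel_measurable (borel \<Otimes>\<^sub>M borel)" "\<And>\<tau> y. \<tau> \<le> 0 \<Longrightarrow> H \<tau> y = 0"
  shows "forward H"
  using assms by (auto simp: forward_def case_prod_beta')

lemma forward_add: "forward H \<Longrightarrow> forward G \<Longrightarrow> forward (\<lambda>\<tau> y. H \<tau> y + G \<tau> y)"
proof (rule forwardI)
  assume H: "forward H" and G: "forward G"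
  note [measurable] = forward_measurable[OF H] forward_measurable[OF G]
  show "(\<lambda>z. H (fst z) (snd z) + G (fst z) (snd z)) \<in> borel_measurable (borel \<Otimes>\<^sub>M borel)" by measurable
  show "H \<tau> y + G \<tau> y = 0" if "\<tau> \<le> 0" for \<tau> y using that by (simp add: forward_zero[OF H] forward_zero[OF G])
qed

lemma forward_diff: "forward H \<Longrightarrow> forward G \<Longrightarrow> forward (\<lambda>\<tau> y. H \<tau> y - G \<tau> y)"
proof (rule forwardI)
  assume H: "forward H" and G: "forward G"
  note [measurable] = forward_measurable[OF H] forward_measurable[OF G]
  show "(\<lambda>z. H (fst z) (snd z) - G (fst z) (snd z)) \<in> borel_measurable (borel \<Otimes>\<^sub>M borel)" by measurable
  show "H \<tau> y - G \<tau> y = 0" if "\<tau> \<le> 0" for \<tau> y using that by (simp add: forward_zero[OF H] forward_zero[OF G])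
qed

lemma forward_cut: "forward H \<Longrightarrow> forward (cut n H)"
proof (rule forwardI)
  assume H: "forward H"
  show "(\<lambda>z. cut n H (fst z) (snd z)) \<in> borel_measurable (borel \<Otimes>\<^sub>M borel)"
    using forward_measurable[OF H, measurable] unfolding cut_def by measurable
qed (auto simp: cut_def forward_zero)

lemma cut_add: "cut n (\<lambda>\<tau> y. H \<tau> y + G \<tau> y) = (\<lambda>\<tau> y. cut n H \<tau> y + cut n G \<tau> y)"
  by (auto simp: cut_def fun_eq_iff)

lemma cut_diff: "cut n (\<lambda>\<tau> y. H \<tau> y - G \<tau> y) = (\<lambda>\<tau> y. cut n H \<tau> y - cut n G \<tau> y)"
  by (auto simp: cut_def fun_eq_iff)

lemma norm_cut_le: "norm (cut n H \<tau> y) \<le> norm (H \<tau> y)"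
  by (simp add: cut_def)

lemma cut_tendsto:
  assumes "forward H"
  shows "\<forall>\<^sub>F n in sequentially. cut n H \<tau> y = H \<tau> y"
proof (cases "\<tau> \<le> 0")
  case True then show ?thesis using forward_zero[OF assms] by (simp add: cut_def)
next
  case False
  obtain k where k: "norm y \<le> real k" using real_arch_simple by blast
  obtain m where m: "1 / real (Suc m) < \<tau>" using reals_Archimedean[of \<tau>] False by (auto simp: inverse_eq_divide)
  show ?thesis using eventually_ge_at_top[of "max k m"]
  proof eventually_elim
    case (elim n)
    have "1 / real (Suc n) \<le> 1 / real (Suc m)" using elim by (intro divide_left_mono) auto
    then show ?case using elim k m by (simp add: cut_def)
  qed
qed

lemma kernel_norm_mono:
  "(\<And>\<tau> y. norm (H \<tau> y) \<le> norm (G \<tau> y)) \<Longrightarrow> kernel_norm H \<le> kernel_norm G"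
  unfolding kernel_norm_def by (intro nn_integral_mono mult_left_mono ennreal_leI) auto

lemma energy_norm_mono:
  assumes H: "forward H" and le: "\<And>\<tau> y. norm (H \<tau> y) \<le> norm (G \<tau> y)"
  shows "energy_norm H \<le> energy_norm G"
proof -
  have [measurable]: "jointly_borel H" by (rule forward_measurable[OF H])
  show ?thesis
    unfolding energy_norm_def
    by (intro nn_integral_mono Lebesgue_norm_mono[OF _ _ one_le_ennreal_2] ennreal_leI le) measurable
qed

lemma nn_integral_kernel_eq:
  fixes H :: "real \<Rightarrow> 'a::euclidean_space \<Rightarrow> complex"
  assumes H: "forward H"
  shows "(\<integral>\<^sub>+z. enorm (schr_kernel (fst z) (x - snd z) * H (fst z) (snd z))) = kernel_norm H"
proof -
  have [measurable]: "jointly_borel H" by (rule forward_measurable[OF H])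
  have "(\<integral>\<^sub>+z. enorm (schr_kernel (fst z) (x - snd z) * H (fst z) (snd z)))
      = (\<integral>\<^sub>+\<tau>. \<integral>\<^sub>+y. enorm (schr_kernel \<tau> (x - y) * H \<tau> y))"
    unfolding lborel_prod[symmetric] by (subst lborel.nn_integral_fst[symmetric]) auto
  also have "\<dots> = kernel_norm H"
    unfolding kernel_norm_def
  proof (intro nn_integral_cong)
    fix \<tau>
    show "(\<integral>\<^sub>+y. enorm (schr_kernel \<tau> (x - y) * H \<tau> y))
        = ennreal ((4 * pi * \<tau>) powr (- DIM('a) / 2)) * (\<integral>\<^sub>+y. enorm (H \<tau> y))"
    proof (cases "0 < \<tau>")
      case True
      then show ?thesis
        by (subst nn_integral_cmult[symmetric]) (auto simp: norm_mult norm_schr_kernel ennreal_mult)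
    qed (simp add: forward_zero[OF H])
  qed
  finally show ?thesis .
qed

lemma schr_int_integrable:
  assumes H: "forward H" and fin: "kernel_norm H < top"
  shows "integrable lborel (\<lambda>z. schr_kernel (fst z) (x - snd z) * H (fst z) (snd z))"
proof (rule integrableI_bounded)
  have [measurable]: "jointly_borel H" by (rule forward_measurable[OF H])
  show "(\<lambda>z. schr_kernel (fst z) (x - snd z) * H (fst z) (snd z)) \<in> borel_measurable lborel"
    unfolding lborel_prod[symmetric] by measurable
qed (use nn_integral_kernel_eq[OF H, of x] fin in simp)

lemma norm_schr_int_le: "forward H \<Longrightarrow> enorm (schr_int H x) \<le> kernel_norm H"
  unfolding schr_int_def by (rule order_trans[OF ennreal_norm_integral_le]) (simp add: nn_integral_kernel_eq)

lemma borel_measurable_schr_int: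
  assumes H: "forward H" and [measurable]: "f \<in> borel_measurable M"
  shows "(\<lambda>x. schr_int H (f x)) \<in> borel_measurable M"
proof -
  have [measurable]: "jointly_borel H" by (rule forward_measurable[OF H])
  have "schr_int H \<in> borel_measurable borel"
    unfolding schr_int_def lborel_prod[symmetric] by measurable
  then show ?thesis by (rule measurable_compose[OF assms(2)])
qed

lemma schr_int_diff:
  assumes "forward H" "kernel_norm H < top" "forward G" "kernel_norm G < top"
  shows "schr_int (\<lambda>\<tau> y. H \<tau> y - G \<tau> y) x = schr_int H x - schr_int G x"
  unfolding schr_int_def
  using schr_int_integrable[of H x] schr_int_integrable[of G x] assms
  by (simp add: right_diff_distrib)

lemma schr_int_add:
  assumes "forward H" "kernel_norm H < top" "forward G" "kernel_norm G < top"
  shows "schr_int (\<lambda>\<tau> y. H \<tau> y + G \<tau> y) x = schr_int H x + schr_int G x"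
  unfolding schr_int_def
  using schr_int_integrable[of H x] schr_int_integrable[of G x] assms
  by (simp add: distrib_left)

lemma forward_section:
  assumes H: "forward H"
  shows "H \<tau> \<in> borel_measurable borel"
  using forward_measurable'[OF H, of "\<lambda>_. \<tau>" borel "\<lambda>y. y"] by simp

lemma AE_integrable_section:
  fixes H :: "real \<Rightarrow> 'a::euclidean_space \<Rightarrow> complex"
  assumes H: "forward H" and fin: "kernel_norm H < top"
  shows "AE \<tau> in lborel. integrable lborel (H \<tau>)"
proof -
  have [measurable]: "jointly_borel H" by (rule forward_measurable[OF H])
  have "AE \<tau> in lborel. ennreal ((4 * pi * \<tau>) powr (- DIM('a) / 2)) * (\<integral>\<^sub>+y. enorm (H \<tau> y)) \<noteq> \<infinity>"
    using fin unfolding kernel_norm_def by (intro nn_integral_PInf_AE) auto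
  then show ?thesis
  proof eventually_elim
    case (elim \<tau>)
    show ?case
    proof (cases "0 < \<tau>")
      case True
      then have "(\<integral>\<^sub>+y. enorm (H \<tau> y)) \<noteq> \<infinity>"
        using elim by (auto simp: ennreal_mult_eq_top_iff ennreal_eq_0_iff)
      then show ?thesis using forward_section[OF H] by (intro integrableI_bounded) (auto simp: less_top)
    next
      case False
      then have "H \<tau> = (\<lambda>_. 0)" using forward_zero[OF H] by auto
      then show ?thesis by simp
    qed
  qed
qed

lemma borel_measurable_schr_conv_section:
  assumes H: "forward H"
  shows "(\<lambda>(\<tau>, x). schr_conv \<tau> (H \<tau>) x) \<in> borel_measurable (lborel \<Otimes>\<^sub>M lborel)"
proof -
  have [measurable]: "jointly_borel H" by (rule forward_measurable[OF H])
  show ?thesis unfolding schr_conv_def by measurable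
qed

lemma L2norm_schr_conv_le:
  assumes g: "integrable lborel g" and \<tau>: "0 < \<tau>"
  shows "L2norm lborel (\<lambda>x. enorm (schr_conv \<tau> g x)) \<le> L2norm lborel (\<lambda>x. enorm (g x))"
  unfolding L2norm_eq ennreal_norm_square[symmetric] using schr_conv_L2[OF g \<tau>] by (intro ennreal_powr_mono) auto

text \<open>Fubini writes \<open>schr_int H\<close> as a time integral of convolutions; Minkowski
  takes the L^2 norm inside, where the group is a contraction.\<close>

lemma L2norm_schr_int_le:
  fixes H :: "real \<Rightarrow> 'a::euclidean_space \<Rightarrow> complex"
  assumes H: "forward H" and fin: "kernel_norm H < top"
  shows "L2norm lborel (\<lambda>x. enorm (schr_int H x)) \<le> energy_norm H"
proof -
  note [measurable] = borel_measurable_schr_conv_section[OF H]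
  have eq: "schr_int H x = (\<integral>\<tau>. schr_conv \<tau> (H \<tau>) x \<partial>lborel)" for x
  proof -
    have "integrable (lborel \<Otimes>\<^sub>M lborel) (\<lambda>z. schr_kernel (fst z) (x - snd z) * H (fst z) (snd z))"
      unfolding lborel_prod by (rule schr_int_integrable[OF H fin])
    from lborel_pair.integral_fst'[OF this] show ?thesis
      unfolding schr_int_def schr_conv_def by (simp add: lborel_prod)
  qed
  have "L2norm lborel (\<lambda>x. enorm (schr_int H x))
      \<le> L2norm lborel (\<lambda>x. \<integral>\<^sub>+\<tau>. enorm (schr_conv \<tau> (H \<tau>) x))"
  proof (rule Lebesgue_norm_mono[OF _ _ one_le_ennreal_2])
    show "(\<lambda>x. enorm (schr_int H x)) \<in> borel_measurable lborel"
      using borel_measurable_schr_int[OF H, of "\<lambda>x. x" borel] by simp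
    show "enorm (schr_int H x) \<le> (\<integral>\<^sub>+\<tau>. enorm (schr_conv \<tau> (H \<tau>) x))" for x
      unfolding eq by (rule ennreal_norm_integral_le)
  qed
  also have "\<dots> \<le> (\<integral>\<^sub>+\<tau>. L2norm lborel (\<lambda>x. enorm (schr_conv \<tau> (H \<tau>) x)))"
    by (rule Minkowski_nn_integral[OF sigma_finite_lborel sigma_finite_lborel one_le_ennreal_2]) measurable
  also have "\<dots> \<le> energy_norm H"
    unfolding energy_norm_def
  proof (rule nn_integral_mono_AE, use AE_integrable_section[OF H fin] in eventually_elim)
    case (elim \<tau>)
    show ?case
    proof (cases "0 < \<tau>")
      case True then show ?thesis by (rule L2norm_schr_conv_le[OF elim])
    next
      case False then show ?thesis by (simp add: schr_conv_def forward_zero[OF H])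
    qed
  qed
  finally show ?thesis .
qed

lemma tendsto_ennreal_powr_0:
  assumes f: "(f \<longlongrightarrow> 0) F" and a: "0 < a"
  shows "((\<lambda>x. ennreal_powr (f x) a) \<longlongrightarrow> 0) F"
proof (rule order_tendstoI)
  fix e :: ennreal assume "0 < e"
  then obtain e' where e': "0 < e'" "e' < e" using dense by blast
  have "0 < ennreal_powr e' (1 / a)" using e'(1) by (simp add: zero_less_iff_neq_zero)
  from order_tendstoD(2)[OF f this] show "\<forall>\<^sub>F x in F. ennreal_powr (f x) a < e"
  proof eventually_elim
    case (elim x)
    then have "ennreal_powr (f x) a \<le> e'" using a by (simp add: ennreal_powr_le_iff)
    then show ?case using e'(2) by (rule le_less_trans)
  qed
qed simp

text \<open>On the truncated region the weight is at most its value at time 1 / (n + 1), and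
  Cauchy-Schwarz on the ball passes from L^1 to L^2.\<close>

lemma kernel_norm_cut_le:
  fixes H :: "real \<Rightarrow> 'a::euclidean_space \<Rightarrow> complex"
  assumes H: "forward H"
  obtains c where "c < top" "kernel_norm (cut n H) \<le> c * energy_norm H"
proof
  have [measurable]: "jointly_borel H" by (rule forward_measurable[OF H])
  let ?w = "\<lambda>\<tau>. ennreal ((4 * pi * \<tau>) powr (- DIM('a) / 2))"
  let ?B = "L2norm lborel (indicator (cball 0 (real n)) :: 'a \<Rightarrow> ennreal)"
  have "?B * ?B < top" unfolding L2norm_square
    using emeasure_bounded_finite[of "cball (0::'a) (real n)"]
    by (simp add: indicator_inter_arith[symmetric])
  then have B: "?B < top" by (auto simp: ennreal_mult_less_top)
  show "?w (1 / real (Suc n)) * ?B < top" using B by (simp add: ennreal_mult_less_top)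
  have "kernel_norm (cut n H) \<le> (\<integral>\<^sub>+\<tau>. (?w (1 / real (Suc n)) * ?B) * L2norm lborel (\<lambda>y. enorm (H \<tau> y)))"
    unfolding kernel_norm_def
  proof (intro nn_integral_mono)
    fix \<tau>
    show "?w \<tau> * (\<integral>\<^sub>+y. enorm (cut n H \<tau> y)) \<le> (?w (1 / real (Suc n)) * ?B) * L2norm lborel (\<lambda>y. enorm (H \<tau> y))"
    proof (cases "1 / real (Suc n) \<le> \<tau>")
      case True
      then have "0 < \<tau>" by (rule less_le_trans[rotated]) simp
      then have w: "?w \<tau> \<le> ?w (1 / real (Suc n))"
        using True by (intro ennreal_leI powr_mono2' mult_left_mono) auto
      have "(\<integral>\<^sub>+y. enorm (cut n H \<tau> y)) \<le> (\<integral>\<^sub>+y. indicator (cball 0 (real n)) y * enorm (H \<tau> y))"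
        by (intro nn_integral_mono) (auto simp: cut_def indicator_def)
      also have "\<dots> \<le> ?B * L2norm lborel (\<lambda>y. enorm (H \<tau> y))"
        using forward_section[OF H, of \<tau>] by (intro Hoelder_L2 borel_measurable_indicator) auto
      finally show ?thesis using w unfolding mult.assoc by (intro mult_mono) auto
    next
      case False then show ?thesis by (simp add: cut_def)
    qed
  qed
  also have "\<dots> = (?w (1 / real (Suc n)) * ?B) * energy_norm H"
    unfolding energy_norm_def
    by (intro nn_integral_cmult borel_measurable_Lebesgue_norm[OF sigma_finite_lborel one_le_ennreal_2]) measurable
  finally show "kernel_norm (cut n H) \<le> (?w (1 / real (Suc n)) * ?B) * energy_norm H" .
qed

text \<open>Dominated convergence twice, in y for almost every \<tau> and then in \<tau>; the
  truncation error is always below H itself.\<close>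

lemma energy_norm_cut_tendsto:
  fixes H :: "real \<Rightarrow> 'a::euclidean_space \<Rightarrow> complex"
  assumes H: "forward H" and fin: "energy_norm H < top"
  shows "(\<lambda>n. energy_norm (\<lambda>\<tau> y. H \<tau> y - cut n H \<tau> y)) \<longlonglongrightarrow> 0"
proof -
  have Hm [measurable]: "jointly_borel H" by (rule forward_measurable[OF H])
  have Cm [measurable]: "jointly_borel (cut n H)" for n
    by (rule forward_measurable[OF forward_cut[OF H]])
  let ?l = "\<lambda>n \<tau>. L2norm lborel (\<lambda>y. enorm (H \<tau> y - cut n H \<tau> y))"
  let ?h = "\<lambda>\<tau>. L2norm lborel (\<lambda>y. enorm (H \<tau> y))"
  have le: "norm (H \<tau> y - cut n H \<tau> y) \<le> norm (H \<tau> y)" for n \<tau> y by (simp add: cut_def)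
  have h_fin: "AE \<tau> in lborel. ?h \<tau> \<noteq> \<infinity>"
    using fin unfolding energy_norm_def
    by (intro nn_integral_PInf_AE borel_measurable_Lebesgue_norm[OF sigma_finite_lborel one_le_ennreal_2]) auto
  have "(\<lambda>n. \<integral>\<^sub>+\<tau>. ?l n \<tau>) \<longlonglongrightarrow> (\<integral>\<^sup>+\<tau>. 0 \<partial>(lborel :: real measure))"
  proof (rule nn_integral_dominated_convergence[where w="?h"])
    show "AE \<tau> in lborel. ?l n \<tau> \<le> ?h \<tau>" for n
      using le by (intro AE_I2 Lebesgue_norm_mono[OF _ _ one_le_ennreal_2] ennreal_leI) auto
    show "(\<integral>\<^sub>+\<tau>. ?h \<tau>) < \<infinity>" using fin by (simp add: energy_norm_def)
    show "AE \<tau> in lborel. (\<lambda>n. ?l n \<tau>) \<longlonglongrightarrow> 0"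
      using h_fin
    proof eventually_elim
      case (elim \<tau>)
      have "(\<lambda>n. \<integral>\<^sub>+y. enorm (H \<tau> y - cut n H \<tau> y) * enorm (H \<tau> y - cut n H \<tau> y)) \<longlonglongrightarrow> (\<integral>\<^sup>+y. 0 \<partial>(lborel :: 'a measure))"
      proof (rule nn_integral_dominated_convergence[where w="\<lambda>y. enorm (H \<tau> y) * enorm (H \<tau> y)"])
        show "AE y in lborel. enorm (H \<tau> y - cut n H \<tau> y) * enorm (H \<tau> y - cut n H \<tau> y) \<le> enorm (H \<tau> y) * enorm (H \<tau> y)" for n
          using le by (intro AE_I2 mult_mono ennreal_leI) auto
        show "(\<integral>\<^sub>+y. enorm (H \<tau> y) * enorm (H \<tau> y)) < \<infinity>"
          using elim unfolding L2norm_eq by (simp add: less_top)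
        show "AE y in lborel. (\<lambda>n. enorm (H \<tau> y - cut n H \<tau> y) * enorm (H \<tau> y - cut n H \<tau> y)) \<longlonglongrightarrow> 0"
        proof (rule AE_I2)
          fix y
          show "(\<lambda>n. enorm (H \<tau> y - cut n H \<tau> y) * enorm (H \<tau> y - cut n H \<tau> y)) \<longlonglongrightarrow> 0"
            using cut_tendsto[OF H, of \<tau> y]
            by (intro tendsto_eventually) (auto elim!: eventually_mono)
        qed
      qed auto
      then show ?case unfolding L2norm_eq by (intro tendsto_ennreal_powr_0) auto
    qed
  qed (auto intro!: borel_measurable_Lebesgue_norm[OF sigma_finite_lborel one_le_ennreal_2])
  then show ?thesis by (simp add: energy_norm_def)
qed

section \<open>Uniqueness, additivity and existence of the limits\<close>

lemma tendsto_0_le_ennreal: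
  fixes f g :: "'a \<Rightarrow> ennreal"
  assumes "(g \<longlongrightarrow> 0) F" "\<And>x. f x \<le> g x"
  shows "(f \<longlongrightarrow> 0) F"
  using tendsto_sandwich[of "\<lambda>_. 0" f F g 0] assms by auto

lemma set_nn_integral_norm_triangle:
  fixes a b u :: "'a::euclidean_space \<Rightarrow> complex"
  assumes [measurable]: "a \<in> borel_measurable borel" "b \<in> borel_measurable borel" "S \<in> sets borel"
    and le: "\<And>x. norm (u x) \<le> norm (a x) + norm (b x)"
  shows "(\<integral>\<^sub>+x. enorm (u x) * indicator S x)
    \<le> (\<integral>\<^sub>+x. enorm (a x) * indicator S x) + (\<integral>\<^sub>+x. enorm (b x) * indicator S x)"
proof -
  have "(\<integral>\<^sub>+x. enorm (u x) * indicator S x)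
      \<le> (\<integral>\<^sub>+x. enorm (a x) * indicator S x + enorm (b x) * indicator S x)"
    using le by (intro nn_integral_mono) (auto simp: indicator_def simp flip: ennreal_plus intro!: ennreal_leI)
  also have "\<dots> = (\<integral>\<^sub>+x. enorm (a x) * indicator S x) + (\<integral>\<^sub>+x. enorm (b x) * indicator S x)"
    by (rule nn_integral_add) measurable
  finally show ?thesis .
qed

text \<open>Convergence in L^1 on balls is weak enough to cover both bounded and square-integrable
  pieces, and strong enough to determine the limit almost everywhere. This identifies the solutions
  that come from different splittings.\<close>

lemma schr_limit_unique:
  fixes v v' :: "'a::euclidean_space \<Rightarrow> complex"
  assumes v: "schr_limit H v" and v': "schr_limit H v'"
  shows "AE x in lborel. v x = v' x"
proof -
  have [measurable]: "v \<in> borel_measurable borel" "v' \<in> borel_measurable borel" and H: "forward H"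
    using v v' by (auto simp: schr_limit_def)
  have "AE x in lborel. x \<in> cball 0 (real k) \<longrightarrow> v x = v' x" for k :: nat
  proof -
    let ?I = "\<lambda>n v. \<integral>\<^sup>+x. enorm (schr_int (cut n H) x - v x) * indicator (cball 0 (real k)) x \<partial>lborel"
    have meas [measurable]: "schr_int (cut n H) \<in> borel_measurable borel" for n
      using borel_measurable_schr_int[OF forward_cut[OF H], of "\<lambda>x. x"] by simp
    have "(\<lambda>n. ?I n v + ?I n v') \<longlonglongrightarrow> 0 + 0"
      using v v' unfolding schr_limit_def by (intro tendsto_add) auto
    moreover have "(\<integral>\<^sub>+x. enorm (v x - v' x) * indicator (cball 0 (real k)) x) \<le> ?I n v + ?I n v'" for n
    proof (rule set_nn_integral_norm_triangle)
      show "norm (v x - v' x) \<le> norm (schr_int (cut n H) x - v x) + norm (schr_int (cut n H) x - v' x)" for x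
        using norm_triangle_ineq4[of "schr_int (cut n H) x - v' x" "schr_int (cut n H) x - v x"] by simp
    qed auto
    ultimately have "(\<integral>\<^sub>+x. enorm (v x - v' x) * indicator (cball 0 (real k)) x) \<le> 0 + 0"
      by (intro LIMSEQ_le_const) auto
    then have "AE x in lborel. enorm (v x - v' x) * indicator (cball 0 (real k)) x = 0"
    proof (subst nn_integral_0_iff_AE[symmetric])
      show "(\<lambda>x. enorm (v x - v' x) * indicator (cball 0 (real k)) x) \<in> borel_measurable lborel" by measurable
    qed simp
    then show ?thesis by eventually_elim (auto simp: indicator_def)
  qed
  then have "AE x in lborel. \<forall>k::nat. x \<in> cball 0 (real k) \<longrightarrow> v x = v' x"
    unfolding AE_all_countable by blast
  then show ?thesis
  proof eventually_elim
    case (elim x)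
    obtain k :: nat where "norm x \<le> real k" using real_arch_simple by blast
    then show ?case using elim by auto
  qed
qed

text \<open>Sums and differences share one truncation, so linearity of \<open>schr_int\<close>
  passes to the limit, and one majorant serves for both.\<close>

lemma schr_limit_combine:
  fixes v v' :: "'a::euclidean_space \<Rightarrow> complex"
  assumes v: "schr_limit H v" and v': "schr_limit G v'"
  shows schr_limit_add: "schr_limit (\<lambda>\<tau> y. H \<tau> y + G \<tau> y) (\<lambda>x. v x + v' x)"
    and schr_limit_diff: "schr_limit (\<lambda>\<tau> y. H \<tau> y - G \<tau> y) (\<lambda>x. v x - v' x)"
proof -
  have [measurable]: "v \<in> borel_measurable borel" "v' \<in> borel_measurable borel" and H: "forward H" "forward G"
    and fin: "kernel_norm (cut n H) < top" "kernel_norm (cut n G) < top" for n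
    using v v' by (auto simp: schr_limit_def)
  have [measurable]: "schr_int (cut n H) \<in> borel_measurable borel" "schr_int (cut n G) \<in> borel_measurable borel" for n
    using borel_measurable_schr_int[OF forward_cut[OF H(1)], of "\<lambda>x. x"] borel_measurable_schr_int[OF forward_cut[OF H(2)], of "\<lambda>x. x"] by simp_all
  note [measurable] = forward_measurable[OF forward_cut[OF H(1)]] forward_measurable[OF forward_cut[OF H(2)]]
  let ?I = "\<lambda>k n H v. \<integral>\<^sup>+x. enorm (schr_int (cut n H) x - v x) * indicator (cball 0 (real k)) x \<partial>lborel"
  have lim: "(\<lambda>n. ?I k n H v + ?I k n G v') \<longlonglongrightarrow> 0" for k :: nat
    using tendsto_add[of "\<lambda>n. ?I k n H v" 0 sequentially "\<lambda>n. ?I k n G v'" 0] v v' unfolding schr_limit_def by auto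
  have kfin: "kernel_norm J < top" if "\<And>\<tau> y. norm (J \<tau> y) \<le> norm (cut n H \<tau> y) + norm (cut n G \<tau> y)" for J n
  proof -
    have "kernel_norm J \<le> kernel_norm (cut n H) + kernel_norm (cut n G)"
    proof -
      have "kernel_norm J \<le> (\<integral>\<^sub>+\<tau>. ennreal ((4 * pi * \<tau>) powr (- DIM('a) / 2)) * (\<integral>\<^sub>+y. enorm (cut n H \<tau> y) + enorm (cut n G \<tau> y)))"
        unfolding kernel_norm_def using that
        by (intro nn_integral_mono mult_left_mono) (auto simp flip: ennreal_plus intro!: ennreal_leI)
      also have "\<dots> = kernel_norm (cut n H) + kernel_norm (cut n G)"
        unfolding kernel_norm_def
        by (simp add: nn_integral_add distrib_left)
      finally show ?thesis .
    qed
    then show ?thesis using fin[of n] by (simp add: order.strict_trans1)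
  qed
  have bound: "(\<integral>\<^sub>+x. enorm (u x) * indicator (cball 0 (real k)) x) \<le> ?I k n H v + ?I k n G v'"
    if "\<And>x. norm (u x) \<le> norm (schr_int (cut n H) x - v x) + norm (schr_int (cut n G) x - v' x)" for u :: "'a \<Rightarrow> complex" and k n
    using that by (intro set_nn_integral_norm_triangle) auto
  show "schr_limit (\<lambda>\<tau> y. H \<tau> y + G \<tau> y) (\<lambda>x. v x + v' x)"
    unfolding schr_limit_def
  proof (intro conjI allI)
    show "kernel_norm (cut n (\<lambda>\<tau> y. H \<tau> y + G \<tau> y)) < top" for n
      unfolding cut_add by (rule kfin) (rule norm_triangle_ineq)
    show "(\<lambda>n. \<integral>\<^sub>+x. enorm (schr_int (cut n (\<lambda>\<tau> y. H \<tau> y + G \<tau> y)) x - (v x + v' x)) * indicator (cball 0 (real k)) x) \<longlonglongrightarrow> 0" for k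
    proof (rule tendsto_0_le_ennreal[OF lim bound])
      fix n x
      have "schr_int (cut n (\<lambda>\<tau> y. H \<tau> y + G \<tau> y)) x - (v x + v' x) = (schr_int (cut n H) x - v x) + (schr_int (cut n G) x - v' x)"
        unfolding cut_add by (simp add: schr_int_add forward_cut H fin)
      then show "norm (schr_int (cut n (\<lambda>\<tau> y. H \<tau> y + G \<tau> y)) x - (v x + v' x)) \<le> norm (schr_int (cut n H) x - v x) + norm (schr_int (cut n G) x - v' x)"
        using norm_triangle_ineq by metis
    qed
  qed (use H in \<open>auto intro: forward_add\<close>)
  show "schr_limit (\<lambda>\<tau> y. H \<tau> y - G \<tau> y) (\<lambda>x. v x - v' x)"
    unfolding schr_limit_def
  proof (intro conjI allI)
    show "kernel_norm (cut n (\<lambda>\<tau> y. H \<tau> y - G \<tau> y)) < top" for n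
      unfolding cut_diff by (rule kfin) (rule norm_triangle_ineq4)
    show "(\<lambda>n. \<integral>\<^sub>+x. enorm (schr_int (cut n (\<lambda>\<tau> y. H \<tau> y - G \<tau> y)) x - (v x - v' x)) * indicator (cball 0 (real k)) x) \<longlonglongrightarrow> 0" for k
    proof (rule tendsto_0_le_ennreal[OF lim bound])
      fix n x
      have "schr_int (cut n (\<lambda>\<tau> y. H \<tau> y - G \<tau> y)) x - (v x - v' x) = (schr_int (cut n H) x - v x) - (schr_int (cut n G) x - v' x)"
        unfolding cut_diff by (simp add: schr_int_diff forward_cut H fin)
      then show "norm (schr_int (cut n (\<lambda>\<tau> y. H \<tau> y - G \<tau> y)) x - (v x - v' x)) \<le> norm (schr_int (cut n H) x - v x) + norm (schr_int (cut n G) x - v' x)"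
        using norm_triangle_ineq4 by metis
    qed
  qed (use H in \<open>auto intro: forward_diff\<close>)
qed

text \<open>The kernel norm is read as a single space-time integral, the kernel being evaluated from
  x = 0, so that dominated convergence applies once.\<close>

lemma kernel_norm_cut_tendsto:
  fixes H :: "real \<Rightarrow> 'a::euclidean_space \<Rightarrow> complex"
  assumes H: "forward H" and fin: "kernel_norm H < top"
  shows "(\<lambda>n. kernel_norm (\<lambda>\<tau> y. H \<tau> y - cut n H \<tau> y)) \<longlonglongrightarrow> 0"
proof -
  have Hm [measurable]: "jointly_borel H" by (rule forward_measurable[OF H])
  have Cm [measurable]: "jointly_borel (cut n H)" for n
    by (rule forward_measurable[OF forward_cut[OF H]])
  let ?K = "\<lambda>H z. enorm (schr_kernel (fst z) (0 - snd z) * H (fst z) (snd z))"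
  have "(\<lambda>n. \<integral>\<^sub>+z. ?K (\<lambda>\<tau> y. H \<tau> y - cut n H \<tau> y) z) \<longlonglongrightarrow> (\<integral>\<^sup>+z. 0 \<partial>(lborel :: (real \<times> 'a) measure))"
  proof (rule nn_integral_dominated_convergence[where w="?K H"])
    show "AE z in lborel. ?K (\<lambda>\<tau> y. H \<tau> y - cut n H \<tau> y) z \<le> ?K H z" for n
      by (intro AE_I2 ennreal_leI) (auto simp: norm_mult cut_def)
    show "(\<integral>\<^sub>+z. ?K H z) < \<infinity>" using fin by (simp only: nn_integral_kernel_eq[OF H] infinity_ennreal_def)
    show "AE z in lborel. (\<lambda>n. ?K (\<lambda>\<tau> y. H \<tau> y - cut n H \<tau> y) z) \<longlonglongrightarrow> 0"
    proof (rule AE_I2)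
      fix z
      show "(\<lambda>n. ?K (\<lambda>\<tau> y. H \<tau> y - cut n H \<tau> y) z) \<longlonglongrightarrow> 0"
        by (rule tendsto_eventually, rule eventually_mono[OF cut_tendsto[OF H, of "fst z" "snd z"]]) simp
    qed
  qed (auto simp: lborel_prod[symmetric])
  then show ?thesis
    unfolding nn_integral_kernel_eq[OF forward_diff[OF H forward_cut[OF H]]] by simp
qed

text \<open>Here the truncated integrals converge uniformly in x, with an error at most the kernel
  norm of what was cut off.\<close>

lemma schr_limit_kernel:
  fixes H :: "real \<Rightarrow> 'a::euclidean_space \<Rightarrow> complex"
  assumes H: "forward H" and fin: "kernel_norm H < top"
  shows "schr_limit H (schr_int H)"
  unfolding schr_limit_def
proof (intro conjI allI)
  have kc: "kernel_norm (cut n H) < top" for n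
    by (rule le_less_trans[OF kernel_norm_mono[where H="cut n H" and G=H, OF norm_cut_le] fin])
  then show "kernel_norm (cut n H) < top" for n .
  show "schr_int H \<in> borel_measurable borel"
    using borel_measurable_schr_int[OF H, of "\<lambda>x. x"] by simp
  fix k :: nat
  let ?m = "emeasure lborel (cball (0::'a) (real k))"
  have m: "?m < top" using emeasure_bounded_finite[of "cball (0::'a) (real k)"] by simp
  have "(\<lambda>n. ?m * kernel_norm (\<lambda>\<tau> y. H \<tau> y - cut n H \<tau> y)) \<longlonglongrightarrow> ?m * 0"
    by (intro ennreal_tendsto_cmult m kernel_norm_cut_tendsto[OF H fin])
  then have lim: "(\<lambda>n. kernel_norm (\<lambda>\<tau> y. H \<tau> y - cut n H \<tau> y) * ?m) \<longlonglongrightarrow> 0" by (simp add: mult.commute)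
  show "(\<lambda>n. \<integral>\<^sub>+x. enorm (schr_int (cut n H) x - schr_int H x) * indicator (cball 0 (real k)) x) \<longlonglongrightarrow> 0"
  proof (rule tendsto_0_le_ennreal[OF lim])
    fix n
    have le: "enorm (schr_int (cut n H) x - schr_int H x) \<le> kernel_norm (\<lambda>\<tau> y. H \<tau> y - cut n H \<tau> y)" for x
      using norm_schr_int_le[OF forward_diff[OF H forward_cut[OF H]], of n x]
      by (simp add: schr_int_diff H fin forward_cut kc norm_minus_commute)
    have "(\<integral>\<^sub>+x. enorm (schr_int (cut n H) x - schr_int H x) * indicator (cball 0 (real k)) x)
        \<le> (\<integral>\<^sub>+x. kernel_norm (\<lambda>\<tau> y. H \<tau> y - cut n H \<tau> y) * indicator (cball (0::'a) (real k)) x)"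
      by (rule nn_integral_mono, rule mult_right_mono[OF le]) simp
    also have "\<dots> = kernel_norm (\<lambda>\<tau> y. H \<tau> y - cut n H \<tau> y) * ?m"
      by (rule nn_integral_cmult_indicator) simp
    finally show "(\<integral>\<^sub>+x. enorm (schr_int (cut n H) x - schr_int H x) * indicator (cball 0 (real k)) x)
      \<le> kernel_norm (\<lambda>\<tau> y. H \<tau> y - cut n H \<tau> y) * ?m" .
  qed
qed (rule H)

text \<open>For data in L^1 in time with values in L^2 the kernel integral may fail to converge
  absolutely. The truncated integrals form a Cauchy sequence in L^2 by
  \<open>L2norm_schr_int_le\<close>, and their limit inherits the bound.\<close>

lemma schr_limit_energy:
  fixes H :: "real \<Rightarrow> 'a::euclidean_space \<Rightarrow> complex"
  assumes H: "forward H" and fin: "energy_norm H < top"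
  obtains v where "schr_limit H v" "L2norm lborel (\<lambda>x. enorm (v x)) \<le> energy_norm H"
    "(\<lambda>n. L2norm lborel (\<lambda>x. enorm (schr_int (cut n H) x - v x))) \<longlonglongrightarrow> 0"
proof -
  define d where "d n = energy_norm (\<lambda>\<tau> y. H \<tau> y - cut n H \<tau> y)" for n
  have d: "d \<longlonglongrightarrow> 0" unfolding d_def by (rule energy_norm_cut_tendsto[OF H fin])
  have kc: "kernel_norm (cut n H) < top" for n
    using kernel_norm_cut_le[OF H, of n] fin by (metis ennreal_mult_less_top le_less_trans)
  note fc = forward_cut[OF H]
  have meas [measurable]: "schr_int (cut n H) \<in> borel_measurable borel" for n
    using borel_measurable_schr_int[OF fc, of "\<lambda>x. x"] by simp
  have Cauchy: "L2norm lborel (\<lambda>x. enorm (schr_int (cut m H) x - schr_int (cut n H) x)) \<le> d n" if "n \<le> m" for n m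
  proof -
    have kd: "kernel_norm (\<lambda>\<tau> y. cut m H \<tau> y - cut n H \<tau> y) \<le> kernel_norm (cut m H)"
    proof (rule kernel_norm_mono)
      fix \<tau> :: real and y :: 'a
      show "norm (cut m H \<tau> y - cut n H \<tau> y) \<le> norm (cut m H \<tau> y)"
        using that frac_le[of 1 1 "real (Suc n)" "real (Suc m)"] by (auto simp: cut_def simp del: of_nat_Suc)
    qed
    have "L2norm lborel (\<lambda>x. enorm (schr_int (\<lambda>\<tau> y. cut m H \<tau> y - cut n H \<tau> y) x)) \<le> energy_norm (\<lambda>\<tau> y. cut m H \<tau> y - cut n H \<tau> y)"
      using kd kc[of m] by (intro L2norm_schr_int_le forward_diff fc) (rule le_less_trans)
    also have "\<dots> \<le> d n"
      unfolding d_def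
    proof (rule energy_norm_mono)
      show "norm (cut m H \<tau> y - cut n H \<tau> y) \<le> norm (H \<tau> y - cut n H \<tau> y)" for \<tau> y
        using that frac_le[of 1 1 "real (Suc n)" "real (Suc m)"] by (auto simp: cut_def simp del: of_nat_Suc)
    qed (intro forward_diff fc)
    finally show ?thesis by (simp add: schr_int_diff fc kc)
  qed
  obtain v where [measurable]: "v \<in> borel_measurable lborel"
    and v: "\<And>n. L2norm lborel (\<lambda>x. enorm (schr_int (cut n H) x - v x)) \<le> d n"
    using L2_complete[OF sigma_finite_lborel _ d Cauchy] by auto
  have lim: "(\<lambda>n. L2norm lborel (\<lambda>x. enorm (schr_int (cut n H) x - v x))) \<longlonglongrightarrow> 0"
    by (rule tendsto_0_le_ennreal[OF d v])
  have "L2norm lborel (\<lambda>x. enorm (v x)) \<le> energy_norm H + d n" for n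
  proof -
    have "L2norm lborel (\<lambda>x. enorm (v x)) \<le> L2norm lborel (\<lambda>x. enorm (schr_int (cut n H) x) + enorm (schr_int (cut n H) x - v x))"
    proof (rule Lebesgue_norm_mono[OF _ _ one_le_ennreal_2])
      show "enorm (v x) \<le> enorm (schr_int (cut n H) x) + enorm (schr_int (cut n H) x - v x)" for x
        using norm_triangle_ineq4[of "schr_int (cut n H) x" "schr_int (cut n H) x - v x"]
        by (simp flip: ennreal_plus add: ennreal_leI)
    qed measurable
    also have "\<dots> \<le> L2norm lborel (\<lambda>x. enorm (schr_int (cut n H) x)) + L2norm lborel (\<lambda>x. enorm (schr_int (cut n H) x - v x))"
      by (rule Lebesgue_norm_add[OF sigma_finite_lborel one_le_ennreal_2]) measurable
    also have "\<dots> \<le> energy_norm H + d n"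
      by (intro add_mono v order_trans[OF L2norm_schr_int_le[OF fc kc] energy_norm_mono] fc norm_cut_le)
    finally show ?thesis .
  qed
  moreover have "(\<lambda>n. energy_norm H + d n) \<longlonglongrightarrow> energy_norm H + 0"
    by (intro tendsto_add tendsto_const d)
  ultimately have v_le: "L2norm lborel (\<lambda>x. enorm (v x)) \<le> energy_norm H"
    using LIMSEQ_le_const[of "\<lambda>n. energy_norm H + d n" "energy_norm H + 0"] by auto
  have "schr_limit H v"
    unfolding schr_limit_def
  proof (intro conjI allI kc H)
    fix k :: nat
    let ?B = "L2norm lborel (indicator (cball 0 (real k)) :: 'a \<Rightarrow> ennreal)"
    have "?B * ?B < top" unfolding L2norm_square
      using emeasure_bounded_finite[of "cball (0::'a) (real k)"]
      by (simp add: indicator_inter_arith[symmetric])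
    then have B: "?B < top" by (auto simp: ennreal_mult_less_top)
    have "(\<lambda>n. ?B * L2norm lborel (\<lambda>x. enorm (schr_int (cut n H) x - v x))) \<longlonglongrightarrow> ?B * 0"
      by (intro ennreal_tendsto_cmult B lim)
    then have lim': "(\<lambda>n. L2norm lborel (\<lambda>x. enorm (schr_int (cut n H) x - v x)) * ?B) \<longlonglongrightarrow> 0" by (simp add: mult.commute)
    show "(\<lambda>n. \<integral>\<^sub>+x. enorm (schr_int (cut n H) x - v x) * indicator (cball 0 (real k)) x) \<longlonglongrightarrow> 0"
      by (rule tendsto_0_le_ennreal[OF lim']) (rule Hoelder_L2, auto intro!: borel_measurable_indicator)
  qed simp
  then show ?thesis using that v_le lim by blast
qed

section \<open>Pairings with Schwartz functions\<close>

lemma borel_measurable_fst_borel [measurable]: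
  "fst \<in> borel_measurable (borel :: ('a::euclidean_space \<times> 'b::euclidean_space) measure)"
  and borel_measurable_snd_borel [measurable]:
  "snd \<in> borel_measurable (borel :: ('a::euclidean_space \<times> 'b::euclidean_space) measure)"
  by (simp_all add: borel_prod[symmetric])

lemma forward_measurable_prod:
  assumes "forward H"
  shows "(\<lambda>z. H (fst z) (snd z)) \<in> borel_measurable borel"
  using forward_measurable[OF assms] by (simp add: borel_prod case_prod_beta')

lemma nn_integral_lborel_prod_iterated:
  fixes f :: "'a::euclidean_space \<times> 'b::euclidean_space \<Rightarrow> ennreal"
  assumes "f \<in> borel_measurable borel"
  shows "(\<integral>\<^sub>+z. f z) = (\<integral>\<^sub>+x. \<integral>\<^sub>+y. f (x, y))"
proof -
  have "f \<in> borel_measurable (lborel \<Otimes>\<^sub>M lborel)" using assms by (simp add: lborel_prod)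
  from lborel.nn_integral_fst[OF this] show ?thesis by (simp add: lborel_prod)
qed

text \<open>Fubini moves the convolution onto \<phi>, the kernel being even in space; for positive
  times the convolution of \<phi> is the group acting on it.\<close>

lemma schroedinger_pairing_kernel:
  fixes H :: "real \<Rightarrow> 'a::euclidean_space \<Rightarrow> complex"
  assumes H: "forward H" and fin: "kernel_norm H < top" and \<phi>: "\<phi> \<in> schwartz_space"
  shows "integrable lborel (\<lambda>z. schr_pair H \<phi> z)"
    and "integrable lborel (\<lambda>x. schr_int H x * \<phi> x)"
    and "(\<integral>x. schr_int H x * \<phi> x \<partial>lborel) = (\<integral>z. schr_pair H \<phi> z \<partial>lborel)"
proof -
  note [measurable] = forward_measurable_prod[OF H] forward_measurable[OF H] borel_measurable_schroedinger[OF \<phi>] schwartz_borel[OF \<phi>]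
  let ?L = "\<integral>\<^sup>+y. enorm (\<phi> y) \<partial>lborel"
  have L: "?L < top" using schwartz_integrable[OF \<phi>] by (simp add: integrable_iff_bounded)
  let ?w = "\<lambda>\<tau>. ennreal ((4 * pi * \<tau>) powr (- DIM('a) / 2))"
  have Hs: "H \<tau> y * schroedinger \<tau> \<phi> y = H \<tau> y * schr_conv \<tau> \<phi> y" for \<tau> y
    by (cases "0 < \<tau>") (auto simp: schroedinger_eq_schr_conv[OF \<phi>] forward_zero[OF H])
  show 1: "integrable lborel (\<lambda>z. schr_pair H \<phi> z)"
  proof (rule integrableI_bounded)
    have "(\<integral>\<^sub>+z. enorm (schr_pair H \<phi> z))
        = (\<integral>\<^sub>+\<tau>. \<integral>\<^sub>+y. enorm (H \<tau> y * schr_conv \<tau> \<phi> y))"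
      by (subst nn_integral_lborel_prod_iterated) (auto simp: Hs)
    also have "\<dots> \<le> (\<integral>\<^sub>+\<tau>. (?w \<tau> * (\<integral>\<^sub>+y. enorm (H \<tau> y))) * ?L)"
    proof (intro nn_integral_mono)
      fix \<tau>
      show "(\<integral>\<^sub>+y. enorm (H \<tau> y * schr_conv \<tau> \<phi> y)) \<le> (?w \<tau> * (\<integral>\<^sub>+y. enorm (H \<tau> y))) * ?L"
      proof (cases "0 < \<tau>")
        case True
        have "(\<integral>\<^sub>+y. enorm (H \<tau> y * schr_conv \<tau> \<phi> y)) \<le> (\<integral>\<^sub>+y. enorm (H \<tau> y) * (?w \<tau> * ?L))"
          using norm_schr_conv_le[OF True, of \<phi>]
          by (intro nn_integral_mono) (auto simp: norm_mult ennreal_mult intro!: mult_left_mono)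
        also have "\<dots> = (?w \<tau> * (\<integral>\<^sub>+y. enorm (H \<tau> y))) * ?L"
          by (subst nn_integral_multc) (auto simp: ac_simps)
        finally show ?thesis .
      qed (simp add: forward_zero[OF H])
    qed
    also have "\<dots> = kernel_norm H * ?L"
      unfolding kernel_norm_def by (rule nn_integral_multc) measurable
    also have "\<dots> < \<infinity>" using fin L by (simp add: ennreal_mult_less_top)
    finally show "(\<integral>\<^sub>+z. enorm (schr_pair H \<phi> z)) < \<infinity>" .
  qed measurable
  let ?f = "\<lambda>x z. schr_kernel (fst z) (x - snd z) * H (fst z) (snd z) * \<phi> x"
  have int: "integrable (lborel \<Otimes>\<^sub>M lborel) (\<lambda>(x, z). ?f x z)"
  proof (rule lborel_pair.integrable_pairI)
    have "(\<integral>\<^sub>+x. \<integral>\<^sub>+z. enorm (?f x z))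
        = (\<integral>\<^sub>+x. kernel_norm H * enorm (\<phi> x))"
    proof (intro nn_integral_cong)
      fix x
      have "(\<integral>\<^sub>+z. enorm (?f x z)) = (\<integral>\<^sub>+z. enorm (schr_kernel (fst z) (x - snd z) * H (fst z) (snd z)) * enorm (\<phi> x))"
        by (simp add: norm_mult ennreal_mult)
      also have "\<dots> = kernel_norm H * enorm (\<phi> x)"
        by (subst nn_integral_multc) (auto simp only: nn_integral_kernel_eq[OF H], measurable)
      finally show "(\<integral>\<^sub>+z. enorm (?f x z)) = kernel_norm H * enorm (\<phi> x)" .
    qed
    also have "\<dots> = kernel_norm H * ?L" by (rule nn_integral_cmult) measurable
    also have "\<dots> < top" using fin L by (simp add: ennreal_mult_less_top)
    finally show "(\<integral>\<^sub>+x. \<integral>\<^sub>+z. enorm (?f x z)) < top" .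
  qed measurable
  have eq1: "(\<integral>z. ?f x z \<partial>lborel) = schr_int H x * \<phi> x" for x
    unfolding schr_int_def by (rule integral_mult_left_zero)
  have eq2: "(\<integral>x. ?f x z \<partial>lborel) = schr_pair H \<phi> z" for z
  proof -
    have "(\<integral>x. ?f x z \<partial>lborel) = (\<integral>x. H (fst z) (snd z) * (schr_kernel (fst z) (snd z - x) * \<phi> x) \<partial>lborel)"
      by (intro Bochner_Integration.integral_cong refl) (simp add: schr_kernel_commute[of _ "snd z"] ac_simps)
    also have "\<dots> = H (fst z) (snd z) * schr_conv (fst z) \<phi> (snd z)"
      unfolding schr_conv_def by (rule integral_mult_right_zero)
    finally show ?thesis by (simp add: Hs)
  qed
  show "integrable lborel (\<lambda>x. schr_int H x * \<phi> x)"
    using lborel_pair.integrable_fst[OF int] by (simp only: eq1)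
  show "(\<integral>x. schr_int H x * \<phi> x \<partial>lborel) = (\<integral>z. schr_pair H \<phi> z \<partial>lborel)"
    using lborel_pair.Fubini_integral[OF int] by (simp only: eq1 eq2)
qed

lemma L2norm_schwartz_less_top:
  "\<phi> \<in> schwartz_space \<Longrightarrow> L2norm lborel (\<lambda>x. enorm (\<phi> x)) < top"
  unfolding L2norm_eq ennreal_norm_square[symmetric] using schwartz_square_integrable[of \<phi>] by simp

lemma L2norm_schroedinger_le:
  "\<phi> \<in> schwartz_space \<Longrightarrow> 0 < \<tau> \<Longrightarrow>
    L2norm lborel (\<lambda>x. enorm (schroedinger \<tau> \<phi> x)) \<le> L2norm lborel (\<lambda>x. enorm (\<phi> x))"
  using L2norm_schr_conv_le[OF schwartz_integrable, of \<phi> \<tau>] by (simp add: schroedinger_eq_schr_conv)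

lemma schroedinger_pairing_energy:
  fixes H :: "real \<Rightarrow> 'a::euclidean_space \<Rightarrow> complex"
  assumes H: "forward H" and fin: "energy_norm H < top" and \<phi>: "\<phi> \<in> schwartz_space"
  shows "integrable lborel (\<lambda>z. schr_pair H \<phi> z)"
proof (rule integrableI_bounded)
  note [measurable] = forward_measurable_prod[OF H] forward_measurable[OF H] borel_measurable_schroedinger[OF \<phi>] schwartz_borel[OF \<phi>]
  let ?L = "L2norm lborel (\<lambda>x. enorm (\<phi> x))"
  have "(\<integral>\<^sub>+z. enorm (schr_pair H \<phi> z))
      = (\<integral>\<^sub>+\<tau>. \<integral>\<^sub>+y. enorm (H \<tau> y) * enorm (schroedinger \<tau> \<phi> y))"
    by (subst nn_integral_lborel_prod_iterated) (auto simp: norm_mult ennreal_mult)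
  also have "\<dots> \<le> (\<integral>\<^sub>+\<tau>. L2norm lborel (\<lambda>y. enorm (H \<tau> y)) * ?L)"
  proof (intro nn_integral_mono)
    fix \<tau>
    show "(\<integral>\<^sub>+y. enorm (H \<tau> y) * enorm (schroedinger \<tau> \<phi> y)) \<le> L2norm lborel (\<lambda>y. enorm (H \<tau> y)) * ?L"
    proof (cases "0 < \<tau>")
      case True
      have "(\<integral>\<^sub>+y. enorm (H \<tau> y) * enorm (schroedinger \<tau> \<phi> y))
          \<le> L2norm lborel (\<lambda>y. enorm (H \<tau> y)) * L2norm lborel (\<lambda>y. enorm (schroedinger \<tau> \<phi> y))"
        by (rule Hoelder_L2) measurable
      also have "\<dots> \<le> L2norm lborel (\<lambda>y. enorm (H \<tau> y)) * ?L"
        by (intro mult_left_mono L2norm_schroedinger_le \<phi> True) simp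
      finally show ?thesis .
    qed (simp add: forward_zero[OF H])
  qed
  also have "\<dots> = energy_norm H * ?L"
    unfolding energy_norm_def
    by (intro nn_integral_multc borel_measurable_Lebesgue_norm[OF sigma_finite_lborel one_le_ennreal_2]) measurable
  also have "\<dots> < \<infinity>" using fin L2norm_schwartz_less_top[OF \<phi>] by (simp add: ennreal_mult_less_top)
  finally show "(\<integral>\<^sub>+z. enorm (schr_pair H \<phi> z)) < \<infinity>" .
  show "(\<lambda>z. schr_pair H \<phi> z) \<in> borel_measurable lborel"
    by measurable
qed

lemma integrable_mult_L2:
  fixes u \<phi> :: "'a::euclidean_space \<Rightarrow> complex"
  assumes [measurable]: "u \<in> borel_measurable borel" "\<phi> \<in> borel_measurable borel"
    and fin: "L2norm lborel (\<lambda>x. enorm (u x)) < top" "L2norm lborel (\<lambda>x. enorm (\<phi> x)) < top"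
  shows "integrable lborel (\<lambda>x. u x * \<phi> x)"
proof (rule integrableI_bounded)
  have "(\<integral>\<^sub>+x. enorm (u x * \<phi> x)) \<le> L2norm lborel (\<lambda>x. enorm (u x)) * L2norm lborel (\<lambda>x. enorm (\<phi> x))"
    unfolding norm_mult ennreal_mult[OF norm_ge_zero norm_ge_zero] by (rule Hoelder_L2) measurable
  also have "\<dots> < \<infinity>" using fin by (simp add: ennreal_mult_less_top)
  finally show "(\<integral>\<^sub>+x. enorm (u x * \<phi> x)) < \<infinity>" .
qed measurable

text \<open>For each truncation the identity is the kernel case. The left side converges by
  Cauchy-Schwarz, the right side by dominated convergence.\<close>

lemma schr_limit_energy_pairing:
  fixes H :: "real \<Rightarrow> 'a::euclidean_space \<Rightarrow> complex"
  assumes H: "forward H" and fin: "energy_norm H < top"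
  obtains v where "schr_limit H v" "L2norm lborel (\<lambda>x. enorm (v x)) \<le> energy_norm H"
    "\<And>\<phi>. \<phi> \<in> schwartz_space \<Longrightarrow> integrable lborel (\<lambda>x. v x * \<phi> x)"
    "\<And>\<phi>. \<phi> \<in> schwartz_space \<Longrightarrow> (\<integral>x. v x * \<phi> x \<partial>lborel) = (\<integral>z. schr_pair H \<phi> z \<partial>lborel)"
proof -
  obtain v where v: "schr_limit H v" "L2norm lborel (\<lambda>x. enorm (v x)) \<le> energy_norm H"
    and lim: "(\<lambda>n. L2norm lborel (\<lambda>x. enorm (schr_int (cut n H) x - v x))) \<longlonglongrightarrow> 0"
    using schr_limit_energy[OF H fin] by blast
  have vm [measurable]: "v \<in> borel_measurable borel" and kc: "kernel_norm (cut n H) < top" for n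
    using v(1) by (auto simp: schr_limit_def)
  note fc = forward_cut[OF H]
  have int: "integrable lborel (\<lambda>x. v x * \<phi> x)" if \<phi>: "\<phi> \<in> schwartz_space" for \<phi>
    using v(2) fin by (intro integrable_mult_L2 vm schwartz_borel[OF \<phi>] L2norm_schwartz_less_top[OF \<phi>]) (rule le_less_trans)
  have "(\<integral>x. v x * \<phi> x \<partial>lborel) = (\<integral>z. schr_pair H \<phi> z \<partial>lborel)" if \<phi>: "\<phi> \<in> schwartz_space" for \<phi>
  proof (rule LIMSEQ_unique)
    note [measurable] = forward_measurable_prod[OF H] forward_measurable_prod[OF fc] borel_measurable_schroedinger[OF \<phi>] schwartz_borel[OF \<phi>]
    have [measurable]: "schr_int (cut n H) \<in> borel_measurable borel" for n
      using borel_measurable_schr_int[OF fc, of "\<lambda>x. x"] by simp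
    let ?V = "\<lambda>n. \<integral>x. schr_int (cut n H) x * \<phi> x \<partial>lborel"
    let ?L = "L2norm lborel (\<lambda>x. enorm (\<phi> x))"
    have "(\<lambda>n. ?L * L2norm lborel (\<lambda>x. enorm (schr_int (cut n H) x - v x))) \<longlonglongrightarrow> ?L * 0"
      by (intro ennreal_tendsto_cmult L2norm_schwartz_less_top[OF \<phi>] lim)
    then have "(\<lambda>n. ?L * L2norm lborel (\<lambda>x. enorm (schr_int (cut n H) x - v x))) \<longlonglongrightarrow> 0" by simp
    then have "(\<lambda>n. enorm (?V n - (\<integral>x. v x * \<phi> x \<partial>lborel))) \<longlonglongrightarrow> 0"
    proof (rule tendsto_0_le_ennreal)
      fix n
      have "?V n - (\<integral>x. v x * \<phi> x \<partial>lborel) = (\<integral>x. \<phi> x * (schr_int (cut n H) x - v x) \<partial>lborel)"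
        using schroedinger_pairing_kernel(2)[OF fc kc \<phi>] int[OF \<phi>]
        by (subst Bochner_Integration.integral_diff[symmetric]) (auto simp: algebra_simps)
      then have "enorm (?V n - (\<integral>x. v x * \<phi> x \<partial>lborel)) \<le> (\<integral>\<^sub>+x. enorm (\<phi> x) * enorm (schr_int (cut n H) x - v x))"
        using ennreal_norm_integral_le[of lborel "\<lambda>x. \<phi> x * (schr_int (cut n H) x - v x)"]
        by (simp add: norm_mult ennreal_mult)
      also have "\<dots> \<le> ?L * L2norm lborel (\<lambda>x. enorm (schr_int (cut n H) x - v x))"
        by (rule Hoelder_L2) measurable
      finally show "enorm (?V n - (\<integral>x. v x * \<phi> x \<partial>lborel)) \<le> ?L * L2norm lborel (\<lambda>x. enorm (schr_int (cut n H) x - v x))" .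
    qed
    then have "(\<lambda>n. norm (?V n - (\<integral>x. v x * \<phi> x \<partial>lborel))) \<longlonglongrightarrow> 0"
      using tendsto_ennrealD[of "\<lambda>n. norm (?V n - (\<integral>x. v x * \<phi> x \<partial>lborel))" 0 sequentially] by simp
    then show "?V \<longlonglongrightarrow> (\<integral>x. v x * \<phi> x \<partial>lborel)"
      by (rule LIM_zero_cancel[OF tendsto_norm_zero_cancel])
    show "?V \<longlonglongrightarrow> (\<integral>z. schr_pair H \<phi> z \<partial>lborel)"
      unfolding schroedinger_pairing_kernel(3)[OF fc kc \<phi>]
    proof (rule integral_dominated_convergence[where w="\<lambda>z. norm (schr_pair H \<phi> z)"])
      show "integrable lborel (\<lambda>z. norm (schr_pair H \<phi> z))"
        by (rule integrable_norm[OF schroedinger_pairing_energy[OF H fin \<phi>]])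
      show "AE z in lborel. norm (cut n H (fst z) (snd z) * schroedinger (fst z) \<phi> (snd z)) \<le> norm (schr_pair H \<phi> z)" for n
        by (intro AE_I2) (auto simp: norm_mult intro!: mult_right_mono norm_cut_le)
      show "AE z in lborel. (\<lambda>n. cut n H (fst z) (snd z) * schroedinger (fst z) \<phi> (snd z)) \<longlonglongrightarrow> H (fst z) (snd z) * schroedinger (fst z) \<phi> (snd z)"
      proof (rule AE_I2)
        fix z
        show "(\<lambda>n. cut n H (fst z) (snd z) * schroedinger (fst z) \<phi> (snd z)) \<longlonglongrightarrow> H (fst z) (snd z) * schroedinger (fst z) \<phi> (snd z)"
          by (rule tendsto_eventually, rule eventually_mono[OF cut_tendsto[OF H, of "fst z" "snd z"]]) simp
      qed
    qed measurable
  qed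
  with v int show ?thesis using that by blast
qed

lemma rearr_L2_le:
  assumes [measurable]: "g \<in> borel_measurable lborel" and a: "0 < a"
  shows "rearr lborel g a \<le> ennreal (a powr (- 1 / 2)) * L2norm lborel g"
proof -
  have "ennreal a * ennreal_powr (rearr lborel g a) 2 \<le> (\<integral>\<^sub>+x. ennreal_powr (g x) 2)"
    by (rule rearr_Chebyshev[OF sigma_finite_lborel _ _ a]) auto
  then have "ennreal_powr (ennreal a * ennreal_powr (rearr lborel g a) 2) (1/2) \<le> L2norm lborel g"
    unfolding L2norm_eq ennreal_powr_2 by (intro ennreal_powr_mono) auto
  then have le: "ennreal (a powr (1/2)) * rearr lborel g a \<le> L2norm lborel g"
    using a by (simp add: ennreal_powr_mult ennreal_powr_powr ennreal_powr_ennreal)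
  have "ennreal (a powr (- 1 / 2)) * ennreal (a powr (1 / 2)) = 1"
    using a by (simp flip: ennreal_mult powr_add)
  then have "rearr lborel g a = ennreal (a powr (- 1 / 2)) * (ennreal (a powr (1 / 2)) * rearr lborel g a)"
    by (simp add: mult.assoc[symmetric])
  also have "\<dots> \<le> ennreal (a powr (- 1 / 2)) * L2norm lborel g" by (rule mult_left_mono[OF le]) simp
  finally show ?thesis .
qed

text \<open>The kernel part is bounded and merely shifts the rearrangement; the energy part is
  controlled by Chebyshev's inequality in L^2. In the application H1 and H2 are tailored to one
  particular a.\<close>

lemma schr_limit_split:
  fixes H1 H2 :: "real \<Rightarrow> 'a::euclidean_space \<Rightarrow> complex"
  assumes H1: "forward H1" "kernel_norm H1 < top" and H2: "forward H2" "energy_norm H2 < top"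
    and H: "H = (\<lambda>\<tau> y. H1 \<tau> y + H2 \<tau> y)"
  obtains v where "schr_limit H v"
    "\<And>a. 0 < a \<Longrightarrow> rearr lborel (\<lambda>x. enorm (v x)) a \<le> kernel_norm H1 + ennreal (a powr (- 1 / 2)) * energy_norm H2"
    "\<And>\<phi>. \<phi> \<in> schwartz_space \<Longrightarrow> integrable lborel (\<lambda>z. schr_pair H \<phi> z)"
    "\<And>\<phi>. \<phi> \<in> schwartz_space \<Longrightarrow> (\<integral>x. v x * \<phi> x \<partial>lborel) = (\<integral>z. schr_pair H \<phi> z \<partial>lborel)"
proof -
  obtain v2 where v2: "schr_limit H2 v2" "L2norm lborel (\<lambda>x. enorm (v2 x)) \<le> energy_norm H2"
    "\<And>\<phi>. \<phi> \<in> schwartz_space \<Longrightarrow> integrable lborel (\<lambda>x. v2 x * \<phi> x)"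
    "\<And>\<phi>. \<phi> \<in> schwartz_space \<Longrightarrow> (\<integral>x. v2 x * \<phi> x \<partial>lborel) = (\<integral>z. schr_pair H2 \<phi> z \<partial>lborel)"
    using schr_limit_energy_pairing[OF H2] by blast
  let ?v = "\<lambda>x. schr_int H1 x + v2 x"
  have [measurable]: "v2 \<in> borel_measurable borel" using v2(1) by (simp add: schr_limit_def)
  have [measurable]: "schr_int H1 \<in> borel_measurable borel"
    using borel_measurable_schr_int[OF H1(1), of "\<lambda>x. x"] by simp
  have eq: "schr_pair H \<phi> z
    = schr_pair H1 \<phi> z + H2 (fst z) (snd z) * schroedinger (fst z) \<phi> (snd z)" for z \<phi>
    by (simp add: H distrib_right)
  show ?thesis
  proof
    show "schr_limit H ?v"
      unfolding H by (rule schr_limit_add[OF schr_limit_kernel[OF H1] v2(1)])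
    show "rearr lborel (\<lambda>x. enorm (?v x)) a \<le> kernel_norm H1 + ennreal (a powr (- 1 / 2)) * energy_norm H2" if a: "0 < a" for a
    proof -
      have "rearr lborel (\<lambda>x. enorm (?v x)) a \<le> kernel_norm H1 + rearr lborel (\<lambda>x. enorm (v2 x)) a"
      proof (rule rearr_le_add)
        show "AE x in lborel. enorm (?v x) \<le> kernel_norm H1 + enorm (v2 x)"
        proof (rule AE_I2)
          fix x
          have "enorm (?v x) \<le> enorm (schr_int H1 x) + enorm (v2 x)"
            by (simp flip: ennreal_plus add: ennreal_leI norm_triangle_ineq)
          also have "\<dots> \<le> kernel_norm H1 + enorm (v2 x)" by (intro add_right_mono norm_schr_int_le H1)
          finally show "enorm (?v x) \<le> kernel_norm H1 + enorm (v2 x)" .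
        qed
      qed measurable
      also have "rearr lborel (\<lambda>x. enorm (v2 x)) a \<le> ennreal (a powr (- 1 / 2)) * L2norm lborel (\<lambda>x. enorm (v2 x))"
        by (rule rearr_L2_le[OF _ a]) measurable
      also have "\<dots> \<le> ennreal (a powr (- 1 / 2)) * energy_norm H2" by (intro mult_left_mono v2) simp
      finally show ?thesis by (simp add: add_left_mono)
    qed
    fix \<phi> :: "'a \<Rightarrow> complex" assume \<phi>: "\<phi> \<in> schwartz_space"
    show "integrable lborel (\<lambda>z. schr_pair H \<phi> z)"
      unfolding eq by (intro Bochner_Integration.integrable_add schroedinger_pairing_kernel(1)[OF H1 \<phi>] schroedinger_pairing_energy[OF H2 \<phi>])
    show "(\<integral>x. ?v x * \<phi> x \<partial>lborel) = (\<integral>z. schr_pair H \<phi> z \<partial>lborel)"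
      unfolding eq distrib_right
      by (simp add: schroedinger_pairing_kernel[OF H1 \<phi>] schroedinger_pairing_energy[OF H2 \<phi>] v2 \<phi>)
  qed
qed

subsection \<open>The Lorentz estimate for time integrals of the group\<close>

lemma nn_integral_powr_0:
  assumes "-1 < (a::real)"
  shows "(\<integral>\<^sub>+\<theta>. indicator {0<..<1} \<theta> * ennreal (\<theta> powr a)) < top"
proof -
  have "(\<integral>\<^sub>+\<theta>. indicator {0<..<1} \<theta> * ennreal (\<theta> powr a)) \<le> (\<integral>\<^sub>+\<theta>. ennreal (indicator {0..1} \<theta> * \<theta> powr a))"
    by (intro nn_integral_mono) (auto simp: indicator_def)
  also have "\<dots> = ennreal (1 powr (a + 1) / (a + 1))"
    by (rule nn_integral_has_integral_lebesgue[OF _ has_integral_powr_from_0]) (use assms in auto)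
  also have "\<dots> < top" by simp
  finally show ?thesis .
qed

lemma nn_integral_powr_inf:
  assumes "(a::real) < -1" "0 < c"
  shows "(\<integral>\<^sub>+\<theta>. indicator {c<..} \<theta> * ennreal (\<theta> powr a)) < top"
proof -
  have "(\<integral>\<^sub>+\<theta>. indicator {c<..} \<theta> * ennreal (\<theta> powr a)) \<le> (\<integral>\<^sub>+\<theta>. ennreal (indicator {c..} \<theta> * \<theta> powr a))"
    by (intro nn_integral_mono) (auto simp: indicator_def)
  also have "\<dots> = ennreal (-(c powr (a + 1)) / (a + 1))"
    by (rule nn_integral_has_integral_lebesgue[OF _ has_integral_powr_to_inf]) (use assms in auto)
  also have "\<dots> < top" by simp
  finally show ?thesis .
qed

lemma ennreal_mult_assoc:
  "0 \<le> A \<Longrightarrow> 0 \<le> B \<Longrightarrow> ennreal A * (ennreal B * x) = ennreal (A * B) * x"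
  by (simp add: ennreal_mult mult.assoc)

text \<open>The weight of the dilation \<theta> once c = b \<theta> is substituted in the two
  truncation bounds: the interval (0, 1) comes from the excess above the height, the tail beyond 1/2
  with its factor 3 from the square-integrable part.\<close>

definition disp_weight :: "real \<Rightarrow> real" where
  "disp_weight \<theta> = indicator {0<..<1} \<theta> + 3 * (indicator {1/2<..} \<theta> * \<theta> powr (- 1 / 2))"

lemma disp_weight_nonneg: "0 \<le> disp_weight \<theta>"
  by (simp add: disp_weight_def)

lemma disp_weight_nonpos: "\<theta> \<le> 0 \<Longrightarrow> disp_weight \<theta> = 0"
  by (simp add: disp_weight_def)

lemma borel_measurable_disp_weight [measurable]: "disp_weight \<in> borel_measurable borel"
  unfolding disp_weight_def[abs_def] by measurable

definition disp_const :: "real \<Rightarrow> ennreal" where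
  "disp_const P = (\<integral>\<^sub>+\<theta>. ennreal (disp_weight \<theta> * \<theta> powr (- (1 - 1 / P))))"

text \<open>The exponent 1 - 1 / P is the reciprocal of the conjugate exponent. It is below 1, which
  gives convergence at 0, and above 1/2 since P > 2, which brings the total power at infinity below
  -1.\<close>

lemma disp_const_less_top:
  assumes P: "2 < P"
  shows "disp_const P < top"
proof -
  define b where "b = 1 - 1 / P"
  have b: "1/2 < b" "b < 1" using P by (auto simp: b_def field_simps)
  have "disp_const P = (\<integral>\<^sub>+\<theta>. indicator {0<..<1} \<theta> * ennreal (\<theta> powr (- b)) + 3 * (indicator {1/2<..} \<theta> * ennreal (\<theta> powr (- 1 / 2 - b))))"
    unfolding disp_const_def b_def[symmetric]
  proof (intro nn_integral_cong)
    fix \<theta> :: real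
    show "ennreal (disp_weight \<theta> * \<theta> powr (- b)) = indicator {0<..<1} \<theta> * ennreal (\<theta> powr (- b)) + 3 * (indicator {1/2<..} \<theta> * ennreal (\<theta> powr (- 1 / 2 - b)))"
    proof -
      have p: "\<theta> powr (- 1 / 2) * \<theta> powr (- b) = \<theta> powr (- 1 / 2 - b)"
        by (simp flip: powr_add)
      have "disp_weight \<theta> * \<theta> powr (- b) = indicator {0<..<1} \<theta> * \<theta> powr (- b) + 3 * (indicator {1/2<..} \<theta> * \<theta> powr (- 1 / 2 - b))"
        unfolding disp_weight_def distrib_right mult.assoc p ..
      then show ?thesis by (auto simp: indicator_def ennreal_mult)
    qed
  qed
  also have "\<dots> = (\<integral>\<^sub>+\<theta>. indicator {0<..<1} \<theta> * ennreal (\<theta> powr (- b))) + 3 * (\<integral>\<^sub>+\<theta>. indicator {1/2<..} \<theta> * ennreal (\<theta> powr (- 1 / 2 - b)))"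
    by (subst nn_integral_add) (auto simp: nn_integral_cmult)
  also have "\<dots> < top"
    using nn_integral_powr_0[of "- b"] nn_integral_powr_inf[of "- 1 / 2 - b" "1/2"] b
    by (auto simp: ennreal_mult_less_top)
  finally show ?thesis .
qed

text \<open>Truncation of the modulus at the height \<open>lev\<close> with the phase kept:
  multiplication by a real factor, which lies in [0, 1] when \<open>lev\<close> is
  nonnegative.\<close>

definition low :: "(real \<Rightarrow> real) \<Rightarrow> (real \<Rightarrow> 'a \<Rightarrow> complex) \<Rightarrow> real \<Rightarrow> 'a \<Rightarrow> complex" where
  "low lev H \<tau> y = H \<tau> y * of_real (min 1 (lev \<tau> / norm (H \<tau> y)))"

definition high :: "(real \<Rightarrow> real) \<Rightarrow> (real \<Rightarrow> 'a \<Rightarrow> complex) \<Rightarrow> real \<Rightarrow> 'a \<Rightarrow> complex" where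
  "high lev H \<tau> y = H \<tau> y - low lev H \<tau> y"

lemma norm_low:
  assumes "0 \<le> lev \<tau>"
  shows "norm (low lev H \<tau> y) = min (norm (H \<tau> y)) (lev \<tau>)"
proof (cases "H \<tau> y = 0")
  case False
  then have "norm (H \<tau> y) * min 1 (lev \<tau> / norm (H \<tau> y)) = min (norm (H \<tau> y)) (lev \<tau>)"
    by (simp add: min_mult_distrib_left)
  moreover have "0 \<le> min 1 (lev \<tau> / norm (H \<tau> y))" using assms by simp
  ultimately show ?thesis by (simp add: low_def norm_mult)
qed (use assms in \<open>simp add: low_def\<close>)

lemma norm_high:
  assumes "0 \<le> lev \<tau>"
  shows "enorm (high lev H \<tau> y) = enorm (H \<tau> y) - ennreal (lev \<tau>)"
proof (cases "H \<tau> y = 0")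
  case False
  define m where "m = min 1 (lev \<tau> / norm (H \<tau> y))"
  have m: "0 \<le> m" "m \<le> 1" using assms by (auto simp: m_def)
  have "high lev H \<tau> y = H \<tau> y * of_real (1 - m)"
    by (simp add: high_def low_def m_def algebra_simps)
  then have "norm (high lev H \<tau> y) = norm (H \<tau> y) * (1 - m)"
    using m by (simp only: norm_mult norm_of_real)
  also have "\<dots> = norm (H \<tau> y) - min (norm (H \<tau> y)) (lev \<tau>)"
    using False by (simp add: m_def right_diff_distrib min_mult_distrib_left)
  finally show ?thesis
    using assms by (auto simp: ennreal_minus min_def ennreal_neg)
qed (use assms in \<open>simp add: high_def low_def ennreal_minus ennreal_neg\<close>)

lemma forward_low:
  assumes H: "forward H" and [measurable]: "lev \<in> borel_measurable borel"
  shows "forward (low lev H)"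
proof (rule forwardI)
  note [measurable] = forward_measurable[OF H]
  show "(\<lambda>z. low lev H (fst z) (snd z)) \<in> borel_measurable (borel \<Otimes>\<^sub>M borel)"
    unfolding low_def by measurable
qed (simp add: low_def forward_zero[OF H])

lemma forward_high: "forward H \<Longrightarrow> lev \<in> borel_measurable borel \<Longrightarrow> forward (high lev H)"
  unfolding high_def[abs_def] by (intro forward_diff forward_low)

lemma rearr_zero [simp]: "rearr M (\<lambda>_. 0) t = 0"
proof -
  have "rearr M (\<lambda>_. 0 :: ennreal) t \<le> 0" by (subst rearr_le_iff) auto
  then show ?thesis by simp
qed

abbreviation section_rearr :: "(real \<Rightarrow> 'a::euclidean_space \<Rightarrow> complex) \<Rightarrow> real \<Rightarrow> real \<Rightarrow> ennreal" where
  "section_rearr H \<tau> \<equiv> rearr lborel (\<lambda>y. enorm (H \<tau> y))"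

lemma borel_measurable_section_rearr:
  assumes H: "forward H"
  shows "(\<lambda>(\<tau>, c). section_rearr H \<tau> c) \<in> borel_measurable (borel \<Otimes>\<^sub>M borel)"
proof -
  note [measurable] = forward_measurable[OF H]
  show ?thesis by (rule borel_measurable_rearr_pair[OF sigma_finite_lborel]) measurable
qed

lemma section_rearr_nonpos: "forward H \<Longrightarrow> \<tau> \<le> 0 \<Longrightarrow> section_rearr H \<tau> c = 0"
  by (simp add: forward_zero)

lemma borel_measurable_lorentz_section:
  assumes H: "forward H" and q: "1 \<le> q"
  shows "(\<lambda>\<tau>. lorentz_fun P q (section_rearr H \<tau>)) \<in> borel_measurable borel"
proof -
  note [measurable] = borel_measurable_section_rearr[OF H]
  show ?thesis unfolding lorentz_fun_def
    by (rule borel_measurable_Lebesgue_norm[OF sigma_finite_lborel q]) measurable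
qed

text \<open>The bound of \<open>schr_limit_split\<close> for the splitting adapted to a, written as
  an integral over dilations of the section rearrangements, which is the form that Minkowski's
  inequality accepts.\<close>

definition disp_majorant :: "(real \<Rightarrow> 'a::euclidean_space \<Rightarrow> complex) \<Rightarrow> real \<Rightarrow> ennreal" where
  "disp_majorant H a = (\<integral>\<^sub>+\<tau>. \<integral>\<^sub>+\<theta>. ennreal (disp_weight \<theta> * (\<tau> powr (DIM('a) / 2) / a)) * section_rearr H \<tau> (\<tau> powr DIM('a) / a * \<theta>))"

text \<open>After the substitution c = b \<theta> the excess and the square-integrable part become
  integrals over \<theta>; \<open>w1\<close> and \<open>w2\<close> show that the common value W
  bounds both prefactors.\<close>

lemma split_section_le:
  fixes H :: "real \<Rightarrow> 'a::euclidean_space \<Rightarrow> complex"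
  assumes H: "forward H" and \<tau>: "0 < \<tau>" and a: "0 < a"
    and lev: "lev \<tau> = enn2real (section_rearr H \<tau> (\<tau> powr DIM('a) / a))"
    and fin: "section_rearr H \<tau> (\<tau> powr DIM('a) / a) < top"
  shows "ennreal ((4 * pi * \<tau>) powr (- DIM('a) / 2)) * (\<integral>\<^sub>+y. enorm (high lev H \<tau> y))
      + ennreal (a powr (- 1 / 2)) * L2norm lborel (\<lambda>y. enorm (low lev H \<tau> y))
    \<le> (\<integral>\<^sub>+\<theta>. ennreal (disp_weight \<theta> * (\<tau> powr (DIM('a) / 2) / a)) * section_rearr H \<tau> (\<tau> powr DIM('a) / a * \<theta>))"
proof -
  define b where "b = \<tau> powr DIM('a) / a"
  have b: "0 < b" using \<tau> a by (simp add: b_def)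
  let ?m = "section_rearr H \<tau>"
  have [measurable]: "H \<tau> \<in> borel_measurable borel" by (rule forward_section[OF H])
  have lev0: "0 \<le> lev \<tau>" by (simp add: lev)
  have lev_eq: "ennreal (lev \<tau>) = ?m b" using fin by (simp add: lev b_def)
  let ?I0 = "\<integral>\<^sup>+\<theta>. indicator {0<..<1} \<theta> * ?m (b * \<theta>) \<partial>lborel"
  let ?I1 = "\<integral>\<^sup>+\<theta>. indicator {1/2<..} \<theta> * (ennreal (\<theta> powr (- 1 / 2)) * ?m (b * \<theta>)) \<partial>lborel"
  have "(\<integral>\<^sub>+y. enorm (high lev H \<tau> y)) = (\<integral>\<^sub>+y. enorm (H \<tau> y) - ennreal (lev \<tau>))"
    by (simp add: norm_high[where lev=lev and \<tau>=\<tau>, OF lev0])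
  also have "\<dots> \<le> (\<integral>\<^sub>+c. indicator {0<..<b} c * ?m c)"
    by (rule nn_integral_diff_rearr_le[OF sigma_finite_lborel]) (use lev_eq lev0 in auto)
  also have "\<dots> = ennreal b * ?I0"
    using b by (subst nn_integral_real_affine[where c=b and t=0])
      (auto intro!: nn_integral_cong arg_cong2[where f="(*)"] simp: indicator_def zero_less_mult_iff)
  finally have 1: "(\<integral>\<^sub>+y. enorm (high lev H \<tau> y)) \<le> ennreal b * ?I0" .
  have "(\<integral>\<^sub>+y. enorm (low lev H \<tau> y) * enorm (low lev H \<tau> y)) = (\<integral>\<^sub>+y. ennreal_powr (min (enorm (H \<tau> y)) (ennreal (lev \<tau>))) 2)"
    by (simp add: norm_low[where lev=lev and \<tau>=\<tau>, OF lev0] ennreal_powr_2 min_ennreal lev0)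
  also have "\<dots> \<le> ennreal_powr (3 * (\<integral>\<^sub>+c. indicator {b / 2<..} c * (ennreal (c powr (- 1 / 2)) * ?m c))) 2"
    by (rule nn_integral_min_rearr_le[OF sigma_finite_lborel _ b]) (use lev_eq in auto)
  finally have "ennreal_powr (\<integral>\<^sub>+y. enorm (low lev H \<tau> y) * enorm (low lev H \<tau> y)) (1/2)
      \<le> ennreal_powr (ennreal_powr (3 * (\<integral>\<^sub>+c. indicator {b / 2<..} c * (ennreal (c powr (- 1 / 2)) * ?m c))) 2) (1/2)"
    by (intro ennreal_powr_mono) auto
  then have "L2norm lborel (\<lambda>y. enorm (low lev H \<tau> y)) \<le> 3 * (\<integral>\<^sub>+c. indicator {b / 2<..} c * (ennreal (c powr (- 1 / 2)) * ?m c))"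
    by (simp add: L2norm_eq ennreal_powr_powr)
  also have "(\<integral>\<^sub>+c. indicator {b / 2<..} c * (ennreal (c powr (- 1 / 2)) * ?m c)) = ennreal (b powr (1 / 2)) * ?I1"
  proof -
    have "(\<integral>\<^sub>+c. indicator {b / 2<..} c * (ennreal (c powr (- 1 / 2)) * ?m c))
        = ennreal b * (\<integral>\<^sub>+\<theta>. indicator {b / 2<..} (b * \<theta>) * (ennreal ((b * \<theta>) powr (- 1 / 2)) * ?m (b * \<theta>)))"
      using b by (subst nn_integral_real_affine[where c=b and t=0]) auto
    also have "(\<integral>\<^sub>+\<theta>. indicator {b / 2<..} (b * \<theta>) * (ennreal ((b * \<theta>) powr (- 1 / 2)) * ?m (b * \<theta>)))
        = (\<integral>\<^sub>+\<theta>. ennreal (b powr (- 1 / 2)) * (indicator {1/2<..} \<theta> * (ennreal (\<theta> powr (- 1 / 2)) * ?m (b * \<theta>))))"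
    proof (intro nn_integral_cong)
      fix \<theta> :: real
      show "indicator {b / 2<..} (b * \<theta>) * (ennreal ((b * \<theta>) powr (- 1 / 2)) * ?m (b * \<theta>))
        = ennreal (b powr (- 1 / 2)) * (indicator {1/2<..} \<theta> * (ennreal (\<theta> powr (- 1 / 2)) * ?m (b * \<theta>)))"
      proof (cases "1/2 < \<theta>")
        case True
        then have "b / 2 < b * \<theta>" using b by simp
        then show ?thesis using True b by (simp add: powr_mult ennreal_mult mult.assoc)
      next
        case False
        then have "\<not> b / 2 < b * \<theta>" using b by simp
        then show ?thesis using False by simp
      qed
    qed
    also have "\<dots> = ennreal (b powr (- 1 / 2)) * ?I1" by (rule nn_integral_cmult) measurable
    also have "ennreal b * (ennreal (b powr (- 1 / 2)) * ?I1) = ennreal (b powr (1/2)) * ?I1"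
    proof -
      have "b * b powr (- 1 / 2) = b powr (1/2)" using b powr_add[of b 1 "- 1/2"] by simp
      then show ?thesis using b by (simp add: mult.assoc[symmetric] flip: ennreal_mult)
    qed
    finally show ?thesis .
  qed
  finally have 2: "L2norm lborel (\<lambda>y. enorm (low lev H \<tau> y)) \<le> 3 * (ennreal (b powr (1 / 2)) * ?I1)" .
  define W where "W = \<tau> powr (DIM('a) / 2) / a"
  have W: "0 \<le> W" using \<tau> a by (simp add: W_def)
  have w1: "(4 * pi * \<tau>) powr (- DIM('a) / 2) * b \<le> W"
  proof -
    have "1 * \<tau> \<le> 4 * pi * \<tau>" using pi_gt3 \<tau> by (intro mult_right_mono) auto
    then have "(4 * pi * \<tau>) powr (- DIM('a) / 2) * b \<le> \<tau> powr (- DIM('a) / 2) * b"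
      using \<tau> b by (intro mult_right_mono powr_mono2') auto
    also have "\<dots> = W" using \<tau> by (simp add: b_def W_def flip: powr_add)
    finally show ?thesis .
  qed
  have w2: "a powr (- 1 / 2) * b powr (1 / 2) = W"
  proof -
    have aa: "a powr (1 / 2) * a powr (1 / 2) = a" using a by (simp flip: powr_add)
    have "a powr (- 1 / 2) = 1 / a powr (1 / 2)" using powr_minus_divide[of a "1/2"] by simp
    moreover have "b powr (1 / 2) = \<tau> powr (DIM('a) / 2) / a powr (1 / 2)"
      unfolding b_def using \<tau> a by (subst powr_divide) (auto simp: powr_powr)
    ultimately show ?thesis unfolding W_def by (simp add: aa)
  qed
  have "ennreal ((4 * pi * \<tau>) powr (- DIM('a) / 2)) * (\<integral>\<^sub>+y. enorm (high lev H \<tau> y))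
      + ennreal (a powr (- 1 / 2)) * L2norm lborel (\<lambda>y. enorm (low lev H \<tau> y))
    \<le> ennreal ((4 * pi * \<tau>) powr (- DIM('a) / 2)) * (ennreal b * ?I0) + ennreal (a powr (- 1 / 2)) * (3 * (ennreal (b powr (1 / 2)) * ?I1))"
    by (intro add_mono mult_left_mono 1 2) auto
  also have "\<dots> = ennreal ((4 * pi * \<tau>) powr (- DIM('a) / 2) * b) * ?I0 + ennreal (a powr (- 1 / 2) * b powr (1 / 2)) * (3 * ?I1)"
    using b by (simp add: ennreal_mult ac_simps)
  also have "\<dots> \<le> ennreal W * ?I0 + ennreal W * (3 * ?I1)"
    unfolding w2 by (intro add_right_mono mult_right_mono ennreal_leI w1) auto
  also have "\<dots> = (\<integral>\<^sub>+\<theta>. ennreal W * (indicator {0<..<1} \<theta> * ?m (b * \<theta>)) + ennreal W * (3 * (indicator {1/2<..} \<theta> * (ennreal (\<theta> powr (- 1 / 2)) * ?m (b * \<theta>)))))"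
    by (subst nn_integral_add) (auto simp: nn_integral_cmult)
  also have "\<dots> = (\<integral>\<^sub>+\<theta>. ennreal (disp_weight \<theta> * W) * ?m (b * \<theta>))"
  proof (intro nn_integral_cong)
    fix \<theta> :: real
    have "ennreal (disp_weight \<theta>) = indicator {0<..<1} \<theta> + 3 * (indicator {1/2<..} \<theta> * ennreal (\<theta> powr (- 1 / 2)))"
      by (auto simp: disp_weight_def indicator_def ennreal_mult)
    then show "ennreal W * (indicator {0<..<1} \<theta> * ?m (b * \<theta>)) + ennreal W * (3 * (indicator {1/2<..} \<theta> * (ennreal (\<theta> powr (- 1 / 2)) * ?m (b * \<theta>))))
      = ennreal (disp_weight \<theta> * W) * ?m (b * \<theta>)"
      using disp_weight_nonneg[of \<theta>] W by (simp add: ennreal_mult distrib_right distrib_left ac_simps)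
  qed
  finally show ?thesis by (simp add: W_def b_def)
qed

text \<open>In logarithmic variables a to \<beta> / a is a reflection followed by a translation, so
  a norm in a of \<phi> (\<beta> / a) is again a Lorentz functional of \<phi>, with the exponent
  read off the weight.\<close>

lemma Lebesgue_norm_inversion:
  assumes [measurable]: "\<phi> \<in> borel_measurable borel" and q: "1 \<le> q" and \<beta>: "0 < \<beta>"
  shows "Lebesgue_norm lborel q (\<lambda>x. ennreal (exp (- x / P)) * \<phi> (\<beta> * exp (- x))) = ennreal (\<beta> powr (- 1 / P)) * lorentz_fun P q \<phi>"
proof -
  have "Lebesgue_norm lborel q (\<lambda>x. ennreal (exp ((0 + - 1 * x) / P)) * \<phi> (\<beta> * exp (0 + - 1 * x))) = lorentz_fun P q (\<lambda>t. \<phi> (\<beta> * t))"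
    unfolding lorentz_fun_def
    by (rule Lebesgue_norm_translate[where g="\<lambda>x. ennreal (exp (x / P)) * \<phi> (\<beta> * exp x)", OF _ q]) auto
  then show ?thesis by (simp add: lorentz_fun_dilation[OF _ q \<beta>])
qed

definition disp_mass :: "real \<Rightarrow> ennreal \<Rightarrow> (real \<Rightarrow> 'a::euclidean_space \<Rightarrow> complex) \<Rightarrow> ennreal" where
  "disp_mass P q H = (\<integral>\<^sub>+\<tau>. ennreal (\<tau> powr (- (DIM('a) / 2 - DIM('a) / P))) * lorentz_fun (P / (P - 1)) q (section_rearr H \<tau>))"

text \<open>The origin of the decay rate: N/2 - N (1 - 1/P) = - (N/2 - N/P).\<close>

lemma disp_exponent:
  assumes "0 < \<tau>" "0 < \<theta>" "2 < P"
  shows "\<tau> powr (real n / 2) * (\<tau> powr real n * \<theta>) powr (- 1 / (P / (P - 1))) = \<tau> powr (- (n / 2 - n / P)) * \<theta> powr (- (1 - 1 / P))"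
proof -
  have e: "- 1 / (P / (P - 1)) = - (1 - 1 / P)" using assms by (simp add: field_simps)
  have "\<tau> powr (real n / 2) * (\<tau> powr real n) powr (- (1 - 1 / P)) = \<tau> powr (- (n / 2 - n / P))"
    unfolding powr_powr powr_add[symmetric] by (rule arg_cong[where f="\<lambda>e. \<tau> powr e"]) (use assms in \<open>simp add: field_simps\<close>)
  then show ?thesis using assms unfolding e by (simp add: powr_mult mult.assoc[symmetric])
qed

lemma Lebesgue_norm_zero:
  assumes "1 \<le> q" shows "Lebesgue_norm M q (\<lambda>_. 0) = 0"
  using assms
proof (cases rule: exponent_cases)
  case top
  have "esssup M (\<lambda>_. 0 :: ennreal) \<le> 0" by (intro esssup_I) auto
  then show ?thesis using top by (simp add: Lebesgue_norm_top)
qed (simp add: Lebesgue_norm_ennreal)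

text \<open>Minkowski's inequality in \<tau> and \<theta> reduces the claim to a single dilation.
  There the weight exp (x / P) and the factor exp (- x) coming from 1 / a combine to exp (- x / P')
  with P' conjugate to P, so the inversion produces the norm of L^(P',q).\<close>

lemma lorentz_disp_majorant_le:
  fixes H :: "real \<Rightarrow> 'a::euclidean_space \<Rightarrow> complex"
  assumes H: "forward H" and P: "2 < P" and q: "1 \<le> q"
  shows "lorentz_fun P q (disp_majorant H) \<le> disp_const P * disp_mass P q H"
proof -
  note [measurable] = borel_measurable_section_rearr[OF H] borel_measurable_lorentz_section[OF H q]
  let ?P = "P / (P - 1)"
  let ?F = "\<lambda>\<tau> \<theta> x. ennreal (exp (x / P)) * (ennreal (disp_weight \<theta> * (\<tau> powr (DIM('a) / 2) / exp x)) * section_rearr H \<tau> (\<tau> powr DIM('a) / exp x * \<theta>))"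
  have "lorentz_fun P q (disp_majorant H) = Lebesgue_norm lborel q (\<lambda>x. \<integral>\<^sub>+\<tau>. \<integral>\<^sub>+\<theta>. ?F \<tau> \<theta> x)"
    unfolding lorentz_fun_def disp_majorant_def by (simp add: nn_integral_cmult)
  also have "\<dots> \<le> (\<integral>\<^sub>+\<tau>. Lebesgue_norm lborel q (\<lambda>x. \<integral>\<^sub>+\<theta>. ?F \<tau> \<theta> x))"
    by (rule Minkowski_nn_integral[OF sigma_finite_lborel sigma_finite_lborel q]) measurable
  also have "\<dots> \<le> (\<integral>\<^sub>+\<tau>. \<integral>\<^sub>+\<theta>. Lebesgue_norm lborel q (\<lambda>x. ?F \<tau> \<theta> x))"
    by (intro nn_integral_mono Minkowski_nn_integral[OF sigma_finite_lborel sigma_finite_lborel q]) measurable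
  also have "\<dots> = (\<integral>\<^sub>+\<tau>. \<integral>\<^sub>+\<theta>. ennreal (disp_weight \<theta> * \<theta> powr (- (1 - 1 / P))) * (ennreal (\<tau> powr (- (DIM('a) / 2 - DIM('a) / P))) * lorentz_fun ?P q (section_rearr H \<tau>)))"
  proof (intro nn_integral_cong)
    fix \<tau> \<theta> :: real
    show "Lebesgue_norm lborel q (\<lambda>x. ?F \<tau> \<theta> x) = ennreal (disp_weight \<theta> * \<theta> powr (- (1 - 1 / P))) * (ennreal (\<tau> powr (- (DIM('a) / 2 - DIM('a) / P))) * lorentz_fun ?P q (section_rearr H \<tau>))"
    proof (cases "0 < \<tau> \<and> 0 < \<theta>")
      case True
      have [measurable]: "section_rearr H \<tau> \<in> borel_measurable borel" by measurable
      have "?F \<tau> \<theta> x = ennreal (disp_weight \<theta> * \<tau> powr (DIM('a) / 2)) * (ennreal (exp (- x / ?P)) * section_rearr H \<tau> (\<tau> powr DIM('a) * \<theta> * exp (- x)))" for x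
      proof -
        have "x / P - x = - x / ?P" using P by (simp add: field_simps)
        then have e: "exp (x / P) * (1 / exp x) = exp (- x / ?P)" by (simp add: exp_diff[symmetric])
        have "exp (x / P) * (disp_weight \<theta> * (\<tau> powr (DIM('a) / 2) / exp x)) = disp_weight \<theta> * \<tau> powr (DIM('a) / 2) * (exp (x / P) * (1 / exp x))"
          by simp
        then have "exp (x / P) * (disp_weight \<theta> * (\<tau> powr (DIM('a) / 2) / exp x)) = disp_weight \<theta> * \<tau> powr (DIM('a) / 2) * exp (- x / ?P)"
          unfolding e .
        then have "ennreal (exp (x / P)) * ennreal (disp_weight \<theta> * (\<tau> powr (DIM('a) / 2) / exp x)) = ennreal (disp_weight \<theta> * \<tau> powr (DIM('a) / 2)) * ennreal (exp (- x / ?P))"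
          using disp_weight_nonneg[of \<theta>] by (subst (1 2) ennreal_mult[symmetric]) auto
        moreover have "\<tau> powr DIM('a) / exp x * \<theta> = \<tau> powr DIM('a) * \<theta> * exp (- x)"
          by (simp add: exp_minus divide_inverse)
        ultimately show ?thesis by (simp only: mult.assoc[symmetric])
      qed
      then have "Lebesgue_norm lborel q (\<lambda>x. ?F \<tau> \<theta> x)
          = Lebesgue_norm lborel q (\<lambda>x. ennreal (disp_weight \<theta> * \<tau> powr (DIM('a) / 2)) * (ennreal (exp (- x / ?P)) * section_rearr H \<tau> (\<tau> powr DIM('a) * \<theta> * exp (- x))))"
        by (simp only:)
      also have "\<dots> = ennreal (disp_weight \<theta> * \<tau> powr (DIM('a) / 2)) * Lebesgue_norm lborel q (\<lambda>x. ennreal (exp (- x / ?P)) * section_rearr H \<tau> (\<tau> powr DIM('a) * \<theta> * exp (- x)))"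
        using disp_weight_nonneg[of \<theta>] by (intro Lebesgue_norm_cmult[OF _ q]) auto
      also have "Lebesgue_norm lborel q (\<lambda>x. ennreal (exp (- x / ?P)) * section_rearr H \<tau> (\<tau> powr DIM('a) * \<theta> * exp (- x)))
          = ennreal ((\<tau> powr DIM('a) * \<theta>) powr (- 1 / ?P)) * lorentz_fun ?P q (section_rearr H \<tau>)"
        using True by (intro Lebesgue_norm_inversion[OF _ q]) auto
      also have "ennreal (disp_weight \<theta> * \<tau> powr (DIM('a) / 2)) * (ennreal ((\<tau> powr DIM('a) * \<theta>) powr (- 1 / ?P)) * lorentz_fun ?P q (section_rearr H \<tau>))
        = ennreal (disp_weight \<theta> * (\<tau> powr (DIM('a) / 2) * (\<tau> powr DIM('a) * \<theta>) powr (- 1 / ?P))) * lorentz_fun ?P q (section_rearr H \<tau>)"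
        using disp_weight_nonneg[of \<theta>] unfolding mult.assoc[symmetric] by (subst ennreal_mult[symmetric]) (auto simp: mult.assoc)
      also have "\<dots> = ennreal (disp_weight \<theta> * (\<tau> powr (- (DIM('a) / 2 - DIM('a) / P)) * \<theta> powr (- (1 - 1 / P)))) * lorentz_fun ?P q (section_rearr H \<tau>)"
        using True P by (subst disp_exponent) auto
      also have "\<dots> = ennreal (disp_weight \<theta> * \<theta> powr (- (1 - 1 / P))) * (ennreal (\<tau> powr (- (DIM('a) / 2 - DIM('a) / P))) * lorentz_fun ?P q (section_rearr H \<tau>))"
        using disp_weight_nonneg[of \<theta>] by (simp add: ennreal_mult ac_simps)
      finally show ?thesis .
    next
      case False
      then show ?thesis
        by (auto simp: not_less disp_weight_nonpos section_rearr_nonpos[OF H] lorentz_fun_def Lebesgue_norm_zero[OF q])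
    qed
  qed
  also have "\<dots> = disp_const P * disp_mass P q H"
    unfolding disp_const_def disp_mass_def by (simp add: nn_integral_multc nn_integral_cmult)
  finally show ?thesis .
qed

lemma rearr_le_lorentz:
  assumes [measurable]: "g \<in> borel_measurable M" and q: "1 \<le> q" and "0 < P" "0 < t"
  shows "rearr M g t \<le> ennreal (exp (1 / P) * t powr (- 1 / P)) * lorentz_fun P q (rearr M g)"
  using assms by (intro lorentz_fun_pointwise rearr_antimono) auto

text \<open>The splitting at a given a requires finite norms of both parts, hence finiteness at
  every single a. The weak-type bound on the section rearrangements provides it, with the same
  integrals in \<tau> and \<theta>.\<close>

lemma disp_majorant_less_top:
  fixes H :: "real \<Rightarrow> 'a::euclidean_space \<Rightarrow> complex"
  assumes H: "forward H" and P: "2 < P" and q: "1 \<le> q" and a: "0 < a" and fin: "disp_mass P q H < top"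
  shows "disp_majorant H a < top"
proof -
  note [measurable] = borel_measurable_section_rearr[OF H] borel_measurable_lorentz_section[OF H q]
  let ?P = "P / (P - 1)"
  define K where "K = exp (1 / ?P) * a powr (1 / ?P) / a"
  have K: "0 \<le> K" using a by (simp add: K_def)
  have "disp_majorant H a \<le> (\<integral>\<^sub>+\<tau>. \<integral>\<^sub>+\<theta>. ennreal K * (ennreal (disp_weight \<theta> * \<theta> powr (- (1 - 1 / P))) * (ennreal (\<tau> powr (- (DIM('a) / 2 - DIM('a) / P))) * lorentz_fun ?P q (section_rearr H \<tau>))))"
    unfolding disp_majorant_def
  proof (intro nn_integral_mono)
    fix \<tau> \<theta> :: real
    show "ennreal (disp_weight \<theta> * (\<tau> powr (DIM('a) / 2) / a)) * section_rearr H \<tau> (\<tau> powr DIM('a) / a * \<theta>)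
      \<le> ennreal K * (ennreal (disp_weight \<theta> * \<theta> powr (- (1 - 1 / P))) * (ennreal (\<tau> powr (- (DIM('a) / 2 - DIM('a) / P))) * lorentz_fun ?P q (section_rearr H \<tau>)))"
    proof (cases "0 < \<tau> \<and> 0 < \<theta>")
      case True
      have [measurable]: "H \<tau> \<in> borel_measurable borel" by (rule forward_section[OF H])
      have "section_rearr H \<tau> (\<tau> powr DIM('a) / a * \<theta>) \<le> ennreal (exp (1 / ?P) * (\<tau> powr DIM('a) / a * \<theta>) powr (- 1 / ?P)) * lorentz_fun ?P q (section_rearr H \<tau>)"
        using True a P by (intro rearr_le_lorentz[OF _ q]) auto
      then have "ennreal (disp_weight \<theta> * (\<tau> powr (DIM('a) / 2) / a)) * section_rearr H \<tau> (\<tau> powr DIM('a) / a * \<theta>)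
        \<le> ennreal (disp_weight \<theta> * (\<tau> powr (DIM('a) / 2) / a)) * (ennreal (exp (1 / ?P) * (\<tau> powr DIM('a) / a * \<theta>) powr (- 1 / ?P)) * lorentz_fun ?P q (section_rearr H \<tau>))"
        by (rule mult_left_mono) simp
      also have "\<dots> = ennreal (disp_weight \<theta> * (\<tau> powr (DIM('a) / 2) / a) * (exp (1 / ?P) * (\<tau> powr DIM('a) / a * \<theta>) powr (- 1 / ?P))) * lorentz_fun ?P q (section_rearr H \<tau>)"
        using disp_weight_nonneg[of \<theta>] a by (intro ennreal_mult_assoc) auto
      also have "disp_weight \<theta> * (\<tau> powr (DIM('a) / 2) / a) * (exp (1 / ?P) * (\<tau> powr DIM('a) / a * \<theta>) powr (- 1 / ?P))
        = K * (disp_weight \<theta> * (\<tau> powr (DIM('a) / 2) * (\<tau> powr DIM('a) * \<theta>) powr (- 1 / ?P)))"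
      proof -
        have "(\<tau> powr DIM('a) / a * \<theta>) powr (- 1 / ?P) = (\<tau> powr DIM('a) * \<theta> * (1 / a)) powr (- 1 / ?P)" by simp
        also have "\<dots> = (\<tau> powr DIM('a) * \<theta>) powr (- 1 / ?P) * (1 / a) powr (- 1 / ?P)"
          by (rule powr_mult)
        also have "(1 / a) powr (- 1 / ?P) = a powr (1 / ?P)"
        proof -
          have "(1 / a) powr (- c) = a powr c" for c using a by (simp add: powr_divide powr_minus_divide)
          from this[of "1 / ?P"] show ?thesis by (simp only: minus_divide_left)
        qed
        finally show ?thesis by (simp add: K_def)
      qed
      also have "\<tau> powr (DIM('a) / 2) * (\<tau> powr DIM('a) * \<theta>) powr (- 1 / ?P) = \<tau> powr (- (DIM('a) / 2 - DIM('a) / P)) * \<theta> powr (- (1 - 1 / P))"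
        using True P by (intro disp_exponent) auto
      also have "ennreal (K * (disp_weight \<theta> * (\<tau> powr (- (DIM('a) / 2 - DIM('a) / P)) * \<theta> powr (- (1 - 1 / P))))) * lorentz_fun ?P q (section_rearr H \<tau>)
        = ennreal K * (ennreal (disp_weight \<theta> * \<theta> powr (- (1 - 1 / P))) * (ennreal (\<tau> powr (- (DIM('a) / 2 - DIM('a) / P))) * lorentz_fun ?P q (section_rearr H \<tau>)))"
        using disp_weight_nonneg[of \<theta>] K by (simp add: ennreal_mult ac_simps)
      finally show ?thesis .
    next
      case False
      then show ?thesis by (auto simp: disp_weight_nonpos section_rearr_nonpos[OF H] not_less)
    qed
  qed
  also have "\<dots> = ennreal K * (disp_const P * disp_mass P q H)"
    unfolding disp_const_def disp_mass_def by (simp add: nn_integral_multc nn_integral_cmult)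
  also have "\<dots> < top" using fin disp_const_less_top[OF P] by (simp add: ennreal_mult_less_top)
  finally show ?thesis .
qed

text \<open>For each a the adapted splitting yields some limit with the desired rearrangement at a;
  \<open>schr_limit_unique\<close> makes all these limits one function, whose whole rearrangement is
  then below the majorant.\<close>

theorem schr_limit_lorentz:
  fixes H :: "real \<Rightarrow> 'a::euclidean_space \<Rightarrow> complex"
  assumes H: "forward H" and P: "2 < P" and q: "1 \<le> q" and fin: "disp_mass P q H < top"
  obtains v where "schr_limit H v" "lorentz_norm (ennreal P) q v \<le> disp_const P * disp_mass P q H"
    "\<And>\<phi>. \<phi> \<in> schwartz_space \<Longrightarrow> integrable lborel (\<lambda>z. schr_pair H \<phi> z)"
    "\<And>\<phi>. \<phi> \<in> schwartz_space \<Longrightarrow> (\<integral>x. v x * \<phi> x \<partial>lborel) = (\<integral>z. schr_pair H \<phi> z \<partial>lborel)"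
proof -
  note [measurable] = borel_measurable_section_rearr[OF H] borel_measurable_lorentz_section[OF H q]
  let ?P = "P / (P - 1)"
  have "AE \<tau> in lborel. ennreal (\<tau> powr (- (DIM('a) / 2 - DIM('a) / P))) * lorentz_fun ?P q (section_rearr H \<tau>) \<noteq> \<infinity>"
    using fin unfolding disp_mass_def by (intro nn_integral_PInf_AE) auto
  \<comment> \<open>Finite mass makes the rearrangement of almost every section finite at every t >
    0, so \<open>enn2real\<close> in the height \<open>lev\<close> loses nothing.\<close>
  then have rearr_fin: "AE \<tau> in lborel. \<forall>t>0. section_rearr H \<tau> t < top"
  proof eventually_elim
    case (elim \<tau>)
    have [measurable]: "H \<tau> \<in> borel_measurable borel" by (rule forward_section[OF H])
    show ?case
    proof (cases "0 < \<tau>")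
      case True
      then have fin_\<tau>: "lorentz_fun ?P q (section_rearr H \<tau>) < top"
        using elim by (auto simp: ennreal_mult_eq_top_iff less_top ennreal_eq_0_iff)
      show ?thesis
      proof (intro allI impI)
        fix t :: real assume t: "0 < t"
        have "section_rearr H \<tau> t \<le> ennreal (exp (1 / ?P) * t powr (- 1 / ?P)) * lorentz_fun ?P q (section_rearr H \<tau>)"
          using P t by (intro rearr_le_lorentz[OF _ q]) auto
        also have "\<dots> < top" using fin_\<tau> by (simp add: ennreal_mult_less_top)
        finally show "section_rearr H \<tau> t < top" .
      qed
    qed (simp add: section_rearr_nonpos[OF H])
  qed
  have split: "\<exists>v. schr_limit H v \<and> rearr lborel (\<lambda>x. enorm (v x)) a \<le> disp_majorant H a \<and>
    (\<forall>\<phi>\<in>schwartz_space. integrable lborel (\<lambda>z. schr_pair H \<phi> z) \<and>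
      (\<integral>x. v x * \<phi> x \<partial>lborel) = (\<integral>z. schr_pair H \<phi> z \<partial>lborel))" if a: "0 < a" for a
  proof -
    define lev where "lev \<tau> = enn2real (section_rearr H \<tau> (\<tau> powr DIM('a) / a))" for \<tau>
    have lm [measurable]: "lev \<in> borel_measurable borel" unfolding lev_def[abs_def] by measurable
    note fl = forward_low[OF H lm] and fh = forward_high[OF H lm]
    note [measurable] = forward_measurable[OF fl] forward_measurable[OF fh]
    have "kernel_norm (high lev H) + ennreal (a powr (- 1 / 2)) * energy_norm (low lev H)
      = (\<integral>\<^sub>+\<tau>. ennreal ((4 * pi * \<tau>) powr (- DIM('a) / 2)) * (\<integral>\<^sub>+y. enorm (high lev H \<tau> y))
      + ennreal (a powr (- 1 / 2)) * L2norm lborel (\<lambda>y. enorm (low lev H \<tau> y)))"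
    proof -
      have [measurable]: "(\<lambda>\<tau>. L2norm lborel (\<lambda>y. enorm (low lev H \<tau> y))) \<in> borel_measurable lborel"
        by (rule borel_measurable_Lebesgue_norm[OF sigma_finite_lborel one_le_ennreal_2]) measurable
      show ?thesis unfolding kernel_norm_def energy_norm_def
        by (subst nn_integral_add) (auto simp: nn_integral_cmult)
    qed
    also have "\<dots> \<le> disp_majorant H a"
      unfolding disp_majorant_def
    proof (rule nn_integral_mono_AE, use rearr_fin in eventually_elim)
      case (elim \<tau>)
      show ?case
      proof (cases "0 < \<tau>")
        case True
        then show ?thesis using elim a by (intro split_section_le[OF H]) (auto simp: lev_def)
      next
        case False
        then have "low lev H \<tau> y = 0" "high lev H \<tau> y = 0" for y by (auto simp: low_def high_def forward_zero[OF H])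
        then show ?thesis by (simp add: L2norm_eq)
      qed
    qed
    finally have le: "kernel_norm (high lev H) + ennreal (a powr (- 1 / 2)) * energy_norm (low lev H) \<le> disp_majorant H a" .
    then have "kernel_norm (high lev H) + ennreal (a powr (- 1 / 2)) * energy_norm (low lev H) < top"
      using disp_majorant_less_top[OF H P q a fin] by (rule le_less_trans)
    then have fins: "kernel_norm (high lev H) < top" "energy_norm (low lev H) < top"
      using a by (auto simp: ennreal_mult_less_top ennreal_add_less_top)
    have Heq: "H = (\<lambda>\<tau> y. high lev H \<tau> y + low lev H \<tau> y)" by (simp add: high_def fun_eq_iff)
    show ?thesis
    proof (rule schr_limit_split[OF fh fins(1) fl fins(2) Heq])
      fix v assume v: "schr_limit H v"
        and r: "\<And>a. 0 < a \<Longrightarrow> rearr lborel (\<lambda>x. enorm (v x)) a \<le> kernel_norm (high lev H) + ennreal (a powr (- 1 / 2)) * energy_norm (low lev H)"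
        and i: "\<And>\<phi>. \<phi> \<in> schwartz_space \<Longrightarrow> integrable lborel (\<lambda>z. schr_pair H \<phi> z)"
        and e: "\<And>\<phi>. \<phi> \<in> schwartz_space \<Longrightarrow> (\<integral>x. v x * \<phi> x \<partial>lborel) = (\<integral>z. schr_pair H \<phi> z \<partial>lborel)"
      show ?thesis using v order_trans[OF r[OF a] le] i e by blast
    qed
  qed
  \<comment> \<open>The choice a = 1 merely fixes a representative.\<close>
  obtain v where v: "schr_limit H v"
    "\<And>\<phi>. \<phi> \<in> schwartz_space \<Longrightarrow> integrable lborel (\<lambda>z. schr_pair H \<phi> z)"
    "\<And>\<phi>. \<phi> \<in> schwartz_space \<Longrightarrow> (\<integral>x. v x * \<phi> x \<partial>lborel) = (\<integral>z. schr_pair H \<phi> z \<partial>lborel)"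
    using split[of 1] by auto
  have [measurable]: "v \<in> borel_measurable borel" using v(1) by (simp add: schr_limit_def)
  have "rearr lborel (\<lambda>x. enorm (v x)) a \<le> disp_majorant H a" if a: "0 < a" for a
  proof -
    obtain v' where v': "schr_limit H v'" "rearr lborel (\<lambda>x. enorm (v' x)) a \<le> disp_majorant H a"
      using split[OF a] by blast
    have [measurable]: "v' \<in> borel_measurable borel" using v'(1) by (simp add: schr_limit_def)
    have "rearr lborel (\<lambda>x. enorm (v x)) a = rearr lborel (\<lambda>x. enorm (v' x)) a"
      using schr_limit_unique[OF v(1) v'(1)] by (intro rearr_cong_AE) (auto elim!: eventually_mono)
    then show ?thesis using v'(2) by simp
  qed
  then have "lorentz_norm (ennreal P) q v \<le> lorentz_fun P q (disp_majorant H)"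
    using P q by (subst lorentz_norm_borel) (auto intro!: lorentz_fun_mono)
  also have "\<dots> \<le> disp_const P * disp_mass P q H" by (rule lorentz_disp_majorant_le[OF H P q])
  finally show ?thesis using that v by blast
qed

subsection \<open>The Hardy--Littlewood--Sobolev inequality on the half-line\<close>

definition frac_int :: "real \<Rightarrow> (real \<Rightarrow> ennreal) \<Rightarrow> real \<Rightarrow> ennreal" where
  "frac_int \<alpha> h t = (\<integral>\<^sub>+\<tau>. frac_kernel \<alpha> \<tau> * h (t - \<tau>))"

lemma borel_measurable_frac_int [measurable]:
  assumes [measurable]: "h \<in> borel_measurable borel"
  shows "frac_int \<alpha> h \<in> borel_measurable borel"
  unfolding frac_int_def[abs_def] by measurable

text \<open>Equimeasurability followed by t = exp x: with both indices equal to \<sigma> the Lorentz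
  norm is the L^\<sigma> norm.\<close>

lemma Lebesgue_norm_eq_lorentz_fun:
  assumes [measurable]: "g \<in> borel_measurable lborel" and \<sigma>: "0 < \<sigma>"
  shows "Lebesgue_norm lborel (ennreal \<sigma>) g = lorentz_fun \<sigma> (ennreal \<sigma>) (rearr lborel g)"
proof -
  have "(\<integral>\<^sub>+x. ennreal_powr (g x) \<sigma>) = (\<integral>\<^sub>+c. indicator {0<..} c * ennreal_powr (rearr lborel g c) \<sigma>)"
    by (rule nn_integral_powr_rearr[OF sigma_finite_lborel _ \<sigma>]) measurable
  also have "\<dots> = (\<integral>\<^sub>+c. (indicator {0<..} c * ennreal (1 / c)) * (ennreal c * ennreal_powr (rearr lborel g c) \<sigma>))"
    by (intro nn_integral_cong) (auto simp: indicator_def ennreal_mult_assoc)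
  also have "\<dots> = (\<integral>\<^sup>+c. ennreal c * ennreal_powr (rearr lborel g c) \<sigma> \<partial>density lborel (\<lambda>t. indicator {0<..} t * ennreal (1 / t)))"
    by (rule nn_integral_density[symmetric]) measurable
  also have "\<dots> = (\<integral>\<^sub>+x. ennreal (exp x) * ennreal_powr (rearr lborel g (exp x)) \<sigma>)"
    unfolding density_inverse_eq_distr_exp by (rule nn_integral_distr) measurable
  also have "\<dots> = (\<integral>\<^sub>+x. ennreal_powr (ennreal (exp (x / \<sigma>)) * rearr lborel g (exp x)) \<sigma>)"
    using \<sigma> by (simp add: ennreal_powr_mult ennreal_powr_ennreal powr_def)
  finally show ?thesis using \<sigma> by (simp add: lorentz_fun_def Lebesgue_norm_ennreal)
qed

text \<open>Minkowski's inequality for an average of dilations, where the dilation by \<eta> costs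
  \<eta>^(-1/P). Hardy's inequality and the estimate of the kernel tail are both instances.\<close>

lemma lorentz_fun_average_le:
  assumes [measurable]: "\<phi> \<in> borel_measurable borel" "w \<in> borel_measurable borel" and q: "1 \<le> q"
    and w0: "\<And>\<eta>. \<eta> \<le> 0 \<Longrightarrow> w \<eta> = 0" and w1: "\<And>\<eta>. 0 \<le> w \<eta>"
  shows "lorentz_fun P q (\<lambda>a. \<integral>\<^sub>+\<eta>. ennreal (w \<eta>) * \<phi> (\<eta> * a))
    \<le> (\<integral>\<^sub>+\<eta>. ennreal (w \<eta> * \<eta> powr (- 1 / P))) * lorentz_fun P q \<phi>"
proof -
  have "lorentz_fun P q (\<lambda>a. \<integral>\<^sub>+\<eta>. ennreal (w \<eta>) * \<phi> (\<eta> * a))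
      = Lebesgue_norm lborel q (\<lambda>x. \<integral>\<^sub>+\<eta>. ennreal (w \<eta>) * (ennreal (exp (x / P)) * \<phi> (\<eta> * exp x)))"
    unfolding lorentz_fun_def by (simp add: nn_integral_cmult[symmetric] ac_simps)
  also have "\<dots> \<le> (\<integral>\<^sub>+\<eta>. Lebesgue_norm lborel q (\<lambda>x. ennreal (w \<eta>) * (ennreal (exp (x / P)) * \<phi> (\<eta> * exp x))))"
    by (rule Minkowski_nn_integral[OF sigma_finite_lborel sigma_finite_lborel q]) measurable
  also have "\<dots> = (\<integral>\<^sub>+\<eta>. ennreal (w \<eta> * \<eta> powr (- 1 / P)) * lorentz_fun P q \<phi>)"
  proof (intro nn_integral_cong)
    fix \<eta> :: real
    show "Lebesgue_norm lborel q (\<lambda>x. ennreal (w \<eta>) * (ennreal (exp (x / P)) * \<phi> (\<eta> * exp x))) = ennreal (w \<eta> * \<eta> powr (- 1 / P)) * lorentz_fun P q \<phi>"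
    proof (cases "0 < \<eta>")
      case True
      have "Lebesgue_norm lborel q (\<lambda>x. ennreal (w \<eta>) * (ennreal (exp (x / P)) * \<phi> (\<eta> * exp x))) = ennreal (w \<eta>) * lorentz_fun P q (\<lambda>t. \<phi> (\<eta> * t))"
        unfolding lorentz_fun_def by (rule Lebesgue_norm_cmult[OF _ q w1]) measurable
      also have "\<dots> = ennreal (w \<eta>) * (ennreal (\<eta> powr (- 1 / P)) * lorentz_fun P q \<phi>)"
        by (subst lorentz_fun_dilation[OF _ q True]) auto
      also have "\<dots> = ennreal (w \<eta> * \<eta> powr (- 1 / P)) * lorentz_fun P q \<phi>"
        using w1 by (intro ennreal_mult_assoc) auto
      finally show ?thesis .
    next
      case False then show ?thesis by (simp add: w0 Lebesgue_norm_zero[OF q])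
    qed
  qed
  also have "\<dots> = (\<integral>\<^sub>+\<eta>. ennreal (w \<eta> * \<eta> powr (- 1 / P))) * lorentz_fun P q \<phi>"
    by (rule nn_integral_multc) measurable
  finally show ?thesis .
qed

text \<open>The Hardy-Littlewood inequality for a set: the rearrangement of the restriction lies
  below that of h and vanishes beyond the measure of E.\<close>

lemma set_nn_integral_le_rearr:
  assumes M: "sigma_finite_measure M" and [measurable]: "h \<in> borel_measurable M" "E \<in> sets M"
    and le: "emeasure M E \<le> ennreal c"
  shows "(\<integral>\<^sup>+x. indicator E x * h x \<partial>M) \<le> (\<integral>\<^sub>+x. indicator {0<..<c} x * rearr M h x)"
proof -
  have "(\<integral>\<^sup>+x. indicator E x * h x \<partial>M) = (\<integral>\<^sub>+x. indicator {0<..} x * rearr M (\<lambda>x. indicator E x * h x) x)"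
    using nn_integral_powr_rearr[OF M, of "\<lambda>x. indicator E x * h x" 1] by simp
  also have "\<dots> \<le> (\<integral>\<^sub>+x. indicator {0<..<c} x * rearr M h x)"
  proof (intro nn_integral_mono)
    fix x
    show "indicator {0<..} x * rearr M (\<lambda>x. indicator E x * h x) x \<le> indicator {0<..<c} x * rearr M h x"
    proof (cases "x < c")
      case True
      have "rearr M (\<lambda>x. indicator E x * h x) x \<le> rearr M h x"
        by (intro rearr_mono_AE AE_I2) (auto simp: indicator_def)
      then show ?thesis using True by (auto simp: indicator_def)
    next
      case False
      have "emeasure M {y \<in> space M. 0 < indicator E y * h y} \<le> emeasure M E"
        by (intro emeasure_mono) (auto simp: indicator_def split: if_splits)
      also have "\<dots> \<le> ennreal x" using le False by (intro order_trans[OF le] ennreal_leI) auto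
      finally have "rearr M (\<lambda>x. indicator E x * h x) x \<le> 0" by (subst rearr_le_iff) auto
      then show ?thesis by simp
    qed
  qed
  finally show ?thesis .
qed

lemma nn_integral_powr_Ioc:
  fixes \<alpha> a :: real
  assumes "\<alpha> < 1" "0 < a"
  shows "(\<integral>\<^sub>+\<tau>. indicator {0<..a} \<tau> * ennreal (\<tau> powr (- \<alpha>))) = ennreal (a powr (1 - \<alpha>) / (1 - \<alpha>))"
proof -
  have "(\<integral>\<^sub>+\<tau>. indicator {0<..a} \<tau> * ennreal (\<tau> powr (- \<alpha>))) = (\<integral>\<^sub>+\<tau>. ennreal (indicator {0..a} \<tau> * \<tau> powr (- \<alpha>)))"
    by (intro nn_integral_cong) (auto simp: indicator_def)
  also have "\<dots> = ennreal (a powr (- \<alpha> + 1) / (- \<alpha> + 1))"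
    by (rule nn_integral_has_integral_lebesgue[OF _ has_integral_powr_from_0]) (use assms in auto)
  finally show ?thesis by (simp add: add.commute)
qed

text \<open>The kernel as a superposition of indicators, so that its tail acts on a function through
  integrals over intervals.\<close>

lemma powr_tail:
  fixes \<alpha> \<tau> :: real
  assumes "0 < \<alpha>" "0 < \<tau>"
  shows "ennreal (\<tau> powr (- \<alpha>)) = (\<integral>\<^sub>+c. indicator {\<tau>..} c * ennreal (\<alpha> * c powr (- \<alpha> - 1)))"
proof -
  have "(\<integral>\<^sub>+c. indicator {\<tau>..} c * ennreal (\<alpha> * c powr (- \<alpha> - 1))) = (\<integral>\<^sub>+c. ennreal \<alpha> * ennreal (indicator {\<tau>..} c * c powr (- \<alpha> - 1)))"
    using assms by (intro nn_integral_cong) (auto simp: indicator_def ennreal_mult)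
  also have "\<dots> = ennreal \<alpha> * (\<integral>\<^sub>+c. ennreal (indicator {\<tau>..} c * c powr (- \<alpha> - 1)))"
    by (rule nn_integral_cmult) measurable
  also have "(\<integral>\<^sub>+c. ennreal (indicator {\<tau>..} c * c powr (- \<alpha> - 1))) = ennreal (-(\<tau> powr (- \<alpha> - 1 + 1)) / (- \<alpha> - 1 + 1))"
    by (rule nn_integral_has_integral_lebesgue[OF _ has_integral_powr_to_inf]) (use assms in auto)
  also have "ennreal \<alpha> * \<dots> = ennreal (\<tau> powr (- \<alpha>))"
    using assms by (simp flip: ennreal_mult)
  finally show ?thesis by simp
qed

text \<open>The maximal rearrangement, that is the mean of the rearrangement over (0, a), written as
  an average of dilations so that \<open>lorentz_fun_average_le\<close> applies to it.\<close>

definition rearr_mean :: "(real \<Rightarrow> ennreal) \<Rightarrow> real \<Rightarrow> ennreal" where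
  "rearr_mean h a = (\<integral>\<^sub>+\<eta>. ennreal (indicator {0<..<1} \<eta>) * rearr lborel h (\<eta> * a))"

lemma nn_integral_rearr_eq_mean:
  assumes [measurable]: "h \<in> borel_measurable lborel" and a: "0 < a"
  shows "(\<integral>\<^sub>+x. indicator {0<..<a} x * rearr lborel h x) = ennreal a * rearr_mean h a"
  unfolding rearr_mean_def using a
  by (subst nn_integral_real_affine[where c=a and t=0])
    (auto intro!: nn_integral_cong arg_cong2[where f="(*)"] simp: indicator_def zero_less_mult_iff mult.commute)

lemma borel_measurable_rearr_mean [measurable]:
  assumes [measurable]: "h \<in> borel_measurable lborel"
  shows "rearr_mean h \<in> borel_measurable borel"
  unfolding rearr_mean_def[abs_def] by measurable

text \<open>
  The function is split at height \<open>h\<^sup>*(a)\<close>. The upper part is convolved with the kernel cut at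
  \<open>\<tau> = a\<close>; for the lower part the tail of the kernel is written as an integral of indicator functions.
\<close>

lemma rearr_frac_int_le:
  fixes h :: "real \<Rightarrow> ennreal"
  assumes [measurable]: "h \<in> borel_measurable lborel" and \<alpha>: "0 < \<alpha>" "\<alpha> < 1" and a: "0 < a"
    and fin: "rearr lborel h a < top"
  shows "rearr lborel (frac_int \<alpha> h) a \<le> ennreal (a powr (1 - \<alpha>)) *
    (ennreal (1 + 2 / (1 - \<alpha>)) * rearr_mean h a
      + (\<integral>\<^sub>+\<xi>. ennreal (indicator {1<..} \<xi> * (\<alpha> * \<xi> powr (- \<alpha>))) * rearr_mean h (\<xi> * a)))"
proof -
  define lev where "lev = enn2real (rearr lborel h a)"
  have lev: "ennreal lev = rearr lborel h a" "0 \<le> lev" using fin by (simp_all add: lev_def)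
  define h1 where "h1 s = h s - ennreal lev" for s
  define h2 where "h2 s = min (h s) (ennreal lev)" for s
  have [measurable]: "h1 \<in> borel_measurable borel" "h2 \<in> borel_measurable borel"
    unfolding h1_def[abs_def] h2_def[abs_def] using assms(1) by measurable
  have h12: "h s = h1 s + h2 s" for s
  proof (cases "h s \<le> ennreal lev")
    case True
    then have "h s - ennreal lev = 0" by (intro diff_eq_0_ennreal) (auto intro: le_less_trans[OF _ ennreal_less_top])
    then show ?thesis using True by (simp add: h1_def h2_def min_def)
  next
    case False
    then show ?thesis by (simp add: h1_def h2_def min_def diff_add_cancel_ennreal)
  qed
  let ?k = "\<lambda>\<tau>. ennreal (\<tau> powr (- \<alpha>))"
  let ?M = "rearr_mean h a"
  have h1_int: "(\<integral>\<^sub>+s. h1 s) \<le> ennreal a * ?M"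
    unfolding h1_def nn_integral_rearr_eq_mean[OF assms(1) a, symmetric]
    by (rule nn_integral_diff_rearr_le[OF sigma_finite_lborel]) (use lev in auto)
  \<comment> \<open>The rearrangement decreases, so its value at a is below its mean over (0,
    a).\<close>
  have lev_le: "ennreal lev \<le> ?M"
  proof -
    have "ennreal lev = (\<integral>\<^sub>+\<eta>. rearr lborel h a * indicator {0<..<1::real} \<eta>)"
      using lev by (subst nn_integral_cmult_indicator) auto
    also have "\<dots> \<le> ?M"
      unfolding rearr_mean_def
    proof (intro nn_integral_mono)
      fix \<eta> :: real
      have "rearr lborel h a \<le> rearr lborel h (\<eta> * a)" if "\<eta> < 1"
        using that a by (intro rearr_antimono) simp
      then show "rearr lborel h a * indicator {0<..<1} \<eta> \<le> ennreal (indicator {0<..<1} \<eta>) * rearr lborel h (\<eta> * a)"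
        by (auto simp: indicator_def)
    qed
    finally show ?thesis .
  qed
  \<comment> \<open>The near kernel against the upper part is the one piece estimated in L^1,
    through Chebyshev's inequality; the other three are bounded pointwise and collected in
    A.\<close>
  define W where "W t = (\<integral>\<^sub>+\<tau>. indicator {0<..a} \<tau> * ?k \<tau> * h1 (t - \<tau>))" for t
  have [measurable]: "W \<in> borel_measurable borel" unfolding W_def[abs_def] by measurable
  define T where "T = (\<integral>\<^sub>+\<xi>. ennreal (indicator {1<..} \<xi> * (\<alpha> * \<xi> powr (- \<alpha>))) * rearr_mean h (\<xi> * a))"
  define A where "A = ennreal (a powr (1 - \<alpha>)) * (ennreal (1 + 1 / (1 - \<alpha>)) * ?M + T)"
  \<comment> \<open>After Fubini the tail integrates h over intervals of length c - a, at most c,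
    and the Hardy-Littlewood inequality bounds each such integral by c times the mean of the
    rearrangement over (0, c).\<close>
  have tail: "(\<integral>\<^sub>+\<tau>. indicator {a<..} \<tau> * ?k \<tau> * h2 (t - \<tau>)) \<le> ennreal (a powr (1 - \<alpha>)) * T" for t
  proof -
    have "(\<integral>\<^sub>+\<tau>. indicator {a<..} \<tau> * ?k \<tau> * h2 (t - \<tau>))
        = (\<integral>\<^sub>+\<tau>. \<integral>\<^sub>+c. indicator {a<..c} \<tau> * (ennreal (\<alpha> * c powr (- \<alpha> - 1)) * h2 (t - \<tau>)))"
    proof (intro nn_integral_cong)
      fix \<tau>
      show "indicator {a<..} \<tau> * ?k \<tau> * h2 (t - \<tau>) = (\<integral>\<^sub>+c. indicator {a<..c} \<tau> * (ennreal (\<alpha> * c powr (- \<alpha> - 1)) * h2 (t - \<tau>)))"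
      proof (cases "a < \<tau>")
        case True
        then have "?k \<tau> * h2 (t - \<tau>) = (\<integral>\<^sub>+c. indicator {\<tau>..} c * ennreal (\<alpha> * c powr (- \<alpha> - 1)) * h2 (t - \<tau>))"
          using a \<alpha> by (subst powr_tail) (auto simp: nn_integral_multc)
        also have "\<dots> = (\<integral>\<^sub>+c. indicator {a<..c} \<tau> * (ennreal (\<alpha> * c powr (- \<alpha> - 1)) * h2 (t - \<tau>)))"
          using True by (intro nn_integral_cong) (auto simp: indicator_def)
        finally show ?thesis using True by simp
      qed simp
    qed
    also have "\<dots> = (\<integral>\<^sub>+c. \<integral>\<^sub>+\<tau>. indicator {a<..c} \<tau> * (ennreal (\<alpha> * c powr (- \<alpha> - 1)) * h2 (t - \<tau>)))"
      unfolding indicator_def greaterThanAtMost_iff by (rule lborel_pair.Fubini'[symmetric]) measurable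
    also have "\<dots> \<le> (\<integral>\<^sub>+c. ennreal (indicator {a<..} c * (\<alpha> * c powr (- \<alpha>))) * rearr_mean h c)"
    proof (intro nn_integral_mono)
      fix c :: real
      show "(\<integral>\<^sub>+\<tau>. indicator {a<..c} \<tau> * (ennreal (\<alpha> * c powr (- \<alpha> - 1)) * h2 (t - \<tau>)))
        \<le> ennreal (indicator {a<..} c * (\<alpha> * c powr (- \<alpha>))) * rearr_mean h c"
      proof (cases "a < c")
        case True
        then have c: "0 < c" using a by simp
        have "(\<integral>\<^sub>+\<tau>. indicator {a<..c} \<tau> * (ennreal (\<alpha> * c powr (- \<alpha> - 1)) * h2 (t - \<tau>)))
            = ennreal (\<alpha> * c powr (- \<alpha> - 1)) * (\<integral>\<^sub>+\<tau>. indicator {a<..c} \<tau> * h2 (t - \<tau>))"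
          by (subst nn_integral_cmult[symmetric]) (auto simp: ac_simps)
        also have "(\<integral>\<^sub>+\<tau>. indicator {a<..c} \<tau> * h2 (t - \<tau>)) \<le> (\<integral>\<^sub>+\<tau>. indicator {t - c..t - a} (t - \<tau>) * h (t - \<tau>))"
          by (intro nn_integral_mono) (auto simp: indicator_def h2_def)
        also have "\<dots> = (\<integral>\<^sub>+s. indicator {t - c..t - a} s * h s)"
          using nn_integral_lborel_diff[of "\<lambda>s. indicator {t - c..t - a} s * h s" t] assms(1) by simp
        also have "\<dots> \<le> (\<integral>\<^sub>+x. indicator {0<..<c} x * rearr lborel h x)"
          by (rule set_nn_integral_le_rearr[OF sigma_finite_lborel]) (use a True in \<open>auto intro!: ennreal_leI\<close>)
        also have "\<dots> = ennreal c * rearr_mean h c" by (rule nn_integral_rearr_eq_mean[OF assms(1) c])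
        also have "ennreal (\<alpha> * c powr (- \<alpha> - 1)) * (ennreal c * rearr_mean h c) = ennreal (indicator {a<..} c * (\<alpha> * c powr (- \<alpha>))) * rearr_mean h c"
        proof -
          have "c powr (- \<alpha> - 1) * c = c powr (- \<alpha>)" using c powr_add[of c "- \<alpha> - 1" 1] by simp
          then have "\<alpha> * c powr (- \<alpha> - 1) * c = indicator {a<..} c * (\<alpha> * c powr (- \<alpha>))" using True by (simp add: mult.assoc)
          moreover have "ennreal (\<alpha> * c powr (- \<alpha> - 1)) * (ennreal c * rearr_mean h c) = ennreal (\<alpha> * c powr (- \<alpha> - 1) * c) * rearr_mean h c"
            using c \<alpha> by (intro ennreal_mult_assoc) auto
          ultimately show ?thesis by (simp only:)
        qed
        finally show ?thesis by (simp add: mult_left_mono)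
      qed simp
    qed
    also have "\<dots> = ennreal (a powr (1 - \<alpha>)) * T"
    proof -
      have "(\<integral>\<^sub>+c. ennreal (indicator {a<..} c * (\<alpha> * c powr (- \<alpha>))) * rearr_mean h c)
          = ennreal a * (\<integral>\<^sub>+\<xi>. ennreal (indicator {a<..} (a * \<xi>) * (\<alpha> * (a * \<xi>) powr (- \<alpha>))) * rearr_mean h (a * \<xi>))"
        using a by (subst nn_integral_real_affine[where c=a and t=0]) auto
      also have "(\<integral>\<^sub>+\<xi>. ennreal (indicator {a<..} (a * \<xi>) * (\<alpha> * (a * \<xi>) powr (- \<alpha>))) * rearr_mean h (a * \<xi>))
          = (\<integral>\<^sub>+\<xi>. ennreal (a powr (- \<alpha>)) * (ennreal (indicator {1<..} \<xi> * (\<alpha> * \<xi> powr (- \<alpha>))) * rearr_mean h (\<xi> * a)))"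
      proof (intro nn_integral_cong)
        fix \<xi> :: real
        show "ennreal (indicator {a<..} (a * \<xi>) * (\<alpha> * (a * \<xi>) powr (- \<alpha>))) * rearr_mean h (a * \<xi>)
          = ennreal (a powr (- \<alpha>)) * (ennreal (indicator {1<..} \<xi> * (\<alpha> * \<xi> powr (- \<alpha>))) * rearr_mean h (\<xi> * a))"
        proof (cases "1 < \<xi>")
          case True
          then have "\<alpha> * (a * \<xi>) powr (- \<alpha>) = a powr (- \<alpha>) * (\<alpha> * \<xi> powr (- \<alpha>))" using a by (simp add: powr_mult)
          then show ?thesis using True a \<alpha> by (simp add: ennreal_mult_assoc mult.commute[of \<xi>] mult.left_commute[of \<alpha>])
        qed (use a in simp)
      qed
      also have "\<dots> = ennreal (a powr (- \<alpha>)) * T" unfolding T_def by (rule nn_integral_cmult) measurable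
      also have "ennreal a * (ennreal (a powr (- \<alpha>)) * T) = ennreal (a powr (1 - \<alpha>)) * T"
      proof -
        have "a * a powr (- \<alpha>) = a powr (1 - \<alpha>)" using a powr_add[of a 1 "- \<alpha>"] by simp
        then show ?thesis using a by (simp add: ennreal_mult_assoc)
      qed
      finally show ?thesis .
    qed
    finally show ?thesis .
  qed
  have pointwise: "frac_int \<alpha> h t \<le> A + W t" for t
  proof -
    have "frac_int \<alpha> h t = (\<integral>\<^sub>+\<tau>. (indicator {a<..} \<tau> * ?k \<tau> * h1 (t - \<tau>) + indicator {0<..a} \<tau> * ?k \<tau> * h2 (t - \<tau>))
        + (indicator {a<..} \<tau> * ?k \<tau> * h2 (t - \<tau>) + indicator {0<..a} \<tau> * ?k \<tau> * h1 (t - \<tau>)))"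
      unfolding frac_int_def using a by (intro nn_integral_cong) (auto simp: indicator_def h12 distrib_left add.commute)
    also have "\<dots> = ((\<integral>\<^sub>+\<tau>. indicator {a<..} \<tau> * ?k \<tau> * h1 (t - \<tau>)) + (\<integral>\<^sub>+\<tau>. indicator {0<..a} \<tau> * ?k \<tau> * h2 (t - \<tau>)))
        + ((\<integral>\<^sub>+\<tau>. indicator {a<..} \<tau> * ?k \<tau> * h2 (t - \<tau>)) + W t)"
      unfolding W_def by (simp add: nn_integral_add)
    also have "\<dots> \<le> (ennreal (a powr (1 - \<alpha>)) * ?M + ennreal (a powr (1 - \<alpha>)) * (ennreal (1 / (1 - \<alpha>)) * ?M)) + (ennreal (a powr (1 - \<alpha>)) * T + W t)"
    proof (intro add_mono tail order_refl)
      have "(\<integral>\<^sub>+\<tau>. indicator {a<..} \<tau> * ?k \<tau> * h1 (t - \<tau>)) \<le> (\<integral>\<^sub>+\<tau>. ennreal (a powr (- \<alpha>)) * h1 (t - \<tau>))"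
        using a \<alpha> by (intro nn_integral_mono mult_right_mono) (auto simp: indicator_def intro!: ennreal_leI powr_mono2')
      also have "\<dots> = ennreal (a powr (- \<alpha>)) * (\<integral>\<^sub>+s. h1 s)"
        using nn_integral_lborel_diff[of h1 t] by (simp add: nn_integral_cmult)
      also have "\<dots> \<le> ennreal (a powr (- \<alpha>)) * (ennreal a * ?M)" by (intro mult_left_mono h1_int) simp
      also have "\<dots> = ennreal (a powr (1 - \<alpha>)) * ?M"
      proof -
        have "a powr (- \<alpha>) * a = a powr (1 - \<alpha>)" using a powr_add[of a "- \<alpha>" 1] by simp
        then show ?thesis using a by (simp add: ennreal_mult_assoc)
      qed
      finally show "(\<integral>\<^sub>+\<tau>. indicator {a<..} \<tau> * ?k \<tau> * h1 (t - \<tau>)) \<le> ennreal (a powr (1 - \<alpha>)) * ?M" .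
      have "(\<integral>\<^sub>+\<tau>. indicator {0<..a} \<tau> * ?k \<tau> * h2 (t - \<tau>)) \<le> (\<integral>\<^sub>+\<tau>. indicator {0<..a} \<tau> * ?k \<tau> * ennreal lev)"
        by (intro nn_integral_mono mult_left_mono) (auto simp: h2_def)
      also have "\<dots> = ennreal (a powr (1 - \<alpha>) / (1 - \<alpha>)) * ennreal lev"
        using \<alpha> a by (subst nn_integral_multc) (auto simp: nn_integral_powr_Ioc)
      also have "\<dots> \<le> ennreal (a powr (1 - \<alpha>) / (1 - \<alpha>)) * ?M" by (intro mult_left_mono lev_le) simp
      also have "\<dots> = ennreal (a powr (1 - \<alpha>)) * (ennreal (1 / (1 - \<alpha>)) * ?M)"
        using \<alpha> by (subst ennreal_mult_assoc) auto
      finally show "(\<integral>\<^sub>+\<tau>. indicator {0<..a} \<tau> * ?k \<tau> * h2 (t - \<tau>)) \<le> ennreal (a powr (1 - \<alpha>)) * (ennreal (1 / (1 - \<alpha>)) * ?M)" .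
    qed
    also have "\<dots> = A + W t"
      unfolding A_def using \<alpha> by (simp add: distrib_left distrib_right add.assoc)
    finally show ?thesis .
  qed
  have W_le: "rearr lborel W a \<le> ennreal (a powr (1 - \<alpha>)) * (ennreal (1 / (1 - \<alpha>)) * ?M)"
  proof -
    have "ennreal a * rearr lborel W a \<le> (\<integral>\<^sub>+t. W t)"
      using rearr_Chebyshev[OF sigma_finite_lborel, of W 1 a] a by simp
    also have "\<dots> = (\<integral>\<^sub>+\<tau>. \<integral>\<^sub>+t. indicator {0<..a} \<tau> * ?k \<tau> * h1 (t - \<tau>))"
      unfolding W_def by (rule lborel_pair.Fubini') measurable
    also have "\<dots> = (\<integral>\<^sub>+\<tau>. indicator {0<..a} \<tau> * ?k \<tau> * (\<integral>\<^sub>+s. h1 s))"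
    proof (intro nn_integral_cong)
      fix \<tau> :: real
      have "(\<integral>\<^sub>+t. h1 (t - \<tau>)) = (\<integral>\<^sub>+s. h1 s)"
        using nn_integral_real_affine[of h1 1 "- \<tau>"] by simp
      then show "(\<integral>\<^sub>+t. indicator {0<..a} \<tau> * ?k \<tau> * h1 (t - \<tau>)) = indicator {0<..a} \<tau> * ?k \<tau> * (\<integral>\<^sub>+s. h1 s)"
        by (subst nn_integral_cmult) auto
    qed
    also have "\<dots> = ennreal (a powr (1 - \<alpha>) / (1 - \<alpha>)) * (\<integral>\<^sub>+s. h1 s)"
      using \<alpha> a by (subst nn_integral_multc) (auto simp: nn_integral_powr_Ioc)
    also have "\<dots> \<le> ennreal (a powr (1 - \<alpha>) / (1 - \<alpha>)) * (ennreal a * ?M)" by (intro mult_left_mono h1_int) simp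
    finally have "ennreal (1 / a) * (ennreal a * rearr lborel W a) \<le> ennreal (1 / a) * (ennreal (a powr (1 - \<alpha>) / (1 - \<alpha>)) * (ennreal a * ?M))"
      by (rule mult_left_mono) simp
    then show ?thesis using a \<alpha> by (simp add: ennreal_mult_assoc)
  qed
  have "rearr lborel (frac_int \<alpha> h) a \<le> A + rearr lborel W a"
    using assms(1) pointwise by (intro rearr_le_add) auto
  also have "\<dots> \<le> A + ennreal (a powr (1 - \<alpha>)) * (ennreal (1 / (1 - \<alpha>)) * ?M)" by (intro add_left_mono W_le)
  \<comment> \<open>The 1 comes from the far kernel on the upper part, one 1 / (1 - \<alpha>) from
    the near kernel on the lower part, the other from W.\<close>
  also have "\<dots> = ennreal (a powr (1 - \<alpha>)) * (ennreal (1 + 2 / (1 - \<alpha>)) * ?M + T)"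
  proof -
    have "ennreal (1 + 2 / (1 - \<alpha>)) = ennreal (1 + 1 / (1 - \<alpha>)) + ennreal (1 / (1 - \<alpha>))"
      using \<alpha> by (subst ennreal_plus[symmetric]) (auto simp: field_simps)
    then show ?thesis unfolding A_def by (simp only: distrib_left distrib_right) (simp only: ac_simps)
  qed
  finally show ?thesis unfolding T_def .
qed

text \<open>L^\<rho> embeds into L^(\<rho>,\<sigma>) with constant 1: Chebyshev's inequality bounds
  the weighted rearrangement pointwise by the norm, and the surplus power \<sigma> - \<rho> is
  absorbed by that supremum.\<close>

lemma lorentz_fun_nested:
  assumes [measurable]: "h \<in> borel_measurable lborel" and \<rho>: "1 \<le> \<rho>" "\<rho> \<le> \<sigma>"
  shows "lorentz_fun \<rho> (ennreal \<sigma>) (rearr lborel h) \<le> Lebesgue_norm lborel (ennreal \<rho>) h"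
proof -
  let ?N = "Lebesgue_norm lborel (ennreal \<rho>) h"
  let ?y = "\<lambda>x. ennreal (exp (x / \<rho>)) * rearr lborel h (exp x)"
  have y: "?y x \<le> ?N" for x
  proof -
    have "ennreal_powr (ennreal (exp x) * ennreal_powr (rearr lborel h (exp x)) \<rho>) (1 / \<rho>) \<le> ?N"
      using rearr_Chebyshev[OF sigma_finite_lborel assms(1), of \<rho> "exp x"] \<rho>
      by (auto simp: Lebesgue_norm_ennreal intro!: ennreal_powr_mono)
    then show ?thesis using \<rho> by (simp add: ennreal_powr_mult ennreal_powr_powr ennreal_powr_ennreal powr_def)
  qed
  have "(\<integral>\<^sub>+x. ennreal_powr (?y x) \<sigma>) \<le> (\<integral>\<^sub>+x. ennreal_powr ?N (\<sigma> - \<rho>) * ennreal_powr (?y x) \<rho>)"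
  proof (intro nn_integral_mono)
    fix x
    have "ennreal_powr (?y x) \<sigma> = ennreal_powr (?y x) (\<sigma> - \<rho>) * ennreal_powr (?y x) \<rho>"
      by (simp flip: ennreal_powr_add)
    also have "\<dots> \<le> ennreal_powr ?N (\<sigma> - \<rho>) * ennreal_powr (?y x) \<rho>"
      using \<rho> by (intro mult_right_mono ennreal_powr_mono y) auto
    finally show "ennreal_powr (?y x) \<sigma> \<le> ennreal_powr ?N (\<sigma> - \<rho>) * ennreal_powr (?y x) \<rho>" .
  qed
  also have "\<dots> = ennreal_powr ?N (\<sigma> - \<rho>) * (\<integral>\<^sub>+x. ennreal_powr (?y x) \<rho>)"
    by (rule nn_integral_cmult) measurable
  also have "(\<integral>\<^sub>+x. ennreal_powr (?y x) \<rho>) = ennreal_powr ?N \<rho>"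
  proof -
    have "?N = ennreal_powr (\<integral>\<^sub>+x. ennreal_powr (?y x) \<rho>) (1 / \<rho>)"
      using \<rho> by (subst Lebesgue_norm_eq_lorentz_fun) (auto simp: lorentz_fun_def Lebesgue_norm_ennreal)
    then show ?thesis using \<rho> by (simp add: ennreal_powr_powr)
  qed
  also have "ennreal_powr ?N (\<sigma> - \<rho>) * ennreal_powr ?N \<rho> = ennreal_powr ?N \<sigma>"
    by (simp flip: ennreal_powr_add)
  finally have "ennreal_powr (\<integral>\<^sub>+x. ennreal_powr (?y x) \<sigma>) (1 / \<sigma>) \<le> ennreal_powr (ennreal_powr ?N \<sigma>) (1 / \<sigma>)"
    using \<rho> by (intro ennreal_powr_mono) auto
  then show ?thesis using \<rho> by (simp add: lorentz_fun_def Lebesgue_norm_ennreal ennreal_powr_powr)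
qed

text \<open>\<open>rearr_frac_int_le\<close> reduces the claim to Hardy-type inequalities in
  L^(\<rho>,\<sigma>), followed by the embedding of L^\<rho>. C1 converges because \<rho> > 1, and
  C2 because \<alpha> + 1/\<rho> = 1 + 1/\<sigma> exceeds 1.\<close>

theorem Hardy_Littlewood_Sobolev:
  fixes \<alpha> \<rho> \<sigma> :: real
  assumes \<alpha>: "0 < \<alpha>" "\<alpha> < 1" and \<rho>: "1 < \<rho>" and \<sigma>: "0 < \<sigma>" and scaling: "1 / \<sigma> = 1 / \<rho> - (1 - \<alpha>)"
  obtains C where "0 \<le> C" "\<And>h. h \<in> borel_measurable lborel \<Longrightarrow>
    Lebesgue_norm lborel (ennreal \<sigma>) (frac_int \<alpha> h) \<le> ennreal C * Lebesgue_norm lborel (ennreal \<rho>) h"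
proof -
  have \<rho>\<sigma>: "\<rho> \<le> \<sigma>"
  proof -
    have "1 / \<sigma> \<le> 1 / \<rho>" using scaling \<alpha> by simp
    then show ?thesis using \<rho> \<sigma> by (simp add: field_simps)
  qed
  let ?q = "ennreal \<sigma>"
  have q: "1 \<le> ?q" using \<rho> \<rho>\<sigma> by (simp flip: ennreal_1)
  define C1 where "C1 = (\<integral>\<^sub>+\<eta>. ennreal (indicator {0<..<1} \<eta> * \<eta> powr (- 1 / \<rho>)))"
  define C2 where "C2 = (\<integral>\<^sub>+\<xi>. ennreal (indicator {1<..} \<xi> * (\<alpha> * \<xi> powr (- \<alpha>)) * \<xi> powr (- 1 / \<rho>)))"
  have C1: "C1 < top"
  proof -
    have "C1 = (\<integral>\<^sub>+\<eta>. indicator {0<..<1} \<eta> * ennreal (\<eta> powr (- 1 / \<rho>)))"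
      unfolding C1_def by (intro nn_integral_cong) (auto simp: indicator_def)
    then show ?thesis using nn_integral_powr_0[of "- 1 / \<rho>"] \<rho> by simp
  qed
  have C2: "C2 < top"
  proof -
    have "C2 = (\<integral>\<^sub>+\<xi>. ennreal \<alpha> * (indicator {1<..} \<xi> * ennreal (\<xi> powr (- \<alpha> - 1 / \<rho>))))"
      unfolding C2_def
    proof (intro nn_integral_cong)
      fix \<xi> :: real
      have "\<xi> powr (- \<alpha>) * \<xi> powr (- 1 / \<rho>) = \<xi> powr (- \<alpha> - 1 / \<rho>)" by (simp flip: powr_add)
      then show "ennreal (indicator {1<..} \<xi> * (\<alpha> * \<xi> powr (- \<alpha>)) * \<xi> powr (- 1 / \<rho>)) = ennreal \<alpha> * (indicator {1<..} \<xi> * ennreal (\<xi> powr (- \<alpha> - 1 / \<rho>)))"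
        using \<alpha> by (auto simp: indicator_def mult.assoc simp flip: ennreal_mult)
    qed
    also have "\<dots> = ennreal \<alpha> * (\<integral>\<^sub>+\<xi>. indicator {1<..} \<xi> * ennreal (\<xi> powr (- \<alpha> - 1 / \<rho>)))"
      by (rule nn_integral_cmult) measurable
    also have "\<dots> < top"
    proof -
      have "0 < 1 / \<sigma>" using \<sigma> by simp
      then have "- \<alpha> - 1 / \<rho> < -1" using scaling by simp
      then show ?thesis using nn_integral_powr_inf[of "- \<alpha> - 1 / \<rho>" 1] by (simp add: ennreal_mult_less_top)
    qed
    finally show ?thesis .
  qed
  define K where "K = ennreal (1 + 2 / (1 - \<alpha>)) * C1 + C2 * C1"
  have K: "K < top" using C1 C2 by (simp add: K_def ennreal_mult_less_top)
  have main: "Lebesgue_norm lborel ?q (frac_int \<alpha> h) \<le> K * Lebesgue_norm lborel (ennreal \<rho>) h"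
    if [measurable]: "h \<in> borel_measurable lborel" and fin: "Lebesgue_norm lborel (ennreal \<rho>) h < top" for h
  proof -
    have h_fin: "rearr lborel h a < top" if "0 < a" for a
    proof -
      have "(\<integral>\<^sub>+x. ennreal_powr (h x) \<rho>) < top"
        using fin unfolding Lebesgue_norm_ennreal[OF less_imp_le[OF less_trans[OF zero_less_one \<rho>]]] ennreal_powr_less_top_iff .
      with rearr_Chebyshev[OF sigma_finite_lborel \<open>h \<in> borel_measurable lborel\<close>, of \<rho> a] \<rho> that
      have "ennreal a * ennreal_powr (rearr lborel h a) \<rho> < top" by (simp add: le_less_trans)
      then show ?thesis using that by (auto simp: ennreal_mult_less_top ennreal_eq_0_iff)
    qed
    let ?T = "\<lambda>a. \<integral>\<^sup>+\<xi>. ennreal (indicator {1<..} \<xi> * (\<alpha> * \<xi> powr (- \<alpha>))) * rearr_mean h (\<xi> * a) \<partial>lborel"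
    let ?c = "ennreal (1 + 2 / (1 - \<alpha>))"
    have "Lebesgue_norm lborel ?q (frac_int \<alpha> h) = lorentz_fun \<sigma> ?q (rearr lborel (frac_int \<alpha> h))"
      by (rule Lebesgue_norm_eq_lorentz_fun[OF _ \<sigma>]) measurable
    also have "\<dots> \<le> lorentz_fun \<sigma> ?q (\<lambda>a. ennreal (a powr (1 - \<alpha>)) * (?c * rearr_mean h a + ?T a))"
      using \<alpha> h_fin by (intro lorentz_fun_mono[OF _ q] rearr_frac_int_le) auto
    \<comment> \<open>The factor a powr (1 - \<alpha>) trades the first index \<sigma> for \<rho>;
      this is the scaling relation.\<close>
    also have "\<dots> = lorentz_fun \<rho> ?q (\<lambda>a. ?c * rearr_mean h a + ?T a)"
    proof -
      have "ennreal (exp (x / \<sigma>)) * (ennreal (exp x powr (1 - \<alpha>)) * z) = ennreal (exp (x / \<rho>)) * z" for x z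
      proof -
        have "x / \<sigma> + (1 - \<alpha>) * x = x * (1 / \<sigma> + (1 - \<alpha>))" by (simp add: field_simps)
        also have "\<dots> = x / \<rho>" by (simp add: scaling)
        finally have "exp (x / \<sigma>) * exp x powr (1 - \<alpha>) = exp (x / \<rho>)" by (simp add: powr_def flip: exp_add)
        then show ?thesis by (simp add: ennreal_mult_assoc)
      qed
      then show ?thesis by (simp only: lorentz_fun_def)
    qed
    also have "\<dots> \<le> lorentz_fun \<rho> ?q (\<lambda>a. ?c * rearr_mean h a) + lorentz_fun \<rho> ?q ?T"
      unfolding lorentz_fun_def distrib_left by (intro Lebesgue_norm_add sigma_finite_lborel q) measurable
    also have "lorentz_fun \<rho> ?q (\<lambda>a. ?c * rearr_mean h a) = ?c * lorentz_fun \<rho> ?q (rearr_mean h)"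
      using \<alpha> by (intro lorentz_fun_cmult[OF _ q]) auto
    also have "lorentz_fun \<rho> ?q ?T \<le> C2 * lorentz_fun \<rho> ?q (rearr_mean h)"
      unfolding C2_def by (rule lorentz_fun_average_le[OF _ _ q]) (use \<alpha> in auto)
    also have "?c * lorentz_fun \<rho> ?q (rearr_mean h) + C2 * lorentz_fun \<rho> ?q (rearr_mean h) = (?c + C2) * lorentz_fun \<rho> ?q (rearr_mean h)"
      by (simp add: distrib_right)
    also have "\<dots> \<le> (?c + C2) * (C1 * lorentz_fun \<rho> ?q (rearr lborel h))"
    proof (rule mult_left_mono)
      have "lorentz_fun \<rho> ?q (\<lambda>a. \<integral>\<^sub>+\<eta>. ennreal (indicator {0<..<1} \<eta>) * rearr lborel h (\<eta> * a)) \<le> C1 * lorentz_fun \<rho> ?q (rearr lborel h)"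
        unfolding C1_def by (rule lorentz_fun_average_le[OF _ _ q]) auto
      then show "lorentz_fun \<rho> ?q (rearr_mean h) \<le> C1 * lorentz_fun \<rho> ?q (rearr lborel h)"
        by (simp add: rearr_mean_def[abs_def])
    qed simp
    also have "\<dots> \<le> (?c + C2) * (C1 * Lebesgue_norm lborel (ennreal \<rho>) h)"
      using \<rho> \<rho>\<sigma> by (intro mult_left_mono lorentz_fun_nested) auto
    also have "\<dots> = K * Lebesgue_norm lborel (ennreal \<rho>) h" by (simp add: K_def distrib_right mult.assoc)
    finally show ?thesis by (simp add: add_left_mono)
  qed
  show ?thesis
  proof
    \<comment> \<open>Adding 1 keeps the constant nonzero, so that the bound also reads \<infinity>
      when the norm of h is infinite.\<close>
    show "0 \<le> enn2real K + 1" by simp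
    fix h :: "real \<Rightarrow> ennreal" assume h: "h \<in> borel_measurable lborel"
    show "Lebesgue_norm lborel ?q (frac_int \<alpha> h) \<le> ennreal (enn2real K + 1) * Lebesgue_norm lborel (ennreal \<rho>) h"
    proof (cases "Lebesgue_norm lborel (ennreal \<rho>) h < top")
      case True
      have "K \<le> ennreal (enn2real K + 1)" using K by (cases K) (auto intro!: ennreal_leI)
      then show ?thesis using main[OF h True] by (metis mult_right_mono order_trans zero_le)
    next
      case False
      then have "Lebesgue_norm lborel (ennreal \<rho>) h = top" unfolding less_top[symmetric] not_not .
      moreover have "ennreal (enn2real K + 1) \<noteq> 0"
        using enn2real_nonneg[of K] by (simp only: ennreal_eq_0_iff)
      ultimately have "ennreal (enn2real K + 1) * Lebesgue_norm lborel (ennreal \<rho>) h = top" by (simp add: ennreal_mult_top)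
      then show ?thesis by simp
    qed
  qed
qed

subsection \<open>Approximation by simple functions of time\<close>

lemma measurable_section:
  assumes "jointly_borel F"
  shows "F t \<in> borel_measurable borel"
proof -
  have "(\<lambda>y. case_prod F (t, y)) \<in> borel_measurable borel" using assms by (rule measurable_compose_Pair1[rotated]) simp
  then show ?thesis by simp
qed

lemma borel_measurable_lorentz_norm_section:
  fixes F :: "real \<Rightarrow> 'a::euclidean_space \<Rightarrow> complex"
  assumes F [measurable]: "jointly_borel F" and q: "1 \<le> q" and P: "0 < P"
  shows "(\<lambda>t. lorentz_norm (ennreal P) q (F t)) \<in> borel_measurable borel"
proof -
  have [measurable]: "(\<lambda>(\<tau>, c). section_rearr F \<tau> c) \<in> borel_measurable (borel \<Otimes>\<^sub>M borel)"
    by (rule borel_measurable_rearr_pair[OF sigma_finite_lborel]) measurable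
  have "(\<lambda>t. lorentz_fun P q (section_rearr F t)) \<in> borel_measurable borel"
    unfolding lorentz_fun_def by (rule borel_measurable_Lebesgue_norm[OF sigma_finite_lborel q]) measurable
  then show ?thesis by (simp add: lorentz_norm_borel[OF measurable_section[OF F] q P])
qed

lemma lorentz_norm_minus_commute: "lorentz_norm p q (\<lambda>x. f x - g x) = lorentz_norm p q (\<lambda>x. g x - f x)"
  unfolding lorentz_norm_def decreasing_rearrangement_def by (simp only: norm_minus_commute)

lemma lorentz_norm_diff_le:
  fixes f g h :: "'a::euclidean_space \<Rightarrow> complex"
  assumes [measurable]: "f \<in> borel_measurable lebesgue" "g \<in> borel_measurable lebesgue" "h \<in> borel_measurable lebesgue"
    and q: "1 \<le> q" and P: "1 \<le> P"
  shows "lorentz_norm (ennreal P) q (\<lambda>x. f x - g x)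
    \<le> 2 * (lorentz_norm (ennreal P) q (\<lambda>x. f x - h x) + lorentz_norm (ennreal P) q (\<lambda>x. g x - h x))"
  using lorentz_norm_add[of "\<lambda>x. f x - h x" "\<lambda>x. h x - g x" q P] q P
  by (simp add: lorentz_norm_minus_commute[of _ _ h g])

lemma lorentz_norm_zero: "1 \<le> q \<Longrightarrow> 0 < P \<Longrightarrow> lorentz_norm (ennreal P) q (\<lambda>_. 0) = 0"
  by (simp add: lorentz_norm_borel lorentz_fun_def Lebesgue_norm_zero)

text \<open>The weak-type bound x^(-1/P) is integrable at 0 because P > 1.\<close>

lemma nn_integral_rearr_le_lorentz:
  assumes [measurable]: "g \<in> borel_measurable M" and q: "1 \<le> q" and P: "1 < P" and c: "0 < c"
  shows "(\<integral>\<^sub>+x. indicator {0<..<c} x * rearr M g x)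
    \<le> ennreal (exp (1 / P) * (c powr (1 - 1 / P) / (1 - 1 / P))) * lorentz_fun P q (rearr M g)"
proof -
  have "(\<integral>\<^sub>+x. indicator {0<..<c} x * rearr M g x)
      \<le> (\<integral>\<^sub>+x. indicator {0<..c} x * ennreal (x powr (- (1 / P))) * (ennreal (exp (1 / P)) * lorentz_fun P q (rearr M g)))"
  proof (intro nn_integral_mono)
    fix x :: real
    show "indicator {0<..<c} x * rearr M g x \<le> indicator {0<..c} x * ennreal (x powr (- (1 / P))) * (ennreal (exp (1 / P)) * lorentz_fun P q (rearr M g))"
      using rearr_le_lorentz[OF assms(1) q, of P x] P
      by (auto simp: indicator_def ennreal_mult_assoc mult.commute[of "exp _"])
  qed
  also have "\<dots> = ennreal (c powr (1 - 1 / P) / (1 - 1 / P)) * (ennreal (exp (1 / P)) * lorentz_fun P q (rearr M g))"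
    using P c by (subst nn_integral_multc) (auto simp: nn_integral_powr_Ioc)
  also have "\<dots> = ennreal (exp (1 / P) * (c powr (1 - 1 / P) / (1 - 1 / P))) * lorentz_fun P q (rearr M g)"
    using P by (subst ennreal_mult_assoc) (auto simp: mult.commute)
  finally show ?thesis .
qed

text \<open>For P > 1 the Lorentz space lies in L^1 on balls, by the Hardy-Littlewood inequality for
  the ball. This is what upgrades convergence in norm to convergence almost everywhere.\<close>

lemma nn_integral_cball_le_lorentz:
  fixes R :: real
  assumes q: "1 \<le> q" and P: "1 < P"
  obtains K where "K < top" "\<And>g :: 'a::euclidean_space \<Rightarrow> complex. g \<in> borel_measurable borel \<Longrightarrow>
    (\<integral>\<^sub>+x. indicator (cball 0 R) x * enorm (g x)) \<le> K * lorentz_norm (ennreal P) q g"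
proof
  \<comment> \<open>Adding 1 keeps c positive also when the ball is null.\<close>
  define c where "c = measure lborel (cball (0::'a) R) + 1"
  have c: "0 < c" by (simp add: c_def add_nonneg_pos)
  let ?K = "ennreal (exp (1 / P) * (c powr (1 - 1 / P) / (1 - 1 / P)))"
  show "?K < top" by simp
  fix g :: "'a \<Rightarrow> complex" assume g [measurable]: "g \<in> borel_measurable borel"
  have "emeasure lborel (cball (0::'a) R) \<le> ennreal c"
    by (subst emeasure_eq_ennreal_measure) (auto simp: c_def intro!: ennreal_leI less_imp_neq[OF emeasure_compact_finite, of "cball (0::'a) R", simplified])
  then have "(\<integral>\<^sub>+x. indicator (cball 0 R) x * enorm (g x))
      \<le> (\<integral>\<^sub>+x. indicator {0<..<c} x * rearr lborel (\<lambda>x. enorm (g x)) x)"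
    by (intro set_nn_integral_le_rearr[OF sigma_finite_lborel]) auto
  also have "\<dots> \<le> ?K * lorentz_fun P q (rearr lborel (\<lambda>x. enorm (g x)))"
    by (rule nn_integral_rearr_le_lorentz[OF _ q P c]) measurable
  finally show "(\<integral>\<^sub>+x. indicator (cball 0 R) x * enorm (g x)) \<le> ?K * lorentz_norm (ennreal P) q g"
    using P by (simp add: lorentz_norm_borel[OF g q])
qed

section \<open>Borel representatives and simple functions of time\<close>

lemma lebesgue_borel_representative:
  fixes g :: "'a::euclidean_space \<Rightarrow> complex"
  assumes g: "g \<in> borel_measurable lebesgue"
  obtains g' where "g' \<in> borel_measurable borel" "AE x in lborel. g x = g' x"
proof -
  have "(\<lambda>x. Re (g x)) \<in> borel_measurable lebesgue" "(\<lambda>x. Im (g x)) \<in> borel_measurable lebesgue"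
    using g by (auto intro: borel_measurable_Re borel_measurable_Im)
  from this[THEN completion_ex_borel_measurable_real] obtain a b where ab: "a \<in> borel_measurable lborel" "b \<in> borel_measurable lborel"
    "AE x in lborel. Re (g x) = a x" "AE x in lborel. Im (g x) = b x" by blast
  show thesis
  proof
    show "(\<lambda>x. Complex (a x) (b x)) \<in> borel_measurable borel" using ab(1,2) unfolding Complex_eq by simp
    show "AE x in lborel. g x = Complex (a x) (b x)" using ab(3,4) by eventually_elim (simp add: complex_eq_iff)
  qed
qed

text \<open>The index set consists of functions because the values of a simple function will serve
  as indices; the summands themselves use the Borel functions \<open>g v\<close>.\<close>

definition tensor_simple :: "real \<Rightarrow> ennreal \<Rightarrow> (real \<Rightarrow> 'a::euclidean_space \<Rightarrow> complex) \<Rightarrow> bool" where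
  "tensor_simple P q S \<longleftrightarrow> (\<exists>(V :: ('a \<Rightarrow> complex) set) A g. finite V \<and>
     (\<forall>v\<in>V. A v \<in> sets borel \<and> g v \<in> borel_measurable borel \<and> lorentz_norm (ennreal P) q (g v) < top) \<and>
     S = (\<lambda>t y. \<Sum>v\<in>V. indicator (A v) t * g v y))"

lemma tensor_simple_measurable:
  fixes S :: "real \<Rightarrow> 'a::euclidean_space \<Rightarrow> complex"
  assumes "tensor_simple P q S"
  shows "jointly_borel S"
proof -
  obtain V :: "('a \<Rightarrow> complex) set" and A g where V: "\<forall>v\<in>V. A v \<in> sets borel \<and> g v \<in> borel_measurable borel \<and> lorentz_norm (ennreal P) q (g v) < top"
    and S: "S = (\<lambda>t y. \<Sum>v\<in>V. indicator (A v) t * g v y)"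
    using assms unfolding tensor_simple_def by (elim exE conjE)
  have "(\<lambda>z. indicator (A v) (fst z) * g v (snd z)) \<in> borel_measurable (borel \<Otimes>\<^sub>M borel)" if "v \<in> V" for v
  proof -
    have [measurable]: "A v \<in> sets borel" "g v \<in> borel_measurable borel" using V that by auto
    show ?thesis by measurable
  qed
  then show ?thesis unfolding S case_prod_beta by (rule borel_measurable_sum)
qed

text \<open>The completion is removed twice: in time by changing the simple function on a null set,
  in space by replacing each of its finitely many values by a Borel function.\<close>

lemma simple_function_lebesgue_on_tensor:
  fixes s :: "real \<Rightarrow> 'a::euclidean_space \<Rightarrow> complex"
  assumes J: "J \<in> sets borel" and s: "simple_function (lebesgue_on J) s" and q: "1 \<le> q" and P: "0 < P"
    and val: "\<And>t. t \<in> J \<Longrightarrow> s t \<in> lorentz_space (ennreal P) q"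
  obtains S where "tensor_simple P q S" "AE t in lborel. t \<in> J \<longrightarrow> (AE y in lborel. S t y = s t y)"
proof -
  define s1 where "s1 t = (if t \<in> J then s t else (\<lambda>_. 0))" for t
  have "simple_function lebesgue s1"
    unfolding simple_function_def
  proof (intro conjI ballI)
    have "finite (s ` J)" using s by (simp add: simple_function_def)
    moreover have "s1 ` space lebesgue \<subseteq> insert (\<lambda>_. 0) (s ` J)" by (auto simp: s1_def)
    ultimately show "finite (s1 ` space lebesgue)" by (meson finite.insertI finite_subset)
    fix v assume "v \<in> s1 ` space lebesgue"
    have "s -` {v} \<inter> J \<in> sets lebesgue"
    proof (cases "v \<in> s ` J")
      case True
      then have "s -` {v} \<inter> J \<in> sets (lebesgue_on J)" using s by (auto simp: simple_function_def)
      then show ?thesis using J by (subst (asm) sets_restrict_space_iff) auto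
    next
      case False
      then have "s -` {v} \<inter> J = {}" by auto
      then show ?thesis by simp
    qed
    moreover have "s1 -` {v} \<inter> space lebesgue = (s -` {v} \<inter> J) \<union> (if v = (\<lambda>_. 0) then - J else {})"
      by (auto simp: s1_def)
    moreover have "- J \<in> sets lebesgue" using J by (metis borel_comp sets_completionI_sets sets_lborel)
    ultimately show "s1 -` {v} \<inter> space lebesgue \<in> sets lebesgue" by auto
  qed
  from completion_ex_simple_function[OF this] obtain s2 where s2: "simple_function lborel s2" and eq: "AE t in lborel. s1 t = s2 t"
    by blast
  \<comment> \<open>On a null set of times s2 may take stray values; only those in the Lorentz space
    are kept.\<close>
  define V where "V = range s2 \<inter> lorentz_space (ennreal P) q"
  have V: "finite V" using s2 by (simp add: V_def simple_function_def)
  have "\<forall>v\<in>V. \<exists>g'. g' \<in> borel_measurable borel \<and> (AE y in lborel. v y = g' y)"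
    using lebesgue_borel_representative unfolding V_def lorentz_space_def by blast
  then obtain g where g: "\<And>v. v \<in> V \<Longrightarrow> g v \<in> borel_measurable borel" "\<And>v. v \<in> V \<Longrightarrow> AE y in lborel. v y = g v y"
    by metis
  define A where "A v = s2 -` {v}" for v
  have A: "A v \<in> sets borel" if "v \<in> V" for v
    using s2 that by (auto simp: A_def V_def simple_function_def)
  have norm_g: "lorentz_norm (ennreal P) q (g v) < top" if v: "v \<in> V" for v
  proof -
    have "lorentz_norm (ennreal P) q (g v) = lorentz_norm (ennreal P) q v"
    proof (rule lorentz_norm_cong_AE[OF _ _ q P])
      show "g v \<in> borel_measurable lebesgue" using g(1)[OF v] by (simp add: measurable_completion)
      show "v \<in> borel_measurable lebesgue" using v by (simp add: V_def lorentz_space_def)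
      show "AE x in lebesgue. g v x = v x" using g(2)[OF v] unfolding AE_completion_iff by eventually_elim simp
    qed
    also have "\<dots> < top" using v by (simp add: V_def lorentz_space_def)
    finally show ?thesis .
  qed
  show thesis
  proof
    show "tensor_simple P q (\<lambda>t y. \<Sum>v\<in>V. indicator (A v) t * g v y)"
      unfolding tensor_simple_def using V A g(1) norm_g by blast
    show "AE t in lborel. t \<in> J \<longrightarrow> (AE y in lborel. (\<Sum>v\<in>V. indicator (A v) t * g v y) = s t y)"
      using eq
    proof eventually_elim
      case (elim t)
      show ?case
      proof
        assume t: "t \<in> J"
        then have s2t: "s2 t = s t" using elim by (simp add: s1_def)
        then have sV: "s t \<in> V" using val[OF t] by (metis IntI V_def rangeI)
        have "(\<Sum>v\<in>V. indicator (A v) t * g v y) = (\<Sum>v\<in>V. if v = s t then g v y else 0)" for y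
          by (intro sum.cong) (auto simp: A_def s2t)
        then have sum: "(\<Sum>v\<in>V. indicator (A v) t * g v y) = g (s t) y" for y using V sV by simp
        show "AE y in lborel. (\<Sum>v\<in>V. indicator (A v) t * g v y) = s t y"
          unfolding sum using g(2)[OF sV] by eventually_elim (rule sym)
      qed
    qed
  qed
qed

lemma nn_integral_suminf_tendsto_0_AE:
  fixes u :: "nat \<Rightarrow> 'a \<Rightarrow> 'b::real_normed_vector"
  assumes [measurable]: "\<And>k. (\<lambda>x. enorm (u k x)) \<in> borel_measurable M"
    and fin: "(\<Sum>k. \<integral>\<^sup>+x. enorm (u k x) \<partial>M) < top"
  shows "AE x in M. (\<lambda>k. u k x) \<longlonglongrightarrow> 0"
proof -
  have "(\<integral>\<^sup>+x. (\<Sum>k. enorm (u k x)) \<partial>M) = (\<Sum>k. \<integral>\<^sup>+x. enorm (u k x) \<partial>M)"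
    by (rule nn_integral_suminf) measurable
  then have "AE x in M. (\<Sum>k. enorm (u k x)) \<noteq> \<infinity>"
    using fin by (intro nn_integral_PInf_AE) auto
  then show ?thesis
  proof eventually_elim
    case (elim x)
    then have "summable (\<lambda>k. norm (u k x))"
      unfolding infinity_ennreal_def by (rule summable_suminf_not_top[OF norm_ge_zero])
    then show ?case by (rule tendsto_norm_zero_cancel[OF summable_LIMSEQ_zero])
  qed
qed

text \<open>Along a subsequence depending measurably on time the convergence is rapid, hence pointwise almost everywhere.\<close>

lemma lorentz_limit_jointly_measurable:
  fixes S :: "nat \<Rightarrow> real \<Rightarrow> 'a::euclidean_space \<Rightarrow> complex"
  assumes J [measurable]: "J \<in> sets borel" and q: "1 \<le> q" and P: "1 < P"
    and S [measurable]: "\<And>n. jointly_borel (S n)"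
    and lim: "AE t in lborel. t \<in> J \<longrightarrow> f t \<in> borel_measurable lebesgue \<and> (\<lambda>n. lorentz_norm (ennreal P) q (\<lambda>y. S n t y - f t y)) \<longlonglongrightarrow> 0"
  obtains F where "jointly_borel F" "\<And>t y. t \<notin> J \<Longrightarrow> F t y = 0"
    "AE t in lborel. t \<in> J \<longrightarrow> (AE y in lborel. F t y = f t y)"
proof -
  let ?L = "lorentz_norm (ennreal P) q"
  have P0: "0 < P" "1 \<le> P" using P by auto
  define D where "D n m t = ?L (\<lambda>y. S n t y - S m t y)" for n m t
  have [measurable]: "D n m \<in> borel_measurable borel" for n m
    unfolding D_def[abs_def] by (rule borel_measurable_lorentz_norm_section[OF _ q P0(1)]) measurable
  \<comment> \<open>The condition says that from index n on the approximants stay within 2^(-k) of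
    the n-th one at time t. It involves only the approximants, so \<open>N k\<close> is Borel
    although joint measurability of f is not known.\<close>
  define good where "good n k t \<longleftrightarrow> (\<forall>j. D n (n + j) t \<le> ennreal ((1 / 2) ^ k))" for n k t
  have [measurable]: "Measurable.pred borel (good n k)" for n k
    unfolding good_def[abs_def] by measurable
  define N where "N k t = (LEAST n. good n k t)" for k t
  have N [measurable]: "N k \<in> measurable borel (count_space UNIV)" for k
    unfolding N_def[abs_def] by measurable
  have SN [measurable]: "(\<lambda>z. S (N k (fst z)) (fst z) (snd z)) \<in> borel_measurable (borel \<Otimes>\<^sub>M borel)" for k
    by (rule measurable_compose_countable[where f="\<lambda>n z. S n (fst z) (snd z)" and g="\<lambda>z. N k (fst z)"]) measurable
  define F where "F t y = (if t \<in> J then lim (\<lambda>k. S (N k t) t y) else 0)" for t y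
  have Fm: "jointly_borel F"
    unfolding F_def case_prod_beta
  proof (rule measurable_If)
    show "(\<lambda>z. lim (\<lambda>k. S (N k (fst z)) (fst z) (snd z))) \<in> borel_measurable (borel \<Otimes>\<^sub>M borel)"
      by (rule borel_measurable_lim_metric[OF SN])
    show "{z \<in> space (borel \<Otimes>\<^sub>M borel). fst z \<in> J} \<in> sets (borel \<Otimes>\<^sub>M borel)" by measurable
  qed simp
  define bound where "bound R K \<longleftrightarrow> K < top \<and> (\<forall>g::'a \<Rightarrow> complex. g \<in> borel_measurable borel \<longrightarrow>
    (\<integral>\<^sub>+x. indicator (cball 0 (real R)) x * enorm (g x)) \<le> K * ?L g)" for R :: nat and K
  have "\<forall>R. \<exists>K. bound R K"
  proof
    fix R :: nat
    show "\<exists>K. bound R K"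
    proof (rule nn_integral_cball_le_lorentz[OF q P, where 'a='a and R="real R"])
      fix K assume "K < top" "\<And>g :: 'a \<Rightarrow> complex. g \<in> borel_measurable borel \<Longrightarrow>
        (\<integral>\<^sub>+x. indicator (cball 0 (real R)) x * enorm (g x)) \<le> K * ?L g"
      then have "bound R K" unfolding bound_def by (intro conjI allI impI)
      then show ?thesis ..
    qed
  qed
  from choice[OF this] obtain K where "\<forall>R. bound R (K R)" ..
  then have K: "K R < top" "\<And>g::'a \<Rightarrow> complex. g \<in> borel_measurable borel \<Longrightarrow>
    (\<integral>\<^sub>+x. indicator (cball 0 (real R)) x * enorm (g x)) \<le> K R * ?L g" for R
    unfolding bound_def by simp_all
  show thesis
  proof (rule that[OF Fm])
    show "F t y = 0" if "t \<notin> J" for t y using that by (simp add: F_def)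
    show "AE t in lborel. t \<in> J \<longrightarrow> (AE y in lborel. F t y = f t y)"
      using lim
    proof eventually_elim
      case (elim t)
      show ?case
      proof
        assume t: "t \<in> J"
        then have ft: "f t \<in> borel_measurable lebesgue" and lim: "(\<lambda>n. ?L (\<lambda>y. S n t y - f t y)) \<longlonglongrightarrow> 0" using elim by auto
        have St: "S n t \<in> borel_measurable borel" for n by (rule measurable_section[OF S])
        then have St': "S n t \<in> borel_measurable lebesgue" for n by (simp add: measurable_completion)
        have "\<exists>n. good n k t" for k
        proof -
          let ?e = "ennreal ((1 / 2) ^ k / 4)"
          have "\<forall>\<^sub>F n in sequentially. ?L (\<lambda>y. S n t y - f t y) < ?e"
            using lim by (rule order_tendstoD) simp
          then obtain n where n: "\<And>m. n \<le> m \<Longrightarrow> ?L (\<lambda>y. S m t y - f t y) < ?e" by (auto simp: eventually_sequentially)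
          have "D n (n + j) t \<le> ennreal ((1 / 2) ^ k)" for j
          proof -
            have "D n (n + j) t \<le> 2 * (?L (\<lambda>y. S n t y - f t y) + ?L (\<lambda>y. S (n + j) t y - f t y))"
              unfolding D_def by (rule lorentz_norm_diff_le[OF St' St' ft q P0(2)])
            also have "\<dots> \<le> ennreal 2 * (?e + ?e)" by (intro mult_mono add_mono less_imp_le[OF n]) auto
            also have "\<dots> = ennreal ((1 / 2) ^ k)"
              by (simp only: ennreal_plus[symmetric] ennreal_mult[symmetric] divide_nonneg_nonneg add_nonneg_nonneg zero_le_power zero_le_numeral zero_le_one) simp
            finally show ?thesis .
          qed
          then show ?thesis unfolding good_def by blast
        qed
        then have good: "good (N k t) k t" for k unfolding N_def by (rule LeastI_ex)
        \<comment> \<open>Let j tend to infinity in the quasi-triangle inequality, whose constant is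
          the factor 2.\<close>
        have close: "?L (\<lambda>y. S (N k t) t y - f t y) \<le> ennreal (2 * (1 / 2) ^ k)" for k
        proof (rule LIMSEQ_le_const)
          have "(\<lambda>j. ?L (\<lambda>y. S (N k t + j) t y - f t y)) \<longlonglongrightarrow> 0"
            using LIMSEQ_ignore_initial_segment[OF lim, of "N k t"] by (simp add: add.commute)
          then have "(\<lambda>j. 2 * (ennreal ((1 / 2) ^ k) + ?L (\<lambda>y. S (N k t + j) t y - f t y))) \<longlonglongrightarrow> 2 * (ennreal ((1 / 2) ^ k) + 0)"
            by (intro ennreal_tendsto_cmult tendsto_add tendsto_const) auto
          then show "(\<lambda>j. 2 * (ennreal ((1 / 2) ^ k) + ?L (\<lambda>y. S (N k t + j) t y - f t y))) \<longlonglongrightarrow> ennreal (2 * (1 / 2) ^ k)"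
            by (simp add: ennreal_mult)
          show "\<exists>j0. \<forall>j\<ge>j0. ?L (\<lambda>y. S (N k t) t y - f t y) \<le> 2 * (ennreal ((1 / 2) ^ k) + ?L (\<lambda>y. S (N k t + j) t y - f t y))"
          proof (intro exI allI impI)
            fix j
            have "?L (\<lambda>y. S (N k t) t y - f t y) \<le> 2 * (D (N k t) (N k t + j) t + ?L (\<lambda>y. f t y - S (N k t + j) t y))"
              unfolding D_def by (rule lorentz_norm_diff_le[OF St' ft St' q P0(2)])
            also have "\<dots> \<le> 2 * (ennreal ((1 / 2) ^ k) + ?L (\<lambda>y. S (N k t + j) t y - f t y))"
              using good[of k] unfolding good_def
              by (subst lorentz_norm_minus_commute) (intro mult_left_mono add_right_mono; simp)
            finally show "?L (\<lambda>y. S (N k t) t y - f t y) \<le> 2 * (ennreal ((1 / 2) ^ k) + ?L (\<lambda>y. S (N k t + j) t y - f t y))" .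
          qed
        qed
        obtain f' where f' [measurable]: "f' \<in> borel_measurable borel" and eq: "AE y in lborel. f t y = f' y"
          using lebesgue_borel_representative[OF ft] .
        have close': "?L (\<lambda>y. S (N k t) t y - f' y) \<le> ennreal (2 * (1 / 2) ^ k)" for k
        proof -
          have "?L (\<lambda>y. S (N k t) t y - f' y) = ?L (\<lambda>y. S (N k t) t y - f t y)"
          proof (rule lorentz_norm_cong_AE[OF _ _ q P0(1)])
            show "(\<lambda>y. S (N k t) t y - f' y) \<in> borel_measurable lebesgue"
              using St' f' by (intro borel_measurable_diff) (auto simp: measurable_completion)
            show "(\<lambda>y. S (N k t) t y - f t y) \<in> borel_measurable lebesgue"
              using St' ft by (intro borel_measurable_diff)
            show "AE x in lebesgue. S (N k t) t x - f' x = S (N k t) t x - f t x"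
              using eq unfolding AE_completion_iff by eventually_elim simp
          qed
          then show ?thesis using close[of k] by simp
        qed
        \<comment> \<open>Errors of size 2^(-k) are summable in L^1 on each ball, which forces
          pointwise convergence almost everywhere.\<close>
        have "AE y in lborel. (\<lambda>k. indicator (cball 0 (real R)) y *\<^sub>R (S (N k t) t y - f' y)) \<longlonglongrightarrow> 0" for R :: nat
        proof (rule nn_integral_suminf_tendsto_0_AE)
          note [measurable] = St
          show "(\<lambda>y. enorm (indicator (cball 0 (real R)) y *\<^sub>R (S (N k t) t y - f' y))) \<in> borel_measurable lborel" for k
            by measurable
          have "(\<integral>\<^sub>+y. enorm (indicator (cball 0 (real R)) y *\<^sub>R (S (N k t) t y - f' y))) \<le> K R * ennreal (2 * (1 / 2) ^ k)" for k
          proof -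
            have "(\<integral>\<^sub>+y. enorm (indicator (cball 0 (real R)) y *\<^sub>R (S (N k t) t y - f' y)))
                = (\<integral>\<^sub>+y. indicator (cball 0 (real R)) y * enorm (S (N k t) t y - f' y))"
              by (intro nn_integral_cong) (auto simp: indicator_def)
            also have "\<dots> \<le> K R * ?L (\<lambda>y. S (N k t) t y - f' y)" by (rule K) measurable
            also have "\<dots> \<le> K R * ennreal (2 * (1 / 2) ^ k)" by (intro mult_left_mono close') simp
            finally show ?thesis .
          qed
          then have "(\<Sum>k. \<integral>\<^sup>+y. enorm (indicator (cball 0 (real R)) y *\<^sub>R (S (N k t) t y - f' y)) \<partial>lborel) \<le> (\<Sum>k. K R * ennreal (2 * (1 / 2) ^ k))"
            by (intro suminf_le) auto
          also have "\<dots> = K R * (\<Sum>k. ennreal (2 * (1 / 2) ^ k))" by simp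
          also have "(\<Sum>k. ennreal (2 * (1 / 2) ^ k)) = ennreal (\<Sum>k. 2 * (1 / 2) ^ k)"
            by (intro suminf_ennreal2 summable_mult summable_geometric) auto
          also have "K R * \<dots> < top" using K(1)[of R] by (simp add: ennreal_mult_less_top)
          finally show "(\<Sum>k. \<integral>\<^sup>+y. enorm (indicator (cball 0 (real R)) y *\<^sub>R (S (N k t) t y - f' y)) \<partial>lborel) < top" .
        qed
        then have "AE y in lborel. \<forall>R::nat. (\<lambda>k. indicator (cball 0 (real R)) y *\<^sub>R (S (N k t) t y - f' y)) \<longlonglongrightarrow> 0"
          unfolding AE_all_countable by blast
        then show "AE y in lborel. F t y = f t y"
          using eq
        proof eventually_elim
          case (elim y)
          obtain R :: nat where "norm y \<le> real R" using real_arch_simple by blast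
          then have "(\<lambda>k. S (N k t) t y - f' y) \<longlonglongrightarrow> 0" using elim(1)[rule_format, of R] by (simp add: dist_norm)
          then have "(\<lambda>k. S (N k t) t y) \<longlonglongrightarrow> f' y" by (simp add: LIM_zero_iff)
          then show ?case using t elim(2) by (simp add: F_def limI)
        qed
      qed
    qed
  qed
qed

lemma tensor_simple_restrict:
  fixes S :: "real \<Rightarrow> 'a::euclidean_space \<Rightarrow> complex"
  assumes S: "tensor_simple P q S" and E: "E \<in> sets borel"
  shows "tensor_simple P q (\<lambda>t y. indicator E t * S t y)"
proof -
  obtain V :: "('a \<Rightarrow> complex) set" and A g where V: "finite V"
    "\<forall>v\<in>V. A v \<in> sets borel \<and> g v \<in> borel_measurable borel \<and> lorentz_norm (ennreal P) q (g v) < top"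
    and eq: "S = (\<lambda>t y. \<Sum>v\<in>V. indicator (A v) t * g v y)"
    using S unfolding tensor_simple_def by (elim exE conjE)
  show ?thesis
    unfolding tensor_simple_def
  proof (intro exI conjI)
    show "finite V" by (rule V)
    show "\<forall>v\<in>V. A v \<inter> E \<in> sets borel \<and> g v \<in> borel_measurable borel \<and> lorentz_norm (ennreal P) q (g v) < top"
      using V(2) E by auto
    show "(\<lambda>t y. indicator E t * S t y) = (\<lambda>t y. \<Sum>v\<in>V. indicator (A v \<inter> E) t * g v y)"
      unfolding eq by (auto simp: fun_eq_iff indicator_def sum_distrib_left intro!: sum.cong)
  qed
qed

lemma time_interval_borel [measurable]: "time_interval T \<in> sets borel"
proof -
  have "Measurable.pred borel (\<lambda>t::real. 0 < t \<and> ereal t < T)" by measurable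
  then show ?thesis by (simp add: time_interval_def pred_def)
qed

lemma AE_lebesgue_on_iff:
  assumes "J \<in> sets borel"
  shows "(AE t in lebesgue_on J. Q t) \<longleftrightarrow> (AE t in lborel. t \<in> J \<longrightarrow> Q t)"
  using assms by (subst AE_restrict_space_iff) (auto simp: AE_completion_iff)

text \<open>The approximants are set to 0 where their error exceeds the norm of F, which gives the
  domination under which fractional integrals of the error tend to 0, and for times beyond n, which
  gives bounded support.\<close>

lemma strongly_measurable_approximation:
  fixes f :: "real \<Rightarrow> 'a::euclidean_space \<Rightarrow> complex"
  assumes q: "1 \<le> q" and P: "1 < P"
    and strong: "lorentz_strongly_measurable T (ennreal P) q f"
    and val: "AE t in lebesgue_on (time_interval T). f t \<in> lorentz_space (ennreal P) q"
  obtains F S where "jointly_borel F" "\<And>t y. t \<notin> time_interval T \<Longrightarrow> F t y = 0"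
    "AE t in lborel. t \<in> time_interval T \<longrightarrow> (AE y in lborel. F t y = f t y)"
    "\<And>n. tensor_simple P q (S n)" "\<And>n t y. t \<notin> {0<..real n} \<Longrightarrow> S n t y = 0"
    "\<And>n t. lorentz_norm (ennreal P) q (\<lambda>y. S n t y - F t y) \<le> lorentz_norm (ennreal P) q (F t)"
    "AE t in lborel. (\<lambda>n. lorentz_norm (ennreal P) q (\<lambda>y. S n t y - F t y)) \<longlonglongrightarrow> 0"
proof -
  let ?J = "time_interval T" and ?L = "lorentz_norm (ennreal P) q"
  have P0: "0 < P" using P by simp
  obtain s where s: "\<And>n. simple_function (lebesgue_on ?J) (s n)" "\<And>n t. t \<in> ?J \<Longrightarrow> s n t \<in> lorentz_space (ennreal P) q"
    and s_lim: "AE t in lebesgue_on ?J. (\<lambda>n. ?L (\<lambda>x. s n t x - f t x)) \<longlonglongrightarrow> 0"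
    using strong unfolding lorentz_strongly_measurable_def by blast
  have "\<forall>n. \<exists>S. tensor_simple P q S \<and> (AE t in lborel. t \<in> ?J \<longrightarrow> (AE y in lborel. S t y = s n t y))"
  proof
    fix n
    show "\<exists>S. tensor_simple P q S \<and> (AE t in lborel. t \<in> ?J \<longrightarrow> (AE y in lborel. S t y = s n t y))"
      by (rule simple_function_lebesgue_on_tensor[OF time_interval_borel s(1)[of n] q P0 s(2)[of _ n]]) (assumption, blast)
  qed
  from choice[OF this] obtain S where S: "\<And>n. tensor_simple P q (S n)"
    and Ss: "\<And>n. AE t in lborel. t \<in> ?J \<longrightarrow> (AE y in lborel. S n t y = s n t y)" by blast
  have Sm [measurable]: "jointly_borel (S n)" for n
    by (rule tensor_simple_measurable[OF S])
  have Sb: "S n t \<in> borel_measurable lebesgue" for n t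
    using measurable_section[OF Sm, of n t] by (simp add: measurable_completion)
  have "AE t in lborel. \<forall>n. t \<in> ?J \<longrightarrow> (AE y in lborel. S n t y = s n t y)"
    unfolding AE_all_countable by (rule allI[OF Ss])
  moreover have "AE t in lborel. t \<in> ?J \<longrightarrow> (\<lambda>n. ?L (\<lambda>x. s n t x - f t x)) \<longlonglongrightarrow> 0"
    using s_lim unfolding AE_lebesgue_on_iff[OF time_interval_borel] .
  moreover have "AE t in lborel. t \<in> ?J \<longrightarrow> f t \<in> lorentz_space (ennreal P) q"
    using val unfolding AE_lebesgue_on_iff[OF time_interval_borel] .
  ultimately have lim: "AE t in lborel. t \<in> ?J \<longrightarrow> f t \<in> borel_measurable lebesgue \<and> (\<lambda>n. ?L (\<lambda>y. S n t y - f t y)) \<longlonglongrightarrow> 0"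
  proof eventually_elim
    case (elim t)
    show ?case
    proof
      assume t: "t \<in> ?J"
      have ft: "f t \<in> borel_measurable lebesgue" using elim(3) t by (simp add: lorentz_space_def)
      have "?L (\<lambda>y. S n t y - f t y) = ?L (\<lambda>y. s n t y - f t y)" for n
      proof (rule lorentz_norm_cong_AE[OF _ _ q P0])
        show "(\<lambda>y. S n t y - f t y) \<in> borel_measurable lebesgue" using Sb ft by (rule borel_measurable_diff)
        have "s n t \<in> borel_measurable lebesgue" using s(2)[OF t] by (simp add: lorentz_space_def)
        then show "(\<lambda>y. s n t y - f t y) \<in> borel_measurable lebesgue" using ft by (rule borel_measurable_diff)
        have "AE y in lborel. S n t y = s n t y" using elim(1) t by blast
        then show "AE y in lebesgue. S n t y - f t y = s n t y - f t y" unfolding AE_completion_iff by eventually_elim simp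
      qed
      then show "f t \<in> borel_measurable lebesgue \<and> (\<lambda>n. ?L (\<lambda>y. S n t y - f t y)) \<longlonglongrightarrow> 0"
        using ft elim(2) t by simp
    qed
  qed
  show thesis
  proof (rule lorentz_limit_jointly_measurable[OF time_interval_borel q P Sm lim])
    fix F assume F [measurable]: "jointly_borel F" and F0: "\<And>t y. t \<notin> ?J \<Longrightarrow> F t y = 0"
      and Ff: "AE t in lborel. t \<in> ?J \<longrightarrow> (AE y in lborel. F t y = f t y)"
    have Fb: "F t \<in> borel_measurable lebesgue" for t
      using measurable_section[OF F, of t] by (simp add: measurable_completion)
    define d where "d n t = ?L (\<lambda>y. S n t y - F t y)" for n t
    define h where "h t = ?L (F t)" for t
    have [measurable]: "d n \<in> borel_measurable borel" "h \<in> borel_measurable borel" for n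
      unfolding d_def[abs_def] h_def[abs_def] by (rule borel_measurable_lorentz_norm_section[OF _ q P0], measurable)+
    have d_lim: "AE t in lborel. t \<in> ?J \<longrightarrow> (\<lambda>n. d n t) \<longlonglongrightarrow> 0"
      using lim Ff
    proof eventually_elim
      case (elim t)
      show ?case
      proof
        assume t: "t \<in> ?J"
        have "d n t = ?L (\<lambda>y. S n t y - f t y)" for n
          unfolding d_def
        proof (rule lorentz_norm_cong_AE[OF _ _ q P0])
          show "(\<lambda>y. S n t y - F t y) \<in> borel_measurable lebesgue" using Sb Fb by (rule borel_measurable_diff)
          show "(\<lambda>y. S n t y - f t y) \<in> borel_measurable lebesgue" using Sb elim(1) t by (intro borel_measurable_diff) auto
          have "AE y in lborel. F t y = f t y" using elim(2) t by blast
          then show "AE y in lebesgue. S n t y - F t y = S n t y - f t y" unfolding AE_completion_iff by eventually_elim simp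
        qed
        then show "(\<lambda>n. d n t) \<longlonglongrightarrow> 0" using elim(1) t by simp
      qed
    qed
    define E where "E n = {t \<in> ?J. t \<le> real n \<and> d n t \<le> h t}" for n
    have E: "E n \<in> sets borel" for n
    proof -
      have "{t \<in> space borel. t \<in> ?J \<and> t \<le> real n \<and> d n t \<le> h t} \<in> sets borel" by measurable
      then show ?thesis by (simp add: E_def)
    qed
    let ?S = "\<lambda>n t y. indicator (E n) t * S n t y"
    have dS: "?L (\<lambda>y. ?S n t y - F t y) = (if t \<in> E n then d n t else h t)" for n t
      using lorentz_norm_minus_commute[of "ennreal P" q "\<lambda>_. 0" "F t"] by (simp add: d_def h_def)
    show thesis
    proof (rule that[OF F F0 Ff])
      show "tensor_simple P q (?S n)" for n by (rule tensor_simple_restrict[OF S E])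
      show "?S n t y = 0" if "t \<notin> {0<..real n}" for n t y
        using that by (auto simp: E_def indicator_def time_interval_def)
      show "?L (\<lambda>y. ?S n t y - F t y) \<le> ?L (F t)" for n t unfolding dS by (auto simp: E_def h_def)
      show "AE t in lborel. (\<lambda>n. ?L (\<lambda>y. ?S n t y - F t y)) \<longlonglongrightarrow> 0"
        unfolding dS using d_lim
      proof eventually_elim
        case (elim t)
        show ?case
        \<comment> \<open>If the norm of F is positive at t, the error is eventually below it and t
          lies in \<open>E n\<close>; if it is 0, the error is 0 whether or not t lies in
          \<open>E n\<close>.\<close>
        proof (cases "t \<in> ?J \<and> h t \<noteq> 0")
          case True
          then have "\<forall>\<^sub>F n in sequentially. d n t < h t" using elim by (intro order_tendstoD(2)[of _ 0]) (auto simp: zero_less_iff_neq_zero)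
          moreover obtain n0 :: nat where "t \<le> real n0" using real_arch_simple by blast
          then have "\<forall>\<^sub>F n in sequentially. t \<le> real n"
            by (intro eventually_sequentiallyI[of n0]) (auto intro: order_trans)
          ultimately have "\<forall>\<^sub>F n in sequentially. d n t = (if t \<in> E n then d n t else h t)"
            by eventually_elim (use True in \<open>auto simp: E_def\<close>)
          then show ?thesis using elim True by (auto intro: Lim_transform_eventually)
        next
          case False
          have "h t = 0"
          proof (cases "t \<in> ?J")
            case True then show ?thesis using False by simp
          next
            case False
            then have "F t = (\<lambda>_. 0)" using F0 by blast
            then show ?thesis by (simp add: h_def lorentz_norm_zero[OF q P0])
          qed
          then have "(if t \<in> E n then d n t else h t) = 0" for n by (auto simp: E_def)
          then show ?thesis by simp
        qed
      qed
    qed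
  qed
qed

subsection \<open>Continuity of translations\<close>

lemma emeasure_lborel_vimage_add:
  assumes "B \<in> sets borel"
  shows "emeasure lborel {s::real. s + h \<in> B} = emeasure lborel B"
proof -
  have "emeasure lborel B = emeasure (distr lborel borel ((+) h)) B" by (simp add: lborel_distr_plus)
  also have "\<dots> = emeasure lborel ((+) h -` B)" using assms by (subst emeasure_distr) auto
  finally show ?thesis by (simp add: vimage_def add.commute)
qed

lemma emeasure_lborel_reflect:
  assumes "B \<in> sets borel"
  shows "emeasure lborel {\<tau>::real. t - \<tau> \<in> B} = emeasure lborel B"
proof -
  have "(\<lambda>\<tau>. t - \<tau>) -` B \<inter> space borel \<in> sets borel" by (rule measurable_sets[OF _ assms]) measurable
  then have B: "{\<tau>. t - \<tau> \<in> B} \<in> sets borel" by (simp add: vimage_def)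
  have "(\<integral>\<^sub>+\<tau>. indicator {\<tau>. t - \<tau> \<in> B} \<tau>) = (\<integral>\<^sub>+\<tau>. indicator B (t - \<tau>))"
    by (intro nn_integral_cong) (auto simp: indicator_def)
  also have "\<dots> = (\<integral>\<^sub>+s. indicator B s)" by (rule nn_integral_lborel_diff) (use assms in measurable)
  finally show ?thesis using assms B by simp
qed

text \<open>Regularity of Lebesgue measure: take a compact K inside A and an open U around A, each
  within c / 4. For shifts shorter than the distance from K to the complement of U, membership in A
  changes only inside four sets of measure at most c / 4.\<close>

lemma translation_continuous:
  fixes A :: "real set"
  assumes A: "A \<in> sets borel" "bounded A" and c: "0 < c"
  obtains \<delta> where "0 < \<delta>" "\<And>h. \<bar>h\<bar> < \<delta> \<Longrightarrow> emeasure lborel {s. (s \<in> A) \<noteq> (s + h \<in> A)} \<le> ennreal c"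
proof -
  have A': "A \<in> sets lebesgue" using A by simp
  have "0 < c / 4" using c by simp
  then have "\<exists>K. closed K \<and> K \<subseteq> A \<and> emeasure lebesgue (A - K) < ennreal (c / 4)"
    "\<exists>U. open U \<and> A \<subseteq> U \<and> emeasure lborel (U - A) < ennreal (c / 4)"
    by (meson sets_lebesgue_inner_closed[OF A'] outer_regular_lborel[OF A(1)])+
  then obtain K U where K: "closed K" "K \<subseteq> A" "emeasure lebesgue (A - K) < ennreal (c / 4)"
    and U: "open U" "A \<subseteq> U" "emeasure lborel (U - A) < ennreal (c / 4)" by (elim exE conjE)
  have [measurable]: "K \<in> sets borel" "U \<in> sets borel" "A \<in> sets borel" using K U A by auto
  have mK: "emeasure lborel (A - K) \<le> ennreal (c / 4)" using K(3) by (simp add: less_imp_le)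
  have mU: "emeasure lborel (U - A) \<le> ennreal (c / 4)" using U(3) by simp
  have "compact K" using K A(2) by (meson bounded_subset compact_eq_bounded_closed)
  moreover have "closed (- U)" "K \<inter> - U = {}" using U K by auto
  ultimately obtain \<delta> where \<delta>: "0 < \<delta>" "\<And>x y. x \<in> K \<Longrightarrow> y \<in> - U \<Longrightarrow> \<delta> \<le> dist x y"
    using separate_compact_closed[of K "- U"] by blast
  show thesis
  proof
    show "0 < \<delta>" by fact
    fix h :: real assume h: "\<bar>h\<bar> < \<delta>"
    let ?N = "(A - K) \<union> {s. s + h \<in> U - A} \<union> ({s. s + h \<in> A - K} \<union> (U - A))"
    have [measurable]: "{s. s + h \<in> B} \<in> sets borel" if "B \<in> sets borel" for B
    proof -
      have "(\<lambda>s. s + h) -` B \<inter> space borel \<in> sets borel" by (rule measurable_sets[OF _ that]) measurable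
      then show ?thesis by (simp add: vimage_def)
    qed
    have near: "x \<in> K \<Longrightarrow> \<bar>x - y\<bar> < \<delta> \<Longrightarrow> y \<in> U" for x y
      using \<delta>(2)[of x y] by (force simp: dist_real_def)
    have "{s. (s \<in> A) \<noteq> (s + h \<in> A)} \<subseteq> ?N"
      using near[of _ "_ + h"] near[of "_ + h"] h by auto
    then have "emeasure lborel {s. (s \<in> A) \<noteq> (s + h \<in> A)} \<le> emeasure lborel ?N"
      by (rule emeasure_mono) (simp, measurable)
    also have "\<dots> \<le> (emeasure lborel (A - K) + emeasure lborel {s. s + h \<in> U - A})
        + (emeasure lborel {s. s + h \<in> A - K} + emeasure lborel (U - A))"
      by (intro order_trans[OF emeasure_subadditive] add_mono order_refl) measurable
    also have "\<dots> \<le> (ennreal (c / 4) + ennreal (c / 4)) + (ennreal (c / 4) + ennreal (c / 4))"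
      by (intro add_mono mK mU) (simp_all only: emeasure_lborel_vimage_add sets.Diff \<open>U \<in> sets borel\<close> \<open>A \<in> sets borel\<close> \<open>K \<in> sets borel\<close> mK mU)
    also have "\<dots> = ennreal c" using c by (simp flip: ennreal_plus)
    finally show "emeasure lborel {s. (s \<in> A) \<noteq> (s + h \<in> A)} \<le> ennreal c" .
  qed
qed

text \<open>The kernel is integrated over (0, c], and beyond c it is at most c^(-\<alpha>). Hence a
  small measure of E makes the integral small, uniformly over the position of E.\<close>

lemma set_nn_integral_powr_le:
  assumes E [measurable]: "E \<in> sets borel" and c: "0 < c" and le: "emeasure lborel E \<le> ennreal c" and \<alpha>: "0 < \<alpha>" "\<alpha> < 1"
  shows "(\<integral>\<^sub>+\<tau>. frac_kernel \<alpha> \<tau> * indicator E \<tau>) \<le> ennreal ((1 / (1 - \<alpha>) + 1) * c powr (1 - \<alpha>))"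
proof -
  have "(\<integral>\<^sub>+\<tau>. frac_kernel \<alpha> \<tau> * indicator E \<tau>)
      \<le> (\<integral>\<^sub>+\<tau>. indicator {0<..c} \<tau> * ennreal (\<tau> powr (- \<alpha>)) + ennreal (c powr (- \<alpha>)) * indicator E \<tau>)"
  proof (intro nn_integral_mono)
    fix \<tau> :: real
    have "ennreal (\<tau> powr (- \<alpha>)) \<le> ennreal (c powr (- \<alpha>))" if "c < \<tau>"
      using that c \<alpha> by (intro ennreal_leI powr_mono2') auto
    then show "frac_kernel \<alpha> \<tau> * indicator E \<tau> \<le> indicator {0<..c} \<tau> * ennreal (\<tau> powr (- \<alpha>)) + ennreal (c powr (- \<alpha>)) * indicator E \<tau>"
      by (cases "\<tau> \<le> c") (auto simp: indicator_def)
  qed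
  also have "\<dots> = ennreal (c powr (1 - \<alpha>) / (1 - \<alpha>)) + ennreal (c powr (- \<alpha>)) * emeasure lborel E"
    using c \<alpha> by (simp add: nn_integral_add nn_integral_powr_Ioc nn_integral_cmult)
  also have "\<dots> \<le> ennreal (c powr (1 - \<alpha>) / (1 - \<alpha>)) + ennreal (c powr (- \<alpha>)) * ennreal c"
    by (intro add_left_mono mult_left_mono le) simp
  also have "\<dots> = ennreal ((1 / (1 - \<alpha>) + 1) * c powr (1 - \<alpha>))"
  proof -
    have "c powr (- \<alpha>) * c = c powr (1 - \<alpha>)" using c powr_add[of c "- \<alpha>" 1] by simp
    then show ?thesis using c \<alpha> by (simp add: distrib_right flip: ennreal_mult ennreal_plus)
  qed
  finally show ?thesis .
qed

text \<open>Each application of the quasi-triangle inequality costs a factor 2, one for every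
  summand.\<close>

lemma lorentz_norm_sum_le:
  fixes g :: "'i \<Rightarrow> 'a::euclidean_space \<Rightarrow> complex"
  assumes "finite V" and "\<And>v. v \<in> V \<Longrightarrow> g v \<in> borel_measurable lebesgue" and q: "1 \<le> q" and P: "1 \<le> P"
  shows "lorentz_norm (ennreal P) q (\<lambda>y. \<Sum>v\<in>V. g v y) \<le> 2 ^ card V * (\<Sum>v\<in>V. lorentz_norm (ennreal P) q (g v))"
  using assms(1,2)
proof (induction V rule: finite_induct)
  case empty
  then show ?case using q P by (simp add: lorentz_norm_zero)
next
  case (insert v V)
  let ?L = "lorentz_norm (ennreal P) q"
  have "?L (\<lambda>y. \<Sum>v\<in>insert v V. g v y) = ?L (\<lambda>y. g v y + (\<Sum>v\<in>V. g v y))" using insert by simp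
  also have "\<dots> \<le> 2 * (?L (g v) + ?L (\<lambda>y. \<Sum>v\<in>V. g v y))"
    using insert.prems by (intro lorentz_norm_add[OF _ _ q P] borel_measurable_sum) auto
  also have "\<dots> \<le> 2 * (2 ^ card V * ?L (g v) + 2 ^ card V * (\<Sum>v\<in>V. ?L (g v)))"
  proof (intro mult_left_mono add_mono)
    have "1 \<le> (2 ^ card V :: ennreal)" by (rule one_le_power) simp
    then show "?L (g v) \<le> 2 ^ card V * ?L (g v)" using mult_right_mono[of 1 "2 ^ card V" "?L (g v)"] by simp
    show "?L (\<lambda>y. \<Sum>v\<in>V. g v y) \<le> 2 ^ card V * (\<Sum>v\<in>V. ?L (g v))" using insert by simp
  qed simp
  also have "\<dots> = 2 ^ card (insert v V) * (\<Sum>v\<in>insert v V. ?L (g v))"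
    using insert by (simp add: distrib_left mult.assoc)
  finally show ?case .
qed

text \<open>In a finite sum only the indicators depend on time. A shift of time changes them on sets
  of small measure, over which the kernel has a small integral, wherever these sets lie.\<close>

lemma tensor_simple_modulus:
  fixes S :: "real \<Rightarrow> 'a::euclidean_space \<Rightarrow> complex"
  assumes S: "tensor_simple P q S" and supp: "\<And>t y. t \<notin> {0<..R} \<Longrightarrow> S t y = 0"
    and q: "1 \<le> q" and P: "1 \<le> P" and \<alpha>: "0 < \<alpha>" "\<alpha> < 1"
  shows frac_int_tensor_less_top: "frac_int \<alpha> (\<lambda>s. lorentz_norm (ennreal P) q (S s)) t < top"
    and "0 < \<epsilon> \<Longrightarrow> \<exists>\<delta>>0. \<forall>t t'. \<bar>t - t'\<bar> < \<delta> \<longrightarrow>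
      (\<integral>\<^sub>+\<tau>. frac_kernel \<alpha> \<tau> * lorentz_norm (ennreal P) q (\<lambda>y. S (t - \<tau>) y - S (t' - \<tau>) y)) \<le> ennreal \<epsilon>"
proof -
  let ?L = "lorentz_norm (ennreal P) q"
  obtain V :: "('a \<Rightarrow> complex) set" and A0 g where V: "finite V" and A0: "\<And>v. v \<in> V \<Longrightarrow> A0 v \<in> sets borel"
    and g: "\<And>v. v \<in> V \<Longrightarrow> g v \<in> borel_measurable borel" "\<And>v. v \<in> V \<Longrightarrow> ?L (g v) < top"
    and S_eq: "S = (\<lambda>t y. \<Sum>v\<in>V. indicator (A0 v) t * g v y)"
  proof -
    obtain V :: "('a \<Rightarrow> complex) set" and A0 g where "finite V"
      and *: "\<forall>v\<in>V. A0 v \<in> sets borel \<and> g v \<in> borel_measurable borel \<and> ?L (g v) < top"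
      and "S = (\<lambda>t y. \<Sum>v\<in>V. indicator (A0 v) t * g v y)"
      using S unfolding tensor_simple_def by (elim exE conjE)
    then show thesis using that[of V A0 g] by simp
  qed
  define A where "A v = A0 v \<inter> {0<..R}" for v
  have A [measurable]: "A v \<in> sets borel" "bounded (A v)" if "v \<in> V" for v
    using A0[OF that] by (auto simp: A_def intro: bounded_subset[OF bounded_closed_interval[of 0 R]])
  have S_A: "S t y = (\<Sum>v\<in>V. indicator (A v) t * g v y)" for t y
  proof (cases "t \<in> {0<..R}")
    case True then show ?thesis by (simp add: S_eq A_def indicator_inter_arith)
  next
    case False then show ?thesis using supp[OF False] by (simp add: A_def)
  qed
  have g': "g v \<in> borel_measurable lebesgue" if "v \<in> V" for v using g(1)[OF that] by (simp add: measurable_completion)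
  define M where "M = enn2real (2 ^ card V * (\<Sum>v\<in>V. ?L (g v)))"
  have M: "2 ^ card V * (\<Sum>v\<in>V. ?L (g v)) = ennreal M" "0 \<le> M"
  proof -
    have "(\<Sum>v\<in>V. ?L (g v)) < top" using g(2) by (subst ennreal_sum_less_top) (auto simp: V)
    moreover have "(2 ^ card V :: ennreal) < top" by (simp add: power_less_top_ennreal)
    ultimately show "2 ^ card V * (\<Sum>v\<in>V. ?L (g v)) = ennreal M" unfolding M_def by (simp add: ennreal_mult_less_top)
  qed (simp add: M_def)
  define C where "C = 1 / (1 - \<alpha>) + 1"
  have C: "0 < C" using \<alpha> by (simp add: C_def add_pos_pos)
  \<comment> \<open>A common bound for both claims, with coefficients supported in sets of measure
    at most c: it is applied to the reflected sets themselves and to their symmetric differences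
    with a translate.\<close>
  have key: "(\<integral>\<^sub>+\<tau>. frac_kernel \<alpha> \<tau> * ?L (\<lambda>y. \<Sum>v\<in>V. w v \<tau> * g v y)) \<le> ennreal (M * (C * c powr (1 - \<alpha>)))"
    if w: "\<And>v \<tau>. v \<in> V \<Longrightarrow> norm (w v \<tau>) \<le> indicator (E v) \<tau>" and E: "\<And>v. v \<in> V \<Longrightarrow> E v \<in> sets borel"
      and c: "0 < c" and m: "\<And>v. v \<in> V \<Longrightarrow> emeasure lborel (E v) \<le> ennreal c" for w :: "('a \<Rightarrow> complex) \<Rightarrow> real \<Rightarrow> complex" and E c
  proof -
    have "?L (\<lambda>y. \<Sum>v\<in>V. w v \<tau> * g v y) \<le> 2 ^ card V * (\<Sum>v\<in>V. indicator (E v) \<tau> * ?L (g v))" for \<tau>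
    proof -
      have "?L (\<lambda>y. \<Sum>v\<in>V. w v \<tau> * g v y) \<le> 2 ^ card V * (\<Sum>v\<in>V. ?L (\<lambda>y. w v \<tau> * g v y))"
        using g' by (intro lorentz_norm_sum_le[OF V _ q P]) auto
      also have "\<dots> \<le> 2 ^ card V * (\<Sum>v\<in>V. indicator (E v) \<tau> * ?L (g v))"
      proof (intro mult_left_mono sum_mono)
        fix v assume v: "v \<in> V"
        have "?L (\<lambda>y. w v \<tau> * g v y) \<le> enorm (w v \<tau>) * ?L (g v)" using P by (intro lorentz_norm_cmult_le[OF g'[OF v] q]) simp
        also have "\<dots> \<le> ennreal (indicator (E v) \<tau>) * ?L (g v)" by (intro mult_right_mono ennreal_leI w v) simp
        finally show "?L (\<lambda>y. w v \<tau> * g v y) \<le> indicator (E v) \<tau> * ?L (g v)" by (simp add: ennreal_indicator)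
      qed simp
      finally show ?thesis .
    qed
    then have "(\<integral>\<^sub>+\<tau>. frac_kernel \<alpha> \<tau> * ?L (\<lambda>y. \<Sum>v\<in>V. w v \<tau> * g v y))
        \<le> (\<integral>\<^sub>+\<tau>. frac_kernel \<alpha> \<tau> * (2 ^ card V * (\<Sum>v\<in>V. indicator (E v) \<tau> * ?L (g v))))"
      by (intro nn_integral_mono mult_left_mono) auto
    also have "\<dots> = (\<integral>\<^sub>+\<tau>. (\<Sum>v\<in>V. 2 ^ card V * ?L (g v) * (frac_kernel \<alpha> \<tau> * indicator (E v) \<tau>)))"
      by (intro nn_integral_cong) (simp add: sum_distrib_left ac_simps)
    also have "\<dots> = (\<Sum>v\<in>V. \<integral>\<^sup>+\<tau>. 2 ^ card V * ?L (g v) * (frac_kernel \<alpha> \<tau> * indicator (E v) \<tau>) \<partial>lborel)"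
    proof (rule nn_integral_sum)
      fix v assume "v \<in> V"
      note [measurable] = E[OF this]
      show "(\<lambda>\<tau>. 2 ^ card V * ?L (g v) * (frac_kernel \<alpha> \<tau> * indicator (E v) \<tau>)) \<in> borel_measurable lborel" by measurable
    qed
    also have "\<dots> \<le> (\<Sum>v\<in>V. 2 ^ card V * ?L (g v) * ennreal (C * c powr (1 - \<alpha>)))"
    proof (rule sum_mono)
      fix v assume v: "v \<in> V"
      note [measurable] = E[OF v]
      have "(\<integral>\<^sub>+\<tau>. 2 ^ card V * ?L (g v) * (frac_kernel \<alpha> \<tau> * indicator (E v) \<tau>))
          = 2 ^ card V * ?L (g v) * (\<integral>\<^sub>+\<tau>. frac_kernel \<alpha> \<tau> * indicator (E v) \<tau>)"
        by (rule nn_integral_cmult) measurable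
      also have "\<dots> \<le> 2 ^ card V * ?L (g v) * ennreal (C * c powr (1 - \<alpha>))"
        unfolding C_def by (intro mult_left_mono set_nn_integral_powr_le[OF E[OF v] c m[OF v] \<alpha>]) simp
      finally show "(\<integral>\<^sub>+\<tau>. 2 ^ card V * ?L (g v) * (frac_kernel \<alpha> \<tau> * indicator (E v) \<tau>))
        \<le> 2 ^ card V * ?L (g v) * ennreal (C * c powr (1 - \<alpha>))" .
    qed
    also have "\<dots> = (2 ^ card V * (\<Sum>v\<in>V. ?L (g v))) * ennreal (C * c powr (1 - \<alpha>))"
      by (simp add: sum_distrib_left sum_distrib_right)
    also have "\<dots> = ennreal (M * (C * c powr (1 - \<alpha>)))"
      unfolding M(1) using M(2) C by (simp add: ennreal_mult)
    finally show ?thesis .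
  qed
  have refl [measurable]: "{\<tau>. t - \<tau> \<in> B} \<in> sets borel" if "B \<in> sets borel" for t :: real and B
  proof -
    have "(\<lambda>\<tau>. t - \<tau>) -` B \<inter> space borel \<in> sets borel" by (rule measurable_sets[OF _ that]) measurable
    then show ?thesis by (simp add: vimage_def)
  qed
  show "frac_int \<alpha> (\<lambda>s. ?L (S s)) t < top"
  proof -
    have "frac_int \<alpha> (\<lambda>s. ?L (S s)) t = (\<integral>\<^sub>+\<tau>. frac_kernel \<alpha> \<tau> * ?L (\<lambda>y. \<Sum>v\<in>V. indicator (A v) (t - \<tau>) * g v y))"
      unfolding frac_int_def by (simp only: S_A[abs_def])
    also have "\<dots> \<le> ennreal (M * (C * (\<bar>R\<bar> + 1) powr (1 - \<alpha>)))"
    proof (rule key[of _ "\<lambda>v. {\<tau>. t - \<tau> \<in> A v}"])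
      fix v assume v: "v \<in> V"
      show "norm (indicator (A v) (t - \<tau>) :: complex) \<le> indicator {\<tau>. t - \<tau> \<in> A v} \<tau>" for \<tau> by (simp add: indicator_def)
      show "{\<tau>. t - \<tau> \<in> A v} \<in> sets borel" by (rule refl[OF A(1)[OF v]])
      have "emeasure lborel {\<tau>. t - \<tau> \<in> A v} = emeasure lborel (A v)" by (rule emeasure_lborel_reflect[OF A(1)[OF v]])
      also have "\<dots> \<le> emeasure lborel {0..\<bar>R\<bar>}" by (rule emeasure_mono) (auto simp: A_def)
      also have "\<dots> \<le> ennreal (\<bar>R\<bar> + 1)" by (simp add: ennreal_leI)
      finally show "emeasure lborel {\<tau>. t - \<tau> \<in> A v} \<le> ennreal (\<bar>R\<bar> + 1)" .
    qed simp
    also have "\<dots> < top" by simp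
    finally show ?thesis .
  qed
  assume \<epsilon>: "0 < \<epsilon>"
  \<comment> \<open>c makes M C c^(1 - \<alpha>) at most \<epsilon>; the denominator M C + 1 avoids
    a division by 0.\<close>
  define c where "c = (\<epsilon> / (M * C + 1)) powr (1 / (1 - \<alpha>))"
  have MC: "0 \<le> M * C" using M(2) C by simp
  then have c: "0 < c" using \<epsilon> by (simp add: c_def add_nonneg_pos)
  have c_le: "M * (C * c powr (1 - \<alpha>)) \<le> \<epsilon>"
  proof -
    have "c powr (1 - \<alpha>) = \<epsilon> / (M * C + 1)" using \<epsilon> MC \<alpha> by (simp add: c_def powr_powr)
    then have "M * (C * c powr (1 - \<alpha>)) = M * C / (M * C + 1) * \<epsilon>" by simp
    also have "\<dots> \<le> 1 * \<epsilon>" using MC \<epsilon> by (intro mult_right_mono) auto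
    finally show ?thesis by simp
  qed
  have "\<forall>v\<in>V. \<exists>\<delta>>0. \<forall>h. \<bar>h\<bar> < \<delta> \<longrightarrow> emeasure lborel {s. (s \<in> A v) \<noteq> (s + h \<in> A v)} \<le> ennreal c"
    using translation_continuous[OF A c] by metis
  then obtain \<delta> where \<delta>: "\<And>v. v \<in> V \<Longrightarrow> 0 < \<delta> v"
    "\<And>v h. v \<in> V \<Longrightarrow> \<bar>h\<bar> < \<delta> v \<Longrightarrow> emeasure lborel {s. (s \<in> A v) \<noteq> (s + h \<in> A v)} \<le> ennreal c" by metis
  define d where "d = Min (insert 1 (\<delta> ` V))"
  have d: "0 < d" unfolding d_def using V \<delta>(1) by (subst Min_gr_iff) auto
  have d_le: "d \<le> \<delta> v" if "v \<in> V" for v unfolding d_def using V that by (intro Min_le) auto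
  show "\<exists>\<delta>>0. \<forall>t t'. \<bar>t - t'\<bar> < \<delta> \<longrightarrow>
      (\<integral>\<^sub>+\<tau>. frac_kernel \<alpha> \<tau> * ?L (\<lambda>y. S (t - \<tau>) y - S (t' - \<tau>) y)) \<le> ennreal \<epsilon>"
  proof (intro exI conjI allI impI)
    fix t t' :: real assume tt': "\<bar>t - t'\<bar> < d"
    let ?B = "\<lambda>v. {s. (s \<in> A v) \<noteq> (s + (t' - t) \<in> A v)}"
    let ?w = "\<lambda>v \<tau>. indicator (A v) (t - \<tau>) - indicator (A v) (t' - \<tau>) :: complex"
    have B: "?B v \<in> sets borel" if "v \<in> V" for v
    proof -
      note [measurable] = A(1)[OF that]
      have "{s \<in> space borel. (s \<in> A v) \<noteq> (s + (t' - t) \<in> A v)} \<in> sets borel" by measurable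
      then show ?thesis by simp
    qed
    have "(\<integral>\<^sub>+\<tau>. frac_kernel \<alpha> \<tau> * ?L (\<lambda>y. S (t - \<tau>) y - S (t' - \<tau>) y))
        = (\<integral>\<^sub>+\<tau>. frac_kernel \<alpha> \<tau> * ?L (\<lambda>y. \<Sum>v\<in>V. ?w v \<tau> * g v y))"
      by (simp only: S_A sum_subtractf left_diff_distrib)
    also have "\<dots> \<le> ennreal (M * (C * c powr (1 - \<alpha>)))"
    proof (rule key[of _ "\<lambda>v. {\<tau>. t - \<tau> \<in> ?B v}"])
      fix v assume v: "v \<in> V"
      show "norm (?w v \<tau>) \<le> indicator {\<tau>. t - \<tau> \<in> ?B v} \<tau>" for \<tau> by (auto simp: indicator_def)
      show "{\<tau>. t - \<tau> \<in> ?B v} \<in> sets borel" by (rule refl[OF B[OF v]])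
      have "emeasure lborel {\<tau>. t - \<tau> \<in> ?B v} = emeasure lborel (?B v)" by (rule emeasure_lborel_reflect[OF B[OF v]])
      also have "\<dots> \<le> ennreal c" using tt' d_le[OF v] by (intro \<delta>(2)[OF v]) simp
      finally show "emeasure lborel {\<tau>. t - \<tau> \<in> ?B v} \<le> ennreal c" .
    qed (rule c)
    also have "\<dots> \<le> ennreal \<epsilon>" by (rule ennreal_leI[OF c_le])
    finally show "(\<integral>\<^sub>+\<tau>. frac_kernel \<alpha> \<tau> * ?L (\<lambda>y. S (t - \<tau>) y - S (t' - \<tau>) y)) \<le> ennreal \<epsilon>" .
  qed (rule d)
qed

subsection \<open>The Duhamel integral\<close>

text \<open>The substitution \<tau> = t - s turns the Duhamel integral into the time integral of the
  group acting on the retarded datum; data that vanish at negative times supply the lower limit s =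
  0.\<close>

definition retard :: "(real \<Rightarrow> 'a \<Rightarrow> complex) \<Rightarrow> real \<Rightarrow> real \<Rightarrow> 'a \<Rightarrow> complex" where
  "retard F t \<tau> y = (if 0 < \<tau> then F (t - \<tau>) y else 0)"

lemma forward_retard:
  fixes F :: "real \<Rightarrow> 'a::euclidean_space \<Rightarrow> complex"
  assumes F: "jointly_borel F"
  shows "forward (retard F t)"
proof (rule forwardI)
  have "(\<lambda>z. case_prod F (t - fst z, snd z)) \<in> borel_measurable (borel \<Otimes>\<^sub>M borel)"
    by (rule measurable_compose[OF _ F]) measurable
  then have [measurable]: "(\<lambda>z. F (t - fst z) (snd z)) \<in> borel_measurable (borel \<Otimes>\<^sub>M borel)" by simp
  show "(\<lambda>z. retard F t (fst z) (snd z)) \<in> borel_measurable (borel \<Otimes>\<^sub>M borel)"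
    unfolding retard_def by (rule measurable_If) measurable
qed (simp add: retard_def)

lemma disp_mass_retard_diff:
  fixes F G :: "real \<Rightarrow> 'a::euclidean_space \<Rightarrow> complex"
  assumes F: "jointly_borel F" and G: "jointly_borel G"
    and P: "2 < P" and q: "1 \<le> q"
  shows "disp_mass P q (\<lambda>\<tau> y. retard F t \<tau> y - retard G t' \<tau> y)
    = (\<integral>\<^sub>+\<tau>. indicator {0<..} \<tau> * ennreal (\<tau> powr (- (DIM('a) / 2 - DIM('a) / P))) *
        lorentz_norm (ennreal (P / (P - 1))) q (\<lambda>y. F (t - \<tau>) y - G (t' - \<tau>) y))"
  unfolding disp_mass_def
proof (intro nn_integral_cong)
  fix \<tau> :: real
  have Q: "0 < P / (P - 1)" using P by simp
  have [measurable]: "(\<lambda>y. F (t - \<tau>) y - G (t' - \<tau>) y) \<in> borel_measurable borel"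
    using measurable_section[OF F] measurable_section[OF G] by (rule borel_measurable_diff)
  show "ennreal (\<tau> powr (- (DIM('a) / 2 - DIM('a) / P))) * lorentz_fun (P / (P - 1)) q (section_rearr (\<lambda>\<tau> y. retard F t \<tau> y - retard G t' \<tau> y) \<tau>)
    = indicator {0<..} \<tau> * ennreal (\<tau> powr (- (DIM('a) / 2 - DIM('a) / P))) * lorentz_norm (ennreal (P / (P - 1))) q (\<lambda>y. F (t - \<tau>) y - G (t' - \<tau>) y)"
  proof (cases "0 < \<tau>")
    case True
    then show ?thesis by (simp add: retard_def lorentz_norm_borel[OF _ q Q])
  next
    case False
    then show ?thesis by (simp add: retard_def lorentz_fun_def Lebesgue_norm_zero[OF q])
  qed
qed

text \<open>Here the spatial estimate hands over to the Hardy-Littlewood-Sobolev inequality in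
  time.\<close>

lemma disp_mass_retard:
  fixes F :: "real \<Rightarrow> 'a::euclidean_space \<Rightarrow> complex"
  assumes F: "jointly_borel F" and P: "2 < P" and q: "1 \<le> q"
  shows "disp_mass P q (retard F t) = frac_int (DIM('a) / 2 - DIM('a) / P) (\<lambda>s. lorentz_norm (ennreal (P / (P - 1))) q (F s)) t"
proof -
  have "retard (\<lambda>_ _. 0) t = (\<lambda>_ (_::'a). 0)" by (auto simp: retard_def fun_eq_iff)
  then show ?thesis
    using disp_mass_retard_diff[OF F _ P q, of "\<lambda>_ _. 0" t t] by (simp add: frac_int_def)
qed

text \<open>\<open>schr_limit_lorentz\<close> provides some limit; uniqueness transfers its
  conclusions to every limit, in particular to the differences built by
  \<open>schr_limit_diff\<close>.\<close>

lemma lorentz_norm_schr_limit_le: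
  fixes v :: "'a::euclidean_space \<Rightarrow> complex"
  assumes v: "schr_limit H v" and P: "2 < P" and q: "1 \<le> q" and fin: "disp_mass P q H < top"
  shows "lorentz_norm (ennreal P) q v \<le> disp_const P * disp_mass P q H"
    and "\<phi> \<in> schwartz_space \<Longrightarrow> integrable lborel (\<lambda>z. schr_pair H \<phi> z)"
    and "\<phi> \<in> schwartz_space \<Longrightarrow> (\<integral>x. v x * \<phi> x \<partial>lborel) = (\<integral>z. schr_pair H \<phi> z \<partial>lborel)"
proof -
  have H: "forward H" using v by (simp add: schr_limit_def)
  obtain w where w: "schr_limit H w" "lorentz_norm (ennreal P) q w \<le> disp_const P * disp_mass P q H"
    and int: "\<And>\<phi>. \<phi> \<in> schwartz_space \<Longrightarrow> integrable lborel (\<lambda>z. schr_pair H \<phi> z)"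
    and eq: "\<And>\<phi>. \<phi> \<in> schwartz_space \<Longrightarrow> (\<integral>x. w x * \<phi> x \<partial>lborel) = (\<integral>z. schr_pair H \<phi> z \<partial>lborel)"
    using schr_limit_lorentz[OF H P q fin] by blast
  have vw: "AE x in lborel. v x = w x" by (rule schr_limit_unique[OF v w(1)])
  have m [measurable]: "v \<in> borel_measurable borel" "w \<in> borel_measurable borel" using v w(1) by (simp_all add: schr_limit_def)
  have "lorentz_norm (ennreal P) q v = lorentz_norm (ennreal P) q w"
  proof (rule lorentz_norm_cong_AE[OF _ _ q])
    show "v \<in> borel_measurable lebesgue" "w \<in> borel_measurable lebesgue" using m by (simp_all add: measurable_completion)
    show "AE x in lebesgue. v x = w x" using vw by (simp add: AE_completion_iff)
  qed (use P in simp)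
  then show "lorentz_norm (ennreal P) q v \<le> disp_const P * disp_mass P q H" using w(2) by simp
  assume \<phi>: "\<phi> \<in> schwartz_space"
  then show "integrable lborel (\<lambda>z. schr_pair H \<phi> z)" by (rule int)
  have [measurable]: "\<phi> \<in> borel_measurable borel" using schwartz_integrable[OF \<phi>] by auto
  have "(\<integral>x. v x * \<phi> x \<partial>lborel) = (\<integral>x. w x * \<phi> x \<partial>lborel)"
  proof (rule integral_cong_AE)
    show "AE x in lborel. v x * \<phi> x = w x * \<phi> x" using vw by eventually_elim simp
  qed measurable
  then show "(\<integral>x. v x * \<phi> x \<partial>lborel) = (\<integral>z. schr_pair H \<phi> z \<partial>lborel)"
    using eq[OF \<phi>] by simp
qed

lemma schr_limit_retard_pairing:
  fixes F :: "real \<Rightarrow> 'a::euclidean_space \<Rightarrow> complex"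
  assumes v: "schr_limit (retard F t) v" and P: "2 < P" and q: "1 \<le> q" and fin: "disp_mass P q (retard F t) < top"
    and \<phi>: "\<phi> \<in> schwartz_space"
  shows "(\<integral>x. v x * \<phi> x \<partial>lborel) = (\<integral>s. indicator {..<t} s *\<^sub>R (\<integral>y. F s y * schroedinger (t - s) \<phi> y \<partial>lborel) \<partial>lborel)"
proof -
  let ?H = "retard F t"
  let ?I = "\<lambda>\<tau>. \<integral>y. ?H \<tau> y * schroedinger \<tau> \<phi> y \<partial>lborel"
  have "integrable (lborel \<Otimes>\<^sub>M lborel) (\<lambda>z. schr_pair ?H \<phi> z)"
    unfolding lborel_prod by (rule lorentz_norm_schr_limit_le(2)[OF v P q fin \<phi>])
  from lborel_pair.integral_fst'[OF this]
  have "(\<integral>z. schr_pair ?H \<phi> z \<partial>lborel) = (\<integral>\<tau>. ?I \<tau> \<partial>lborel)"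
    unfolding lborel_prod by simp
  also have "\<dots> = (\<integral>s. ?I (t - s) \<partial>lborel)"
    using lborel_integral_real_affine[of "-1" ?I t] by simp
  also have "\<dots> = (\<integral>s. indicator {..<t} s *\<^sub>R (\<integral>y. F s y * schroedinger (t - s) \<phi> y \<partial>lborel) \<partial>lborel)"
    by (intro Bochner_Integration.integral_cong refl) (auto simp: retard_def indicator_def)
  finally show ?thesis using lorentz_norm_schr_limit_le(3)[OF v P q fin \<phi>] by simp
qed

text \<open>Split g at its rearrangement at 1: the excess is integrable since Q > 1 and meets the
  supremum of \<psi>, the rest is square-integrable since Q < 2 and meets its L^2 norm. A Schwartz
  function keeps both quantities bounded under the group.\<close>

lemma nn_integral_mult_lorentz_le:
  assumes Q: "1 < Q" "Q < 2" and q: "1 \<le> q"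
  obtains K1 K2 where "K1 < top" "K2 < top"
    "\<And>(g :: 'a::euclidean_space \<Rightarrow> complex) \<psi> S. g \<in> borel_measurable borel \<Longrightarrow> \<psi> \<in> borel_measurable borel \<Longrightarrow> (\<And>x. norm (\<psi> x) \<le> S) \<Longrightarrow>
      lorentz_norm (ennreal Q) q g < top \<Longrightarrow>
      (\<integral>\<^sub>+x. enorm (g x * (\<psi> x :: complex)))
        \<le> (K1 * ennreal S + K2 * L2norm lborel (\<lambda>x. enorm (\<psi> x))) * lorentz_norm (ennreal Q) q g"
proof
  define J where "J = (\<integral>\<^sub>+c. indicator {1 / 2<..} c * ennreal (c powr (- 1 / 2 - 1 / Q)))"
  let ?K1 = "ennreal (exp (1 / Q) * (1 powr (1 - 1 / Q) / (1 - 1 / Q)))" and ?K2 = "3 * (J * ennreal (exp (1 / Q)))"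
  have "- 1 / 2 - 1 / Q < - 1" using Q by (simp add: field_simps)
  then have "J < top" unfolding J_def by (rule nn_integral_powr_inf) simp
  then show "?K1 < top" "?K2 < top" by (simp_all add: ennreal_mult_less_top)
  fix g :: "'a \<Rightarrow> complex" and \<psi> :: "'a \<Rightarrow> complex" and S
  assume [measurable]: "g \<in> borel_measurable borel" "\<psi> \<in> borel_measurable borel"
    and S: "\<And>x. norm (\<psi> x) \<le> S" and fin: "lorentz_norm (ennreal Q) q g < top"
  let ?g = "\<lambda>x. enorm (g x)" and ?\<psi> = "\<lambda>x. enorm (\<psi> x)"
  let ?r = "rearr lborel ?g" and ?L = "lorentz_norm (ennreal Q) q g"
  have L: "?L = lorentz_fun Q q ?r" using Q q by (simp add: lorentz_norm_borel)
  have r_le: "?r c \<le> ennreal (exp (1 / Q) * c powr (- 1 / Q)) * ?L" if "0 < c" for c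
    unfolding L using Q that by (intro rearr_le_lorentz[OF _ q]) auto
  have "?r 1 < top" using r_le[of 1] fin by (auto simp: ennreal_mult_less_top intro: le_less_trans)
  define lev where "lev = enn2real (?r 1)"
  have lev: "ennreal lev = ?r 1" "0 \<le> lev" using \<open>?r 1 < top\<close> by (simp_all add: lev_def)
  have split: "?g x = (?g x - ennreal lev) + min (?g x) (ennreal lev)" for x
  proof (cases "?g x \<le> ennreal lev")
    case True
    then show ?thesis using diff_eq_0_ennreal[OF _ True] by (simp add: min_def)
  next
    case False
    then have "ennreal lev \<le> ?g x" by (rule less_imp_le[OF not_le_imp_less])
    then show ?thesis by (simp add: min_absorb2 diff_add_cancel_ennreal)
  qed
  have "(\<integral>\<^sub>+x. enorm (g x * \<psi> x)) = (\<integral>\<^sub>+x. (?g x - ennreal lev) * ?\<psi> x + min (?g x) (ennreal lev) * ?\<psi> x)"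
  proof (intro nn_integral_cong)
    fix x
    show "enorm (g x * \<psi> x) = (?g x - ennreal lev) * ?\<psi> x + min (?g x) (ennreal lev) * ?\<psi> x"
      using split[of x] by (simp add: norm_mult ennreal_mult flip: distrib_right)
  qed
  also have "\<dots> = (\<integral>\<^sub>+x. (?g x - ennreal lev) * ?\<psi> x) + (\<integral>\<^sub>+x. min (?g x) (ennreal lev) * ?\<psi> x)"
    by (rule nn_integral_add) measurable
  also have "\<dots> \<le> ?K1 * ennreal S * ?L + ?K2 * L2norm lborel ?\<psi> * ?L"
  proof (rule add_mono)
    have "(\<integral>\<^sub>+x. (?g x - ennreal lev) * ?\<psi> x) \<le> (\<integral>\<^sub>+x. (?g x - ennreal lev) * ennreal S)"
      by (intro nn_integral_mono mult_left_mono ennreal_leI S) simp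
    also have "\<dots> = (\<integral>\<^sub>+x. ?g x - ennreal lev) * ennreal S" by (rule nn_integral_multc) measurable
    also have "\<dots> \<le> (\<integral>\<^sub>+c. indicator {0<..<1} c * ?r c) * ennreal S"
      using lev by (intro mult_right_mono nn_integral_diff_rearr_le[OF sigma_finite_lborel]) auto
    also have "\<dots> \<le> ?K1 * ?L * ennreal S"
      unfolding L by (intro mult_right_mono nn_integral_rearr_le_lorentz[OF _ q Q(1)]) auto
    finally show "(\<integral>\<^sub>+x. (?g x - ennreal lev) * ?\<psi> x) \<le> ?K1 * ennreal S * ?L" by (simp only: ac_simps)
    have "(\<integral>\<^sub>+x. min (?g x) (ennreal lev) * ?\<psi> x) \<le> L2norm lborel (\<lambda>x. min (?g x) (ennreal lev)) * L2norm lborel ?\<psi>"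
      by (rule Hoelder_L2) measurable
    also have "L2norm lborel (\<lambda>x. min (?g x) (ennreal lev)) \<le> ?K2 * ?L"
    proof -
      have "L2norm lborel (\<lambda>x. min (?g x) (ennreal lev)) = ennreal_powr (\<integral>\<^sub>+x. ennreal_powr (min (?g x) (ennreal lev)) 2) (1 / 2)"
        using Lebesgue_norm_ennreal[of 2 lborel] by simp
      also have "\<dots> \<le> ennreal_powr (ennreal_powr (3 * (\<integral>\<^sub>+c. indicator {1 / 2<..} c * (ennreal (c powr (- 1 / 2)) * ?r c))) 2) (1 / 2)"
        using lev by (intro ennreal_powr_mono nn_integral_min_rearr_le[OF sigma_finite_lborel]) auto
      also have "\<dots> = 3 * (\<integral>\<^sub>+c. indicator {1 / 2<..} c * (ennreal (c powr (- 1 / 2)) * ?r c))"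
        by (simp add: ennreal_powr_powr)
      also have "(\<integral>\<^sub>+c. indicator {1 / 2<..} c * (ennreal (c powr (- 1 / 2)) * ?r c))
          \<le> (\<integral>\<^sub>+c. indicator {1 / 2<..} c * ennreal (c powr (- 1 / 2 - 1 / Q)) * (ennreal (exp (1 / Q)) * ?L))"
      proof (intro nn_integral_mono)
        fix c :: real
        show "indicator {1 / 2<..} c * (ennreal (c powr (- 1 / 2)) * ?r c) \<le> indicator {1 / 2<..} c * ennreal (c powr (- 1 / 2 - 1 / Q)) * (ennreal (exp (1 / Q)) * ?L)"
        proof (cases "1 / 2 < c")
          case True
          have "ennreal (c powr (- 1 / 2)) * ?r c \<le> ennreal (c powr (- 1 / 2)) * (ennreal (exp (1 / Q) * c powr (- 1 / Q)) * ?L)"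
            using True by (intro mult_left_mono r_le) auto
          also have "\<dots> = ennreal (c powr (- 1 / 2) * (exp (1 / Q) * c powr (- 1 / Q))) * ?L" by (rule ennreal_mult_assoc) auto
          also have "c powr (- 1 / 2) * (exp (1 / Q) * c powr (- 1 / Q)) = c powr (- 1 / 2 - 1 / Q) * exp (1 / Q)"
            using powr_add[of c "- 1 / 2" "- 1 / Q"] by simp
          also have "ennreal (c powr (- 1 / 2 - 1 / Q) * exp (1 / Q)) * ?L = ennreal (c powr (- 1 / 2 - 1 / Q)) * (ennreal (exp (1 / Q)) * ?L)"
            by (rule ennreal_mult_assoc[symmetric]) auto
          finally show ?thesis using True by simp
        qed simp
      qed
      also have "\<dots> = J * (ennreal (exp (1 / Q)) * ?L)" unfolding J_def by (rule nn_integral_multc) measurable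
      finally show ?thesis by (simp add: mult.assoc mult_left_mono)
    qed
    finally show "(\<integral>\<^sub>+x. min (?g x) (ennreal lev) * ?\<psi> x) \<le> ?K2 * L2norm lborel ?\<psi> * ?L"
      by (simp only: ac_simps mult_right_mono zero_le)
  qed
  also have "\<dots> = (?K1 * ennreal S + ?K2 * L2norm lborel ?\<psi>) * ?L" by (simp add: distrib_right)
  finally show "(\<integral>\<^sub>+x. enorm (g x * \<psi> x)) \<le> (?K1 * ennreal S + ?K2 * L2norm lborel ?\<psi>) * ?L" .
qed

text \<open>A pointwise substitute for Hoelder's inequality: on bounded time intervals L^\<rho> lies
  in L^1.\<close>

lemma le_one_plus_ennreal_powr:
  assumes "1 \<le> \<rho>"
  shows "h \<le> 1 + ennreal_powr h \<rho>"
proof (cases h)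
  case (real x)
  have "x \<le> 1 + x powr \<rho>"
  proof (cases "x \<le> 1")
    case True
    then show ?thesis using powr_ge_zero[of x \<rho>] by linarith
  next
    case False
    then have "x powr 1 \<le> x powr \<rho>" using assms by (intro powr_mono) auto
    then show ?thesis using False by simp
  qed
  then have "ennreal x \<le> ennreal (1 + x powr \<rho>)" by (rule ennreal_leI)
  then show ?thesis using real by (simp add: ennreal_powr_ennreal)
qed simp

text \<open>F is the jointly measurable representative of f, to which Fubini applies, while the
  Duhamel integral is defined through f itself; the lemmas below pass from one to the other.\<close>

context
  fixes F :: "real \<Rightarrow> 'a::euclidean_space \<Rightarrow> complex" and f :: "real \<Rightarrow> 'a \<Rightarrow> complex" and T :: ereal and Q \<rho> :: real and q :: ennreal
  assumes F: "jointly_borel F"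
    and F_0: "\<And>t y. t \<notin> time_interval T \<Longrightarrow> F t y = 0"
    and Ff: "AE t in lborel. t \<in> time_interval T \<longrightarrow> (AE y in lborel. F t y = f t y)"
    and val: "AE t in lebesgue_on (time_interval T). f t \<in> lorentz_space (ennreal Q) q"
    and Q: "1 < Q" "Q < 2" and q: "1 \<le> q" and \<rho>: "1 \<le> \<rho>"
    and fin: "(\<integral>\<^sub>+s. ennreal_powr (lorentz_norm (ennreal Q) q (F s)) \<rho>) < top"
begin

lemma borel_measurable_pairing:
  assumes \<phi>: "\<phi> \<in> schwartz_space"
  shows "(\<lambda>s. \<integral>y. F s y * schroedinger (t - s) \<phi> y \<partial>lborel) \<in> borel_measurable borel"
proof (rule sigma_finite_measure.borel_measurable_lebesgue_integral[OF sigma_finite_lborel])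
  note [measurable] = F
  have "(\<lambda>z. F (fst z) (snd z) * schroedinger (t - fst z) \<phi> (snd z)) \<in> borel_measurable (borel \<Otimes>\<^sub>M lborel)"
  proof (rule borel_measurable_times)
    show "(\<lambda>z. F (fst z) (snd z)) \<in> borel_measurable (borel \<Otimes>\<^sub>M lborel)" using F by (simp add: case_prod_beta')
    show "(\<lambda>z. schroedinger (t - fst z) \<phi> (snd z)) \<in> borel_measurable (borel \<Otimes>\<^sub>M lborel)"
      by (rule borel_measurable_schroedinger[OF \<phi>]) measurable
  qed
  then show "(\<lambda>(s, y). F s y * schroedinger (t - s) \<phi> y) \<in> borel_measurable (borel \<Otimes>\<^sub>M lborel)"
    by (simp add: case_prod_beta')
qed

text \<open>The evolved test function is bounded in L^\<infinity> and in L^2 uniformly over positive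
  times, so the pairing is at most a constant times the norm of F s. This works for every t, not
  only for those with a finite fractional integral.\<close>

lemma integrable_pairing:
  assumes \<phi>: "\<phi> \<in> schwartz_space"
  shows "integrable lborel (\<lambda>s. indicator {0..t} s *\<^sub>R (\<integral>y. F s y * schroedinger (t - s) \<phi> y \<partial>lborel))"
proof (rule integrableI_bounded)
  note [measurable] = borel_measurable_pairing[OF \<phi>, of t]
  let ?L = "\<lambda>s. lorentz_norm (ennreal Q) q (F s)"
  have [measurable]: "?L \<in> borel_measurable borel"
    using Q by (intro borel_measurable_lorentz_norm_section[OF F q]) simp
  show "(\<lambda>s. indicator {0..t} s *\<^sub>R (\<integral>y. F s y * schroedinger (t - s) \<phi> y \<partial>lborel)) \<in> borel_measurable lborel"
    by measurable
  obtain S where S: "0 \<le> S" "\<And>t x. norm (schroedinger t \<phi> x) \<le> S" using schroedinger_bounded[OF \<phi>] by blast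
  show "(\<integral>\<^sub>+s. enorm (indicator {0..t} s *\<^sub>R (\<integral>y. F s y * schroedinger (t - s) \<phi> y \<partial>lborel))) < \<infinity>"
  proof (rule nn_integral_mult_lorentz_le[OF Q q, where 'a='a])
    fix K1 K2 :: ennreal
    assume K: "K1 < top" "K2 < top" and le: "\<And>(g :: 'a \<Rightarrow> complex) \<psi> S. g \<in> borel_measurable borel \<Longrightarrow> \<psi> \<in> borel_measurable borel \<Longrightarrow>
      (\<And>x. norm (\<psi> x) \<le> S) \<Longrightarrow> lorentz_norm (ennreal Q) q g < top \<Longrightarrow>
      (\<integral>\<^sub>+x. enorm (g x * (\<psi> x :: complex)))
        \<le> (K1 * ennreal S + K2 * L2norm lborel (\<lambda>x. enorm (\<psi> x))) * lorentz_norm (ennreal Q) q g"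
    define C where "C = K1 * ennreal S + K2 * L2norm lborel (\<lambda>x. enorm (\<phi> x))"
    have C: "C < top" using K L2norm_schwartz_less_top[OF \<phi>] by (simp add: C_def ennreal_mult_less_top)
    have "AE s in lborel. ennreal_powr (?L s) \<rho> \<noteq> \<infinity>"
      using fin by (intro nn_integral_PInf_AE) auto
    then have "AE s in lborel. enorm (indicator {0..t} s *\<^sub>R (\<integral>y. F s y * schroedinger (t - s) \<phi> y \<partial>lborel)) \<le> C * (indicator {0..t} s + ennreal_powr (?L s) \<rho>)"
      using AE_lborel_singleton[of t]
    proof eventually_elim
      case (elim s)
      then have Ls: "?L s < top" by (simp add: less_top)
      show ?case
      proof (cases "s \<in> {0..t}")
        case True
        then have s: "0 < t - s" using elim by auto
        have [measurable]: "schroedinger (t - s) \<phi> \<in> borel_measurable borel"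
          by (rule borel_measurable_schroedinger[OF \<phi>]) measurable
        have "enorm (\<integral>y. F s y * schroedinger (t - s) \<phi> y \<partial>lborel) \<le> (\<integral>\<^sub>+y. enorm (F s y * schroedinger (t - s) \<phi> y))"
          by (rule ennreal_norm_integral_le)
        also have "\<dots> \<le> (K1 * ennreal S + K2 * L2norm lborel (\<lambda>x. enorm (schroedinger (t - s) \<phi> x))) * ?L s"
          by (rule le[OF measurable_section[OF F] _ S(2) Ls]) measurable
        also have "\<dots> \<le> C * ?L s"
          unfolding C_def by (intro mult_right_mono add_left_mono mult_left_mono L2norm_schroedinger_le[OF \<phi> s]) auto
        also have "\<dots> \<le> C * (1 + ennreal_powr (?L s) \<rho>)" by (intro mult_left_mono le_one_plus_ennreal_powr \<rho>) simp
        finally show ?thesis using True by simp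
      qed simp
    qed
    then have "(\<integral>\<^sub>+s. enorm (indicator {0..t} s *\<^sub>R (\<integral>y. F s y * schroedinger (t - s) \<phi> y \<partial>lborel)))
        \<le> (\<integral>\<^sub>+s. C * (indicator {0..t} s + ennreal_powr (?L s) \<rho>))"
      by (rule nn_integral_mono_AE)
    also have "\<dots> = C * (emeasure lborel {0..t} + (\<integral>\<^sub>+s. ennreal_powr (?L s) \<rho>))"
      by (simp add: nn_integral_cmult nn_integral_add)
    also have "\<dots> < top" using C fin by (simp add: ennreal_mult_less_top emeasure_lborel_Icc_eq)
    finally show ?thesis by simp
  qed
qed

lemma duhamel_integrand_eq:
  assumes \<phi>: "\<phi> \<in> schwartz_space" and t: "ereal t < T"
  shows "AE s in lebesgue. indicator {0..t} s *\<^sub>R (\<integral>y. F s y * schroedinger (t - s) \<phi> y \<partial>lborel) = indicator {0..t} s *\<^sub>R duhamel_integrand f t s \<phi>"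
  unfolding AE_completion_iff
  using Ff val[unfolded AE_lebesgue_on_iff[OF time_interval_borel]] AE_lborel_singleton[of 0]
proof eventually_elim
  case (elim s)
  show ?case
  proof (cases "s \<in> {0..t}")
    case True
    then have "ereal s \<le> ereal t" by simp
    then have s: "s \<in> time_interval T" using True elim(3) le_less_trans[OF _ t, of "ereal s"] by (auto simp: time_interval_def)
    have fs: "f s \<in> borel_measurable lebesgue" using elim(2) s by (simp add: lorentz_space_def)
    have m: "schroedinger (t - s) \<phi> \<in> borel_measurable borel" "F s \<in> borel_measurable borel"
      by (rule borel_measurable_schroedinger[OF \<phi>]; measurable) (rule measurable_section[OF F])
    have "duhamel_integrand f t s \<phi> = (\<integral>y. f s y * schroedinger (t - s) \<phi> y \<partial>lebesgue)"
      by (simp add: duhamel_integrand_def schroedinger_distribution_def regular_distribution_def)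
    also have "\<dots> = (\<integral>y. F s y * schroedinger (t - s) \<phi> y \<partial>lebesgue)"
    proof (rule integral_cong_AE)
      show "(\<lambda>y. f s y * schroedinger (t - s) \<phi> y) \<in> borel_measurable lebesgue"
        using m(1) by (intro borel_measurable_times[OF fs]) (simp add: measurable_completion)
      show "(\<lambda>y. F s y * schroedinger (t - s) \<phi> y) \<in> borel_measurable lebesgue"
        using m by (intro borel_measurable_times) (simp_all add: measurable_completion)
      have "AE y in lborel. F s y = f s y" using elim(1) s by blast
      then show "AE y in lebesgue. f s y * schroedinger (t - s) \<phi> y = F s y * schroedinger (t - s) \<phi> y"
        unfolding AE_completion_iff by eventually_elim simp
    qed
    also have "\<dots> = (\<integral>y. F s y * schroedinger (t - s) \<phi> y \<partial>lborel)"
      using m by (intro integral_completion) simp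
    finally show ?thesis by simp
  qed simp
qed

lemma
  assumes t: "ereal t < T"
  shows duhamel_convergesI: "duhamel_converges f t"
    and duhamel_eq: "\<phi> \<in> schwartz_space \<Longrightarrow>
      duhamel f t \<phi> = (\<integral>s. indicator {..<t} s *\<^sub>R (\<integral>y. F s y * schroedinger (t - s) \<phi> y \<partial>lborel) \<partial>lborel)"
proof -
  let ?G = "\<lambda>\<phi> s. \<integral>y. F s y * schroedinger (t - s) \<phi> y \<partial>lborel"
  have G: "(\<lambda>s. indicator {0..t} s *\<^sub>R ?G \<phi> s) \<in> borel_measurable lborel" if \<phi>: "\<phi> \<in> schwartz_space" for \<phi>
    using integrable_pairing[OF \<phi>] by (rule borel_measurable_integrable)
  then have G': "(\<lambda>s. indicator {0..t} s *\<^sub>R ?G \<phi> s) \<in> borel_measurable lebesgue" if \<phi>: "\<phi> \<in> schwartz_space" for \<phi>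
    using that by (simp add: measurable_completion)
  have X: "(\<lambda>s. indicator {0..t} s *\<^sub>R duhamel_integrand f t s \<phi>) \<in> borel_measurable lebesgue" if \<phi>: "\<phi> \<in> schwartz_space" for \<phi>
    by (rule borel_measurable_AE[OF G'[OF \<phi>] duhamel_integrand_eq[OF \<phi> t]])
  show "duhamel_converges f t"
    unfolding duhamel_converges_def
  proof
    fix \<phi> :: "'a \<Rightarrow> complex" assume \<phi>: "\<phi> \<in> schwartz_space"
    have "integrable lebesgue (\<lambda>s. indicator {0..t} s *\<^sub>R ?G \<phi> s)"
      using integrable_pairing[OF \<phi>, of t] integrable_completion[OF G[OF \<phi>]] by simp
    then have "integrable lebesgue (\<lambda>s. indicator {0..t} s *\<^sub>R duhamel_integrand f t s \<phi>)"
      using integrable_cong_AE[OF G'[OF \<phi>] X[OF \<phi>] duhamel_integrand_eq[OF \<phi> t]] by simp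
    then show "integrable (lebesgue_on {0..t}) (\<lambda>s. duhamel_integrand f t s \<phi>)"
      by (subst integrable_restrict_space) auto
  qed
  assume \<phi>: "\<phi> \<in> schwartz_space"
  have "duhamel f t \<phi> = (\<integral>s. indicator {0..t} s *\<^sub>R duhamel_integrand f t s \<phi> \<partial>lebesgue)"
    unfolding duhamel_def by (subst integral_restrict_space) auto
  also have "\<dots> = (\<integral>s. indicator {0..t} s *\<^sub>R ?G \<phi> s \<partial>lebesgue)"
  proof (rule integral_cong_AE[OF X[OF \<phi>] G'[OF \<phi>]])
    show "AE s in lebesgue. indicator {0..t} s *\<^sub>R duhamel_integrand f t s \<phi> = indicator {0..t} s *\<^sub>R ?G \<phi> s"
      using duhamel_integrand_eq[OF \<phi> t] by eventually_elim (rule sym)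
  qed
  also have "\<dots> = (\<integral>s. indicator {0..t} s *\<^sub>R ?G \<phi> s \<partial>lborel)" by (rule integral_completion[OF G[OF \<phi>]])
  \<comment> \<open>The lower limit may be dropped because F vanishes at negative times, and the
    endpoint t is a null set.\<close>
  also have "\<dots> = (\<integral>s. indicator {..<t} s *\<^sub>R ?G \<phi> s \<partial>lborel)"
  proof (rule integral_cong_AE[OF G[OF \<phi>]])
    note [measurable] = borel_measurable_pairing[OF \<phi>, of t]
    show "(\<lambda>s. indicator {..<t} s *\<^sub>R ?G \<phi> s) \<in> borel_measurable lborel" by measurable
    show "AE s in lborel. indicator {0..t} s *\<^sub>R ?G \<phi> s = indicator {..<t} s *\<^sub>R ?G \<phi> s"
      using AE_lborel_singleton[of t]
    proof eventually_elim
      case (elim s)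
      have "F s = (\<lambda>_. 0)" if "s < 0" using that by (intro ext F_0) (simp add: time_interval_def)
      then show ?case using elim by (cases "s < 0") (auto simp: indicator_def)
    qed
  qed
  finally show "duhamel f t \<phi> = (\<integral>s. indicator {..<t} s *\<^sub>R ?G \<phi> s \<partial>lborel)" .
qed

end

section \<open>Limits and strong measurability in time\<close>

lemma AE_lborel_reflect:
  assumes "AE s in lborel. R (s::real)"
  shows "AE \<tau> in lborel. R (t - \<tau>)"
proof -
  obtain N where N: "{s \<in> space lborel. \<not> R s} \<subseteq> N" "emeasure lborel N = 0" "N \<in> sets lborel"
    using assms by (rule AE_E)
  have "(\<lambda>\<tau>. t - \<tau>) -` N \<inter> space borel \<in> sets borel" by (rule measurable_sets[of _ borel borel]) (use N in auto)
  then have "{\<tau>. t - \<tau> \<in> N} \<in> null_sets lborel"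
    using emeasure_lborel_reflect[of N t] N by (simp add: null_sets_def vimage_def)
  then show ?thesis by (rule AE_I') (use N(1) in auto)
qed

text \<open>Dominated convergence; at each \<tau> the kernel is finite and so preserves a null
  sequence.\<close>

lemma frac_int_tendsto_0:
  fixes d :: "nat \<Rightarrow> real \<Rightarrow> ennreal"
  assumes [measurable]: "\<And>n. d n \<in> borel_measurable borel" "h \<in> borel_measurable borel"
    and le: "\<And>n s. d n s \<le> h s" and lim: "AE s in lborel. (\<lambda>n. d n s) \<longlonglongrightarrow> 0" and fin: "frac_int \<alpha> h t < top"
  shows "(\<lambda>n. frac_int \<alpha> (d n) t) \<longlonglongrightarrow> 0"
proof -
  let ?k = "\<lambda>\<tau>. frac_kernel \<alpha> \<tau>"
  have "(\<lambda>n. \<integral>\<^sub>+\<tau>. ?k \<tau> * d n (t - \<tau>)) \<longlonglongrightarrow> (\<integral>\<^sup>+\<tau>. 0 \<partial>(lborel :: real measure))"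
  proof (rule nn_integral_dominated_convergence)
    show "AE \<tau> in lborel. ?k \<tau> * d n (t - \<tau>) \<le> ?k \<tau> * h (t - \<tau>)" for n
      by (intro AE_I2 mult_left_mono le) simp
    show "(\<integral>\<^sub>+\<tau>. ?k \<tau> * h (t - \<tau>)) < \<infinity>" using fin by (simp add: frac_int_def)
    show "AE \<tau> in lborel. (\<lambda>n. ?k \<tau> * d n (t - \<tau>)) \<longlonglongrightarrow> 0"
      using AE_lborel_reflect[OF lim, of t]
    proof eventually_elim
      case (elim \<tau>)
      have "(\<lambda>n. ?k \<tau> * d n (t - \<tau>)) \<longlonglongrightarrow> ?k \<tau> * 0"
        using elim by (intro ennreal_tendsto_cmult) (auto simp: ennreal_mult_less_top indicator_def)
      then show ?case by simp
    qed
  qed measurable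
  then show ?thesis by (simp add: frac_int_def)
qed

text \<open>
  For simple \<open>S n\<close> the solution is uniformly continuous in time, hence a uniform limit of its samples on
  a grid; the error caused by replacing \<open>F\<close> by \<open>S n\<close> is controlled by a fractional integral.
\<close>

lemma retarded_strongly_measurable:
  fixes F :: "real \<Rightarrow> 'a::euclidean_space \<Rightarrow> complex"
  assumes F: "jointly_borel F"
    and P: "2 < P" and q: "1 \<le> q" and Q: "Q = P / (P - 1)" and \<alpha>: "\<alpha> = DIM('a) / 2 - DIM('a) / P" "0 < \<alpha>" "\<alpha> < 1"
    and S: "\<And>n. tensor_simple Q q (S n)" "\<And>n t y. t \<notin> {0<..real n} \<Longrightarrow> S n t y = 0"
    and S_le: "\<And>n t. lorentz_norm (ennreal Q) q (\<lambda>y. S n t y - F t y) \<le> lorentz_norm (ennreal Q) q (F t)"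
    and S_lim: "AE t in lborel. (\<lambda>n. lorentz_norm (ennreal Q) q (\<lambda>y. S n t y - F t y)) \<longlonglongrightarrow> 0"
    and u: "AE t in lborel. frac_int \<alpha> (\<lambda>s. lorentz_norm (ennreal Q) q (F s)) t < top \<and> schr_limit (retard F t) (u t)"
  shows "lorentz_strongly_measurable T (ennreal P) q u"
proof -
  let ?L = "lorentz_norm (ennreal P) q" and ?N = "lorentz_norm (ennreal Q) q"
  have Q0: "0 < Q" "1 \<le> Q" using P by (auto simp: Q field_simps)
  have P0: "0 < P" "1 \<le> P" using P by auto
  have Sm: "jointly_borel (S n)" for n by (rule tensor_simple_measurable[OF S(1)])
  define D where "D = enn2real (disp_const P)"
  have D: "disp_const P = ennreal D" "0 \<le> D" using disp_const_less_top[OF P] by (simp_all add: D_def)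
  have mass: "disp_mass P q (\<lambda>\<tau> y. retard G t \<tau> y - retard G' t' \<tau> y)
      = (\<integral>\<^sub>+\<tau>. frac_kernel \<alpha> \<tau> * ?N (\<lambda>y. G (t - \<tau>) y - G' (t' - \<tau>) y))"
    if "jointly_borel G" "jointly_borel G'"
    for G G' :: "real \<Rightarrow> 'a \<Rightarrow> complex" and t t'
    unfolding Q \<alpha>(1) by (rule disp_mass_retard_diff[OF that P q])
  have ex: "\<exists>v. schr_limit (retard (S n) t) v \<and> ?L v < top" for n t
  proof -
    have eq: "disp_mass P q (retard (S n) t) = frac_int \<alpha> (\<lambda>s. ?N (S n s)) t"
      unfolding Q \<alpha>(1) by (rule disp_mass_retard[OF Sm P q])
    also have "\<dots> < top" by (rule frac_int_tensor_less_top[OF S q Q0(2) \<alpha>(2,3)])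
    finally have fin: "disp_mass P q (retard (S n) t) < top" .
    obtain v where v: "schr_limit (retard (S n) t) v" "?L v \<le> disp_const P * disp_mass P q (retard (S n) t)"
      using schr_limit_lorentz[OF forward_retard[OF Sm] P q fin] by blast
    have "disp_const P * disp_mass P q (retard (S n) t) < top"
      using fin disp_const_less_top[OF P] by (simp add: ennreal_mult_less_top)
    then show ?thesis using v by (intro exI[of _ v] conjI) (auto intro: le_less_trans)
  qed
  \<comment> \<open>The limits are chosen separately for each t; they are related through
    \<open>schr_limit_diff\<close>, by which the difference of two of them is a limit for the
    difference of the data.\<close>
  define w where "w n t = (SOME v. schr_limit (retard (S n) t) v \<and> ?L v < top)" for n t
  have w: "schr_limit (retard (S n) t) (w n t)" "?L (w n t) < top" for n t
    using someI_ex[OF ex[of n t]] by (simp_all add: w_def)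
  have wm: "w n t \<in> borel_measurable lebesgue" for n t
    using w(1)[of n t] by (simp add: schr_limit_def measurable_completion)
  have "\<exists>\<delta>>0. \<forall>t t'. \<bar>t - t'\<bar> < \<delta> \<longrightarrow> ?L (\<lambda>y. w n t y - w n t' y) \<le> ennreal D * ennreal (1 / real (Suc n))" for n
  proof -
    obtain \<delta> where \<delta>: "0 < \<delta>" "\<And>t t'. \<bar>t - t'\<bar> < \<delta> \<Longrightarrow>
      (\<integral>\<^sub>+\<tau>. frac_kernel \<alpha> \<tau> * ?N (\<lambda>y. S n (t - \<tau>) y - S n (t' - \<tau>) y)) \<le> ennreal (1 / real (Suc n))"
    proof -
      have "0 < 1 / real (Suc n)" by simp
      from tensor_simple_modulus(2)[OF S(1)[of n] S(2)[of _ n] q Q0(2) \<alpha>(2,3) this] show thesis using that by blast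
    qed
    have "?L (\<lambda>y. w n t y - w n t' y) \<le> ennreal D * ennreal (1 / real (Suc n))" if "\<bar>t - t'\<bar> < \<delta>" for t t'
    proof -
      let ?H = "\<lambda>\<tau> y. retard (S n) t \<tau> y - retard (S n) t' \<tau> y"
      have m: "disp_mass P q ?H \<le> ennreal (1 / real (Suc n))"
        unfolding mass[OF Sm Sm] by (rule \<delta>(2)[OF that])
      have "?L (\<lambda>y. w n t y - w n t' y) \<le> disp_const P * disp_mass P q ?H"
        by (rule lorentz_norm_schr_limit_le(1)[OF schr_limit_diff[OF w(1) w(1)] P q]) (rule le_less_trans[OF m], simp)
      also have "\<dots> \<le> ennreal D * ennreal (1 / real (Suc n))" unfolding D(1) by (intro mult_left_mono m) simp
      finally show ?thesis .
    qed
    then show ?thesis using \<delta>(1) by blast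
  qed
  then have "\<forall>n. \<exists>\<delta>>0. \<forall>t t'. \<bar>t - t'\<bar> < \<delta> \<longrightarrow> ?L (\<lambda>y. w n t y - w n t' y) \<le> ennreal D * ennreal (1 / real (Suc n))" ..
  from choice[OF this] obtain \<delta> where \<delta>: "\<And>n. 0 < \<delta> n"
    "\<And>n t t'. \<bar>t - t'\<bar> < \<delta> n \<Longrightarrow> ?L (\<lambda>y. w n t y - w n t' y) \<le> ennreal D * ennreal (1 / real (Suc n))" by blast
  \<comment> \<open>The value -1 marks times outside (0, n), where the approximation is 0; grid
    points belonging to times in (0, n) are nonnegative, so the mark is unambiguous. Restriction to
    (0, n) leaves finitely many grid points.\<close>
  define grid where "grid n t = (if 0 < t \<and> t < real n then \<delta> n * of_int \<lfloor>t / \<delta> n\<rfloor> else - 1)" for n t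
  define v where "v n t = (if grid n t = - 1 then (\<lambda>_. 0) else w n (grid n t))" for n t
  have grid_close: "\<bar>grid n t - t\<bar> < \<delta> n \<and> 0 \<le> grid n t" if "0 < t" "t < real n" for n t
  proof -
    have eq: "\<delta> n * (t / \<delta> n) = t" using \<delta>(1)[of n] by simp
    have "\<delta> n * of_int \<lfloor>t / \<delta> n\<rfloor> \<le> \<delta> n * (t / \<delta> n)" using \<delta>(1)[of n] by (intro mult_left_mono of_int_floor_le) simp
    moreover have "\<delta> n * (t / \<delta> n) < \<delta> n * (of_int \<lfloor>t / \<delta> n\<rfloor> + 1)"
      using \<delta>(1)[of n] by (intro mult_strict_left_mono) linarith+
    ultimately have "\<delta> n * of_int \<lfloor>t / \<delta> n\<rfloor> \<le> t" "t < \<delta> n * of_int \<lfloor>t / \<delta> n\<rfloor> + \<delta> n"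
      unfolding eq by (simp_all add: distrib_left)
    moreover have "0 \<le> \<delta> n * of_int \<lfloor>t / \<delta> n\<rfloor>" using \<delta>(1)[of n] that by simp
    ultimately show ?thesis using that by (simp add: grid_def)
  qed
  show ?thesis
    unfolding lorentz_strongly_measurable_def
  proof (intro exI conjI allI ballI)
    fix n
    show "simple_function (lebesgue_on (time_interval T)) (v n)"
    proof -
      have "grid n \<in> borel_measurable borel" unfolding grid_def[abs_def] by measurable
      then have "grid n \<in> borel_measurable lebesgue" by (simp add: measurable_completion)
      then have gm: "grid n \<in> borel_measurable (lebesgue_on (time_interval T))" by (rule measurable_restrict_space1)
      have "range (grid n) \<subseteq> insert (- 1) ((\<lambda>k. \<delta> n * of_int k) ` {0..\<lfloor>real n / \<delta> n\<rfloor>})"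
      proof
        fix x assume "x \<in> range (grid n)"
        then obtain t where t: "x = grid n t" by blast
        show "x \<in> insert (- 1) ((\<lambda>k. \<delta> n * of_int k) ` {0..\<lfloor>real n / \<delta> n\<rfloor>})"
        proof (cases "0 < t \<and> t < real n")
          case True
          have "\<lfloor>t / \<delta> n\<rfloor> \<le> \<lfloor>real n / \<delta> n\<rfloor>" using True \<delta>(1)[of n] by (intro floor_mono divide_right_mono) auto
          moreover have "0 \<le> \<lfloor>t / \<delta> n\<rfloor>" using True \<delta>(1)[of n] by simp
          ultimately show ?thesis using True by (auto simp: t grid_def)
        qed (auto simp: t grid_def)
      qed
      then have "finite (range (grid n))" by (rule finite_subset) simp
      then have "finite (grid n ` space (lebesgue_on (time_interval T)))" by (rule rev_finite_subset) auto
      then have "simple_function (lebesgue_on (time_interval T)) (grid n)" by (rule simple_function_borel_measurable[OF gm])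
      then have "simple_function (lebesgue_on (time_interval T)) (\<lambda>t. (\<lambda>x. if x = - 1 then (\<lambda>_. 0) else w n x) (grid n t))"
        by (rule simple_function_compose1)
      then show ?thesis by (simp add: v_def[abs_def])
    qed
    fix t
    show "v n t \<in> lorentz_space (ennreal P) q"
      using w(2) wm by (auto simp: v_def lorentz_space_def lorentz_norm_zero[OF q P0(1)])
  next
    show "AE t in lebesgue_on (time_interval T). (\<lambda>n. ?L (\<lambda>x. v n t x - u t x)) \<longlonglongrightarrow> 0"
      unfolding AE_lebesgue_on_iff[OF time_interval_borel]
      using u
    proof eventually_elim
      case (elim t)
      show ?case
      proof
        assume t: "t \<in> time_interval T"
        let ?h = "\<lambda>s. ?N (F s)" and ?d = "\<lambda>n s. ?N (\<lambda>y. S n s y - F s y)"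
        have ut: "u t \<in> borel_measurable lebesgue" using elim by (simp add: schr_limit_def measurable_completion)
        have fd: "jointly_borel (\<lambda>s y. S n s y - F s y)" for n
          using borel_measurable_diff[OF Sm[of n] F] by (simp add: case_prod_beta')
        have lim0: "(\<lambda>n. frac_int \<alpha> (?d n) t) \<longlonglongrightarrow> 0"
        proof (rule frac_int_tendsto_0[where h="?h"])
          show "?d n \<in> borel_measurable borel" for n by (rule borel_measurable_lorentz_norm_section[OF fd q Q0(1)])
          show "?h \<in> borel_measurable borel" by (rule borel_measurable_lorentz_norm_section[OF F q Q0(1)])
        qed (use S_le S_lim elim in auto)
        have wu: "?L (\<lambda>y. w n t y - u t y) \<le> ennreal D * frac_int \<alpha> (?d n) t" for n
        proof -
          let ?H = "\<lambda>\<tau> y. retard (S n) t \<tau> y - retard F t \<tau> y"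
          have m: "disp_mass P q ?H = frac_int \<alpha> (?d n) t" unfolding mass[OF Sm F] frac_int_def ..
          have "frac_int \<alpha> (?d n) t \<le> frac_int \<alpha> ?h t"
            unfolding frac_int_def by (intro nn_integral_mono mult_left_mono S_le) simp
          also have "\<dots> < top" using elim by simp
          finally have "disp_mass P q ?H < top" unfolding m .
          then have "?L (\<lambda>y. w n t y - u t y) \<le> disp_const P * disp_mass P q ?H"
            using elim by (intro lorentz_norm_schr_limit_le(1)[OF schr_limit_diff[OF w(1)] P q]) auto
          then show ?thesis unfolding m D(1) .
        qed
        have bound: "?L (\<lambda>x. v n t x - u t x) \<le> 2 * (ennreal D * ennreal (1 / real (Suc n)) + ennreal D * frac_int \<alpha> (?d n) t)" if n: "t < real n" for n
        proof -
          have t0: "0 < t" using t by (simp add: time_interval_def)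
          have g: "\<bar>grid n t - t\<bar> < \<delta> n" "0 \<le> grid n t" using grid_close[OF t0 n] by auto
          then have v: "v n t = w n (grid n t)" by (simp add: v_def)
          have "?L (\<lambda>x. v n t x - u t x) \<le> 2 * (?L (\<lambda>x. w n (grid n t) x - w n t x) + ?L (\<lambda>x. u t x - w n t x))"
            unfolding v by (rule lorentz_norm_diff_le[OF wm ut wm q P0(2)])
          also have "\<dots> \<le> 2 * (ennreal D * ennreal (1 / real (Suc n)) + ennreal D * frac_int \<alpha> (?d n) t)"
            using wu[of n] by (intro mult_left_mono add_mono \<delta>(2)[OF g(1)]) (simp_all add: lorentz_norm_minus_commute[of _ _ "u t"])
          finally show ?thesis .
        qed
        have "(\<lambda>n. ennreal (1 / real (Suc n))) \<longlonglongrightarrow> ennreal 0"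
          using LIMSEQ_inverse_real_of_nat by (intro tendsto_ennrealI) (simp add: inverse_eq_divide)
        then have "(\<lambda>n. 2 * (ennreal D * ennreal (1 / real (Suc n)) + ennreal D * frac_int \<alpha> (?d n) t)) \<longlonglongrightarrow> 2 * (ennreal D * ennreal 0 + ennreal D * 0)"
          using lim0 by (intro ennreal_tendsto_cmult tendsto_add) auto
        then have lim: "(\<lambda>n. 2 * (ennreal D * ennreal (1 / real (Suc n)) + ennreal D * frac_int \<alpha> (?d n) t)) \<longlonglongrightarrow> 0" by simp
        show "(\<lambda>n. ?L (\<lambda>x. v n t x - u t x)) \<longlonglongrightarrow> 0"
        proof (rule tendsto_sandwich[OF _ _ tendsto_const lim])
          obtain n0 :: nat where "t < real n0" using reals_Archimedean2 by blast
          then have "\<forall>\<^sub>F n in sequentially. t < real n"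
            by (intro eventually_sequentiallyI[of n0]) (auto intro: less_le_trans)
          then show "\<forall>\<^sub>F n in sequentially. ?L (\<lambda>x. v n t x - u t x) \<le> 2 * (ennreal D * ennreal (1 / real (Suc n)) + ennreal D * frac_int \<alpha> (?d n) t)"
            by eventually_elim (rule bound)
        qed simp
      qed
    qed
  qed
qed

section \<open>The estimate for real exponents\<close>

theorem duhamel_lorentz_estimate:
  fixes f :: "real \<Rightarrow> 'a::euclidean_space \<Rightarrow> complex"
  assumes P: "2 < P" and q: "1 \<le> q" and \<alpha>: "\<alpha> = DIM('a) / 2 - DIM('a) / P" "0 < \<alpha>" "\<alpha> < 1"
    and \<rho>: "1 \<le> \<rho>" and \<sigma>: "1 \<le> \<sigma>" and Q: "Q = P / (P - 1)"
    and HLS: "\<And>h. h \<in> borel_measurable lborel \<Longrightarrow>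
      Lebesgue_norm lborel (ennreal \<sigma>) (frac_int \<alpha> h) \<le> ennreal K * Lebesgue_norm lborel (ennreal \<rho>) h"
    and f: "f \<in> bochner_lorentz_space (ennreal \<rho>) T (ennreal Q) q"
  shows "(\<forall>t. 0 \<le> t \<and> ereal t < T \<longrightarrow> duhamel_converges f t) \<and>
    (\<exists>u \<in> bochner_lorentz_space (ennreal \<sigma>) T (ennreal P) q. represents T u (duhamel f) \<and>
      bochner_lorentz_norm (ennreal \<sigma>) T (ennreal P) q u
        \<le> disp_const P * ennreal K * bochner_lorentz_norm (ennreal \<rho>) T (ennreal Q) q f)"
proof -
  let ?J = "time_interval T" and ?N = "lorentz_norm (ennreal Q) q" and ?L = "lorentz_norm (ennreal P) q"
  have Q1: "1 < Q" "Q < 2" "0 < Q" using P by (auto simp: Q field_simps)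
  have P0: "0 < P" using P by simp
  have strong: "lorentz_strongly_measurable T (ennreal Q) q f"
    and val: "AE t in lebesgue_on ?J. f t \<in> lorentz_space (ennreal Q) q"
    and norm_fin: "bochner_lorentz_norm (ennreal \<rho>) T (ennreal Q) q f < top"
    using f by (simp_all add: bochner_lorentz_space_def)
  have J: "?J \<inter> space lebesgue \<in> sets lebesgue" by simp
  show ?thesis
  proof (rule strongly_measurable_approximation[OF q Q1(1) strong val])
    fix F S
    assume F: "jointly_borel F" and F_0: "\<And>t y. t \<notin> ?J \<Longrightarrow> F t y = 0"
      and Ff: "AE t in lborel. t \<in> ?J \<longrightarrow> (AE y in lborel. F t y = f t y)"
      and S: "\<And>n. tensor_simple Q q (S n)" "\<And>n t y. t \<notin> {0<..real n} \<Longrightarrow> S n t y = 0"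
        "\<And>n t. ?N (\<lambda>y. S n t y - F t y) \<le> ?N (F t)"
        "AE t in lborel. (\<lambda>n. ?N (\<lambda>y. S n t y - F t y)) \<longlonglongrightarrow> 0"
    define h where "h t = ?N (F t)" for t
    have h [measurable]: "h \<in> borel_measurable borel"
      unfolding h_def[abs_def] by (rule borel_measurable_lorentz_norm_section[OF F q Q1(3)])
    have h_0: "h t = 0" if "t \<notin> ?J" for t
    proof -
      have "F t = (\<lambda>_. 0)" using F_0[OF that] by blast
      then show ?thesis by (simp add: h_def lorentz_norm_zero[OF q Q1(3)])
    qed
    \<comment> \<open>F vanishes outside the time interval, so the norm over (0, T) is a norm over
      the whole line, and T disappears from the inequality in time.\<close>
    have norm_f: "bochner_lorentz_norm (ennreal \<rho>) T (ennreal Q) q f = Lebesgue_norm lborel (ennreal \<rho>) h"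
    proof -
      have "AE t in lborel. ennreal_powr (?N (f t)) \<rho> * indicator ?J t = ennreal_powr (h t) \<rho>"
        using Ff val[unfolded AE_lebesgue_on_iff[OF time_interval_borel]]
      proof eventually_elim
        case (elim t)
        show ?case
        proof (cases "t \<in> ?J")
          case True
          have "?N (f t) = ?N (F t)"
          proof (rule lorentz_norm_cong_AE[OF _ _ q Q1(3)])
            show "f t \<in> borel_measurable lebesgue" using elim(2) True by (simp add: lorentz_space_def)
            show "F t \<in> borel_measurable lebesgue" using measurable_section[OF F, of t] by (simp add: measurable_completion)
            have "AE y in lborel. F t y = f t y" using elim(1) True by blast
            then show "AE y in lebesgue. f t y = F t y" unfolding AE_completion_iff by eventually_elim (rule sym)
          qed
          then show ?thesis using True by (simp add: h_def)
        next
          case False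
          then show ?thesis by (simp add: h_0)
        qed
      qed
      then have "(\<integral>\<^sub>+t. ennreal_powr (?N (f t)) \<rho> * indicator ?J t) = (\<integral>\<^sub>+t. ennreal_powr (h t) \<rho>)"
        by (rule nn_integral_cong_AE)
      then show ?thesis using \<rho>
        by (simp add: bochner_lorentz_norm_def Lebesgue_norm_ennreal nn_integral_restrict_space[OF J] nn_integral_completion)
    qed
    have h_fin: "(\<integral>\<^sub>+s. ennreal_powr (?N (F s)) \<rho>) < top"
      using norm_fin \<rho> unfolding norm_f by (simp add: Lebesgue_norm_ennreal h_def)
    have converges: "duhamel_converges f t" if "ereal t < T" for t
      by (rule duhamel_convergesI[OF F F_0 Ff val Q1(1,2) q \<rho> h_fin that])
    have pairing: "duhamel f t \<phi> = (\<integral>s. indicator {..<t} s *\<^sub>R (\<integral>y. F s y * schroedinger (t - s) \<phi> y \<partial>lborel) \<partial>lborel)"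
      if "ereal t < T" "\<phi> \<in> schwartz_space" for t \<phi>
      by (rule duhamel_eq[OF F F_0 Ff val Q1(1,2) q \<rho> h_fin that])
    have mass: "disp_mass P q (retard F t) = frac_int \<alpha> h t" for t
      unfolding h_def[abs_def] Q \<alpha>(1) by (rule disp_mass_retard[OF F P q])
    \<comment> \<open>The value 0 is taken where the fractional integral is infinite, which by the
      bound in L^\<sigma> happens on a null set of times only.\<close>
    define u where "u t = (if frac_int \<alpha> h t < top then SOME v. schr_limit (retard F t) v else (\<lambda>_. 0))" for t
    have u: "schr_limit (retard F t) (u t)" if t: "frac_int \<alpha> h t < top" for t
    proof -
      have "disp_mass P q (retard F t) < top" using t by (simp add: mass)
      then have "\<exists>v. schr_limit (retard F t) v"
        using schr_limit_lorentz[OF forward_retard[OF F] P q] by blast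
      then show ?thesis using t by (simp add: u_def someI_ex)
    qed
    have u_le: "?L (u t) \<le> disp_const P * frac_int \<alpha> h t" for t
    proof (cases "frac_int \<alpha> h t < top")
      case True
      then show ?thesis using lorentz_norm_schr_limit_le(1)[OF u[OF True] P q] by (simp add: mass)
    next
      case False
      then show ?thesis by (simp add: u_def lorentz_norm_zero[OF q P0])
    qed
    have norm_frac: "Lebesgue_norm lborel (ennreal \<sigma>) (frac_int \<alpha> h) \<le> ennreal K * bochner_lorentz_norm (ennreal \<rho>) T (ennreal Q) q f"
      unfolding norm_f by (rule HLS) simp
    have \<sigma>': "1 \<le> ennreal \<sigma>" using \<sigma> by simp
    have "Lebesgue_norm lborel (ennreal \<sigma>) (frac_int \<alpha> h) < top"
      by (rule le_less_trans[OF norm_frac]) (use norm_fin in \<open>simp add: ennreal_mult_less_top\<close>)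
    then have fin: "AE t in lborel. frac_int \<alpha> h t < top"
      by (intro Lebesgue_norm_less_top_AE[OF _ \<sigma>']) auto
    have u_meas: "u t \<in> borel_measurable lebesgue" for t
    proof (cases "frac_int \<alpha> h t < top")
      case True
      then show ?thesis using u[OF True] by (simp add: schr_limit_def measurable_completion)
    qed (simp add: u_def)
    have norm_u: "bochner_lorentz_norm (ennreal \<sigma>) T (ennreal P) q u \<le> disp_const P * ennreal K * bochner_lorentz_norm (ennreal \<rho>) T (ennreal Q) q f"
    proof -
      define D where "D = enn2real (disp_const P)"
      have D: "disp_const P = ennreal D" "0 \<le> D" using disp_const_less_top[OF P] by (simp_all add: D_def)
      have "(\<integral>\<^sup>+t. ennreal_powr (?L (u t)) \<sigma> \<partial>lebesgue_on ?J) \<le> (\<integral>\<^sub>+t. ennreal_powr (disp_const P * frac_int \<alpha> h t) \<sigma>)"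
        unfolding nn_integral_restrict_space[OF J] nn_integral_completion
      proof (intro nn_integral_mono)
        fix t
        have "ennreal_powr (?L (u t)) \<sigma> \<le> ennreal_powr (disp_const P * frac_int \<alpha> h t) \<sigma>"
          using \<sigma> by (intro ennreal_powr_mono u_le) simp
        then show "ennreal_powr (?L (u t)) \<sigma> * indicator ?J t \<le> ennreal_powr (disp_const P * frac_int \<alpha> h t) \<sigma>"
          by (simp add: indicator_def)
      qed
      then have "bochner_lorentz_norm (ennreal \<sigma>) T (ennreal P) q u \<le> Lebesgue_norm lborel (ennreal \<sigma>) (\<lambda>t. ennreal D * frac_int \<alpha> h t)"
        using \<sigma> unfolding D(1) by (simp add: bochner_lorentz_norm_def Lebesgue_norm_ennreal ennreal_powr_mono)
      also have "\<dots> = ennreal D * Lebesgue_norm lborel (ennreal \<sigma>) (frac_int \<alpha> h)"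
        by (rule Lebesgue_norm_cmult[OF _ \<sigma>' D(2)]) measurable
      also have "\<dots> \<le> ennreal D * (ennreal K * bochner_lorentz_norm (ennreal \<rho>) T (ennreal Q) q f)"
        by (intro mult_left_mono norm_frac) simp
      finally show ?thesis unfolding D(1) by (simp only: mult.assoc)
    qed
    have "u \<in> bochner_lorentz_space (ennreal \<sigma>) T (ennreal P) q"
      unfolding bochner_lorentz_space_def
    proof (intro CollectI conjI)
      have ae: "AE t in lborel. frac_int \<alpha> (\<lambda>s. ?N (F s)) t < top \<and> schr_limit (retard F t) (u t)"
        using fin u unfolding h_def[abs_def] by (auto elim: AE_mp)
      show "lorentz_strongly_measurable T (ennreal P) q u"
        by (rule retarded_strongly_measurable[OF F P q Q \<alpha> S ae])
      show "AE t in lebesgue_on ?J. u t \<in> lorentz_space (ennreal P) q"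
        unfolding AE_lebesgue_on_iff[OF time_interval_borel] using fin
      proof eventually_elim
        case (elim t)
        have "?L (u t) < top"
          by (rule le_less_trans[OF u_le]) (use elim disp_const_less_top[OF P] in \<open>simp add: ennreal_mult_less_top\<close>)
        then show ?case using u_meas by (simp add: lorentz_space_def)
      qed
      show "bochner_lorentz_norm (ennreal \<sigma>) T (ennreal P) q u < \<infinity>"
        by (rule le_less_trans[OF norm_u]) (use norm_fin disp_const_less_top[OF P] in \<open>simp add: ennreal_mult_less_top\<close>)
    qed
    moreover have "represents T u (duhamel f)"
      unfolding represents_def AE_lebesgue_on_iff[OF time_interval_borel] using fin
    proof eventually_elim
      case (elim t)
      show ?case
        unfolding distribution_eq_def
      proof (intro impI ballI)
        assume "t \<in> ?J"
        then have t: "ereal t < T" by (simp add: time_interval_def)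
        fix \<phi> :: "'a \<Rightarrow> complex" assume \<phi>: "\<phi> \<in> schwartz_space"
        have [measurable]: "\<phi> \<in> borel_measurable borel" "u t \<in> borel_measurable borel"
          using schwartz_integrable[OF \<phi>] u[OF elim] by (auto simp: schr_limit_def)
        have "duhamel f t \<phi> = (\<integral>s. indicator {..<t} s *\<^sub>R (\<integral>y. F s y * schroedinger (t - s) \<phi> y \<partial>lborel) \<partial>lborel)"
          by (rule pairing[OF t \<phi>])
        also have "\<dots> = (\<integral>x. u t x * \<phi> x \<partial>lborel)"
          by (rule schr_limit_retard_pairing[OF u[OF elim] P q _ \<phi>, symmetric]) (use elim in \<open>simp add: mass\<close>)
        also have "\<dots> = (\<integral>x. u t x * \<phi> x \<partial>lebesgue)" by (rule integral_completion[symmetric]) measurable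
        finally show "duhamel f t \<phi> = regular_distribution (u t) \<phi>" by (simp add: regular_distribution_def)
      qed
    qed
    ultimately show ?thesis using converges norm_u by blast
  qed
qed

section \<open>Arithmetic of the exponents\<close>

lemma conj_exponent_ennreal:
  assumes "1 < x"
  shows "conj_exponent (ennreal x) = ennreal (x / (x - 1))"
proof -
  have "1 - 1 / ennreal x = ennreal (1 - 1 / x)"
    using assms by (simp add: divide_ennreal ennreal_minus flip: ennreal_1)
  moreover have "0 < 1 - 1 / x" using assms by simp
  moreover have "1 / (1 - 1 / x) = x / (x - 1)" using assms by (simp add: field_simps)
  ultimately show ?thesis unfolding conj_exponent_def by (simp add: divide_ennreal flip: ennreal_1)
qed

theorem proposition2p3:
  fixes r p q \<sigma> \<sigma>t :: ennreal
  assumes "admissible_pair CARD('n::finite) r p" and "p < \<infinity>" and "2 < r"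
    and "1 \<le> q"
    and "r / 2 < \<sigma>" and "\<sigma> < \<infinity>"
    and "1 / \<sigma>t + 1 / \<sigma> = 2 / r"
  shows "\<exists>C::real. 0 < C \<and>
    (\<forall>T::ereal. 0 < T \<longrightarrow>
      (\<forall>f :: real \<Rightarrow> real ^ 'n \<Rightarrow> complex.
        f \<in> bochner_lorentz_space (conj_exponent \<sigma>t) T (conj_exponent p) q \<longrightarrow>
          (\<forall>t. 0 \<le> t \<and> ereal t < T \<longrightarrow> duhamel_converges f t) \<and>
          (\<exists>u \<in> bochner_lorentz_space \<sigma> T p q.
             represents T u (duhamel f) \<and>
             bochner_lorentz_norm \<sigma> T p q u
               \<le> ennreal C * bochner_lorentz_norm (conj_exponent \<sigma>t) T (conj_exponent p) q f)))"
proof -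
  let ?N = "real CARD('n)"
  \<comment> \<open>r / 2 < \<sigma> < \<infinity> forces r to be finite; hence \<alpha> = 2 / r is
    positive, which in turn excludes p = 2.\<close>
  have "r < top"
  proof (rule ccontr)
    assume "\<not> r < top"
    then have "r = top" unfolding less_top[symmetric] not_not .
    then have "r / 2 = top" by (simp add: ennreal_top_divide)
    then show False using assms(5,6) by simp
  qed
  then obtain R where R: "r = ennreal R" "0 \<le> R" by (cases r) auto
  obtain P where P: "p = ennreal P" "0 \<le> P" using assms(2) by (cases p) auto
  obtain s where s: "\<sigma> = ennreal s" "0 \<le> s" using assms(6) by (cases \<sigma>) auto
  have R2: "2 < R" using assms(3) R ennreal_less_iff[of 2 R] by simp
  have P2: "2 \<le> P" using assms(1) P by (simp add: admissible_pair_def flip: ennreal_numeral)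
  have "ennreal R / ennreal 2 < ennreal s" using assms(5) R s by simp
  then have Rs: "R / 2 < s" using R by (subst (asm) divide_ennreal) (auto simp: ennreal_less_iff)
  define \<alpha> where "\<alpha> = 2 / R"
  have \<alpha>: "0 < \<alpha>" "\<alpha> < 1" using R2 by (auto simp: \<alpha>_def)
  have N: "0 < ?N" by simp
  have \<alpha>_eq: "\<alpha> = ?N / 2 - ?N / P"
  proof -
    have "ennreal 2 / ennreal R + ennreal ?N / ennreal P = ennreal ?N / ennreal 2"
      using assms(1) unfolding admissible_pair_def R P by (simp add: ennreal_of_nat_eq_real_of_nat)
    then have "ennreal (2 / R + ?N / P) = ennreal (?N / 2)"
      using R2 P2 by (simp only: divide_ennreal) (simp add: divide_ennreal)
    then have "2 / R + ?N / P = ?N / 2" using R2 P2 by (subst (asm) ennreal_inj) auto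
    then show ?thesis by (simp add: \<alpha>_def)
  qed
  have P: "p = ennreal P" "2 < P"
  proof -
    have "P \<noteq> 2" using \<alpha>_eq \<alpha>(1) by auto
    then show "2 < P" using P2 by simp
  qed (rule P)
  \<comment> \<open>a is the reciprocal of \<sigma>t; it is positive because \<sigma> > r /
    2.\<close>
  define a where "a = \<alpha> - 1 / s"
  have s1: "1 < s" using Rs R2 by simp
  have a: "0 < a" "a < 1"
  proof -
    have "1 / s < 2 / R" using Rs R2 by (simp add: field_simps)
    then show "0 < a" by (simp add: a_def \<alpha>_def)
    have "0 < 1 / s" using s1 by simp
    then show "a < 1" using \<alpha> unfolding a_def by linarith
  qed
  have \<sigma>t: "\<sigma>t = ennreal (1 / a)"
  proof -
    have "1 / \<sigma>t + ennreal (1 / s) = ennreal \<alpha>"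
      using assms(7) s1 R2 unfolding s(1) R(1) \<alpha>_def by (simp add: divide_ennreal flip: ennreal_1 ennreal_numeral)
    then have "1 / \<sigma>t + ennreal (1 / s) = ennreal a + ennreal (1 / s)"
      using a s1 by (simp add: a_def flip: ennreal_plus)
    then have eq: "1 / \<sigma>t = ennreal a" by simp
    show ?thesis
    proof (cases \<sigma>t)
      case (real x)
      have "x \<noteq> 0" using eq real by (auto simp: divide_ennreal_def)
      then have "ennreal (1 / x) = ennreal a" using eq real by (simp add: divide_ennreal flip: ennreal_1)
      then have "1 / x = a" using real a by (subst (asm) ennreal_inj) auto
      then show ?thesis using real by auto
    next
      case top
      then show ?thesis using eq a by (simp add: ennreal_divide_top)
    qed
  qed
  \<comment> \<open>\<rho> is the conjugate of \<sigma>t = 1 / a, so 1 / \<rho> = 1 - a = 1 -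
    \<alpha> + 1 / \<sigma>, which is the scaling relation of the Hardy-Littlewood-Sobolev
    inequality.\<close>
  define \<rho> where "\<rho> = 1 / (1 - a)"
  have \<rho>: "1 < \<rho>" using a by (simp add: \<rho>_def field_simps)
  have "conj_exponent \<sigma>t = ennreal ((1 / a) / (1 / a - 1))"
    unfolding \<sigma>t using a by (intro conj_exponent_ennreal) (simp add: field_simps)
  also have "(1 / a) / (1 / a - 1) = \<rho>" using a by (simp add: \<rho>_def field_simps)
  finally have conj_\<sigma>: "conj_exponent \<sigma>t = ennreal \<rho>" .
  have conj_p: "conj_exponent p = ennreal (P / (P - 1))" unfolding P(1) using P(2) by (intro conj_exponent_ennreal) simp
  have scaling: "1 / s = 1 / \<rho> - (1 - \<alpha>)" by (simp add: \<rho>_def a_def)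
  have "0 < s" using s1 by simp
  from Hardy_Littlewood_Sobolev[OF \<alpha> \<rho> this scaling]
  obtain K where K: "0 \<le> K" "\<And>h. h \<in> borel_measurable lborel \<Longrightarrow>
    Lebesgue_norm lborel (ennreal s) (frac_int \<alpha> h) \<le> ennreal K * Lebesgue_norm lborel (ennreal \<rho>) h" by blast
  \<comment> \<open>Adding 1 makes the constant positive; it is fixed before T and f are
    introduced.\<close>
  define C where "C = enn2real (disp_const P) * K + 1"
  have C: "0 < C" using K(1) by (simp add: C_def add_nonneg_pos)
  have C_le: "disp_const P * ennreal K \<le> ennreal C"
  proof -
    have "disp_const P * ennreal K = ennreal (enn2real (disp_const P) * K)"
      using disp_const_less_top[OF P(2)] K(1) by (simp add: ennreal_mult)
    then show ?thesis by (simp add: C_def ennreal_leI)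
  qed
  have dim: "\<alpha> = DIM(real ^ 'n) / 2 - DIM(real ^ 'n) / P" using \<alpha>_eq by simp
  show ?thesis
  proof (intro exI[of _ C] conjI allI impI C)
    fix T :: ereal and f :: "real \<Rightarrow> real ^ 'n \<Rightarrow> complex"
    assume "f \<in> bochner_lorentz_space (conj_exponent \<sigma>t) T (conj_exponent p) q"
    then have f: "f \<in> bochner_lorentz_space (ennreal \<rho>) T (ennreal (P / (P - 1))) q" unfolding conj_\<sigma> conj_p .
    have est: "(\<forall>t. 0 \<le> t \<and> ereal t < T \<longrightarrow> duhamel_converges f t) \<and>
      (\<exists>u \<in> bochner_lorentz_space \<sigma> T p q. represents T u (duhamel f) \<and>
        bochner_lorentz_norm \<sigma> T p q u \<le> disp_const P * ennreal K * bochner_lorentz_norm (conj_exponent \<sigma>t) T (conj_exponent p) q f)"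
      unfolding conj_\<sigma> conj_p unfolding s(1) P(1)
      by (rule duhamel_lorentz_estimate[OF P(2) assms(4) dim \<alpha> less_imp_le[OF \<rho>] less_imp_le[OF s1] refl K(2) f])
    show "duhamel_converges f t" if "0 \<le> t \<and> ereal t < T" for t
      by (rule est[THEN conjunct1, THEN spec, THEN mp, OF that])
    obtain u where u: "u \<in> bochner_lorentz_space \<sigma> T p q" "represents T u (duhamel f)"
      "bochner_lorentz_norm \<sigma> T p q u \<le> disp_const P * ennreal K * bochner_lorentz_norm (conj_exponent \<sigma>t) T (conj_exponent p) q f"
      using est[THEN conjunct2] by (elim bexE conjE)
    have "disp_const P * ennreal K * bochner_lorentz_norm (conj_exponent \<sigma>t) T (conj_exponent p) q f
        \<le> ennreal C * bochner_lorentz_norm (conj_exponent \<sigma>t) T (conj_exponent p) q f"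
      by (rule mult_right_mono[OF C_le]) simp
    with u show "\<exists>u \<in> bochner_lorentz_space \<sigma> T p q. represents T u (duhamel f) \<and>
      bochner_lorentz_norm \<sigma> T p q u \<le> ennreal C * bochner_lorentz_norm (conj_exponent \<sigma>t) T (conj_exponent p) q f"
      by (intro bexI[of _ u] conjI order_trans[OF u(3)])
  qed
qed

end
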